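(* Let $N\in\{2,3\}$, let $\Omega\subset\mathbb{R}^N$ be an open, bounded set with Lipschitz continuous boundary, and let $\varepsilon,\xi>0$ be fixed. Let $W:[0,\infty)\to[0,\infty)$ be continuous, with $\frac1C|x|^2-C\le W(x)\le C(1+|x|^2)$ for all $x\in[0,\infty)$ and some constant $C>0$, and $\{x\in[0,\infty):W(x)=0\}=\{0,2\}$. For $k\in W^{1,2}(\Omega;\mathbb{R}^N)$ and $B\in H_{\mathrm{curl}}(\Omega;\mathbb{R}^{N\times N})$ let $$E_{\varepsilon,\xi}[k,B]:=\int_\Omega\left[\frac{(|k|-1)^2}{\varepsilon\xi^2}+|\nabla k-B|^2+\varepsilon\xi^2|\mathrm{curl}\,B|^2+\frac{1}{\varepsilon\xi^2}W(\varepsilon\xi|B|)\right]dx .$$ For all $k\in W^{1,2}(\Omega;\mathbb{R}^N)$ and $B\in H_{\mathrm{curl}}(\Omega;\mathbb{R}^{N\times N})$, define the relaxation $$\bar E_{\varepsilon,\xi}[k,B]:=\inf\left\{\liminf_{n\to\infty}E_{\varepsilon,\xi}[k_n,B_n]\;:\;k_n\to k \text{ strongly in } L^2(\Omega;\mathbb{R}^N),\ B_n\rightharpoonup B\text{ weakly in }L^2(\Omega;\mathbb{R}^{N\times N})\right\},$$ where the infimum is over sequences $(k_n,B_n)$ in $W^{1,2}(\Omega;\mathbb{R}^N)\times H_{\mathrm{curl}}(\Omega;\mathbb{R}^{N\times N})$. Then for all such $k$ and $B$, $$\bar E_{\varepsilon,\xi}[k,B]=\int_\Omega\left[\frac{(|k|-1)^2}{\varepsilon\xi^2}+|\nabla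 k-B|^2+\varepsilon\xi^2|\mathrm{curl}\,B|^2+\frac{1}{\varepsilon\xi^2}Q(W(|\cdot|))(\varepsilon\xi B)\right]dx .$$
   Context: The operator $\mathrm{curl}$ acts row-wise on matrix fields, in the sense of distributions; for $N=2$ the curl of a row $g=(g_1,g_2)$ is the scalar $\partial_1g_2-\partial_2g_1$, and for $N=3$ it is the usual vector curl. $H_{\mathrm{curl}}(\Omega;\mathbb{R}^{N\times N})$ is the space of matrix fields in $L^2(\Omega;\mathbb{R}^{N\times N})$ whose row-wise distributional curl is also in $L^2$. $|\cdot|$ on matrices is the Euclidean (Frobenius) norm. A Borel measurable function $g:\mathbb{R}^{d\times N}\to[0,\infty]$ is quasiconvex if $g(\eta)\le\int_{(0,1)^N}g(\eta+\nabla\phi)\,dx$ for all $\eta\in\mathbb{R}^{d\times N}$ and $\phi\in C^1_c((0,1)^N;\mathbb{R}^d)$. The quasiconvex envelope of $f$ is $Qf(\eta):=\sup\{g(\eta):g\text{ quasiconvex and }g\le f\}$. $Q(W(|\cdot|))$ is the quasiconvex envelope of the function $\mathbb{R}^{N\times N}\ni\eta\mapsto W(|\eta|)$. *)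

theory Defs
  imports "HOL-Analysis.Analysis"
begin

text \<open>
  Functions on an open set are represented by total functions on the whole space; only their
  values on the set matter. Functions in \<open>L\<^sup>2\<close> are not quotiented by almost everywhere equality.
  The norm on \<open>real^'n^'m\<close> is the Frobenius norm, and rows are the outer components.
\<close>

section \<open>Test functions\<close>

primrec cont_diff :: "nat \<Rightarrow> ('a::euclidean_space \<Rightarrow> 'b::euclidean_space) \<Rightarrow> bool" where
  "cont_diff 0 f \<longleftrightarrow> continuous_on UNIV f"
| "cont_diff (Suc m) f \<longleftrightarrow>
     (\<forall>x. f differentiable (at x)) \<and> (\<forall>v. cont_diff m (\<lambda>x. frechet_derivative f (at x) v))"

definition compact_support_in :: "'a::euclidean_space set \<Rightarrow> ('a \<Rightarrow> 'b::euclidean_space) \<Rightarrow> bool" where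
  "compact_support_in S f \<longleftrightarrow>
     compact (closure {x. f x \<noteq> 0}) \<and> closure {x. f x \<noteq> 0} \<subseteq> S"

definition C1_compact :: "'a::euclidean_space set \<Rightarrow> ('a \<Rightarrow> 'b::euclidean_space) set" where
  "C1_compact S = {\<phi>. cont_diff 1 \<phi> \<and> compact_support_in S \<phi>}"

definition Cinf_compact :: "'a::euclidean_space set \<Rightarrow> ('a \<Rightarrow> 'b::euclidean_space) set" where
  "Cinf_compact S = {\<phi>. (\<forall>m. cont_diff m \<phi>) \<and> compact_support_in S \<phi>}"

definition partial :: "'n::finite \<Rightarrow> (real^'n \<Rightarrow> 'b::real_normed_vector) \<Rightarrow> real^'n \<Rightarrow> 'b" where
  "partial j f x = frechet_derivative f (at x) (axis j 1)"

definition grad :: "(real^'n::finite \<Rightarrow> real) \<Rightarrow> real^'n \<Rightarrow> real^'n" where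
  "grad f x = (\<chi> j. partial j f x)"

definition grad_matrix :: "(real^'n::finite \<Rightarrow> real^'d::finite) \<Rightarrow> real^'n \<Rightarrow> real^'n^'d" where
  "grad_matrix f x = (\<chi> i j. partial j f x $ i)"


section \<open>Lebesgue and Sobolev spaces\<close>

definition L2 :: "'a::euclidean_space set \<Rightarrow> ('a \<Rightarrow> 'b::euclidean_space) set" where
  "L2 \<Omega> = {f \<in> borel_measurable (lebesgue_on \<Omega>). integrable (lebesgue_on \<Omega>) (\<lambda>x. (norm (f x))\<^sup>2)}"

definition L2_strong_lim ::
  "'a::euclidean_space set \<Rightarrow> (nat \<Rightarrow> 'a \<Rightarrow> 'b::euclidean_space) \<Rightarrow> ('a \<Rightarrow> 'b) \<Rightarrow> bool" where
  "L2_strong_lim \<Omega> u v \<longleftrightarrow>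
     (\<lambda>n. \<integral>x. (norm (u n x - v x))\<^sup>2 \<partial>(lebesgue_on \<Omega>)) \<longlonglongrightarrow> 0"

definition L2_weak_lim ::
  "'a::euclidean_space set \<Rightarrow> (nat \<Rightarrow> 'a \<Rightarrow> 'b::euclidean_space) \<Rightarrow> ('a \<Rightarrow> 'b) \<Rightarrow> bool" where
  "L2_weak_lim \<Omega> u v \<longleftrightarrow>
     (\<forall>\<psi>\<in>L2 \<Omega>. (\<lambda>n. \<integral>x. u n x \<bullet> \<psi> x \<partial>(lebesgue_on \<Omega>)) \<longlonglongrightarrow> (\<integral>x. v x \<bullet> \<psi> x \<partial>(lebesgue_on \<Omega>)))"

definition has_weak_gradient ::
  "(real^'n::finite) set \<Rightarrow> (real^'n \<Rightarrow> real^'d::finite) \<Rightarrow> (real^'n \<Rightarrow> real^'n^'d) \<Rightarrow> bool" where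
  "has_weak_gradient \<Omega> k G \<longleftrightarrow>
     (\<forall>\<phi>\<in>Cinf_compact \<Omega>. \<forall>i j.
        (\<integral>x. G x $ i $ j * \<phi> x \<partial>(lebesgue_on \<Omega>)) = - (\<integral>x. k x $ i * partial j \<phi> x \<partial>(lebesgue_on \<Omega>)))"

definition W12 :: "(real^'n::finite) set \<Rightarrow> (real^'n \<Rightarrow> real^'d::finite) set" where
  "W12 \<Omega> = {k \<in> L2 \<Omega>. \<exists>G\<in>L2 \<Omega>. has_weak_gradient \<Omega> k G}"

text \<open>A representative; for open \<open>\<Omega>\<close> and \<open>k \<in> W12 \<Omega>\<close> it is unique up to null sets.\<close>

definition weak_gradient :: "(real^'n::finite) set \<Rightarrow> (real^'n \<Rightarrow> real^'d::finite) \<Rightarrow> real^'n \<Rightarrow> real^'n^'d" where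
  "weak_gradient \<Omega> k = (SOME G. G \<in> L2 \<Omega> \<and> has_weak_gradient \<Omega> k G)"


section \<open>The distributional curl\<close>

text \<open>
  The curl of a row \<open>g\<close> is the formal product \<open>\<nabla> \<times> g\<close>, where \<open>\<times>\<close> is \<open>cross2\<close> below for \<open>N = 2\<close>
  (so the curl is the scalar \<open>\<partial>\<^sub>1 g\<^sub>2 - \<partial>\<^sub>2 g\<^sub>1\<close>) and the library's \<open>cross3\<close> for \<open>N = 3\<close>. As a
  distribution, tested against a scalar \<open>\<phi>\<close>, it is \<open>\<phi> \<mapsto> - \<integral> \<nabla>\<phi> \<times> g\<close>. The two dimensions differ only
  in the product, which is therefore a parameter \<open>X\<close> of what follows; \<open>'c\<close> is the type of values
  of the curl of a row (\<open>real\<close> or \<open>real^3\<close>).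
\<close>

definition cross2 :: "real^2 \<Rightarrow> real^2 \<Rightarrow> real" where
  "cross2 a b = a $ 1 * b $ 2 - a $ 2 * b $ 1"

definition has_weak_curl ::
  "(real^'n \<Rightarrow> real^'n \<Rightarrow> 'c::euclidean_space) \<Rightarrow> (real^'n::finite) set \<Rightarrow>
     (real^'n \<Rightarrow> real^'n^'n) \<Rightarrow> (real^'n \<Rightarrow> 'c^'n) \<Rightarrow> bool" where
  "has_weak_curl X \<Omega> B c \<longleftrightarrow>
     (\<forall>\<phi>\<in>Cinf_compact \<Omega>. \<forall>i.
        (\<integral>x. \<phi> x *\<^sub>R (c x $ i) \<partial>(lebesgue_on \<Omega>)) = - (\<integral>x. X (grad \<phi> x) (B x $ i) \<partial>(lebesgue_on \<Omega>)))"

definition Hcurl ::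
  "(real^'n \<Rightarrow> real^'n \<Rightarrow> 'c::euclidean_space) \<Rightarrow> (real^'n::finite) set \<Rightarrow> (real^'n \<Rightarrow> real^'n^'n) set" where
  "Hcurl X \<Omega> = {B \<in> L2 \<Omega>. \<exists>c\<in>L2 \<Omega>. has_weak_curl X \<Omega> B c}"

definition weak_curl ::
  "(real^'n \<Rightarrow> real^'n \<Rightarrow> 'c::euclidean_space) \<Rightarrow> (real^'n::finite) set \<Rightarrow>
     (real^'n \<Rightarrow> real^'n^'n) \<Rightarrow> real^'n \<Rightarrow> 'c^'n" where
  "weak_curl X \<Omega> B = (SOME c. c \<in> L2 \<Omega> \<and> has_weak_curl X \<Omega> B c)"


section \<open>Lipschitz boundary\<close>

text \<open>
  Near each boundary point, \<open>\<Omega>\<close> is the strict epigraph, in a direction \<open>e\<close>, of a Lipschitz function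
  on the hyperplane orthogonal to \<open>e\<close>; as \<open>U\<close> is open, the boundary in \<open>U\<close> is then its graph.
\<close>

definition lipschitz_boundary :: "'a::euclidean_space set \<Rightarrow> bool" where
  "lipschitz_boundary \<Omega> \<longleftrightarrow>
     (\<forall>p\<in>frontier \<Omega>. \<exists>U e \<gamma> L. open U \<and> p \<in> U \<and> norm e = 1 \<and> L-lipschitz_on {y. y \<bullet> e = 0} \<gamma> \<and>
        \<Omega> \<inter> U = {x \<in> U. x \<bullet> e > (\<gamma> (x - (x \<bullet> e) *\<^sub>R e) :: real)})"


section \<open>Quasiconvexity\<close>

text \<open>The open unit cube \<open>(0,1)\<^sup>N\<close> is \<open>box 0 1\<close>, where \<open>1\<close> is the vector with all components \<open>1\<close>.\<close>

definition quasiconvex :: "(real^'n::finite^'d::finite \<Rightarrow> ennreal) \<Rightarrow> bool" where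
  "quasiconvex g \<longleftrightarrow> g \<in> borel_measurable borel \<and>
     (\<forall>\<eta>. \<forall>\<phi>\<in>C1_compact (box 0 1).
        g \<eta> \<le> (\<integral>\<^sup>+x. g (\<eta> + grad_matrix \<phi> x) \<partial>(lebesgue_on (box 0 1))))"

definition quasiconvex_envelope ::
  "(real^'n::finite^'d::finite \<Rightarrow> ennreal) \<Rightarrow> real^'n^'d \<Rightarrow> ennreal" where
  "quasiconvex_envelope f \<eta> = Sup {g \<eta> | g. quasiconvex g \<and> (\<forall>\<zeta>. g \<zeta> \<le> f \<zeta>)}"


section \<open>The functional and its relaxation\<close>

text \<open>
  The energy and the integral representing its relaxation differ only in the density \<open>\<Phi>\<close> in the
  last term. The integrand is nonnegative, so all energies live in \<open>[0,\<infinity>]\<close>.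
\<close>

definition energy_functional ::
  "(real^'n \<Rightarrow> real^'n \<Rightarrow> 'c::euclidean_space) \<Rightarrow> (real^'n::finite) set \<Rightarrow> real \<Rightarrow> real \<Rightarrow>
     (real^'n^'n \<Rightarrow> ennreal) \<Rightarrow> (real^'n \<Rightarrow> real^'n) \<Rightarrow> (real^'n \<Rightarrow> real^'n^'n) \<Rightarrow> ennreal" where
  "energy_functional X \<Omega> \<epsilon> \<xi> \<Phi> k B =
     (\<integral>\<^sup>+x. ennreal ((norm (k x) - 1)\<^sup>2 / (\<epsilon> * \<xi>\<^sup>2) + (norm (weak_gradient \<Omega> k x - B x))\<^sup>2
              + \<epsilon> * \<xi>\<^sup>2 * (norm (weak_curl X \<Omega> B x))\<^sup>2)
            + ennreal (1 / (\<epsilon> * \<xi>\<^sup>2)) * \<Phi> (B x) \<partial>(lebesgue_on \<Omega>))"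

definition energy ::
  "(real^'n \<Rightarrow> real^'n \<Rightarrow> 'c::euclidean_space) \<Rightarrow> (real^'n::finite) set \<Rightarrow> real \<Rightarrow> real \<Rightarrow>
     (real \<Rightarrow> real) \<Rightarrow> (real^'n \<Rightarrow> real^'n) \<Rightarrow> (real^'n \<Rightarrow> real^'n^'n) \<Rightarrow> ennreal" where
  "energy X \<Omega> \<epsilon> \<xi> W = energy_functional X \<Omega> \<epsilon> \<xi> (\<lambda>\<eta>. ennreal (W (\<epsilon> * \<xi> * norm \<eta>)))"

definition relaxed_energy ::
  "(real^'n \<Rightarrow> real^'n \<Rightarrow> 'c::euclidean_space) \<Rightarrow> (real^'n::finite) set \<Rightarrow> real \<Rightarrow> real \<Rightarrow>
     (real \<Rightarrow> real) \<Rightarrow> (real^'n \<Rightarrow> real^'n) \<Rightarrow> (real^'n \<Rightarrow> real^'n^'n) \<Rightarrow> ennreal" where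
  "relaxed_energy X \<Omega> \<epsilon> \<xi> W k B =
     Inf {liminf (\<lambda>n. energy X \<Omega> \<epsilon> \<xi> W (kn n) (Bn n)) | kn Bn.
            (\<forall>n. kn n \<in> W12 \<Omega> \<and> Bn n \<in> Hcurl X \<Omega>) \<and>
            L2_strong_lim \<Omega> kn k \<and> L2_weak_lim \<Omega> Bn B}"

end

theory Submission
 imports Defs
begin

text \<open>
 Write \<open>f \<eta> = W |\<eta>|\<close> and \<open>Z \<eta> = inf \<integral>\<^sub>Q f (\<eta> + \<nabla>\<phi>)\<close>, the infimum over \<open>\<phi> \<in> C\<^sup>1\<^sub>c(Q)\<close>, \<open>Q\<close> the unit cube.

 Upper bound: adding \<open>\<Phi>\<close> to \<open>k\<close> and \<open>\<nabla>\<Phi>\<close> to \<open>B\<close>, with \<open>\<Phi> \<in> C\<^sup>1\<^sub>c(\<Omega>)\<close> uniformly small and \<open>\<nabla>\<Phi>\<close> bounded, changes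
 neither \<open>\<nabla>k - B\<close> nor the curl of \<open>B\<close>, hardly changes \<open>k\<close>, and is weakly negligible for \<open>B\<close>. Pasting rescaled copies of
 test functions into small cubes on which \<open>B\<close> is nearly constant brings the last term down to \<open>\<integral> Z (\<epsilon>\<xi> B)\<close>. The same
 construction shows that \<open>Z\<close> is quasiconvex, hence the envelope of \<open>f\<close>.

 Lower bound: the first three terms are weakly lower semicontinuous. If \<open>B\<^sub>n\<close> tends to \<open>B\<close> weakly and the curls are bounded in
 \<open>L\<^sup>2\<close>, then on compact sets \<open>B\<^sub>n - B\<close> is, up to a small error in \<open>L\<^sup>2\<close>, the gradient of a function that is small in \<open>L\<^sup>2\<close>:
 a mean of the line integral potentials based at the points \<open>x - \<delta> y\<close>. On small cubes a cutoff of that function is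
 a test function for \<open>Z\<close>. No extension of \<open>B\<close> across the boundary is needed.
\<close>

section \<open>Continuously differentiable functions\<close>

\<comment> \<open>Quadratic growth gives no equiintegrability: |B_n|^2 may concentrate exactly in
  the layer where a cutoff has its gradient, so one cutoff in a fixed layer does not suffice. Values
  at two arguments a and b are therefore compared with an error of the form small + K |a - b|^2,
  which can be integrated when the arguments are merely close in L^2. Continuity of f gives such an
  estimate only on bounded sets; \<open>Z\<close> has one on the whole space, with \<delta> (1 +
  |a|^2) as the small part, because its test functions may be altered near the boundary of the cube.

  The order of choices in the lower bound is forced: \<delta> and the constants it produces, then
  the cube size h, then the tolerance of the gradient decomposition, which is divided by h^2, and n
  last. Inside the decomposition the shift length is fixed before n, since weak convergence makes
  local means small only at a fixed length.

  Test functions are C^1, so cutoffs and potentials are built as averages of translates. Members of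
  L^2 are replaced by Borel functions extended by zero, for which Fubini's theorem and mollification
  on the whole space are available.\<close>
syntax
 "_nn_lborel" :: "pttrn \<Rightarrow> ennreal \<Rightarrow> ennreal" ("(2NNINT _./ _)" [0,10] 10)
 "_set_nn_lborel" :: "pttrn \<Rightarrow> 'a set \<Rightarrow> ennreal \<Rightarrow> ennreal" ("(3NNINT _:_./ _)" [0,60,10] 10)
translations
 "NNINT x. f" \<rightleftharpoons> "CONST nn_integral CONST lborel (\<lambda>x. f)"
 "NNINT x:A. f" \<rightharpoonup> "CONST set_nn_integral CONST lborel A (\<lambda>x. f)"

lemma cont_diff_SucI:
 assumes "\<And>x. (f has_derivative f' x) (at x)" and "\<And>v. cont_diff m (\<lambda>x. f' x v)"
 shows "cont_diff (Suc m) f"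
proof -
 have "frechet_derivative f (at x) = f' x" for x
  using assms(1) frechet_derivative_at by metis
 with assms show ?thesis
  by (auto simp: differentiable_def)
qed

lemma cont_diff_SucD:
 assumes "cont_diff (Suc m) f"
 shows "(f has_derivative frechet_derivative f (at x)) (at x)"
  and "cont_diff m (\<lambda>x. frechet_derivative f (at x) v)"
 using assms by (auto simp: frechet_derivative_works)

lemma cont_diff_continuous: "cont_diff m f \<Longrightarrow> continuous_on UNIV f"
 by (cases m) (auto simp: continuous_on_eq_continuous_at differentiable_imp_continuous_within)

lemma cont_diff_measurable: "cont_diff m f \<Longrightarrow> f \<in> borel_measurable borel"
 by (rule borel_measurable_continuous_onI[OF cont_diff_continuous])

lemma cont_diff_Suc_imp: "cont_diff (Suc m) f \<Longrightarrow> cont_diff m f"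
proof (induction m arbitrary: f)
 case 0
 then show ?case using cont_diff_continuous[OF 0] by simp
next
 case (Suc m)
 then show ?case by (metis cont_diff.simps(2))
qed

lemma cont_diff_const [simp]: "cont_diff m (\<lambda>x. c)"
proof (induction m arbitrary: c)
 case (Suc m)
 show ?case by (rule cont_diff_SucI[of _ "\<lambda>x v. 0"]) (auto simp: Suc)
qed auto

lemma cont_diff_bounded_linear:
 assumes "bounded_linear L" "cont_diff m f"
 shows "cont_diff m (\<lambda>x. L (f x))"
 using assms(2)
proof (induction m arbitrary: f)
 case 0
 then show ?case by (simp add: bounded_linear.continuous_on[OF assms(1)])
next
 case (Suc m)
 show ?case
  by (rule cont_diff_SucI[of _ "\<lambda>x v. L (frechet_derivative f (at x) v)"])
   (intro bounded_linear.has_derivative[OF assms(1)] cont_diff_SucD(1)[OF Suc.prems],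
    intro Suc.IH cont_diff_SucD(2)[OF Suc.prems])
qed

lemma cont_diff_id [simp]: "cont_diff m (\<lambda>x::'a::euclidean_space. x)"
proof (cases m)
 case (Suc k)
 show ?thesis unfolding Suc
  by (rule cont_diff_SucI[of _ "\<lambda>x v. v"]) auto
qed auto

lemma cont_diff_add:
 assumes "cont_diff m f" "cont_diff m g"
 shows "cont_diff m (\<lambda>x. f x + g x)"
 using assms
proof (induction m arbitrary: f g)
 case 0
 then show ?case by (auto intro!: continuous_intros)
next
 case (Suc m)
 show ?case
  by (rule cont_diff_SucI[of _ "\<lambda>x v. frechet_derivative f (at x) v + frechet_derivative g (at x) v"])
   (intro has_derivative_add cont_diff_SucD(1)[OF Suc.prems(1)] cont_diff_SucD(1)[OF Suc.prems(2)],
    intro Suc.IH cont_diff_SucD(2)[OF Suc.prems(1)] cont_diff_SucD(2)[OF Suc.prems(2)])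
qed

lemma cont_diff_sum:
 assumes "\<And>i. i \<in> I \<Longrightarrow> cont_diff m (f i)"
 shows "cont_diff m (\<lambda>x. \<Sum>i\<in>I. f i x)"
 using assms by (induction I rule: infinite_finite_induct) (auto intro: cont_diff_add)

lemma cont_diff_scaleR:
 assumes "cont_diff m f" "cont_diff m g"
 shows "cont_diff m (\<lambda>x. f x *\<^sub>R g x)"
 using assms
proof (induction m arbitrary: f g)
 case 0
 then show ?case by (auto intro!: continuous_intros)
next
 case (Suc m)
 have "((\<lambda>x. f x *\<^sub>R g x) has_derivative
   (\<lambda>v. f x *\<^sub>R frechet_derivative g (at x) v + frechet_derivative f (at x) v *\<^sub>R g x)) (at x)" for x
  by (intro has_derivative_scaleR cont_diff_SucD(1)[OF Suc.prems(1)] cont_diff_SucD(1)[OF Suc.prems(2)])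
 then show ?case
  by (rule cont_diff_SucI)
   (intro cont_diff_add Suc.IH cont_diff_SucD Suc.prems cont_diff_Suc_imp)
qed

lemma cont_diff_affine:
 fixes c :: "'a::euclidean_space"
 assumes "cont_diff m f"
 shows "cont_diff m (\<lambda>x. f (c + s *\<^sub>R x))"
 using assms
proof (induction m arbitrary: f)
 case 0
 then show ?case by (auto intro!: continuous_on_compose2[of UNIV f] continuous_intros)
next
 case (Suc m)
 have d: "((\<lambda>x. f (c + s *\<^sub>R x)) has_derivative
   (\<lambda>v. frechet_derivative f (at (c + s *\<^sub>R x)) (s *\<^sub>R v))) (at x)" for x
  by (rule has_derivative_compose[of "\<lambda>x. c + s *\<^sub>R x"])
   (auto intro!: derivative_eq_intros cont_diff_SucD Suc.prems)
 show ?case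
  by (rule cont_diff_SucI[OF d]) (intro Suc.IH[of "\<lambda>y. frechet_derivative f (at y) (s *\<^sub>R _)"]
    cont_diff_SucD Suc.prems)
qed

lemma C1_compact_iff:
 "\<phi> \<in> C1_compact S \<longleftrightarrow> cont_diff 1 \<phi> \<and> compact_support_in S \<phi>"
 by (simp add: C1_compact_def)

subsection \<open>Supports\<close>

lemma compact_support_inI:
 assumes "compact K" "K \<subseteq> S" "\<And>x. x \<notin> K \<Longrightarrow> f x = 0"
 shows "compact_support_in S f"
proof -
 have "closure {x. f x \<noteq> 0} \<subseteq> K"
  using assms by (intro closure_minimal) (auto simp: compact_imp_closed)
 with assms show ?thesis
  unfolding compact_support_in_def
  by (metis compact_Int_closed closed_closure inf.absorb_iff2 order_trans)
qed

lemma compact_support_inE: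
 assumes "compact_support_in S f"
 obtains K where "compact K" "K \<subseteq> S" "\<And>x. x \<notin> K \<Longrightarrow> f x = 0"
 using assms closure_subset[of "{x. f x \<noteq> 0}"] that unfolding compact_support_in_def by blast

lemma has_derivative_eq_0_outside:
 assumes "(f has_derivative D) (at x)" "closed K" "x \<notin> K" "\<And>x. x \<notin> K \<Longrightarrow> f x = 0"
 shows "D = (\<lambda>v. 0)"
proof -
 have "((\<lambda>x. 0) has_derivative D) (at x)"
  by (rule has_derivative_transform_within_open[OF assms(1), of "- K"]) (use assms in auto)
 then show ?thesis
  using has_derivative_unique has_derivative_const by blast
qed

lemma compact_support_cont_bounded:
 fixes f :: "'a::euclidean_space \<Rightarrow> 'b::real_normed_vector"
 assumes "continuous_on UNIV f" "compact K" "\<And>x. x \<notin> K \<Longrightarrow> f x = 0"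
 obtains M where "M > 0" "\<And>x. norm (f x) \<le> M"
proof -
 have "bounded (f ` K)"
  using assms by (metis compact_continuous_image compact_imp_bounded continuous_on_subset subset_UNIV)
 then obtain M where M: "M > 0" "\<And>x. x \<in> K \<Longrightarrow> norm (f x) \<le> M"
  by (auto simp: bounded_pos)
 show ?thesis
  by (rule that[of M]) (use M assms(3) in \<open>auto, metis norm_zero less_imp_le\<close>)
qed

lemma uniformly_continuous_compact_support:
 fixes f :: "'a::euclidean_space \<Rightarrow> 'b::real_normed_vector"
 assumes "continuous_on UNIV f" "compact K" "\<And>x. x \<notin> K \<Longrightarrow> f x = 0"
 shows "uniformly_continuous_on UNIV f"
proof -
 obtain R where R: "R > 0" "\<And>x. x \<in> K \<Longrightarrow> norm x \<le> R"
  using compact_imp_bounded[OF assms(2)] by (auto simp: bounded_pos)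
 \<comment> \<open>The margin 1 matches the cap \<open>min d 1\<close> below: two points at distance
   less than 1 either both lie in the larger ball or both lie outside K, where f vanishes.\<close>
 have uc: "uniformly_continuous_on (cball 0 (R+1)) f"
  using assms(1) by (intro compact_uniformly_continuous) (auto intro: continuous_on_subset)
 show ?thesis unfolding uniformly_continuous_on_def
 proof (intro allI impI)
  fix e :: real assume "e > 0"
  then obtain d where d: "d > 0" "\<And>x y. x \<in> cball 0 (R+1) \<Longrightarrow> y \<in> cball 0 (R+1) \<Longrightarrow> dist y x < d \<Longrightarrow> dist (f y) (f x) < e"
   using uc unfolding uniformly_continuous_on_def by blast
  have "dist (f y) (f x) < e" if "dist y x < min d 1" for x y
  proof (cases "x \<in> cball 0 (R+1) \<and> y \<in> cball 0 (R+1)")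
   case True
   then show ?thesis using d that by auto
  next
   case False
   have "norm y \<le> norm x + dist y x" "norm x \<le> norm y + dist y x"
    using norm_triangle_sub[of y x] norm_triangle_sub[of x y] by (simp_all add: dist_norm norm_minus_commute)
   with False that have "norm x > R" "norm y > R" by auto
   then have "x \<notin> K" "y \<notin> K" using R(2)[of x] R(2)[of y] by auto
   then have "f x = 0" "f y = 0" using assms(3) by auto
   then show ?thesis using \<open>e > 0\<close> by simp
  qed
  then show "\<exists>d>0. \<forall>x\<in>UNIV. \<forall>x'\<in>UNIV. dist x' x < d \<longrightarrow> dist (f x') (f x) < e"
   using d(1) by (intro exI[of _ "min d 1"]) auto
 qed
qed

lemma linear_euclidean:
 fixes L :: "'a::euclidean_space \<Rightarrow> 'b::real_vector"
 assumes "linear L"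
 shows "L h = (\<Sum>b\<in>Basis. (h \<bullet> b) *\<^sub>R L b)"
proof -
 have "L h = L (\<Sum>b\<in>Basis. (h \<bullet> b) *\<^sub>R b)" by (simp add: euclidean_representation)
 also have "\<dots> = (\<Sum>b\<in>Basis. (h \<bullet> b) *\<^sub>R L b)"
  using assms by (simp add: linear_sum linear_scale)
 finally show ?thesis .
qed

subsection \<open>A smooth bump function\<close>

text \<open>The polynomial is a parameter because the functions p(1/t) exp(-1/t), extended by 0 to t
  \<le> 0, are closed under differentiation; p = 1 is the usual flat function. One induction then
  gives smoothness of every order.\<close>

definition bump_exp :: "real poly \<Rightarrow> real \<Rightarrow> real" where
 "bump_exp p t = (if t > 0 then poly p (1 / t) * exp (- (1 / t)) else 0)"

lemma bump_exp_tendsto_0: "((\<lambda>t. poly p (1 / t) * exp (- (1 / t))) \<longlongrightarrow> 0) (at_right (0::real))"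
proof -
 have "((\<lambda>x. \<Sum>i\<le>degree p. coeff p i * (x ^ i / exp x)) \<longlongrightarrow> (\<Sum>i\<le>degree p. coeff p i * 0)) at_top"
  by (intro tendsto_sum tendsto_mult tendsto_const tendsto_power_div_exp_0)
 then have "((\<lambda>x. poly p x * exp (- x)) \<longlongrightarrow> 0) at_top"
  by (simp add: poly_altdef sum_distrib_right exp_minus divide_inverse mult.assoc)
 then show ?thesis
  by (rule filterlim_compose) (simp add: filterlim_inverse_at_top_right flip: inverse_eq_divide)
qed

text \<open>For t > 0 the product rule gives (1/t^2) (p - p')(1/t) exp(-1/t). At 0 the right
  difference quotient is (1/t) p(1/t) exp(-1/t), which belongs to the same family with polynomial x
  p and tends to 0; on the left everything is 0.\<close>

lemma bump_exp_deriv: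
 "(bump_exp p has_real_derivative bump_exp ([:0,0,1:] * (p - pderiv p)) t) (at t)"
proof -
 consider "t > 0" | "t < 0" | "t = 0" by linarith
 then show ?thesis
 proof cases
  case 1
  have "((\<lambda>t. poly p (1 / t) * exp (- (1 / t))) has_real_derivative
    (poly ([:0,0,1:] * (p - pderiv p)) (1 / t) * exp (- (1 / t)))) (at t)"
   using 1 by (auto intro!: derivative_eq_intros simp: field_simps power2_eq_square)
  then have "(bump_exp p has_real_derivative
    (poly ([:0,0,1:] * (p - pderiv p)) (1 / t) * exp (- (1 / t)))) (at t)"
   by (rule has_field_derivative_transform_within_open[of _ _ _ "{0<..}"])
    (use 1 in \<open>auto simp: bump_exp_def\<close>)
  then show ?thesis using 1 by (simp add: bump_exp_def)
 next
  case 2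
  have "((\<lambda>t. 0) has_real_derivative 0) (at t)" by simp
  then have "(bump_exp p has_real_derivative 0) (at t)"
   by (rule has_field_derivative_transform_within_open[of _ _ _ "{..<0}"])
    (use 2 in \<open>auto simp: bump_exp_def\<close>)
  then show ?thesis using 2 by (simp add: bump_exp_def)
 next
  case 3
  have "((\<lambda>h. (bump_exp p h - 0) / h) \<longlongrightarrow> 0) (at_right 0)"
  proof (rule Lim_transform_eventually[OF bump_exp_tendsto_0[of "[:0,1:] * p"]])
   show "\<forall>\<^sub>F h in at_right 0. poly ([:0, 1:] * p) (1 / h) * exp (- (1 / h)) = (bump_exp p h - 0) / h"
    unfolding eventually_at_right_field by (intro exI[of _ 1]) (auto simp: bump_exp_def)
  qed
  moreover have "((\<lambda>h. (bump_exp p h - 0) / h) \<longlongrightarrow> 0) (at_left 0)"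
  proof (rule Lim_transform_eventually[OF tendsto_const])
   show "\<forall>\<^sub>F h in at_left 0. 0 = (bump_exp p h - 0) / h"
    unfolding eventually_at_left_field by (intro exI[of _ "-1"]) (auto simp: bump_exp_def)
  qed
  ultimately have "((\<lambda>h. (bump_exp p h - 0) / h) \<longlongrightarrow> 0) (at 0)"
   by (simp add: filterlim_split_at)
  then show ?thesis using 3
   by (simp add: has_field_derivative_iff bump_exp_def)
 qed
qed

lemma cont_diff_bump_exp:
 assumes "\<And>m. cont_diff m q"
 shows "cont_diff m (\<lambda>x. bump_exp p (q x))"
proof (induction m arbitrary: p)
 case 0
 have "continuous_on UNIV (bump_exp p)"
  by (meson DERIV_isCont bump_exp_deriv continuous_at_imp_continuous_on)
 then show ?case
  using assms[of 0] by (auto intro: continuous_on_compose2)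
next
 case (Suc m)
 have qd: "(q has_derivative frechet_derivative q (at x)) (at x)" for x
  using assms[of 1] cont_diff_SucD(1)[of 0 q] by simp
 have "((\<lambda>x. bump_exp p (q x)) has_derivative
   (\<lambda>v. bump_exp ([:0,0,1:] * (p - pderiv p)) (q x) *\<^sub>R frechet_derivative q (at x) v)) (at x)" for x
  using has_derivative_compose[OF qd[of x] bump_exp_deriv[of p "q x", unfolded has_field_derivative_def]]
  by simp
 then show ?case
  by (rule cont_diff_SucI) (intro cont_diff_scaleR Suc.IH cont_diff_SucD assms)
qed

definition bump :: "'a::euclidean_space \<Rightarrow> real" where
 "bump x = bump_exp 1 (1 - x \<bullet> x)"

lemma cont_diff_bump: "cont_diff m (bump :: 'a::euclidean_space \<Rightarrow> real)"
proof -
 have e: "(\<lambda>x::'a. 1 - x \<bullet> x) = (\<lambda>x. 1 + (-1) * (\<Sum>b\<in>Basis. (x \<bullet> b) *\<^sub>R (x \<bullet> b)))"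
  by (rule ext, subst euclidean_inner) simp
 have "cont_diff m (\<lambda>x::'a. 1 - x \<bullet> x)" for m
  unfolding e
  by (intro cont_diff_add cont_diff_const cont_diff_bounded_linear[OF bounded_linear_mult_right]
    cont_diff_sum cont_diff_scaleR cont_diff_bounded_linear[OF bounded_linear_inner_left] cont_diff_id)
 then show ?thesis unfolding bump_def[abs_def] by (rule cont_diff_bump_exp)
qed

lemma bump_nonneg [simp]: "bump x \<ge> 0"
 by (simp add: bump_def bump_exp_def)

lemma bump_eq_0: "norm x \<ge> 1 \<Longrightarrow> bump x = 0"
proof -
 assume "norm x \<ge> 1"
 then have "x \<bullet> x \<ge> 1"
  unfolding dot_square_norm by (rule one_le_power)
 then show ?thesis by (simp add: bump_def bump_exp_def)
qed

section \<open>Averages of translates\<close>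

text \<open>Compact support makes each partial derivative uniformly continuous; finitely many of
  them control the operator norm of \<open>D z - D y\<close>, and the mean value inequality on a
  ball does the rest. Uniformity in y is what allows the remainder to be integrated against an
  arbitrary integrable weight.\<close>

lemma C1_uniform_linearization:
 fixes \<kappa> :: "'a::euclidean_space \<Rightarrow> 'b::euclidean_space"
 assumes \<kappa>: "cont_diff 1 \<kappa>" and K: "compact K" "\<And>x. x \<notin> K \<Longrightarrow> \<kappa> x = 0" and "e > 0"
 obtains d where "d > 0"
  "\<And>y h. norm h < d \<Longrightarrow> norm (\<kappa> (y + h) - \<kappa> y - frechet_derivative \<kappa> (at y) h) \<le> e * norm h"
proof -
 define D where "D y = frechet_derivative \<kappa> (at y)" for y
 have D: "(\<kappa> has_derivative D y) (at y)" for y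
  using cont_diff_SucD(1)[of 0 \<kappa>] \<kappa> by (simp add: D_def)
 have D0: "D y v = 0" if "y \<notin> K" for y v
  using has_derivative_eq_0_outside[OF D compact_imp_closed[OF K(1)] that K(2)] by simp
 define e' where "e' = e / DIM('a)"
 have "e' > 0" using \<open>e > 0\<close> by (simp add: e'_def)
 have "\<exists>d>0. \<forall>y z. dist z y < d \<longrightarrow> norm (D z b - D y b) \<le> e'" if "b \<in> Basis" for b
 proof -
  have "continuous_on UNIV (\<lambda>y. D y b)"
   using cont_diff_SucD(2)[of 0 \<kappa> b] \<kappa> by (simp add: D_def)
  then have "uniformly_continuous_on UNIV (\<lambda>y. D y b)"
   by (rule uniformly_continuous_compact_support[OF _ K(1)]) (simp add: D0)
  then show ?thesis
   using \<open>e' > 0\<close> unfolding uniformly_continuous_on_def dist_norm by (meson UNIV_I less_imp_le)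
 qed
 then obtain d where d: "\<And>b. b \<in> Basis \<Longrightarrow> d b > (0::real)"
  "\<And>b y z. b \<in> Basis \<Longrightarrow> dist z y < d b \<Longrightarrow> norm (D z b - D y b) \<le> e'"
  by metis
 define \<delta> where "\<delta> = Min (d ` Basis)"
 have "\<delta> > 0" using d(1) by (simp add: \<delta>_def)
 have \<delta>_le: "\<delta> \<le> d b" if "b \<in> Basis" for b
  using that by (simp add: \<delta>_def)
 have on: "onorm (D z - D y) \<le> e" if "dist z y < \<delta>" for y z
 proof (rule onorm_le)
  fix h :: 'a
  have "(D z - D y) h = (\<Sum>b\<in>Basis. (h \<bullet> b) *\<^sub>R (D z b - D y b))"
   using linear_euclidean[OF has_derivative_linear[OF D], of z h]
    linear_euclidean[OF has_derivative_linear[OF D], of y h]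
   by (simp add: scaleR_diff_right sum_subtractf)
  also have "norm \<dots> \<le> (\<Sum>b\<in>(Basis::'a set). norm h * e')"
  proof (rule sum_norm_le)
   fix b :: 'a assume b: "b \<in> Basis"
   show "norm ((h \<bullet> b) *\<^sub>R (D z b - D y b)) \<le> norm h * e'"
    using d(2)[OF b, of z y] \<delta>_le[OF b] that Basis_le_norm[OF b, of h]
    by (auto intro!: mult_mono)
  qed
  also have "\<dots> = e * norm h" by (simp add: e'_def)
  finally show "norm ((D z - D y) h) \<le> e * norm h" .
 qed
 show ?thesis
 proof (rule that[OF \<open>\<delta> > 0\<close>])
  fix y h :: 'a assume h: "norm h < \<delta>"
  have "norm (\<kappa> (y + h) - \<kappa> y - D y (y + h - y)) \<le> norm (y + h - y) * e"
  proof (rule differentiable_bound_linearization[where S="ball y \<delta>"])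
   fix t :: real assume "t \<in> {0..1}"
   then have "norm (t *\<^sub>R h) \<le> norm h" by (simp add: mult_left_le_one_le)
   then show "y + t *\<^sub>R (y + h - y) \<in> ball y \<delta>"
    using h by (simp add: dist_norm)
  next
   fix x show "(\<kappa> has_derivative D x) (at x within ball y \<delta>)"
    using D has_derivative_at_withinI by blast
  next
   fix x assume "x \<in> ball y \<delta>" then show "onorm (D x - D y) \<le> e"
    using on by (simp add: dist_commute)
  qed (use \<open>\<delta> > 0\<close> in auto)
  then show "norm (\<kappa> (y + h) - \<kappa> y - frechet_derivative \<kappa> (at y) h) \<le> e * norm h"
   by (simp add: D_def mult.commute)
 qed
qed

text \<open>Averages of translates over an arbitrary measure space with an integrable weight. They
  cover mollification (a p = p), the translations used for integration by parts (a p = - p), and the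
  means over shifted points of a product of a cube and an interval from which the potentials are
  built.\<close>

lemma integrable_average:
 fixes \<psi> :: "'a::euclidean_space \<Rightarrow> real" and w :: "'p \<Rightarrow> 'b::euclidean_space"
 assumes \<psi>: "continuous_on UNIV \<psi>" "compact K" "\<And>x. x \<notin> K \<Longrightarrow> \<psi> x = 0"
  and [measurable]: "a \<in> borel_measurable M" and w: "integrable M w"
 shows "integrable M (\<lambda>p. \<psi> (x - a p) *\<^sub>R w p)"
proof -
 obtain C where C: "C > 0" "\<And>x. norm (\<psi> x) \<le> C"
  using compact_support_cont_bounded[OF \<psi>] by blast
 have [measurable]: "\<psi> \<in> borel_measurable borel" "w \<in> borel_measurable M"
  using \<psi>(1) w by (auto intro: borel_measurable_continuous_onI)
 show ?thesis
 proof (rule Bochner_Integration.integrable_bound[of _ "\<lambda>p. C *\<^sub>R w p"])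
  show "integrable M (\<lambda>p. C *\<^sub>R w p)" using w by simp
  show "AE p in M. norm (\<psi> (x - a p) *\<^sub>R w p) \<le> norm (C *\<^sub>R w p)"
   using C by (auto intro!: mult_right_mono simp: less_imp_le)
 qed measurable
qed

lemma continuous_average:
 fixes \<psi> :: "'a::euclidean_space \<Rightarrow> real" and w :: "'p \<Rightarrow> 'b::euclidean_space"
 assumes \<psi>: "continuous_on UNIV \<psi>" "compact K" "\<And>x. x \<notin> K \<Longrightarrow> \<psi> x = 0"
  and a[measurable]: "a \<in> borel_measurable M" and w: "integrable M w"
 shows "continuous_on UNIV (\<lambda>x. \<integral>p. \<psi> (x - a p) *\<^sub>R w p \<partial>M)"
proof -
 obtain C where C: "C > 0" "\<And>x. norm (\<psi> x) \<le> C"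
  using compact_support_cont_bounded[OF \<psi>] by blast
 have [measurable]: "\<psi> \<in> borel_measurable borel" "w \<in> borel_measurable M"
  using \<psi>(1) w by (auto intro: borel_measurable_continuous_onI)
 have "(\<lambda>n. \<integral>p. \<psi> (u n - a p) *\<^sub>R w p \<partial>M) \<longlonglongrightarrow> (\<integral>p. \<psi> (x - a p) *\<^sub>R w p \<partial>M)"
  if "u \<longlonglongrightarrow> x" for u x
 proof (rule integral_dominated_convergence[where w="\<lambda>p. C * norm (w p)"])
  show "integrable M (\<lambda>p. C * norm (w p))" using w by simp
  have "(\<lambda>n. \<psi> (u n - a p)) \<longlonglongrightarrow> \<psi> (x - a p)" for p
   by (rule continuous_on_tendsto_compose[OF \<psi>(1)]) (use that in \<open>auto intro!: tendsto_intros\<close>)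
  then show "AE p in M. (\<lambda>n. \<psi> (u n - a p) *\<^sub>R w p) \<longlonglongrightarrow> \<psi> (x - a p) *\<^sub>R w p"
   by (auto intro!: tendsto_intros)
  show "AE p in M. norm (\<psi> (u n - a p) *\<^sub>R w p) \<le> C * norm (w p)" for n
   using C by (auto intro!: mult_right_mono simp: less_imp_le)
 qed measurable
 then show ?thesis
  by (simp add: continuous_on_sequentially comp_def)
qed

text \<open>The linearization error of \<kappa> is at most e/(N + 1) |h| at all points
  simultaneously, N being the L^1 norm of w, so integration against w leaves an error of at most e
  |h|. The 1 in N + 1 covers w = 0.\<close>

lemma has_derivative_average:
 fixes \<kappa> :: "'a::euclidean_space \<Rightarrow> real" and w :: "'p \<Rightarrow> 'b::euclidean_space"
 assumes \<kappa>: "cont_diff 1 \<kappa>" "compact K" "\<And>x. x \<notin> K \<Longrightarrow> \<kappa> x = 0"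
  and a[measurable]: "a \<in> borel_measurable M" and w: "integrable M w"
 shows "((\<lambda>x. \<integral>p. \<kappa> (x - a p) *\<^sub>R w p \<partial>M) has_derivative
   (\<lambda>h. \<integral>p. frechet_derivative \<kappa> (at (x - a p)) h *\<^sub>R w p \<partial>M)) (at x)"
proof -
 define D where "D y = frechet_derivative \<kappa> (at y)" for y
 have D: "(\<kappa> has_derivative D y) (at y)" for y
  using cont_diff_SucD(1)[of 0 \<kappa>] \<kappa> by (simp add: D_def)
 have D0: "D y v = 0" if "y \<notin> K" for y v
  using has_derivative_eq_0_outside[OF D compact_imp_closed[OF \<kappa>(2)] that \<kappa>(3)] by simp
 have cD: "continuous_on UNIV (\<lambda>y. D y v)" for v
  using cont_diff_SucD(2)[of 0 \<kappa> v] \<kappa>(1) by (simp add: D_def)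
 have c\<kappa>: "continuous_on UNIV \<kappa>" using \<kappa>(1) cont_diff_continuous by blast
 note iD = integrable_average[OF cD \<kappa>(2) D0 a w]
 note i\<kappa> = integrable_average[OF c\<kappa> \<kappa>(2,3) a w]
 have lD: "linear (D y)" for y using D has_derivative_linear by blast
 have "linear (\<lambda>h. \<integral>p. D (x - a p) h *\<^sub>R w p \<partial>M)"
 proof (rule linearI)
  show "(\<integral>p. D (x - a p) (h + k) *\<^sub>R w p \<partial>M) =
    (\<integral>p. D (x - a p) h *\<^sub>R w p \<partial>M) + (\<integral>p. D (x - a p) k *\<^sub>R w p \<partial>M)" for h k
   by (subst Bochner_Integration.integral_add[OF iD iD, symmetric])
    (auto simp: linear_add[OF lD] scaleR_add_left)
  show "(\<integral>p. D (x - a p) (r *\<^sub>R h) *\<^sub>R w p \<partial>M) = r *\<^sub>R (\<integral>p. D (x - a p) h *\<^sub>R w p \<partial>M)" for r h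
   by (subst Bochner_Integration.integral_scaleR_right[symmetric])
    (auto simp: linear_scale[OF lD])
 qed
 then have bl: "bounded_linear (\<lambda>h. \<integral>p. D (x - a p) h *\<^sub>R w p \<partial>M)"
  by (simp add: linear_conv_bounded_linear)
 define N where "N = (\<integral>p. norm (w p) \<partial>M)"
 have "N \<ge> 0" by (simp add: N_def)
 show ?thesis
  unfolding has_derivative_at_alt D_def[symmetric]
 proof (intro conjI bl allI impI)
  fix e :: real assume "e > 0"
  then have "e / (N + 1) > 0" using \<open>N \<ge> 0\<close> by simp
  then obtain d where d: "d > 0"
   "\<And>y h. norm h < d \<Longrightarrow> norm (\<kappa> (y + h) - \<kappa> y - D y h) \<le> e / (N + 1) * norm h"
   using C1_uniform_linearization[OF \<kappa>] unfolding D_def by blast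
  have "norm ((\<integral>p. \<kappa> (y - a p) *\<^sub>R w p \<partial>M) - (\<integral>p. \<kappa> (x - a p) *\<^sub>R w p \<partial>M)
     - (\<integral>p. D (x - a p) (y - x) *\<^sub>R w p \<partial>M)) \<le> e * norm (y - x)"
   if y: "norm (y - x) < d" for y
  proof -
   have eq: "(\<integral>p. \<kappa> (y - a p) *\<^sub>R w p \<partial>M) - (\<integral>p. \<kappa> (x - a p) *\<^sub>R w p \<partial>M)
     - (\<integral>p. D (x - a p) (y - x) *\<^sub>R w p \<partial>M)
    = (\<integral>p. (\<kappa> (y - a p) - \<kappa> (x - a p) - D (x - a p) (y - x)) *\<^sub>R w p \<partial>M)"
    by (simp add: scaleR_diff_left Bochner_Integration.integral_diff[OF i\<kappa> i\<kappa>]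
      Bochner_Integration.integral_diff[OF Bochner_Integration.integrable_diff[OF i\<kappa> i\<kappa>] iD])
   have "norm (\<integral>p. (\<kappa> (y - a p) - \<kappa> (x - a p) - D (x - a p) (y - x)) *\<^sub>R w p \<partial>M)
    \<le> (\<integral>p. e / (N + 1) * norm (y - x) * norm (w p) \<partial>M)"
   proof (rule order_trans[OF integral_norm_bound], rule integral_mono)
    show "integrable M (\<lambda>p. norm ((\<kappa> (y - a p) - \<kappa> (x - a p) - D (x - a p) (y - x)) *\<^sub>R w p))"
     unfolding scaleR_diff_left
     by (intro Bochner_Integration.integrable_norm Bochner_Integration.integrable_diff i\<kappa> iD)
    show "integrable M (\<lambda>p. e / (N + 1) * norm (y - x) * norm (w p))"
     using w by simp
    fix p assume "p \<in> space M"
    have "norm (\<kappa> (y - a p) - \<kappa> (x - a p) - D (x - a p) (y - x)) \<le> e / (N + 1) * norm (y - x)"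
     using d(2)[OF y, of "x - a p"] by (simp add: algebra_simps)
    then show "norm ((\<kappa> (y - a p) - \<kappa> (x - a p) - D (x - a p) (y - x)) *\<^sub>R w p)
      \<le> e / (N + 1) * norm (y - x) * norm (w p)"
     unfolding norm_scaleR real_norm_def by (rule mult_right_mono) simp
   qed
   also have "\<dots> = e * norm (y - x) * (N / (N + 1))" by (simp add: N_def)
   also have "\<dots> \<le> e * norm (y - x) * 1"
    using \<open>e > 0\<close> \<open>N \<ge> 0\<close> by (intro mult_left_mono) auto
   finally show ?thesis unfolding eq by simp
  qed
  then show "\<exists>d>0. \<forall>y. norm (y - x) < d \<longrightarrow>
    norm ((\<integral>p. \<kappa> (y - a p) *\<^sub>R w p \<partial>M) - (\<integral>p. \<kappa> (x - a p) *\<^sub>R w p \<partial>M)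
     - (\<integral>p. D (x - a p) (y - x) *\<^sub>R w p \<partial>M)) \<le> e * norm (y - x)"
   using d(1) by blast
 qed
qed

lemma C1_deriv_continuous:
 "cont_diff 1 \<kappa> \<Longrightarrow> continuous_on UNIV (\<lambda>x. frechet_derivative \<kappa> (at x) v)"
 using cont_diff_SucD(2)[of 0 \<kappa> v] by simp

lemma C1_has_derivative:
 "cont_diff 1 \<kappa> \<Longrightarrow> (\<kappa> has_derivative frechet_derivative \<kappa> (at x)) (at x)"
 using cont_diff_SucD(1)[of 0 \<kappa> x] by simp

lemma C1_compact_deriv:
 fixes \<kappa> :: "'a::euclidean_space \<Rightarrow> 'b::euclidean_space"
 assumes "cont_diff 1 \<kappa>" "compact K" "\<And>x. x \<notin> K \<Longrightarrow> \<kappa> x = 0" "x \<notin> K"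
 shows "frechet_derivative \<kappa> (at x) v = 0"
 using has_derivative_eq_0_outside[OF C1_has_derivative[OF assms(1)]
   compact_imp_closed[OF assms(2)] assms(4) assms(3)] by simp

lemma cont_diff_average:
 fixes \<kappa> :: "'a::euclidean_space \<Rightarrow> real" and w :: "'p \<Rightarrow> 'b::euclidean_space"
 assumes \<kappa>: "cont_diff 1 \<kappa>" "compact K" "\<And>x. x \<notin> K \<Longrightarrow> \<kappa> x = 0"
  and a[measurable]: "a \<in> borel_measurable M" and w: "integrable M w"
 shows "cont_diff 1 (\<lambda>x. \<integral>p. \<kappa> (x - a p) *\<^sub>R w p \<partial>M)"
proof -
 have "cont_diff (Suc 0) (\<lambda>x. \<integral>p. \<kappa> (x - a p) *\<^sub>R w p \<partial>M)"
 proof (rule cont_diff_SucI[OF has_derivative_average[OF assms]])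
  show "cont_diff 0 (\<lambda>x. \<integral>p. frechet_derivative \<kappa> (at (x - a p)) v *\<^sub>R w p \<partial>M)" for v
   unfolding cont_diff.simps(1)
   by (rule continuous_average[OF C1_deriv_continuous[OF \<kappa>(1)] \<kappa>(2) C1_compact_deriv[OF \<kappa>] a w])
 qed
 then show ?thesis by simp
qed

section \<open>Integration by parts\<close>

lemma integrable_compact_support:
 fixes f :: "'a::euclidean_space \<Rightarrow> 'b::euclidean_space"
 assumes "continuous_on UNIV f" "compact K" "\<And>x. x \<notin> K \<Longrightarrow> f x = 0"
 shows "integrable lborel f"
proof -
 have "(\<lambda>x. indicator K x *\<^sub>R f x) = f"
  using assms(3) by (auto simp: indicator_def)
 then show ?thesis
  using borel_integrable_compact[OF assms(2) continuous_on_subset[OF assms(1)]] by simp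
qed

text \<open>Translation invariance: the integral of \<kappa>(x + p) over p does not depend on x, and
  its derivative at x = 0 is the integral of the derivative of \<kappa>.\<close>

lemma integral_deriv_eq_0:
 fixes \<kappa> :: "'a::euclidean_space \<Rightarrow> real"
 assumes \<kappa>: "cont_diff 1 \<kappa>" "compact K" "\<And>x. x \<notin> K \<Longrightarrow> \<kappa> x = 0"
 shows "(LBINT x. frechet_derivative \<kappa> (at x) v) = 0"
proof -
 obtain R where R: "R > 0" "\<And>x. x \<in> K \<Longrightarrow> norm x \<le> R"
  using compact_imp_bounded[OF \<kappa>(2)] by (auto simp: bounded_pos)
 \<comment> \<open>The weight 1 is not integrable over the whole space. For |x| \<le> 1 the
   indicator of this ball equals 1 wherever \<kappa>(x + p) is nonzero, so nothing is lost.\<close>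
 define w :: "'a \<Rightarrow> real" where "w = indicator (cball 0 (R + 1))"
 have w: "integrable lborel w"
  unfolding w_def using emeasure_lborel_cball_finite by (simp add: integrable_indicator_iff)
 have K1: "p \<in> cball 0 (R + 1)" if "x + p \<in> K" "norm x \<le> 1" for x p
  using R(2)[OF that(1)] that(2) norm_triangle_ineq4[of "x + p" x] by simp
 have eq: "(LBINT p. \<kappa> (x - (- p)) *\<^sub>R w p) = (LBINT p. \<kappa> p)" if "norm x \<le> 1" for x
 proof -
  have "(\<lambda>p. \<kappa> (x - (- p)) *\<^sub>R w p) = (\<lambda>p. \<kappa> (x + p))"
   using \<kappa>(3) K1[OF _ that] by (fastforce simp: w_def indicator_def fun_eq_iff)
  then have "(LBINT p. \<kappa> (x - (- p)) *\<^sub>R w p) = (LBINT p. \<kappa> (x + p))" by simp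
  also have "\<dots> = (\<integral>p. \<kappa> p \<partial>distr lborel borel ((+) x))"
   using cont_diff_measurable[OF \<kappa>(1)]
   by (subst integral_distr) auto
  finally show ?thesis by (simp add: lborel_distr_plus)
 qed
 have "((\<lambda>x. LBINT p. \<kappa> (x - (- p)) *\<^sub>R w p) has_derivative
   (\<lambda>h. LBINT p. frechet_derivative \<kappa> (at (0 - (- p))) h *\<^sub>R w p)) (at 0)"
  by (rule has_derivative_average[OF \<kappa> _ w]) auto
 then have "((\<lambda>x::'a. LBINT p. \<kappa> p) has_derivative
   (\<lambda>h. LBINT p. frechet_derivative \<kappa> (at (0 - (- p))) h *\<^sub>R w p)) (at 0)"
  by (rule has_derivative_transform_within_open[of _ _ _ _ "ball 0 1"]) (use eq in auto)
 then have "(\<lambda>h. LBINT p. frechet_derivative \<kappa> (at (0 - (- p))) h *\<^sub>R w p) = (\<lambda>h. 0)"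
  using has_derivative_unique has_derivative_const by blast
 then have "(LBINT p. frechet_derivative \<kappa> (at (0 - (- p))) v *\<^sub>R w p) = 0"
  by meson
 moreover have "(\<lambda>p. frechet_derivative \<kappa> (at (0 - (- p))) v *\<^sub>R w p) = (\<lambda>p. frechet_derivative \<kappa> (at p) v)"
  using C1_compact_deriv[OF \<kappa>, of _ v] K1[of 0] by (fastforce simp: w_def indicator_def)
 ultimately show ?thesis by metis
qed

lemma integral_by_parts:
 fixes \<kappa> g :: "'a::euclidean_space \<Rightarrow> real"
 assumes \<kappa>: "cont_diff 1 \<kappa>" "compact K" "\<And>x. x \<notin> K \<Longrightarrow> \<kappa> x = 0" and g: "cont_diff 1 g"
 shows "(LBINT x. frechet_derivative \<kappa> (at x) v * g x) =
  - (LBINT x. \<kappa> x * frechet_derivative g (at x) v)"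
proof -
 have d: "((\<lambda>x. \<kappa> x * g x) has_derivative (\<lambda>v. \<kappa> x * frechet_derivative g (at x) v
   + frechet_derivative \<kappa> (at x) v * g x)) (at x)" for x
  using g \<kappa>(1) cont_diff_SucD(1)[of 0 g] cont_diff_SucD(1)[of 0 \<kappa>] by (intro has_derivative_mult) auto
 have c: "cont_diff 1 (\<lambda>x. \<kappa> x * g x)"
  using cont_diff_scaleR[OF \<kappa>(1) g] by simp
 have cg: "continuous_on UNIV g" "continuous_on UNIV (\<lambda>x. frechet_derivative g (at x) v)"
  "continuous_on UNIV \<kappa>"
  using cont_diff_continuous[OF g] C1_deriv_continuous[OF g] cont_diff_continuous[OF \<kappa>(1)] by auto
 have "0 = (LBINT x. frechet_derivative (\<lambda>x. \<kappa> x * g x) (at x) v)"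
  by (rule integral_deriv_eq_0[OF c \<kappa>(2), symmetric]) (simp add: \<kappa>(3))
 also have "\<dots> = (LBINT x. \<kappa> x * frechet_derivative g (at x) v + frechet_derivative \<kappa> (at x) v * g x)"
  using frechet_derivative_at[OF d] by (metis (no_types, lifting))
 also have "\<dots> = (LBINT x. \<kappa> x * frechet_derivative g (at x) v) + (LBINT x. frechet_derivative \<kappa> (at x) v * g x)"
  by (intro Bochner_Integration.integral_add integrable_compact_support[OF _ \<kappa>(2)])
   (auto intro!: continuous_intros cg C1_deriv_continuous[OF \<kappa>(1)] simp: \<kappa>(3) C1_compact_deriv[OF \<kappa>])
 finally show ?thesis by simp
qed

text \<open>Two ways of differentiating \<open>s \<mapsto> \<integral> \<phi> (s + p) \<partial>\<^sub>b\<Phi> p\<close> at \<open>0\<close>.\<close>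

lemma integral_deriv_deriv_swap:
 fixes \<phi> \<Phi> :: "'a::euclidean_space \<Rightarrow> real"
 assumes \<phi>: "cont_diff 2 \<phi>" "compact K" "\<And>x. x \<notin> K \<Longrightarrow> \<phi> x = 0"
  and \<Phi>: "cont_diff 1 \<Phi>" "compact L" "\<And>x. x \<notin> L \<Longrightarrow> \<Phi> x = 0"
 shows "(LBINT x. frechet_derivative \<phi> (at x) a * frechet_derivative \<Phi> (at x) b) =
  (LBINT x. frechet_derivative \<phi> (at x) b * frechet_derivative \<Phi> (at x) a)"
proof -
 have \<phi>1: "cont_diff 1 \<phi>" using \<phi>(1) cont_diff_Suc_imp[of 1 \<phi>] by (simp add: numeral_2_eq_2)
 define \<phi>b where "\<phi>b x = frechet_derivative \<phi> (at x) b" for x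
 have \<phi>b: "cont_diff 1 \<phi>b"
  using \<phi>(1) cont_diff_SucD(2)[of 1 \<phi> b] by (simp add: numeral_2_eq_2 \<phi>b_def[abs_def])
 have \<phi>b0: "x \<notin> K \<Longrightarrow> \<phi>b x = 0" for x
  using C1_compact_deriv[OF \<phi>1 \<phi>(2,3)] by (simp add: \<phi>b_def)
 have w1: "integrable lborel (\<lambda>x. frechet_derivative \<Phi> (at x) b)"
  by (rule integrable_compact_support[OF C1_deriv_continuous[OF \<Phi>(1)] \<Phi>(2) C1_compact_deriv[OF \<Phi>]])
 have w2: "integrable lborel (\<lambda>x. - \<Phi> x)"
  using integrable_compact_support[OF cont_diff_continuous[OF \<Phi>(1)] \<Phi>(2,3)] by simp
 \<comment> \<open>Integration by parts moves the b-derivative to \<phi>, which is C^2; second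
   derivatives of \<Phi>, which is only C^1, never appear.\<close>
 have swap: "(LBINT p. \<phi> (s - (- p)) *\<^sub>R frechet_derivative \<Phi> (at p) b) =
   (LBINT p. \<phi>b (s - (- p)) *\<^sub>R (- \<Phi> p))" for s
 proof -
  have g: "cont_diff 1 (\<lambda>p. \<phi> (s + 1 *\<^sub>R p))"
   by (rule cont_diff_affine[OF \<phi>1])
  have "((\<lambda>p. s + p) has_derivative (\<lambda>h. h)) (at p)" for p
   by (auto intro!: derivative_eq_intros)
  from has_derivative_compose[OF this C1_has_derivative[OF \<phi>1]]
  have "((\<lambda>p. \<phi> (s + p)) has_derivative frechet_derivative \<phi> (at (s + p))) (at p)" for p .
  then have d: "frechet_derivative (\<lambda>p. \<phi> (s + p)) (at p) = frechet_derivative \<phi> (at (s + p))" for p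
   using frechet_derivative_at by metis
  show ?thesis
   using integral_by_parts[OF \<Phi> g, of b] by (simp add: d \<phi>b_def mult.commute)
 qed
 have "((\<lambda>s. LBINT p. \<phi> (s - (- p)) *\<^sub>R frechet_derivative \<Phi> (at p) b) has_derivative
   (\<lambda>h. LBINT p. frechet_derivative \<phi> (at (0 - (- p))) h *\<^sub>R frechet_derivative \<Phi> (at p) b)) (at 0)"
  by (rule has_derivative_average[OF \<phi>1 \<phi>(2,3) _ w1]) auto
 moreover have "((\<lambda>s. LBINT p. \<phi>b (s - (- p)) *\<^sub>R (- \<Phi> p)) has_derivative
   (\<lambda>h. LBINT p. frechet_derivative \<phi>b (at (0 - (- p))) h *\<^sub>R (- \<Phi> p))) (at 0)"
  by (rule has_derivative_average[OF \<phi>b \<phi>(2) \<phi>b0 _ w2]) auto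
 ultimately have "(\<lambda>h. LBINT p. frechet_derivative \<phi> (at (0 - (- p))) h *\<^sub>R frechet_derivative \<Phi> (at p) b)
   = (\<lambda>h. LBINT p. frechet_derivative \<phi>b (at (0 - (- p))) h *\<^sub>R (- \<Phi> p))"
  using has_derivative_unique unfolding swap by blast
 from fun_cong[OF this, of a]
 have "(LBINT p. frechet_derivative \<phi> (at p) a * frechet_derivative \<Phi> (at p) b) =
   - (LBINT p. frechet_derivative \<phi>b (at p) a * \<Phi> p)"
  by simp
 also have "\<dots> = (LBINT p. \<phi>b p * frechet_derivative \<Phi> (at p) a)"
  using integral_by_parts[OF \<phi>b \<phi>(2) \<phi>b0 \<Phi>(1), of a] by simp
 finally show ?thesis by (simp add: \<phi>b_def)
qed

section \<open>Square integrals and mollification\<close>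

text \<open>Extended nonnegative values keep integrability out of the estimates: they hold for
  measurable functions, and finiteness is asked for only where it matters.\<close>

definition sqn :: "'a::euclidean_space set \<Rightarrow> ('a \<Rightarrow> 'b::euclidean_space) \<Rightarrow> ennreal" where
 "sqn A F = (NNINT x:A. ennreal ((norm (F x))\<^sup>2))"

lemma sqn_mono: "A \<subseteq> A' \<Longrightarrow> sqn A F \<le> sqn A' F"
 unfolding sqn_def by (intro nn_integral_mono) (auto simp: indicator_def)

lemma norm_add_sq_le: "(norm (a + b))\<^sup>2 \<le> 2 * (norm a)\<^sup>2 + 2 * (norm (b::'a::real_normed_vector))\<^sup>2"
proof -
 have "(norm (a + b))\<^sup>2 \<le> (norm a + norm b)\<^sup>2"
  by (intro power_mono norm_triangle_ineq) auto
 also have "\<dots> \<le> 2 * (norm a)\<^sup>2 + 2 * (norm b)\<^sup>2"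
  using sum_squares_ge_zero[of "norm a - norm b" 0] by (simp add: power2_eq_square algebra_simps)
 finally show ?thesis .
qed

lemma sqn_add_le:
 assumes [measurable]: "F \<in> borel_measurable borel" "G \<in> borel_measurable borel" "A \<in> sets borel"
 shows "sqn A (\<lambda>x. F x + G x) \<le> 2 * sqn A F + 2 * sqn A G"
proof -
 have "ennreal ((norm (F x + G x))\<^sup>2) \<le> 2 * ennreal ((norm (F x))\<^sup>2) + 2 * ennreal ((norm (G x))\<^sup>2)" for x
 proof -
  have "ennreal ((norm (F x + G x))\<^sup>2) \<le> ennreal (2 * (norm (F x))\<^sup>2 + 2 * (norm (G x))\<^sup>2)"
   by (intro ennreal_leI norm_add_sq_le)
  then show ?thesis by (simp add: ennreal_mult)
 qed
 then have "sqn A (\<lambda>x. F x + G x) \<le>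
   (NNINT x. 2 * (ennreal ((norm (F x))\<^sup>2) * indicator A x) + 2 * (ennreal ((norm (G x))\<^sup>2) * indicator A x))"
  unfolding sqn_def by (intro nn_integral_mono) (auto simp: indicator_def)
 also have "\<dots> = 2 * sqn A F + 2 * sqn A G"
  unfolding sqn_def by (simp add: nn_integral_add nn_integral_cmult)
 finally show ?thesis .
qed

lemma sqn_uminus [simp]: "sqn A (\<lambda>x. - F x) = sqn A F"
 by (simp add: sqn_def)

lemma sqn_diff_le:
 assumes [measurable]: "F \<in> borel_measurable borel" "G \<in> borel_measurable borel" "A \<in> sets borel"
 shows "sqn A (\<lambda>x. F x - G x) \<le> 2 * sqn A F + 2 * sqn A G"
 using sqn_add_le[of F "\<lambda>x. - G x" A] by simp

lemma sqn_diff_commute: "sqn A (\<lambda>x. F x - G x) = sqn A (\<lambda>x. G x - F x)"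
 by (simp add: sqn_def norm_minus_commute)

text \<open>Every point eventually leaves the sets {F > n}, and g dominates. It controls
  truncations: g is then a common integrable bound of the integrands where the truncation changes
  something.\<close>

lemma tail_tendsto_0:
 fixes g :: "'a \<Rightarrow> ennreal" and F :: "'a \<Rightarrow> real"
 assumes [measurable]: "g \<in> borel_measurable M" "F \<in> borel_measurable M" and fin: "(\<integral>\<^sup>+x. g x \<partial>M) < \<infinity>"
 shows "(\<lambda>n::nat. \<integral>\<^sup>+x. g x * indicator {x. F x > real n} x \<partial>M) \<longlonglongrightarrow> 0"
proof -
 have "(\<lambda>n::nat. \<integral>\<^sup>+x. g x * indicator {x. F x > real n} x \<partial>M) \<longlonglongrightarrow> (\<integral>\<^sup>+x. 0 \<partial>M)"
 proof (rule nn_integral_dominated_convergence[where w=g])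
  show "AE x in M. (\<lambda>n::nat. g x * indicator {x. F x > real n} x) \<longlonglongrightarrow> 0"
  proof (rule AE_I2)
   fix x
   obtain N :: nat where "F x \<le> real N" using real_arch_simple by blast
   then have "eventually (\<lambda>n. g x * indicator {x. F x > real n} x = 0) sequentially"
    by (intro eventually_sequentiallyI[of N]) (auto simp: indicator_def)
   then show "(\<lambda>n::nat. g x * indicator {x. F x > real n} x) \<longlonglongrightarrow> 0"
    by (rule tendsto_eventually)
  qed
 qed (use fin in \<open>auto simp: indicator_def\<close>)
 then show ?thesis by simp
qed

lemma ennreal_tendsto_0_le:
 assumes "f \<longlonglongrightarrow> (0::ennreal)" "\<tau> > 0"
 obtains n where "\<And>m. m \<ge> n \<Longrightarrow> f m \<le> ennreal \<tau>"
proof -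
 have "eventually (\<lambda>n. f n < ennreal \<tau>) sequentially"
  using assms by (intro order_tendstoD(2)) auto
 then show ?thesis
  using that unfolding eventually_sequentially by (meson less_imp_le)
qed

text \<open>Measurability supplies continuous functions that converge to F almost everywhere.
  Composed with the nearest point map P of the closed ball of radius R they remain continuous and
  still converge to P F = F, but now obey the bound R, so dominated convergence applies on a set of
  finite measure.\<close>

lemma continuous_approx_bounded:
 fixes F :: "'a::euclidean_space \<Rightarrow> 'b::euclidean_space"
 assumes [measurable]: "F \<in> borel_measurable borel" "T \<in> sets borel" and T: "emeasure lborel T < \<infinity>"
  and R: "\<And>x. norm (F x) \<le> R" and "\<tau> > 0"
 obtains g where "continuous_on UNIV g" "\<And>x. norm (g x) \<le> R" "sqn T (\<lambda>x. F x - g x) \<le> ennreal \<tau>"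
proof -
 have "R \<ge> 0" using R norm_ge_zero order_trans by blast
 have "F measurable_on UNIV"
  by (subst measurable_on_iff_borel_measurable) (simp_all add: lebesgue_on_UNIV_eq measurable_completion)
 then obtain N g where N: "negligible N" and g: "\<And>n. continuous_on UNIV (g n)"
  "\<And>x. x \<notin> N \<Longrightarrow> (\<lambda>n. g n x) \<longlonglongrightarrow> F x"
  unfolding measurable_on_def by auto
 define P :: "'b \<Rightarrow> 'b" where "P = closest_point (cball 0 R)"
 have cP: "continuous_on UNIV P"
  unfolding P_def using \<open>R \<ge> 0\<close> by (intro continuous_on_closest_point) auto
 have PR: "norm (P y) \<le> R" for y
  using closest_point_in_set[of "cball 0 R" y] \<open>R \<ge> 0\<close> by (auto simp: P_def)
 have PF: "P (F x) = F x" for x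
  unfolding P_def by (rule closest_point_self) (simp add: R)
 have cPg: "continuous_on UNIV (\<lambda>x. P (g n x))" for n
  by (rule continuous_on_compose2[OF cP g(1)]) auto
 then have [measurable]: "(\<lambda>x. P (g n x)) \<in> borel_measurable borel" for n
  by (rule borel_measurable_continuous_onI)
 have ae: "AE x in lborel. x \<notin> N"
  using AE_not_in[of N lebesgue] N by (simp add: negligible_iff_null_sets AE_completion_iff)
 have "(\<lambda>n. sqn T (\<lambda>x. F x - P (g n x))) \<longlonglongrightarrow> (NNINT x:T. 0)"
  unfolding sqn_def
 proof (rule nn_integral_dominated_convergence[where w="\<lambda>x. ennreal ((2*R)\<^sup>2) * indicator T x"])
  show "AE x in lborel. ennreal ((norm (F x - P (g j x)))\<^sup>2) * indicator T x \<le> ennreal ((2*R)\<^sup>2) * indicator T x" for j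
  proof (rule AE_I2)
   fix x
   have "norm (F x - P (g j x)) \<le> 2 * R"
    using norm_triangle_ineq4[of "F x" "P (g j x)"] R[of x] PR[of "g j x"] by linarith
   then have "ennreal ((norm (F x - P (g j x)))\<^sup>2) \<le> ennreal ((2*R)\<^sup>2)"
    by (intro ennreal_leI power_mono) auto
   then show "ennreal ((norm (F x - P (g j x)))\<^sup>2) * indicator T x \<le> ennreal ((2*R)\<^sup>2) * indicator T x"
    by (rule mult_right_mono) simp
  qed
  show "(NNINT x. ennreal ((2*R)\<^sup>2) * indicator T x) < \<infinity>"
   using T by (simp add: nn_integral_cmult ennreal_mult_less_top)
  show "AE x in lborel. (\<lambda>j. ennreal ((norm (F x - P (g j x)))\<^sup>2) * indicator T x) \<longlonglongrightarrow> 0 * indicator T x"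
   using ae
  proof eventually_elim
   fix x assume "x \<notin> N"
   then have "(\<lambda>n. P (g n x)) \<longlonglongrightarrow> P (F x)"
    by (intro continuous_on_tendsto_compose[OF cP] g(2)) auto
   then have "(\<lambda>n. (norm (F x - P (g n x)))\<^sup>2) \<longlonglongrightarrow> (norm (F x - F x))\<^sup>2"
    unfolding PF by (intro tendsto_intros)
   then have "(\<lambda>n. ennreal ((norm (F x - P (g n x)))\<^sup>2)) \<longlonglongrightarrow> ennreal 0"
    by (intro tendsto_ennrealI) simp
   then show "(\<lambda>j. ennreal ((norm (F x - P (g j x)))\<^sup>2) * indicator T x) \<longlonglongrightarrow> 0 * indicator T x"
    by (cases "x \<in> T") auto
  qed
 qed measurable
 then have "(\<lambda>n. sqn T (\<lambda>x. F x - P (g n x))) \<longlonglongrightarrow> 0" by simp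
 from ennreal_tendsto_0_le[OF this \<open>\<tau> > 0\<close>]
 obtain n where "sqn T (\<lambda>x. F x - P (g n x)) \<le> ennreal \<tau>" by blast
 then show ?thesis by (intro that[OF cPg PR])
qed

definition truncate_fun :: "real \<Rightarrow> ('a \<Rightarrow> 'b::euclidean_space) \<Rightarrow> 'a \<Rightarrow> 'b" where
 "truncate_fun R F x = (if norm (F x) \<le> R then F x else 0)"

lemma truncate_fun_measurable [measurable]:
 assumes [measurable]: "F \<in> borel_measurable M"
 shows "truncate_fun R F \<in> borel_measurable M"
 unfolding truncate_fun_def[abs_def] by measurable

lemma norm_truncate_fun: "R \<ge> 0 \<Longrightarrow> norm (truncate_fun R F x) \<le> R"
 by (simp add: truncate_fun_def)

lemma continuous_approx:
 fixes F :: "'a::euclidean_space \<Rightarrow> 'b::euclidean_space"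
 assumes [measurable]: "F \<in> borel_measurable borel" "T \<in> sets borel" and T: "emeasure lborel T < \<infinity>"
  and fin: "sqn T F < \<infinity>" and "\<tau> > 0"
 obtains g where "continuous_on UNIV g" "bounded (range g)" "sqn T (\<lambda>x. F x - g x) \<le> ennreal \<tau>"
proof -
 have "(\<lambda>n::nat. NNINT x. (ennreal ((norm (F x))\<^sup>2) * indicator T x) * indicator {x. norm (F x) > real n} x) \<longlonglongrightarrow> 0"
  by (rule tail_tendsto_0) (use fin in \<open>auto simp: sqn_def\<close>)
 \<comment> \<open>Adding two errors costs a factor 2 for each square integral, and 2 (\<tau>/4) + 2
   (\<tau>/4) = \<tau>.\<close>
 then obtain n :: nat where n: "(NNINT x. (ennreal ((norm (F x))\<^sup>2) * indicator T x) * indicator {x. norm (F x) > real n} x) \<le> ennreal (\<tau>/4)"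
  using \<open>\<tau> > 0\<close> by (elim ennreal_tendsto_0_le[of _ "\<tau>/4"]) auto
 let ?G = "truncate_fun (real n) F"
 have "sqn T (\<lambda>x. F x - ?G x) = (NNINT x. (ennreal ((norm (F x))\<^sup>2) * indicator T x) * indicator {x. norm (F x) > real n} x)"
  unfolding sqn_def by (intro nn_integral_cong) (auto simp: truncate_fun_def indicator_def)
 with n have n': "sqn T (\<lambda>x. F x - ?G x) \<le> ennreal (\<tau>/4)" by simp
 obtain g where g: "continuous_on UNIV g" "\<And>x. norm (g x) \<le> real n" "sqn T (\<lambda>x. ?G x - g x) \<le> ennreal (\<tau>/4)"
  using continuous_approx_bounded[of ?G T "real n" "\<tau>/4"] T \<open>\<tau> > 0\<close> norm_truncate_fun[of "real n" F]
  by auto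
 have [measurable]: "g \<in> borel_measurable borel"
  using g(1) by (rule borel_measurable_continuous_onI)
 have "sqn T (\<lambda>x. (F x - ?G x) + (?G x - g x)) \<le> 2 * sqn T (\<lambda>x. F x - ?G x) + 2 * sqn T (\<lambda>x. ?G x - g x)"
  by (rule sqn_add_le) auto
 also have "\<dots> \<le> 2 * ennreal (\<tau>/4) + 2 * ennreal (\<tau>/4)"
  by (intro add_mono mult_left_mono n' g(3)) auto
 also have "\<dots> = ennreal \<tau>"
  using \<open>\<tau> > 0\<close> by (simp add: ennreal_mult[symmetric] ennreal_plus[symmetric] flip: ennreal_numeral del: ennreal_plus)
 finally show ?thesis
  using g(1,2) by (intro that[of g]) (auto simp: bounded_iff)
qed

lemma lborel_distr_reflect: "distr lborel borel (\<lambda>z. x - z) = (lborel :: 'a::euclidean_space measure)"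
 using lborel_affine[of "-1" x] by (simp add: density_1)

lemma integral_reflect:
 fixes f :: "'a::euclidean_space \<Rightarrow> 'b::euclidean_space"
 assumes [measurable]: "f \<in> borel_measurable borel"
 shows "(LBINT z. f (x - z)) = (LBINT z. f z)"
 using integral_distr[of "\<lambda>z. x - z" lborel borel f] by (simp add: lborel_distr_reflect)

definition moll :: "real \<Rightarrow> 'a::euclidean_space \<Rightarrow> real" where
 "moll s x = bump ((1 / s) *\<^sub>R x) / (LBINT z. bump ((1 / s) *\<^sub>R (z::'a)))"

lemma moll_nonneg [simp]: "moll s x \<ge> 0"
 unfolding moll_def by (intro divide_nonneg_nonneg integral_nonneg) auto

lemma cont_diff_moll: "cont_diff m (moll s)"
proof -
 have "cont_diff m (\<lambda>x. (1 / (LBINT z. bump ((1 / s) *\<^sub>R (z::'a)))) *\<^sub>R bump (0 + (1 / s) *\<^sub>R x))"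
  by (intro cont_diff_scaleR cont_diff_const cont_diff_affine cont_diff_bump)
 then show ?thesis by (simp add: moll_def[abs_def])
qed

lemma moll_eq_0: "s > 0 \<Longrightarrow> norm x \<ge> s \<Longrightarrow> moll s x = 0"
 unfolding moll_def by (subst bump_eq_0) auto

lemma moll_measurable [measurable]: "moll s \<in> borel_measurable borel"
 using cont_diff_continuous[OF cont_diff_moll] by (rule borel_measurable_continuous_onI)

lemma integrable_bump_scaled:
 assumes "s > 0"
 shows "integrable lborel (\<lambda>z::'a::euclidean_space. bump ((1 / s) *\<^sub>R z))"
proof (rule integrable_compact_support[of _ "cball 0 s"])
 have "cont_diff 0 (\<lambda>z::'a. bump (0 + (1 / s) *\<^sub>R z))"
  by (intro cont_diff_affine cont_diff_bump)
 then show "continuous_on UNIV (\<lambda>z::'a. bump ((1 / s) *\<^sub>R z))" by simp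
 show "bump ((1 / s) *\<^sub>R x) = 0" if "x \<notin> cball 0 s" for x :: 'a
  using that assms by (intro bump_eq_0) auto
qed simp

lemma integral_bump_scaled_pos:
 assumes "s > 0"
 shows "(LBINT z. bump ((1 / s) *\<^sub>R (z::'a::euclidean_space))) > 0"
proof -
 \<comment> \<open>On the ball of radius s/2 the rescaled point y = z/s satisfies 1 - |y|^2 \<ge>
   3/4, so the bump is at least exp(-4/3) there.\<close>
 have "0 < exp (- (4/3) :: real) * measure lborel (ball (0::'a) (s/2))"
  using assms content_ball_pos[of "s/2" "0::'a"] by simp
 also have "\<dots> = (LBINT z. exp (- (4/3) :: real) * indicator (ball (0::'a) (s/2)) z)"
  by simp
 also have "\<dots> \<le> (LBINT z. bump ((1 / s) *\<^sub>R (z::'a)))"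
 proof (rule integral_mono)
  show "integrable lborel (\<lambda>z. exp (- (4/3) :: real) * indicator (ball (0::'a) (s/2)) z)"
   using emeasure_lborel_ball_finite by (auto simp: integrable_indicator_iff)
  show "integrable lborel (\<lambda>z::'a. bump ((1 / s) *\<^sub>R z))" by (rule integrable_bump_scaled[OF assms])
  fix z :: 'a
  show "exp (- (4/3) :: real) * indicator (ball 0 (s/2)) z \<le> bump ((1 / s) *\<^sub>R z)"
  proof (cases "norm z < s / 2")
   case True
   define y where "y = (1/s) *\<^sub>R z"
   have "norm y \<le> 1/2" using True assms by (simp add: y_def field_simps)
   then have "(norm y)\<^sup>2 \<le> (1/2)\<^sup>2" by (intro power_mono) auto
   then have yy: "1 - y \<bullet> y \<ge> 3/4" by (simp add: dot_square_norm power2_eq_square)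
   have "1 / (1 - y \<bullet> y) \<le> 1 / (3/4)" by (rule divide_left_mono[OF yy]) (use yy in auto)
   with yy show ?thesis using True by (simp add: bump_def bump_exp_def y_def[symmetric])
  qed auto
 qed
 finally show ?thesis .
qed

lemma integral_moll: "s > 0 \<Longrightarrow> (LBINT z. moll s (x - z)) = 1"
proof -
 assume s: "s > 0"
 have "(LBINT z. moll s (x - z)) = (LBINT z. moll s (z::'a))"
  by (rule integral_reflect) simp
 also have "\<dots> = 1"
  using integral_bump_scaled_pos[OF s, where 'a='a] unfolding moll_def by simp
 finally show ?thesis .
qed

lemma moll_supp: "s > 0 \<Longrightarrow> x \<notin> cball 0 s \<Longrightarrow> moll s x = 0"
 by (auto intro: moll_eq_0)

lemma integrable_moll: "s > 0 \<Longrightarrow> integrable lborel (\<lambda>z. moll s (x - z))"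
proof (rule integrable_compact_support[of _ "cball x s"])
 assume s: "s > 0"
 show "moll s (x - z) = 0" if "z \<notin> cball x s" for z
  using that s by (intro moll_eq_0) (auto simp: dist_norm)
 show "continuous_on UNIV (\<lambda>z. moll s (x - z))"
  by (intro continuous_on_compose2[OF cont_diff_continuous[OF cont_diff_moll[of 0]]] continuous_intros) auto
qed simp

lemma nn_integral_moll: "s > 0 \<Longrightarrow> (NNINT z. ennreal (moll s (x - z))) = 1"
 using nn_integral_eq_integral[OF integrable_moll[of s x]] integral_moll[of s x] by simp

lemma nn_integral_moll': "s > 0 \<Longrightarrow> (NNINT x. ennreal (moll s (x - z))) = 1"
proof -
 assume s: "s > 0"
 have "(NNINT x. ennreal (moll s (x - z))) = (\<integral>\<^sup>+x. ennreal (moll s (x::'a)) \<partial>distr lborel borel ((+) (-z)))"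
  by (subst nn_integral_distr) (auto simp: algebra_simps)
 also have "\<dots> = (\<integral>\<^sup>+x. ennreal (moll s (x::'a)) \<partial>distr lborel borel (\<lambda>z. 0 - z))"
  by (simp only: lborel_distr_plus lborel_distr_reflect)
 also have "\<dots> = 1"
  using nn_integral_moll[OF s, of 0] by (subst nn_integral_distr) auto
 finally show ?thesis .
qed

definition mollify :: "real \<Rightarrow> ('a::euclidean_space \<Rightarrow> 'b::euclidean_space) \<Rightarrow> 'a \<Rightarrow> 'b" where
 "mollify s F x = (LBINT z. moll s (x - z) *\<^sub>R F z)"

lemma cont_diff_mollify:
 "s > 0 \<Longrightarrow> integrable lborel F \<Longrightarrow> cont_diff 1 (mollify s F)"
 unfolding mollify_def[abs_def]
 by (rule cont_diff_average[OF cont_diff_moll compact_cball[of 0 s] moll_supp]) auto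

lemma mollify_measurable:
 "s > 0 \<Longrightarrow> integrable lborel F \<Longrightarrow> mollify s F \<in> borel_measurable borel"
 by (rule cont_diff_measurable[OF cont_diff_mollify])

lemma integrable_moll_mult:
 fixes F :: "'a::euclidean_space \<Rightarrow> 'b::euclidean_space"
 shows
 "s > 0 \<Longrightarrow> integrable lborel F \<Longrightarrow> integrable lborel (\<lambda>z. moll s (x - z) *\<^sub>R F z)"
 by (rule integrable_average[OF cont_diff_continuous[OF cont_diff_moll] compact_cball[of 0 s] moll_supp]) auto

text \<open>Jensen's inequality for the kernel, which has mass 1: the Cauchy-Schwarz inequality with
  the kernel split into two square roots.\<close>

lemma mollify_sq_le:
 fixes F :: "'a::euclidean_space \<Rightarrow> 'b::euclidean_space"
 assumes s: "s > 0" and F: "integrable lborel F"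
 shows "ennreal ((norm (mollify s F x))\<^sup>2) \<le> (NNINT z. ennreal (moll s (x - z)) * ennreal ((norm (F z))\<^sup>2))"
proof -
 have [measurable]: "F \<in> borel_measurable borel" using F by simp
 have "ennreal (norm (mollify s F x)) \<le> (NNINT z. ennreal (norm (moll s (x - z) *\<^sub>R F z)))"
  unfolding mollify_def by (rule integral_norm_bound_ennreal[OF integrable_moll_mult[OF s F]])
 also have "\<dots> = (NNINT z. ennreal (sqrt (moll s (x - z))) * ennreal (sqrt (moll s (x - z)) * norm (F z)))"
  by (intro nn_integral_cong) (simp add: ennreal_mult[symmetric] mult.assoc[symmetric])
 finally have "(ennreal (norm (mollify s F x)))\<^sup>2 \<le> \<dots>\<^sup>2"
  by (rule power_mono) simp
 also have "\<dots> \<le> (NNINT z. (ennreal (sqrt (moll s (x - z))))\<^sup>2) * (NNINT z. (ennreal (sqrt (moll s (x - z)) * norm (F z)))\<^sup>2)"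
  by (rule Cauchy_Schwarz_nn_integral) auto
 also have "(NNINT z. (ennreal (sqrt (moll s (x - z))))\<^sup>2) = 1"
  using nn_integral_moll[OF s, of x] by (simp add: ennreal_power)
 also have "(NNINT z. (ennreal (sqrt (moll s (x - z)) * norm (F z)))\<^sup>2)
   = (NNINT z. ennreal (moll s (x - z)) * ennreal ((norm (F z))\<^sup>2))"
  by (intro nn_integral_cong) (simp add: ennreal_power power_mult_distrib ennreal_mult)
 finally show ?thesis by (simp add: ennreal_power)
qed

text \<open>Jensen's inequality, Fubini's theorem, and mass 1 of the kernel in its other variable.
  The local form with A and T is what makes the estimate usable on compact subsets of a
  domain.\<close>

lemma sqn_mollify_le:
 fixes F :: "'a::euclidean_space \<Rightarrow> 'b::euclidean_space"
 assumes s: "s > 0" and F: "integrable lborel F"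
  and [measurable]: "A \<in> sets borel" "T \<in> sets borel" and AT: "\<And>x. x \<in> A \<Longrightarrow> ball x s \<subseteq> T"
 shows "sqn A (mollify s F) \<le> sqn T F"
proof -
 have [measurable]: "F \<in> borel_measurable borel" using F by simp
 have "sqn A (mollify s F) \<le>
   (NNINT x. (NNINT z. ennreal (moll s (x - z)) * ennreal ((norm (F z))\<^sup>2) * indicator A x))"
  unfolding sqn_def using mollify_sq_le[OF s F] by (intro nn_integral_mono) (auto simp: indicator_def)
 also have "\<dots> = (NNINT z. (NNINT x. ennreal (moll s (x - z)) * ennreal ((norm (F z))\<^sup>2) * indicator A x))"
  by (rule lborel_pair.Fubini') measurable
 also have "\<dots> \<le> (NNINT z. (NNINT x. ennreal (moll s (x - z)) * (ennreal ((norm (F z))\<^sup>2) * indicator T z)))"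
 proof (intro nn_integral_mono)
  fix z x :: 'a
  show "ennreal (moll s (x - z)) * ennreal ((norm (F z))\<^sup>2) * indicator A x
    \<le> ennreal (moll s (x - z)) * (ennreal ((norm (F z))\<^sup>2) * indicator T z)"
  proof (cases "x \<in> A \<and> z \<notin> T")
   case True
   then have "z \<notin> ball x s" using AT[of x] by auto
   then have "moll s (x - z) = 0" using s by (intro moll_eq_0) (auto simp: dist_norm)
   then show ?thesis by simp
  qed (auto simp: indicator_def)
 qed
 also have "\<dots> = sqn T F"
  unfolding sqn_def
  by (intro nn_integral_cong) (simp add: nn_integral_multc nn_integral_moll'[OF s])
 finally show ?thesis .
qed

lemma mollify_close:
 fixes g :: "'a::euclidean_space \<Rightarrow> 'b::euclidean_space"
 assumes s: "s > 0" and g: "integrable lborel g" and close: "\<And>z. z \<in> ball x s \<Longrightarrow> norm (g z - y) \<le> e"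
 shows "norm (mollify s g x - y) \<le> e"
proof -
 have i: "integrable lborel (\<lambda>z. moll s (x - z) *\<^sub>R (g z - y))"
  unfolding scaleR_diff_right
  by (intro Bochner_Integration.integrable_diff integrable_moll_mult[OF s g] integrable_scaleR_left integrable_moll[OF s])
 have "mollify s g x - y = (LBINT z. moll s (x - z) *\<^sub>R (g z - y))"
  unfolding scaleR_diff_right mollify_def
  by (subst Bochner_Integration.integral_diff[OF integrable_moll_mult[OF s g] integrable_scaleR_left[OF integrable_moll[OF s]]])
   (simp add: integral_moll[OF s] integrable_moll[OF s])
 also have "norm \<dots> \<le> (LBINT z. moll s (x - z) * e)"
 proof (rule order_trans[OF integral_norm_bound], rule integral_mono)
  show "integrable lborel (\<lambda>z. norm (moll s (x - z) *\<^sub>R (g z - y)))" using i by (rule integrable_norm)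
  show "integrable lborel (\<lambda>z. moll s (x - z) * e)" by (simp add: integrable_moll[OF s])
  fix z
  show "norm (moll s (x - z) *\<^sub>R (g z - y)) \<le> moll s (x - z) * e"
  proof (cases "z \<in> ball x s")
   case True then show ?thesis using close by (auto intro!: mult_left_mono)
  next
   case False then show ?thesis using s by (subst (1 2) moll_eq_0) (auto simp: dist_norm)
  qed
 qed
 also have "\<dots> = e" using integral_moll[OF s, of x] by simp
 finally show ?thesis .
qed

lemma mollify_diff:
 "s > 0 \<Longrightarrow> integrable lborel F \<Longrightarrow> integrable lborel G \<Longrightarrow>
  mollify s (\<lambda>x. F x - G x) x = mollify s F x - mollify s G x"
 unfolding mollify_def scaleR_diff_right
 by (rule Bochner_Integration.integral_diff) (rule integrable_moll_mult; assumption)+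

text \<open>The class in which all analysis on the whole space takes place. Vanishing outside a ball
  together with square integrability gives integrability, so these functions can be mollified
  without further assumptions.\<close>

definition L2c :: "('a::euclidean_space \<Rightarrow> 'b::euclidean_space) \<Rightarrow> bool" where
 "L2c F \<longleftrightarrow> F \<in> borel_measurable borel \<and> (\<exists>R. \<forall>x. norm x > R \<longrightarrow> F x = 0) \<and> sqn UNIV F < \<infinity>"

lemma L2c_measurable: "L2c F \<Longrightarrow> F \<in> borel_measurable borel"
 by (simp add: L2c_def)

lemma L2c_integrable: "L2c F \<Longrightarrow> integrable lborel F"
proof (rule integrableI_bounded)
 assume F: "L2c F"
 then have [measurable]: "F \<in> borel_measurable borel" by (simp add: L2c_def)
 then show "F \<in> borel_measurable lborel" by simp
 obtain R where R: "\<And>x. norm x > R \<Longrightarrow> F x = 0" using F by (auto simp: L2c_def)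
 have "(NNINT x. ennreal (norm (F x))) \<le> (NNINT x. indicator (cball 0 R) x + ennreal ((norm (F x))\<^sup>2))"
 proof (intro nn_integral_mono)
  fix x
  have "norm (F x) \<le> 1 + (norm (F x))\<^sup>2"
   using sum_squares_ge_zero[of "norm (F x) - 1/2" 0] by (simp add: power2_eq_square algebra_simps)
  then have "ennreal (norm (F x)) \<le> 1 + ennreal ((norm (F x))\<^sup>2)"
   using ennreal_leI[of "norm (F x)" "1 + (norm (F x))\<^sup>2"] by simp
  then show "ennreal (norm (F x)) \<le> indicator (cball 0 R) x + ennreal ((norm (F x))\<^sup>2)"
   using R[of x] by (cases "norm x > R") auto
 qed
 also have "\<dots> = emeasure lborel (cball (0::'a) R) + sqn UNIV F"
  by (subst nn_integral_add) (simp_all add: sqn_def borel_measurable_indicator)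
 also have "\<dots> < \<infinity>"
  using F emeasure_lborel_cball_finite[of "0::'a" R] by (simp add: L2c_def less_top)
 finally show "(NNINT x. ennreal (norm (F x))) < \<infinity>" .
qed

lemma L2c_diff: "L2c F \<Longrightarrow> L2c G \<Longrightarrow> L2c (\<lambda>x. F x - G x)"
proof -
 assume F: "L2c F" and G: "L2c G"
 from F G obtain R R' where R: "\<And>x. norm x > R \<Longrightarrow> F x = 0" "\<And>x. norm x > R' \<Longrightarrow> G x = 0"
  unfolding L2c_def by metis
 have "sqn UNIV (\<lambda>x. F x - G x) \<le> 2 * sqn UNIV F + 2 * sqn UNIV G"
  using F G by (intro sqn_diff_le) (auto simp: L2c_def)
 also have "\<dots> < \<infinity>" using F G by (auto simp: L2c_def ennreal_mult_less_top)
 finally have "sqn UNIV (\<lambda>x. F x - G x) < \<infinity>" .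
 with F G R show ?thesis unfolding L2c_def by (auto intro!: exI[of _ "max R R'"])
qed

lemma L2c_continuous_restrict:
 assumes "continuous_on UNIV g" "A \<in> sets borel" "bounded A"
 shows "L2c (\<lambda>x. indicator A x *\<^sub>R g x)"
proof -
 obtain R where R: "R > 0" "\<And>x. x \<in> A \<Longrightarrow> norm x \<le> R" using assms(3) by (auto simp: bounded_pos)
 have [measurable]: "g \<in> borel_measurable borel" "A \<in> sets borel"
  using assms by (auto intro: borel_measurable_continuous_onI)
 have "bounded (g ` cball 0 R)"
  by (intro compact_imp_bounded compact_continuous_image continuous_on_subset[OF assms(1)]) auto
 then obtain C where C: "C > 0" "\<And>x. norm x \<le> R \<Longrightarrow> norm (g x) \<le> C"
  by (auto simp: bounded_pos)
 have "sqn UNIV (\<lambda>x. indicator A x *\<^sub>R g x) \<le> (NNINT x. ennreal (C\<^sup>2) * indicator (cball (0::'a) R) x)"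
  unfolding sqn_def
 proof (rule nn_integral_mono)
  fix x
  show "ennreal ((norm (indicator A x *\<^sub>R g x))\<^sup>2) * indicator UNIV x \<le> ennreal (C\<^sup>2) * indicator (cball 0 R) x"
   using R(2)[of x] C(2)[of x] by (cases "x \<in> A") (auto intro!: ennreal_leI power_mono)
 qed
 also have "\<dots> < \<infinity>"
  using emeasure_lborel_cball_finite[of "0::'a" R]
  by (simp add: nn_integral_cmult_indicator ennreal_mult_less_top less_top)
 finally show ?thesis
  unfolding L2c_def using R(2) by (auto intro!: exI[of _ R] simp: indicator_def) force
qed

text \<open>The usual three terms: mollification contracts the square integral, so F may be replaced
  by a function G that is continuous on a ball with a margin of 1 around A; there uniform continuity
  controls \<open>mollify s G - G\<close>.\<close>

lemma mollify_tendsto: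
 fixes F :: "'a::euclidean_space \<Rightarrow> 'b::euclidean_space"
 assumes F: "L2c F" and A: "A \<in> sets borel" "bounded A" and "\<tau> > 0"
 obtains s0 where "s0 > 0" "\<And>s. 0 < s \<Longrightarrow> s \<le> s0 \<Longrightarrow> sqn A (\<lambda>x. mollify s F x - F x) \<le> ennreal \<tau>"
proof -
 note [measurable] = L2c_measurable[OF F] A(1)
 obtain R where R: "R > 0" "\<And>x. x \<in> A \<Longrightarrow> norm x \<le> R" using A(2) by (auto simp: bounded_pos)
 define T :: "'a set" where "T = cball 0 (R + 1)"
 have TF: "emeasure lborel T < \<infinity>" using emeasure_lborel_cball_finite by (simp add: T_def less_top)
 have "sqn T F < \<infinity>" using F sqn_mono[of T UNIV F] by (auto simp: L2c_def intro: le_less_trans)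
 moreover have [measurable]: "T \<in> sets borel" by (simp add: T_def)
 ultimately obtain g where g: "continuous_on UNIV g" "sqn T (\<lambda>x. F x - g x) \<le> ennreal (\<tau> / 16)"
  using continuous_approx[of F T "\<tau>/16"] TF \<open>\<tau> > 0\<close> by auto
 define G where "G x = indicator T x *\<^sub>R g x" for x
 have G: "L2c G" unfolding G_def[abs_def] by (rule L2c_continuous_restrict[OF g(1)]) (auto simp: T_def)
 note [measurable] = L2c_measurable[OF G]
 have FG: "sqn T (\<lambda>x. F x - G x) \<le> ennreal (\<tau> / 16)"
 proof -
  have "sqn T (\<lambda>x. F x - G x) = sqn T (\<lambda>x. F x - g x)"
   unfolding sqn_def by (intro nn_integral_cong) (auto simp: G_def indicator_def)
  with g(2) show ?thesis by simp
 qed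
 define m where "m = measure lborel A"
 have "emeasure lborel A \<le> emeasure lborel (cball (0::'a) R)"
  using R by (intro emeasure_mono) auto
 then have Afin: "emeasure lborel A < \<infinity>"
  using emeasure_lborel_cball_finite[of "0::'a" R] by (metis infinity_ennreal_def le_less_trans less_top)
 then have m: "emeasure lborel A = ennreal m" by (simp add: m_def emeasure_eq_ennreal_measure)
 have "m \<ge> 0" by (simp add: m_def)
 define e where "e = sqrt (\<tau> / (16 * (m + 1)))"
 have "e > 0" using \<open>\<tau> > 0\<close> \<open>m \<ge> 0\<close> by (simp add: e_def)
 have "uniformly_continuous_on T g"
  using g(1) unfolding T_def by (intro compact_uniformly_continuous) (auto intro: continuous_on_subset)
 then obtain d where d: "d > 0" "\<And>x z. x \<in> T \<Longrightarrow> z \<in> T \<Longrightarrow> dist z x < d \<Longrightarrow> dist (g z) (g x) < e"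
  using \<open>e > 0\<close> unfolding uniformly_continuous_on_def by blast
 show ?thesis
 proof (rule that[of "min d 1"])
  show "min d 1 > 0" using d by simp
  fix s assume s: "0 < s" "s \<le> min d 1"
  have AT: "ball x s \<subseteq> T" if "x \<in> A" for x
  proof
   fix z assume "z \<in> ball x s"
   then show "z \<in> T" using R(2)[OF that] s norm_triangle_sub[of z x] by (auto simp: T_def dist_norm norm_minus_commute)
  qed
  have AT': "A \<subseteq> T" using R by (force simp: T_def)
  note iF = L2c_integrable[OF F] and iG = L2c_integrable[OF G]
  note [measurable] = mollify_measurable[OF s(1) iF] mollify_measurable[OF s(1) iG]
   mollify_measurable[OF s(1) L2c_integrable[OF L2c_diff[OF F G]]]
  have 1: "sqn A (mollify s (\<lambda>x. F x - G x)) \<le> ennreal (\<tau> / 16)"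
   using sqn_mollify_le[OF s(1) L2c_integrable[OF L2c_diff[OF F G]] A(1) \<open>T \<in> sets borel\<close> AT] FG
   by (rule order_trans)
  have 2: "sqn A (\<lambda>x. mollify s G x - G x) \<le> ennreal (\<tau> / 16)"
  proof -
   have "norm (mollify s G x - G x) \<le> e" if "x \<in> A" for x
   proof (rule mollify_close[OF s(1) iG])
    fix z assume z: "z \<in> ball x s"
    then have "z \<in> T" "x \<in> T" using AT[OF that] s by auto
    then show "norm (G z - G x) \<le> e"
     using d(2)[of x z] z s by (auto simp: G_def dist_norm norm_minus_commute)
   qed
   then have "sqn A (\<lambda>x. mollify s G x - G x) \<le> (NNINT x. ennreal (e\<^sup>2) * indicator A x)"
    unfolding sqn_def by (intro nn_integral_mono) (auto simp: indicator_def intro!: ennreal_leI power_mono)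
   also have "\<dots> = ennreal (e\<^sup>2 * m)"
    using m \<open>m \<ge> 0\<close> by (simp add: nn_integral_cmult ennreal_mult)
   also have "\<dots> \<le> ennreal (\<tau> / 16)"
   proof (rule ennreal_leI)
    have "e\<^sup>2 * m = \<tau> / 16 * (m / (m + 1))" using \<open>\<tau> > 0\<close> \<open>m \<ge> 0\<close> by (simp add: e_def)
    also have "\<dots> \<le> \<tau> / 16 * 1" using \<open>\<tau> > 0\<close> \<open>m \<ge> 0\<close> by (intro mult_left_mono) auto
    finally show "e\<^sup>2 * m \<le> \<tau> / 16" by simp
   qed
   finally show ?thesis .
  qed
  have 3: "sqn A (\<lambda>x. G x - F x) \<le> ennreal (\<tau> / 16)"
   using sqn_mono[OF AT', of "\<lambda>x. F x - G x"] FG by (subst sqn_diff_commute) (rule order_trans)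
  have "sqn A (\<lambda>x. mollify s F x - F x) =
    sqn A (\<lambda>x. mollify s (\<lambda>x. F x - G x) x + ((mollify s G x - G x) + (G x - F x)))"
   by (simp add: mollify_diff[OF s(1) iF iG])
  also have "\<dots> \<le> 2 * sqn A (mollify s (\<lambda>x. F x - G x)) + 2 * sqn A (\<lambda>x. (mollify s G x - G x) + (G x - F x))"
   by (rule sqn_add_le) auto
  also have "\<dots> \<le> 2 * sqn A (mollify s (\<lambda>x. F x - G x)) +
    2 * (2 * sqn A (\<lambda>x. mollify s G x - G x) + 2 * sqn A (\<lambda>x. G x - F x))"
   by (intro add_mono mult_left_mono sqn_add_le) auto
  \<comment> \<open>Two nested uses of the squared triangle inequality give the factors 2, 4 and 4;
    their sum 10 is below 16.\<close>
  also have "\<dots> \<le> 2 * ennreal (\<tau> / 16) + 2 * (2 * ennreal (\<tau> / 16) + 2 * ennreal (\<tau> / 16))"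
   by (intro add_mono mult_left_mono 1 2 3) auto
  also have "\<dots> = ennreal (10 * (\<tau> / 16))"
   using \<open>\<tau> > 0\<close> by (simp add: ennreal_mult[symmetric] ennreal_plus[symmetric] flip: ennreal_numeral del: ennreal_plus)
  also have "\<dots> \<le> ennreal \<tau>"
   using \<open>\<tau> > 0\<close> by (intro ennreal_leI) simp
  finally show "sqn A (\<lambda>x. mollify s F x - F x) \<le> ennreal \<tau>" .
 qed
qed

section \<open>Cutoff functions and Borel representatives\<close>

text \<open>Mollification at scale s of the indicator of the s-neighbourhood of K: at points of K
  only the value 1 is averaged, and farther than 2 s = e from K only the value 0.\<close>

lemma smooth_cutoff:
 fixes K U :: "'a::euclidean_space set"
 assumes K: "compact K" "open U" "K \<subseteq> U"
 obtains \<theta> :: "'a \<Rightarrow> real" and L where "cont_diff 1 \<theta>" "\<And>x. 0 \<le> \<theta> x" "\<And>x. \<theta> x \<le> 1"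
  "\<And>x. x \<in> K \<Longrightarrow> \<theta> x = 1" "compact L" "L \<subseteq> U" "\<And>x. x \<notin> L \<Longrightarrow> \<theta> x = 0"
\<comment> \<open>\<open>infdist\<close> to the empty set is 0 by convention, so the neighbourhoods
  below would be meaningless.\<close>
proof (cases "K = {}")
 case True
 show ?thesis by (rule that[of "\<lambda>x. 0" "{}"]) (use True in auto)
next
 case False
 obtain e where e: "e > 0" "{x. infdist x K \<le> e} \<subseteq> U"
  using compact_in_open_separated[OF False assms] by blast
 define s where "s = e / 2"
 have s: "s > 0" using e by (simp add: s_def)
 define A where "A = {x. infdist x K \<le> s}"
 have A: "compact A" unfolding A_def by (rule compact_infdist_le[OF False K(1) s])
 have iA: "integrable lborel (indicator A :: 'a \<Rightarrow> real)"
  using emeasure_bounded_finite[OF compact_imp_bounded[OF A]] A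
  by (simp add: integrable_indicator_iff compact_imp_closed less_top)
 define \<theta> where "\<theta> = mollify s (indicator A :: 'a \<Rightarrow> real)"
 have c: "cont_diff 1 \<theta>" unfolding \<theta>_def by (rule cont_diff_mollify[OF s iA])
 have ge: "\<theta> x \<ge> 0" for x
  unfolding \<theta>_def mollify_def by (intro integral_nonneg_AE AE_I2) auto
 have le: "\<theta> x \<le> 1" for x
 proof -
  have "\<theta> x \<le> (LBINT z. moll s (x - z))"
   unfolding \<theta>_def mollify_def
   by (intro integral_mono integrable_moll_mult[OF s iA] integrable_moll[OF s]) (auto simp: indicator_def)
  then show ?thesis by (simp add: integral_moll[OF s])
 qed
 have tri: "infdist z K \<le> infdist x K + dist x z" for x z
  by (metis infdist_triangle dist_commute)
 have one: "\<theta> x = 1" if "x \<in> K" for x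
 proof -
  have "norm (mollify s (indicator A) x - (1::real)) \<le> 0"
  proof (rule mollify_close[OF s iA])
   fix z assume "z \<in> ball x s"
   then have "z \<in> A" using tri[of z x] that by (simp add: A_def)
   then show "norm (indicator A z - (1::real)) \<le> 0" by simp
  qed
  then show ?thesis by (simp add: \<theta>_def)
 qed
 have zero: "\<theta> x = 0" if "x \<notin> {x. infdist x K \<le> e}" for x
 proof -
  have "norm (mollify s (indicator A) x - (0::real)) \<le> 0"
  proof (rule mollify_close[OF s iA])
   fix z assume "z \<in> ball x s"
   then have "z \<notin> A" using tri[of x z] that by (simp add: A_def s_def dist_commute)
   then show "norm (indicator A z - (0::real)) \<le> 0" by simp
  qed
  then show ?thesis by (simp add: \<theta>_def)
 qed
 show ?thesis
  by (rule that[OF c ge le one compact_infdist_le[OF False K(1) e(1)] e(2) zero])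
qed

lemma nn_integral_lebesgue_on:
 "\<Omega> \<in> sets borel \<Longrightarrow> (\<integral>\<^sup>+x. h x \<partial>lebesgue_on \<Omega>) = (NNINT x:\<Omega>. h x)"
 by (simp add: nn_integral_restrict_space nn_integral_completion)

text \<open>The passage from the completed measure on \<Omega>, in which the functionals are
  defined, to Borel functions on the whole space: with values 0 off \<Omega> the restriction
  disappears from the integral.\<close>

lemma integral_lebesgue_on_rep:
 fixes h :: "'a::euclidean_space \<Rightarrow> 'b::euclidean_space"
 assumes \<Omega>: "\<Omega> \<in> sets borel" and h: "h \<in> borel_measurable (lebesgue_on \<Omega>)" "h' \<in> borel_measurable borel"
  and ae: "AE x in lebesgue_on \<Omega>. h x = h' x" and 0: "\<And>x. x \<notin> \<Omega> \<Longrightarrow> h' x = 0"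
 shows "integral\<^sup>L (lebesgue_on \<Omega>) h = integral\<^sup>L lborel h'"
proof -
 have m: "h' \<in> borel_measurable lebesgue"
  using h(2) by (simp add: measurable_completion)
 then have m': "h' \<in> borel_measurable (lebesgue_on \<Omega>)"
  by (rule measurable_restrict_space1)
 have "integral\<^sup>L (lebesgue_on \<Omega>) h = integral\<^sup>L (lebesgue_on \<Omega>) h'"
  by (rule integral_cong_AE[OF h(1) m' ae])
 also have "\<dots> = integral\<^sup>L lebesgue (\<lambda>x. indicator \<Omega> x *\<^sub>R h' x)"
  using \<Omega> by (simp add: integral_restrict_space)
 also have "(\<lambda>x. indicator \<Omega> x *\<^sub>R h' x) = h'"
  using 0 by (auto simp: indicator_def)
 also have "integral\<^sup>L lebesgue h' = integral\<^sup>L lborel h'"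
  using h(2) by (simp add: integral_completion)
 finally show ?thesis .
qed

text \<open>Members of \<open>L2\<close> are only Lebesgue measurable on \<Omega> and arbitrary
  outside. A Borel representative that vanishes off \<Omega> can be fed to mollification and to
  Fubini's theorem.\<close>

definition L2_rep :: "'a::euclidean_space set \<Rightarrow> ('a \<Rightarrow> 'b::euclidean_space) \<Rightarrow> ('a \<Rightarrow> 'b) \<Rightarrow> bool" where
 "L2_rep \<Omega> F F' \<longleftrightarrow> L2c F' \<and> (\<forall>x. x \<notin> \<Omega> \<longrightarrow> F' x = 0) \<and> (AE x in lebesgue_on \<Omega>. F x = F' x)"

lemma L2_rep_exists:
 fixes F :: "'a::euclidean_space \<Rightarrow> 'b::euclidean_space"
 assumes \<Omega>: "open \<Omega>" "bounded \<Omega>" and F: "F \<in> L2 \<Omega>"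
 obtains F' where "L2_rep \<Omega> F F'"
proof -
 have \<Omega>': "\<Omega> \<in> sets borel" using \<Omega> by simp
 have \<Omega>L: "\<Omega> \<in> sets lebesgue" using \<Omega>' by simp
 have Fm: "F \<in> borel_measurable (lebesgue_on \<Omega>)" using F by (simp add: L2_def)
 then have Fm0: "(\<lambda>x. if x \<in> \<Omega> then F x else 0) \<in> borel_measurable lebesgue"
  using borel_measurable_if[OF \<Omega>L] by blast
 have "\<exists>g\<in>borel_measurable lborel. AE x in lborel. (if x \<in> \<Omega> then F x else 0) \<bullet> b = (g x :: real)" for b
  by (rule completion_ex_borel_measurable_real) (intro borel_measurable_inner Fm0 borel_measurable_const)
 then obtain g where g: "\<And>b. g b \<in> borel_measurable borel"
  "\<And>b. AE x in lborel. (if x \<in> \<Omega> then F x else 0) \<bullet> b = (g b x :: real)"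
  by (metis measurable_lborel2)
 define F' where "F' x = indicator \<Omega> x *\<^sub>R (\<Sum>b\<in>Basis. g b x *\<^sub>R b)" for x
 have [measurable]: "F' \<in> borel_measurable borel"
  unfolding F'_def[abs_def] using g(1) \<Omega>' by (intro borel_measurable_scaleR borel_measurable_sum) auto
 have "AE x in lborel. \<forall>b\<in>Basis. (if x \<in> \<Omega> then F x else 0) \<bullet> b = g b x"
  using g(2) by (intro AE_finite_allI) auto
 then have "AE x in lborel. x \<in> \<Omega> \<longrightarrow> F x = F' x"
 proof eventually_elim
  case (elim x)
  show ?case
  proof
   assume "x \<in> \<Omega>"
   with elim have "F' x = (\<Sum>b\<in>Basis. (F x \<bullet> b) *\<^sub>R b)"
    unfolding F'_def by (auto intro!: sum.cong)
   then show "F x = F' x" by (simp add: euclidean_representation)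
  qed
 qed
 then have "AE x in lebesgue. x \<in> \<Omega> \<longrightarrow> F x = F' x" by (rule AE_completion)
 then have ae: "AE x in lebesgue_on \<Omega>. F x = F' x"
  using \<Omega>L by (subst AE_restrict_space_iff) auto
 have 0: "F' x = 0" if "x \<notin> \<Omega>" for x using that by (simp add: F'_def)
 have "sqn UNIV F' = (NNINT x:\<Omega>. ennreal ((norm (F' x))\<^sup>2))"
  unfolding sqn_def by (intro nn_integral_cong) (auto simp: 0 indicator_def)
 also have "\<dots> = (\<integral>\<^sup>+x. ennreal ((norm (F' x))\<^sup>2) \<partial>lebesgue_on \<Omega>)"
  by (rule nn_integral_lebesgue_on[OF \<Omega>', symmetric])
 also have "\<dots> = (\<integral>\<^sup>+x. ennreal ((norm (F x))\<^sup>2) \<partial>lebesgue_on \<Omega>)"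
  by (rule nn_integral_cong_AE) (use ae in eventually_elim, simp)
 also have "\<dots> < \<infinity>"
  using F unfolding L2_def by (auto simp: integrable_iff_bounded)
 finally have "sqn UNIV F' < \<infinity>" .
 moreover have "\<exists>R. \<forall>x. norm x > R \<longrightarrow> F' x = 0"
  using \<Omega>(2) 0 unfolding bounded_iff by (meson leD)
 ultimately have "L2_rep \<Omega> F F'"
  using 0 ae by (simp add: L2_rep_def L2c_def)
 then show ?thesis by (rule that)
qed

lemma L2_rep_nn_integral:
 assumes "\<Omega> \<in> sets borel" "L2_rep \<Omega> F F'"
 shows "(\<integral>\<^sup>+x. h (F x) \<partial>lebesgue_on \<Omega>) = (NNINT x:\<Omega>. h (F' x))"
proof -
 have ae: "AE x in lebesgue_on \<Omega>. F x = F' x" using assms(2) by (simp add: L2_rep_def)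
 have "(\<integral>\<^sup>+x. h (F x) \<partial>lebesgue_on \<Omega>) = (\<integral>\<^sup>+x. h (F' x) \<partial>lebesgue_on \<Omega>)"
  by (rule nn_integral_cong_AE) (use ae in eventually_elim, simp)
 then show ?thesis by (simp add: nn_integral_lebesgue_on[OF assms(1)])
qed

lemma emeasure_bounded_lt_top: "bounded (A::'a::euclidean_space set) \<Longrightarrow> emeasure lborel A < \<infinity>"
 using emeasure_bounded_finite[of A] by (simp add: less_top)

lemma L2_intro_bounded:
 fixes \<psi> :: "'a::euclidean_space \<Rightarrow> 'b::euclidean_space"
 assumes \<Omega>: "\<Omega> \<in> sets borel" "bounded \<Omega>" and [measurable]: "\<psi> \<in> borel_measurable borel" and C: "\<And>x. norm (\<psi> x) \<le> C"
 shows "\<psi> \<in> L2 \<Omega>"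
proof -
 have m: "\<psi> \<in> borel_measurable (lebesgue_on \<Omega>)"
  by (intro measurable_restrict_space1 measurable_completion) simp
 have "(\<integral>\<^sup>+x. ennreal (norm ((norm (\<psi> x))\<^sup>2)) \<partial>lebesgue_on \<Omega>) \<le> (NNINT x:\<Omega>. ennreal (C\<^sup>2))"
  unfolding nn_integral_lebesgue_on[OF \<Omega>(1)] using C
  by (intro nn_integral_mono) (auto simp: indicator_def intro!: ennreal_leI power_mono)
 also have "\<dots> = ennreal (C\<^sup>2) * emeasure lborel \<Omega>"
  using \<Omega>(1) by (intro nn_integral_cmult_indicator) simp
 also have "\<dots> < \<infinity>"
  using emeasure_bounded_lt_top[OF \<Omega>(2)] by (simp add: ennreal_mult_less_top)
 finally show ?thesis
  unfolding L2_def using m by (auto simp: integrable_iff_bounded)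
qed

lemma L2c_integrable_mult:
 fixes F :: "'a::euclidean_space \<Rightarrow> 'b::euclidean_space"
 assumes F: "L2c F" and [measurable]: "\<psi> \<in> borel_measurable borel" and C: "\<And>x. \<bar>\<psi> x\<bar> \<le> (C::real)"
 shows "integrable lborel (\<lambda>x. \<psi> x *\<^sub>R F x)"
proof (rule Bochner_Integration.integrable_bound[of _ "\<lambda>x. C *\<^sub>R F x"])
 note [measurable] = L2c_measurable[OF F]
 have "C \<ge> 0" using C[of 0] by linarith
 show "integrable lborel (\<lambda>x. C *\<^sub>R F x)" using L2c_integrable[OF F] by simp
 show "AE x in lborel. norm (\<psi> x *\<^sub>R F x) \<le> norm (C *\<^sub>R F x)"
  using C \<open>C \<ge> 0\<close> by (auto intro!: mult_right_mono)
 show "(\<lambda>x. \<psi> x *\<^sub>R F x) \<in> borel_measurable lborel" by simp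
qed

text \<open>On a bounded set a bounded scalar \<psi> times a constant vector b lies in
  \<open>L2\<close>, so it is an admissible test function; letting b run through the basis turns the
  scalar limits into a limit of vectors.\<close>

lemma L2_weak_lim_rep:
 fixes u :: "nat \<Rightarrow> 'a::euclidean_space \<Rightarrow> 'b::euclidean_space"
 assumes \<Omega>: "open \<Omega>" "bounded \<Omega>" and u: "\<And>n. u n \<in> L2 \<Omega>" "\<And>n. L2_rep \<Omega> (u n) (u' n)"
  and v: "v \<in> L2 \<Omega>" "L2_rep \<Omega> v v'" and lim: "L2_weak_lim \<Omega> u v"
  and [measurable]: "\<psi> \<in> borel_measurable borel" and C: "\<And>x. \<bar>\<psi> x\<bar> \<le> (C::real)"
 shows "(\<lambda>n. LBINT x. \<psi> x *\<^sub>R u' n x) \<longlonglongrightarrow> (LBINT x. \<psi> x *\<^sub>R v' x)"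
proof -
 have \<Omega>': "\<Omega> \<in> sets borel" using \<Omega> by simp
 have eq: "(LBINT x. \<psi> x *\<^sub>R w' x) \<bullet> b = (\<integral>x. w x \<bullet> (\<psi> x *\<^sub>R b) \<partial>lebesgue_on \<Omega>)"
  if w: "w \<in> L2 \<Omega>" "L2_rep \<Omega> w w'" for w w' and b :: 'b
 proof -
  have w': "L2c w'" and ae: "AE x in lebesgue_on \<Omega>. w x = w' x" using w(2) by (auto simp: L2_rep_def)
  note [measurable] = L2c_measurable[OF w']
  have \<psi>m: "(\<lambda>x. \<psi> x *\<^sub>R b) \<in> borel_measurable (lebesgue_on \<Omega>)"
   by (intro measurable_restrict_space1 measurable_completion) simp
  have "(\<integral>x. w x \<bullet> (\<psi> x *\<^sub>R b) \<partial>lebesgue_on \<Omega>) = (LBINT x. w' x \<bullet> (\<psi> x *\<^sub>R b))"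
  proof (rule integral_lebesgue_on_rep[OF \<Omega>'])
   show "(\<lambda>x. w x \<bullet> (\<psi> x *\<^sub>R b)) \<in> borel_measurable (lebesgue_on \<Omega>)"
    using w(1) \<psi>m by (intro borel_measurable_inner) (auto simp: L2_def)
   show "AE x in lebesgue_on \<Omega>. w x \<bullet> (\<psi> x *\<^sub>R b) = w' x \<bullet> (\<psi> x *\<^sub>R b)"
    using ae by eventually_elim simp
  qed (use w(2) in \<open>auto simp: L2_rep_def\<close>)
  also have "\<dots> = (LBINT x. (\<psi> x *\<^sub>R w' x) \<bullet> b)" by simp
  also have "\<dots> = (LBINT x. \<psi> x *\<^sub>R w' x) \<bullet> b"
   by (intro integral_inner_left) (use L2c_integrable_mult[OF w' _ C] in auto)
  finally show ?thesis by simp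
 qed
 show ?thesis
  unfolding tendsto_componentwise_iff[where f="\<lambda>n. LBINT x. \<psi> x *\<^sub>R u' n x"]
 proof
  fix b :: 'b assume "b \<in> Basis"
  have "(\<lambda>x. \<psi> x *\<^sub>R b) \<in> L2 \<Omega>"
   by (rule L2_intro_bounded[OF \<Omega>' \<Omega>(2), of _ "C * norm b"]) (auto intro!: mult_right_mono C)
  from bspec[OF lim[unfolded L2_weak_lim_def] this]
  show "(\<lambda>n. (LBINT x. \<psi> x *\<^sub>R u' n x) \<bullet> b) \<longlonglongrightarrow> (LBINT x. \<psi> x *\<^sub>R v' x) \<bullet> b"
   unfolding eq[OF u] eq[OF v] .
 qed
qed

section \<open>Lower semicontinuity of the square integral\<close>

text \<open>Continuity from below of the measure with density h along a compact exhaustion. It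
  reduces lower bounds on \<Omega> to compact subsets, where there is room for mollification and for
  shifts.\<close>

lemma nn_integral_open_le:
 fixes \<Omega> :: "'a::euclidean_space set"
 assumes "open \<Omega>" and [measurable]: "h \<in> borel_measurable borel"
  and le: "\<And>K. compact K \<Longrightarrow> K \<subseteq> \<Omega> \<Longrightarrow> (NNINT x:K. h x) \<le> L"
 shows "(NNINT x:\<Omega>. h x) \<le> L"
proof -
 obtain C where C: "\<And>n. compact (C n)" "\<And>n. C n \<subseteq> \<Omega>" "\<And>n. C n \<subseteq> interior (C (Suc n))" "(\<Union>n. C n) = \<Omega>"
  using open_Union_compact_subsets[OF assms(1)] by metis
 have "incseq C" using C(3) interior_subset by (intro incseq_SucI) blast
 have Cb: "C n \<in> sets borel" for n using C(1) by (simp add: compact_imp_closed)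
 have e: "emeasure (density lborel h) A = (NNINT x:A. h x)" if "A \<in> sets borel" for A
  using that by (simp add: emeasure_density)
 have "(SUP n. emeasure (density lborel h) (C n)) = emeasure (density lborel h) (\<Union>n. C n)"
  by (rule SUP_emeasure_incseq) (use Cb \<open>incseq C\<close> in auto)
 then have "(NNINT x:\<Omega>. h x) = (SUP n. (NNINT x:C n. h x))"
  using C(4) assms(1) by (simp add: e Cb)
 also have "\<dots> \<le> L" by (intro SUP_least le C)
 finally show ?thesis .
qed

lemma moll_test:
 assumes s: "s > 0" and "cball x s \<subseteq> \<Omega>"
 shows "(\<lambda>z. moll s (x - z)) \<in> Cinf_compact \<Omega>"
proof -
 have "cont_diff m (\<lambda>z. moll s (x + (-1) *\<^sub>R z))" for m
  by (intro cont_diff_affine cont_diff_moll)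
 moreover have "compact_support_in \<Omega> (\<lambda>z. moll s (x - z))"
  by (rule compact_support_inI[of "cball x s"])
   (use assms in \<open>auto intro!: moll_eq_0 simp: dist_norm\<close>)
 ultimately show ?thesis by (simp add: Cinf_compact_def)
qed

text \<open>Young's inequality. Unlike the squared triangle inequality with factor 2 it leaves a
  factor close to 1 on the main term, which is indispensable for semicontinuity.\<close>

lemma norm_sq_split:
 assumes "\<tau> > 0"
 shows "(norm (a::'a::real_normed_vector))\<^sup>2 \<le> (1 + \<tau>) * (norm b)\<^sup>2 + (1 + 1 / \<tau>) * (norm (a - b))\<^sup>2"
proof -
 have "(norm a)\<^sup>2 \<le> (norm b + norm (a - b))\<^sup>2"
  using norm_triangle_sub[of a b] by (intro power_mono) auto
 also have "\<dots> \<le> (1 + \<tau>) * (norm b)\<^sup>2 + (1 + 1 / \<tau>) * (norm (a - b))\<^sup>2"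
 proof -
  have "0 \<le> (sqrt \<tau> * norm b - norm (a - b) / sqrt \<tau>)\<^sup>2" by simp
  also have "\<dots> = \<tau> * (norm b)\<^sup>2 + (norm (a - b))\<^sup>2 / \<tau> - 2 * norm b * norm (a - b)"
   using assms by (simp add: power2_diff power_mult_distrib power_divide)
  finally show ?thesis by (simp add: power2_sum algebra_simps)
 qed
 finally show ?thesis .
qed

lemma sqn_split:
 assumes \<tau>: "\<tau> > 0" and [measurable]: "F \<in> borel_measurable borel" "G \<in> borel_measurable borel" "A \<in> sets borel"
 shows "sqn A F \<le> ennreal (1 + \<tau>) * sqn A G + ennreal (1 + 1 / \<tau>) * sqn A (\<lambda>x. F x - G x)"
proof -
 have "ennreal ((norm (F x))\<^sup>2) \<le> ennreal (1 + \<tau>) * ennreal ((norm (G x))\<^sup>2) + ennreal (1 + 1 / \<tau>) * ennreal ((norm (F x - G x))\<^sup>2)" for x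
  using ennreal_leI[OF norm_sq_split[OF \<tau>, of "F x" "G x"]] \<tau> by (simp add: ennreal_mult)
 then have "sqn A F \<le> (NNINT x. ennreal (1 + \<tau>) * (ennreal ((norm (G x))\<^sup>2) * indicator A x)
   + ennreal (1 + 1 / \<tau>) * (ennreal ((norm (F x - G x))\<^sup>2) * indicator A x))"
  unfolding sqn_def by (intro nn_integral_mono) (auto simp: indicator_def)
 also have "\<dots> = ennreal (1 + \<tau>) * sqn A G + ennreal (1 + 1 / \<tau>) * sqn A (\<lambda>x. F x - G x)"
  unfolding sqn_def by (simp add: nn_integral_add nn_integral_cmult)
 finally show ?thesis .
qed

lemma compact_cball_subset:
 fixes K \<Omega> :: "'a::euclidean_space set"
 assumes "compact K" "open \<Omega>" "K \<subseteq> \<Omega>"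
 obtains s0 where "s0 > 0" "\<And>x s. x \<in> K \<Longrightarrow> s \<le> s0 \<Longrightarrow> cball x s \<subseteq> \<Omega>"
proof (cases "K = {}")
 case True
 then show ?thesis using that[of 1] by simp
next
 case False
 obtain e where e: "e > 0" "{x. infdist x K \<le> e} \<subseteq> \<Omega>"
  using compact_in_open_separated[OF False assms] by blast
 show ?thesis
 proof (rule that[OF e(1)])
  fix x s assume "x \<in> K" "s \<le> e"
  show "cball x s \<subseteq> \<Omega>"
  proof
   fix z assume "z \<in> cball x s"
   then have "infdist z K \<le> e" using \<open>s \<le> e\<close> infdist_le[OF \<open>x \<in> K\<close>, of z] by (simp add: dist_commute)
   then show "z \<in> \<Omega>" using e(2) by blast
  qed
 qed
qed

lemma ennreal_le_of_approx:
 fixes a L :: ennreal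
 assumes "L < \<infinity>" and "\<And>\<tau>. 0 < \<tau> \<Longrightarrow> \<tau> < 1 \<Longrightarrow> a \<le> ennreal (1 + \<tau>) * L + ennreal \<tau>"
 shows "a \<le> L"
proof -
 obtain l where l: "L = ennreal l" "l \<ge> 0" using assms(1) by (cases L) auto
 have "((\<lambda>\<tau>. ennreal ((1 + \<tau>) * l + \<tau>)) \<longlongrightarrow> ennreal ((1 + 0) * l + 0)) (at_right 0)"
  by (intro tendsto_ennrealI tendsto_intros)
 moreover have "eventually (\<lambda>\<tau>. a \<le> ennreal ((1 + \<tau>) * l + \<tau>)) (at_right 0)"
  unfolding eventually_at_right_field
  using assms(2) l by (intro exI[of _ 1]) (auto simp: ennreal_mult)
 ultimately show ?thesis
  unfolding l by (intro tendsto_lowerbound[of _ "ennreal l"]) auto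
qed

text \<open>The kernel z \<mapsto> moll s (x - z) is itself a test function, so convergence against
  test functions becomes pointwise convergence of the mollified functions on a compact set. Fatou's
  lemma applies, mollification does not increase the square integral, and s is small at the end. No
  bound on the sequence is used.\<close>

lemma sqn_lsc:
 fixes F :: "'a::euclidean_space \<Rightarrow> 'b::euclidean_space"
 assumes \<Omega>: "open \<Omega>" and F: "L2c F" and Fn: "\<And>n. L2c (Fn n)"
  and lim: "\<And>\<phi>. \<phi> \<in> Cinf_compact \<Omega> \<Longrightarrow> (\<lambda>n. LBINT x. \<phi> x *\<^sub>R Fn n x) \<longlonglongrightarrow> (LBINT x. \<phi> x *\<^sub>R F x)"
 shows "sqn \<Omega> F \<le> liminf (\<lambda>n. sqn \<Omega> (Fn n))"
proof (cases "liminf (\<lambda>n. sqn \<Omega> (Fn n)) < \<infinity>")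
 case True
 note [measurable] = L2c_measurable[OF F] L2c_measurable[OF Fn]
 let ?L = "liminf (\<lambda>n. sqn \<Omega> (Fn n))"
 show ?thesis
  unfolding sqn_def[of \<Omega> F]
 proof (rule nn_integral_open_le[OF \<Omega>])
  fix K assume K: "compact K" "K \<subseteq> \<Omega>"
  have Kb[measurable]: "K \<in> sets borel" using K by (simp add: compact_imp_closed)
  obtain s1 where s1: "s1 > 0" "\<And>x s. x \<in> K \<Longrightarrow> s \<le> s1 \<Longrightarrow> cball x s \<subseteq> \<Omega>"
   using compact_cball_subset[OF K(1) \<Omega> K(2)] by blast
  have "sqn K F \<le> ?L"
  proof (rule ennreal_le_of_approx[OF True])
   fix \<tau> :: real assume \<tau>: "0 < \<tau>" "\<tau> < 1"
   \<comment> \<open>Chosen so that (1 + 1/\<tau>) \<tau>' = \<tau>, the factor in front of the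
     mollification error being 1 + 1/\<tau>.\<close>
   define \<tau>' where "\<tau>' = \<tau> / (1 + 1 / \<tau>)"
   have "\<tau>' > 0" using \<tau> by (simp add: \<tau>'_def add_pos_pos)
   obtain s0 where s0: "s0 > 0" "\<And>s. 0 < s \<Longrightarrow> s \<le> s0 \<Longrightarrow> sqn K (\<lambda>x. mollify s F x - F x) \<le> ennreal \<tau>'"
    using mollify_tendsto[OF F Kb compact_imp_bounded[OF K(1)] \<open>\<tau>' > 0\<close>] by blast
   define s where "s = min s0 s1"
   have s: "s > 0" "s \<le> s0" "s \<le> s1" using s0 s1 by (auto simp: s_def)
   note [measurable] = mollify_measurable[OF s(1) L2c_integrable[OF F]]
    mollify_measurable[OF s(1) L2c_integrable[OF Fn]]
   have "sqn K (mollify s F) \<le> (NNINT x. liminf (\<lambda>n. ennreal ((norm (mollify s (Fn n) x))\<^sup>2) * indicator K x))"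
    unfolding sqn_def
   proof (rule nn_integral_mono)
    fix x
    have "(\<lambda>n. ennreal ((norm (mollify s (Fn n) x))\<^sup>2)) \<longlonglongrightarrow> ennreal ((norm (mollify s F x))\<^sup>2)" if "x \<in> K"
     using lim[OF moll_test[OF s(1) s1(2)[OF that s(3)]]] unfolding mollify_def
     by (intro tendsto_ennrealI tendsto_intros)
    note this = lim_imp_Liminf[OF trivial_limit_sequentially this]
    then show "ennreal ((norm (mollify s F x))\<^sup>2) * indicator K x \<le>
      liminf (\<lambda>n. ennreal ((norm (mollify s (Fn n) x))\<^sup>2) * indicator K x)"
     by (cases "x \<in> K") simp_all
   qed
   also have "\<dots> \<le> liminf (\<lambda>n. sqn K (mollify s (Fn n)))"
    unfolding sqn_def by (intro nn_integral_liminf) simp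
   also have "\<dots> \<le> ?L"
   proof (intro Liminf_mono always_eventually allI)
    fix n
    have "ball x s \<subseteq> \<Omega>" if "x \<in> K" for x
     using s1(2)[OF that s(3)] ball_subset_cball by blast
    then show "sqn K (mollify s (Fn n)) \<le> sqn \<Omega> (Fn n)"
     using \<Omega> by (intro sqn_mollify_le[OF s(1) L2c_integrable[OF Fn]]) auto
   qed
   finally have 1: "sqn K (mollify s F) \<le> ?L" .
   have "sqn K F \<le> ennreal (1 + \<tau>) * sqn K (mollify s F) + ennreal (1 + 1 / \<tau>) * sqn K (\<lambda>x. F x - mollify s F x)"
    by (rule sqn_split[OF \<tau>(1)]) auto
   also have "\<dots> \<le> ennreal (1 + \<tau>) * ?L + ennreal (1 + 1 / \<tau>) * ennreal \<tau>'"
    using 1 s0(2)[OF s(1,2)] by (intro add_mono mult_left_mono) (auto simp: sqn_diff_commute)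
   also have "ennreal (1 + 1 / \<tau>) * ennreal \<tau>' = ennreal \<tau>"
   proof -
    have "1 + 1 / \<tau> > 0" using \<tau> by (simp add: add_pos_pos)
    then have "(1 + 1 / \<tau>) * \<tau>' = \<tau>" by (simp add: \<tau>'_def)
    then show ?thesis using \<open>1 + 1 / \<tau> > 0\<close> \<open>\<tau>' > 0\<close> by (simp add: ennreal_mult[symmetric])
   qed
   finally show "sqn K F \<le> ennreal (1 + \<tau>) * ?L + ennreal \<tau>" .
  qed
  then show "(NNINT x:K. ennreal ((norm (F x))\<^sup>2)) \<le> ?L" by (simp add: sqn_def)
 qed simp
next
 case False
 then have "liminf (\<lambda>n. sqn \<Omega> (Fn n)) = \<infinity>" by (simp add: less_top[symmetric])
 then show ?thesis by simp
qed

text \<open>The fundamental lemma of the calculus of variations as a special case of semicontinuity: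
  the zero sequence has the same limits against test functions as F, so the square integral of F is
  at most 0.\<close>

lemma L2c_eq_0_AE:
 fixes F :: "'a::euclidean_space \<Rightarrow> 'b::euclidean_space"
 assumes \<Omega>: "open \<Omega>" and F: "L2c F"
  and 0: "\<And>\<phi>. \<phi> \<in> Cinf_compact \<Omega> \<Longrightarrow> (LBINT x. \<phi> x *\<^sub>R F x) = 0"
 shows "AE x in lborel. x \<in> \<Omega> \<longrightarrow> F x = 0"
proof -
 note [measurable] = L2c_measurable[OF F]
 have "L2c (\<lambda>x::'a. 0::'b)" by (simp add: L2c_def sqn_def)
 then have "sqn \<Omega> F \<le> liminf (\<lambda>n::nat. sqn \<Omega> (\<lambda>x::'a. 0::'b))"
  by (intro sqn_lsc[OF \<Omega> F]) (simp_all add: 0)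
 then have "sqn \<Omega> F = 0" by (simp add: sqn_def Liminf_const)
 then have "AE x in lborel. ennreal ((norm (F x))\<^sup>2) * indicator \<Omega> x = 0"
  unfolding sqn_def using \<Omega> by (subst (asm) nn_integral_0_iff_AE) auto
 then show ?thesis
  by eventually_elim (auto simp: indicator_def split: if_splits)
qed

section \<open>Gradients and rescaling\<close>

lemma grad_matrix_eq:
 fixes \<phi> :: "real^'n \<Rightarrow> real^'d"
 assumes "(\<phi> has_derivative D) (at x)"
 shows "grad_matrix \<phi> x = (\<chi> i j. D (axis j 1) $ i)"
 using frechet_derivative_at[OF assms] by (simp add: grad_matrix_def partial_def)

lemma grad_eq:
 assumes "(\<phi> has_derivative D) (at x)"
 shows "grad \<phi> x = (\<chi> j. D (axis j 1))"
 using frechet_derivative_at[OF assms] by (simp add: grad_def partial_def)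

lemma continuous_grad_matrix:
 fixes \<phi> :: "real^'n \<Rightarrow> real^'d"
 assumes "cont_diff 1 \<phi>"
 shows "continuous_on UNIV (grad_matrix \<phi>)"
 unfolding grad_matrix_def partial_def
 by (intro continuous_on_vec_lambda continuous_on_component C1_deriv_continuous[OF assms])

lemma grad_matrix_measurable:
 fixes \<phi> :: "real^'n \<Rightarrow> real^'d"
 shows "cont_diff 1 \<phi> \<Longrightarrow> grad_matrix \<phi> \<in> borel_measurable borel"
 by (rule borel_measurable_continuous_onI[OF continuous_grad_matrix])

lemma grad_matrix_eq_0:
 fixes \<phi> :: "real^'n \<Rightarrow> real^'d"
 assumes "cont_diff 1 \<phi>" "compact K" "\<And>x. x \<notin> K \<Longrightarrow> \<phi> x = 0" "x \<notin> K"
 shows "grad_matrix \<phi> x = 0"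
 using C1_compact_deriv[OF assms] by (simp add: grad_matrix_def partial_def vec_eq_iff)

lemma grad_matrix_add:
 fixes \<phi> \<psi> :: "real^'n \<Rightarrow> real^'d"
 assumes "cont_diff 1 \<phi>" "cont_diff 1 \<psi>"
 shows "grad_matrix (\<lambda>x. \<phi> x + \<psi> x) x = grad_matrix \<phi> x + grad_matrix \<psi> x"
 using grad_matrix_eq[OF has_derivative_add[OF C1_has_derivative[OF assms(1)] C1_has_derivative[OF assms(2)]], of x]
 by (simp add: grad_matrix_def partial_def vec_eq_iff)

lemma grad_matrix_sum:
 fixes \<phi> :: "'i \<Rightarrow> real^'n \<Rightarrow> real^'d"
 assumes "\<And>i. i \<in> I \<Longrightarrow> cont_diff 1 (\<phi> i)"
 shows "grad_matrix (\<lambda>x. \<Sum>i\<in>I. \<phi> i x) x = (\<Sum>i\<in>I. grad_matrix (\<phi> i) x)"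
 using grad_matrix_eq[OF has_derivative_sum[of I \<phi> "\<lambda>i. frechet_derivative (\<phi> i) (at x)"], OF C1_has_derivative, OF assms]
 by (simp add: grad_matrix_def partial_def vec_eq_iff)

lemma grad_matrix_scaleR_const:
 fixes \<phi> :: "real^'n \<Rightarrow> real^'d"
 assumes "cont_diff 1 \<phi>"
 shows "grad_matrix (\<lambda>x. c *\<^sub>R \<phi> x) x = c *\<^sub>R grad_matrix \<phi> x"
 using grad_matrix_eq[OF has_derivative_scaleR_right[OF C1_has_derivative[OF assms]], of c x]
 by (simp add: grad_matrix_def partial_def vec_eq_iff)

lemma grad_matrix_cutoff:
 fixes u :: "real^'n \<Rightarrow> real^'d" and \<theta> :: "real^'n \<Rightarrow> real"
 assumes "cont_diff 1 \<theta>" "cont_diff 1 u"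
 shows "grad_matrix (\<lambda>x. \<theta> x *\<^sub>R u x) x = \<theta> x *\<^sub>R grad_matrix u x + (\<chi> i j. u x $ i * grad \<theta> x $ j)"
 using grad_matrix_eq[OF has_derivative_scaleR[OF C1_has_derivative[OF assms(1)] C1_has_derivative[OF assms(2)]], of x]
 by (simp add: grad_matrix_def grad_def partial_def vec_eq_iff)

lemma norm_vec_le:
 fixes A :: "'a::real_normed_vector^'n"
 shows "norm A \<le> (\<Sum>i\<in>UNIV. norm (A $ i))"
 unfolding norm_vec_def by (rule L2_set_le_sum) simp

lemma norm_outer_le:
 "norm ((\<chi> i j. a $ i * b $ j) :: real^'n^'d) \<le> norm a * norm b"
proof -
 have "((\<chi> i j. a $ i * b $ j) :: real^'n^'d) $ i = (a $ i) *\<^sub>R b" for i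
  by (simp add: vec_eq_iff)
 then have "norm ((\<chi> i j. a $ i * b $ j) :: real^'n^'d) = L2_set (\<lambda>i. \<bar>a $ i\<bar> * norm b) UNIV"
  unfolding norm_vec_def[of "(\<chi> i j. a $ i * b $ j) :: real^'n^'d"] by simp
 also have "\<dots> = norm a * norm b"
  by (simp only: L2_set_left_distrib[OF norm_ge_zero, symmetric] norm_vec_def[of a] real_norm_def)
 finally show ?thesis by simp
qed

text \<open>The factor h in front compensates for 1/h in the argument: gradients keep their values
  while amplitudes shrink with h.\<close>

definition rescale :: "'a::euclidean_space \<Rightarrow> real \<Rightarrow> ('a \<Rightarrow> 'b::euclidean_space) \<Rightarrow> 'a \<Rightarrow> 'b" where
 "rescale c h \<phi> x = h *\<^sub>R \<phi> ((1 / h) *\<^sub>R (x - c))"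

lemma cont_diff_rescale_arg:
 assumes "cont_diff m \<phi>"
 shows "cont_diff m (\<lambda>x. \<phi> ((1 / h) *\<^sub>R (x - c)))"
 using cont_diff_affine[OF assms, of "- ((1/h) *\<^sub>R c)" "1/h"] by (simp add: scaleR_diff_right)

lemma cont_diff_rescale:
 assumes "cont_diff m \<phi>"
 shows "cont_diff m (rescale c h \<phi>)"
 using cont_diff_scaleR[OF cont_diff_const[of m h] cont_diff_rescale_arg[OF assms, of h c]]
 by (simp add: rescale_def[abs_def])

lemma has_derivative_rescale_arg:
 assumes "cont_diff 1 \<phi>"
 shows "((\<lambda>x. \<phi> ((1 / h) *\<^sub>R (x - c))) has_derivative
  (\<lambda>v. frechet_derivative \<phi> (at ((1 / h) *\<^sub>R (x - c))) ((1 / h) *\<^sub>R v))) (at x)"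
proof -
 have "((\<lambda>x. (1 / h) *\<^sub>R (x - c)) has_derivative (\<lambda>v. (1 / h) *\<^sub>R v)) (at x)"
  by (auto intro!: derivative_eq_intros)
 from has_derivative_compose[OF this C1_has_derivative[OF assms]] show ?thesis .
qed

lemma grad_matrix_rescale:
 fixes \<phi> :: "real^'n \<Rightarrow> real^'d"
 assumes "cont_diff 1 \<phi>" "h \<noteq> 0"
 shows "grad_matrix (rescale c h \<phi>) x = grad_matrix \<phi> ((1 / h) *\<^sub>R (x - c))"
proof -
 have l: "linear (frechet_derivative \<phi> (at y))" for y
  using C1_has_derivative[OF assms(1)] has_derivative_linear by blast
 have "(rescale c h \<phi> has_derivative
   (\<lambda>v. h *\<^sub>R frechet_derivative \<phi> (at ((1 / h) *\<^sub>R (x - c))) ((1 / h) *\<^sub>R v))) (at x)"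
  unfolding rescale_def[abs_def] by (intro has_derivative_scaleR_right has_derivative_rescale_arg assms)
 from grad_matrix_eq[OF this] show ?thesis
  using assms(2) by (simp add: linear_scale[OF l] grad_matrix_def partial_def vec_eq_iff)
qed

lemma rescale_C1_compact:
 assumes "\<phi> \<in> C1_compact S" "h \<noteq> 0"
 shows "rescale c h \<phi> \<in> C1_compact ((\<lambda>y. c + h *\<^sub>R y) ` S)"
proof -
 obtain K where K: "compact K" "K \<subseteq> S" "\<And>x. x \<notin> K \<Longrightarrow> \<phi> x = 0"
  using assms(1) by (auto simp: C1_compact_iff elim: compact_support_inE)
 have "compact_support_in ((\<lambda>y. c + h *\<^sub>R y) ` S) (rescale c h \<phi>)"
 proof (rule compact_support_inI)
  show "compact ((\<lambda>y. c + h *\<^sub>R y) ` K)"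
   using K(1) by (intro compact_continuous_image continuous_intros)
  show "(\<lambda>y. c + h *\<^sub>R y) ` K \<subseteq> (\<lambda>y. c + h *\<^sub>R y) ` S" using K(2) by blast
  fix x assume x: "x \<notin> (\<lambda>y. c + h *\<^sub>R y) ` K"
  have "x = c + h *\<^sub>R ((1 / h) *\<^sub>R (x - c))" using assms(2) by simp
  with x have "(1 / h) *\<^sub>R (x - c) \<notin> K" by blast
  then show "rescale c h \<phi> x = 0" using K(3) by (simp add: rescale_def)
 qed
 then show ?thesis
  using assms(1) by (simp only: C1_compact_iff cont_diff_rescale)
qed

section \<open>Cubes\<close>

definition cube :: "real^'n \<Rightarrow> real \<Rightarrow> (real^'n) set" where
 "cube c h = box c (c + h *\<^sub>R 1)"

lemma mem_cube: "x \<in> cube c h \<longleftrightarrow> (\<forall>i. c $ i < x $ i \<and> x $ i < c $ i + h)"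
proof -
 have "x \<in> cube c h \<longleftrightarrow> (\<forall>i. c $ i < x $ i \<and> x $ i < (c + h *\<^sub>R 1) $ i)"
  unfolding cube_def by (rule mem_box_cart(1))
 moreover have "(c + h *\<^sub>R 1) $ i = c $ i + h" for i
  by (simp only: vector_add_component vector_scaleR_component one_index real_scaleR_def mult_1_right)
 ultimately show ?thesis by (simp only:)
qed

lemma mem_unit_cube: "x \<in> box 0 (1::real^'n) \<longleftrightarrow> (\<forall>i. 0 < x $ i \<and> x $ i < 1)"
 unfolding mem_box_cart by simp

lemma cube_borel [measurable]: "cube c h \<in> sets borel"
 by (simp add: cube_def)

lemma mem_cube_iff_unit:
 assumes "h > 0"
 shows "x \<in> cube c h \<longleftrightarrow> (1 / h) *\<^sub>R (x - c) \<in> box 0 1"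
 using assms by (auto simp: mem_cube mem_unit_cube field_simps)

lemma image_unit_cube:
 assumes "h > 0"
 shows "(\<lambda>y. c + h *\<^sub>R y) ` box 0 1 = cube c h"
proof
 show "(\<lambda>y. c + h *\<^sub>R y) ` box 0 1 \<subseteq> cube c h"
  using assms by (auto simp: mem_cube_iff_unit)
 show "cube c h \<subseteq> (\<lambda>y. c + h *\<^sub>R y) ` box 0 1"
 proof
  fix x assume "x \<in> cube c h"
  then show "x \<in> (\<lambda>y. c + h *\<^sub>R y) ` box 0 1"
   using assms by (intro image_eqI[of _ _ "(1 / h) *\<^sub>R (x - c)"]) (auto simp: mem_cube_iff_unit)
 qed
qed

lemma nn_integral_cube:
 fixes G :: "real^'n \<Rightarrow> ennreal"
 assumes h: "h > 0" and [measurable]: "G \<in> borel_measurable borel"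
 shows "(NNINT x:cube c h. G ((1 / h) *\<^sub>R (x - c))) = ennreal (h ^ CARD('n)) * (NNINT x:box 0 1. G x)"
proof -
 have "(NNINT x:cube c h. G ((1 / h) *\<^sub>R (x - c))) =
   (\<integral>\<^sup>+x. G ((1 / h) *\<^sub>R (x - c)) * indicator (cube c h) x
    \<partial>density (distr lborel borel (\<lambda>x. c + h *\<^sub>R x)) (\<lambda>_. \<bar>h\<bar> ^ DIM(real^'n)))"
  using lborel_affine[of h c] h by simp
 also have "\<dots> = ennreal (h ^ CARD('n)) * (NNINT x. G ((1 / h) *\<^sub>R ((c + h *\<^sub>R x) - c)) * indicator (cube c h) (c + h *\<^sub>R x))"
  using h by (simp add: nn_integral_density nn_integral_distr nn_integral_cmult)
 also have "(NNINT x. G ((1 / h) *\<^sub>R ((c + h *\<^sub>R x) - c)) * indicator (cube c h) (c + h *\<^sub>R x))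
   = (NNINT x:box 0 1. G x)"
  using h by (intro nn_integral_cong) (simp add: indicator_def mem_cube_iff_unit)
 finally show ?thesis .
qed

lemma emeasure_unit_cube: "emeasure lborel (box 0 (1::real^'n)) = 1"
proof -
 have "(0::real^'n) \<bullet> b \<le> 1 \<bullet> b" if "b \<in> Basis" for b :: "real^'n"
  using that by (auto simp: Basis_vec_def inner_axis)
 then have "emeasure lborel (box 0 (1::real^'n)) = ennreal (\<Prod>b\<in>Basis. (1 - (0::real^'n)) \<bullet> b)"
  by (rule emeasure_lborel_box)
 also have "(\<Prod>b\<in>Basis. (1 - (0::real^'n)) \<bullet> b) = 1"
  by (intro prod.neutral) (auto simp: Basis_vec_def inner_axis)
 finally show ?thesis by simp
qed

lemma emeasure_cube:
 assumes "h > 0"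
 shows "emeasure lborel (cube (c::real^'n) h) = ennreal (h ^ CARD('n))"
proof -
 have "emeasure lborel (cube c h) = (NNINT x:cube c h. 1)" by simp
 also have "\<dots> = ennreal (h ^ CARD('n)) * (NNINT x:box 0 (1::real^'n). 1)"
  by (rule nn_integral_cube[OF assms]) simp
 also have "(NNINT x:box 0 (1::real^'n). 1) = 1"
  by (simp add: emeasure_unit_cube)
 finally show ?thesis by simp
qed

definition grid :: "real \<Rightarrow> (real^'n) set" where
 "grid h = {c. \<forall>i. \<exists>k::int. c $ i = h * of_int k}"

text \<open>The lower corner of the half-open grid cell of x. It recovers c from any point of the
  open grid cube at c, which makes distinct open grid cubes disjoint without a separate
  argument.\<close>

definition corner :: "real \<Rightarrow> real^'n \<Rightarrow> real^'n" where
 "corner h x = (\<chi> i. h * of_int \<lfloor>x $ i / h\<rfloor>)"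

lemma corner_grid: "corner h x \<in> grid h"
 by (auto simp: grid_def corner_def)

lemma corner_bounds:
 assumes "h > 0"
 shows "corner h x $ i \<le> x $ i" "x $ i < corner h x $ i + h"
proof -
 have "h * of_int \<lfloor>x $ i / h\<rfloor> \<le> h * (x $ i / h)" "h * (x $ i / h) < h * (of_int \<lfloor>x $ i / h\<rfloor> + 1)"
  using assms by (intro mult_left_mono mult_strict_left_mono; linarith)+
 then show "corner h x $ i \<le> x $ i" "x $ i < corner h x $ i + h"
  using assms by (simp_all add: corner_def algebra_simps)
qed

lemma corner_eq:
 assumes "h > 0" "c \<in> grid h" "x \<in> cube c h"
 shows "corner h x = c"
proof (subst vec_eq_iff, rule allI)
 fix i
 obtain k :: int where k: "c $ i = h * of_int k" using assms(2) by (auto simp: grid_def)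
 have "c $ i < x $ i" "x $ i < c $ i + h" using assms(3) by (auto simp: mem_cube)
 then have "\<lfloor>x $ i / h\<rfloor> = k"
  using assms(1) k by (intro floor_unique) (auto simp: field_simps)
 then show "corner h x $ i = c $ i" by (simp add: corner_def k)
qed

lemma norm_cube_diff_le:
 assumes "\<And>i. \<bar>x $ i - y $ i\<bar> \<le> h"
 shows "norm (x - y :: real^'n) \<le> h * CARD('n)"
proof -
 have "norm (x - y) \<le> (\<Sum>i\<in>UNIV. \<bar>(x - y) $ i\<bar>)" by (rule norm_le_l1_cart)
 also have "\<dots> \<le> (\<Sum>i\<in>(UNIV::'n set). h)" by (intro sum_mono) (simp add: assms)
 finally show ?thesis by (simp add: mult.commute)
qed

lemma finite_grid_bounded:
 fixes A :: "(real^'n) set"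
 assumes "h > 0" "bounded A"
 shows "finite (corner h ` A)"
proof -
 obtain R where R: "R > 0" "\<And>x. x \<in> A \<Longrightarrow> norm x \<le> R" using assms(2) by (auto simp: bounded_pos)
 define N where "N = \<lceil>R / h\<rceil> + 1"
 define F where "F = (\<lambda>k::int. h * of_int k) ` {-N..N}"
 have "corner h x $ i \<in> F" if "x \<in> A" for x i
 proof -
  have "\<bar>x $ i\<bar> \<le> R" using R(2)[OF that] component_le_norm_cart[of x i] by linarith
  then have "\<bar>x $ i / h\<bar> \<le> R / h" using assms(1) by (simp add: divide_right_mono)
  then have "\<lfloor>x $ i / h\<rfloor> \<in> {-N..N}" unfolding N_def by (simp, linarith)
  then show ?thesis by (auto simp: F_def corner_def)
 qed
 then have "vec_nth ` (corner h ` A) \<subseteq> (UNIV \<rightarrow>\<^sub>E F)" by auto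
 moreover have "finite (UNIV \<rightarrow>\<^sub>E F :: ('n \<Rightarrow> real) set)"
  by (intro finite_PiE) (auto simp: F_def)
 ultimately have "finite (vec_nth ` (corner h ` A))" using finite_subset by blast
 then show ?thesis by (rule finite_imageD) (auto simp: inj_on_def vec_eq_iff)
qed

definition inner_grid :: "real \<Rightarrow> (real^'n) set \<Rightarrow> (real^'n) set" where
 "inner_grid h \<Omega> = {c \<in> grid h. cube c h \<subseteq> \<Omega>}"

lemma cube_nonempty: "h > 0 \<Longrightarrow> c + (h/2) *\<^sub>R 1 \<in> cube c h"
 by (simp add: mem_cube)

lemma finite_inner_grid:
 assumes "h > 0" "bounded \<Omega>"
 shows "finite (inner_grid h \<Omega>)"
proof (rule finite_subset[OF _ finite_grid_bounded[OF assms]])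
 show "inner_grid h \<Omega> \<subseteq> corner h ` \<Omega>"
 proof
  fix c assume c: "c \<in> inner_grid h \<Omega>"
  have "corner h (c + (h/2) *\<^sub>R 1) = c"
   using c cube_nonempty[OF assms(1), of c] by (intro corner_eq[OF assms(1)]) (auto simp: inner_grid_def)
  then show "c \<in> corner h ` \<Omega>"
   using c cube_nonempty[OF assms(1), of c] unfolding inner_grid_def
   by (metis (no_types, lifting) image_eqI mem_Collect_eq subsetD)
 qed
qed

lemma AE_off_grid:
 fixes h :: real
 shows "AE x::real^'n in lborel. \<forall>i. \<forall>k::int. x $ i \<noteq> h * of_int k"
proof -
 have "AE x::real^'n in lborel. x $ i \<noteq> h * of_int k" for i and k :: int
 proof -
  have "negligible {x::real^'n. axis i 1 \<bullet> x = h * of_int k}"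
   by (rule negligible_hyperplane) (simp add: axis_eq_0_iff)
  then have "{x::real^'n. x $ i = h * of_int k} \<in> null_sets lebesgue"
   by (simp add: negligible_iff_null_sets inner_axis')
  from AE_not_in[OF this] show ?thesis
   by (simp add: AE_completion_iff)
 qed
 then show ?thesis
  by (simp add: AE_all_countable)
qed

text \<open>Off the grid hyperplanes, a null set, x lies in the open cube at its corner. That cube
  has diameter at most h times the dimension, hence stays within a distance of K that \<Omega> still
  contains.\<close>

lemma cubes_cover:
 fixes K \<Omega> :: "(real^'n) set"
 assumes "compact K" "open \<Omega>" "K \<subseteq> \<Omega>"
 obtains h0 where "h0 > 0"
  "\<And>h. 0 < h \<Longrightarrow> h \<le> h0 \<Longrightarrow> AE x in lborel. x \<in> K \<longrightarrow> x \<in> (\<Union>c\<in>inner_grid h \<Omega>. cube c h)"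
proof -
 obtain s0 where s0: "s0 > 0" "\<And>x s. x \<in> K \<Longrightarrow> s \<le> s0 \<Longrightarrow> cball x s \<subseteq> \<Omega>"
  using compact_cball_subset[OF assms] by blast
 show ?thesis
 proof (rule that[of "s0 / CARD('n)"])
  show "s0 / CARD('n) > 0" using s0 by simp
  fix h :: real assume h: "0 < h" "h \<le> s0 / CARD('n)"
  show "AE x in lborel. x \<in> K \<longrightarrow> x \<in> (\<Union>c\<in>inner_grid h \<Omega>. cube c h)"
   using AE_off_grid[of h]
  proof eventually_elim
   case (elim x)
   show ?case
   proof
    assume x: "x \<in> K"
    have "corner h x $ i \<noteq> x $ i" for i using elim by (simp add: corner_def) metis
    then have xc: "x \<in> cube (corner h x) h"
     using corner_bounds[OF h(1), of x] by (auto simp: mem_cube order_less_le)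
    have "cube (corner h x) h \<subseteq> cball x s0"
    proof
     fix y assume y: "y \<in> cube (corner h x) h"
     have "\<bar>x $ i - y $ i\<bar> \<le> h" for i
     proof -
      have "corner h x $ i < x $ i" "x $ i < corner h x $ i + h" using xc by (auto simp: mem_cube)
      moreover have "corner h x $ i < y $ i" "y $ i < corner h x $ i + h" using y by (auto simp: mem_cube)
      ultimately show ?thesis by linarith
     qed
     then have "norm (x - y) \<le> h * CARD('n)" by (rule norm_cube_diff_le)
     also have "\<dots> \<le> s0" using h by (simp add: field_simps)
     finally show "y \<in> cball x s0" by (simp add: dist_norm)
    qed
    then have "corner h x \<in> inner_grid h \<Omega>"
     using s0(2)[OF x order_refl] corner_grid[of h x] by (auto simp: inner_grid_def)
    then show "x \<in> (\<Union>c\<in>inner_grid h \<Omega>. cube c h)" using xc by blast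
   qed
  qed
 qed
qed

text \<open>Disjointness leaves at most one term, the one at the corner of x.\<close>

lemma sum_indicator_cubes:
 fixes f :: "real^'n \<Rightarrow> ennreal"
 assumes h: "h > 0" and I: "finite I" "I \<subseteq> grid h"
 shows "(\<Sum>c\<in>I. f c * indicator (cube c h) x) =
  f (corner h x) * indicator (\<Union>c\<in>I. cube c h) x"
proof (cases "x \<in> (\<Union>c\<in>I. cube c h)")
 case True
 then obtain c where c: "c \<in> I" "x \<in> cube c h" by blast
 have eq: "c' = c" if "c' \<in> I" "x \<in> cube c' h" for c'
  using corner_eq[OF h, of c' x] corner_eq[OF h, of c x] that c I(2) by auto
 have "(\<Sum>c\<in>I. f c * indicator (cube c h) x) = (\<Sum>c'\<in>I. if c' = c then f c else 0)"
 proof (intro sum.cong refl)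
  fix c' assume "c' \<in> I"
  show "f c' * indicator (cube c' h) x = (if c' = c then f c else 0)"
  proof (cases "c' = c")
   case True
   then show ?thesis using c(2) by simp
  next
   case False
   then have "x \<notin> cube c' h" using eq[OF \<open>c' \<in> I\<close>] by blast
   then show ?thesis using False by simp
  qed
 qed
 also have "\<dots> = f c" using I(1) c(1) by simp
 also have "f c = f (corner h x)" using corner_eq[OF h _ c(2)] c(1) I(2) by auto
 finally show ?thesis using True by simp
next
 case False
 then show ?thesis by (auto intro!: sum.neutral simp: indicator_def)
qed

lemma norm_matrix_vector_le: "norm ((A::real^'n^'d) *v x) \<le> norm A * norm x"
proof -
 have "\<bar>(A *v x) $ i\<bar> \<le> norm (A $ i) * norm x" for i
  using Cauchy_Schwarz_ineq2[of "A $ i" x] by (simp add: matrix_vector_mul_component)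
 then have "norm (A *v x) \<le> L2_set (\<lambda>i. norm (A $ i) * norm x) UNIV"
  unfolding norm_vec_def[of "A *v x"] by (intro L2_set_mono) auto
 also have "\<dots> = norm A * norm x"
  by (simp only: L2_set_left_distrib[OF norm_ge_zero, symmetric] norm_vec_def[of A])
 finally show ?thesis .
qed

section \<open>The quasiconvex envelope\<close>

lemma C1_compactD:
 assumes "\<phi> \<in> C1_compact S"
 shows "cont_diff 1 \<phi>" and "x \<notin> S \<Longrightarrow> \<phi> x = 0"
proof -
 show "cont_diff 1 \<phi>" using assms by (simp only: C1_compact_iff)
 assume "x \<notin> S"
 then show "\<phi> x = 0"
  using assms by (auto simp: C1_compact_iff elim!: compact_support_inE)
qed

lemma C1_compactE:
 assumes "\<phi> \<in> C1_compact S"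
 obtains K where "compact K" "K \<subseteq> S" "\<And>x. x \<notin> K \<Longrightarrow> \<phi> x = 0"
 using assms by (auto simp: C1_compact_iff elim!: compact_support_inE)

lemma C1_compact_grad_0:
 fixes \<phi> :: "real^'n \<Rightarrow> real^'d"
 assumes "\<phi> \<in> C1_compact S" "x \<notin> S"
 shows "grad_matrix \<phi> x = 0"
proof -
 obtain K where K: "compact K" "K \<subseteq> S" "\<And>x. x \<notin> K \<Longrightarrow> \<phi> x = 0"
  using C1_compactE[OF assms(1)] by blast
 show ?thesis
  by (rule grad_matrix_eq_0[OF C1_compactD(1)[OF assms(1)] K(1,3)]) (use K assms in auto)
qed

lemma C1_compact_bounded:
 fixes \<phi> :: "real^'n \<Rightarrow> real^'d"
 assumes "\<phi> \<in> C1_compact S"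
 obtains M where "M > 0" "\<And>x. norm (\<phi> x) \<le> M" "\<And>x. norm (grad_matrix \<phi> x) \<le> M"
proof -
 obtain K where K: "compact K" "K \<subseteq> S" "\<And>x. x \<notin> K \<Longrightarrow> \<phi> x = 0"
  using C1_compactE[OF assms] by blast
 note c = C1_compactD(1)[OF assms]
 obtain M1 where M1: "M1 > 0" "\<And>x. norm (\<phi> x) \<le> M1"
  using compact_support_cont_bounded[OF cont_diff_continuous[OF c] K(1,3)] by blast
 obtain M2 where M2: "M2 > 0" "\<And>x. norm (grad_matrix \<phi> x) \<le> M2"
  using compact_support_cont_bounded[OF continuous_grad_matrix[OF c] K(1) grad_matrix_eq_0[OF c K(1,3)]] by blast
 show ?thesis
  by (rule that[of "max M1 M2"]) (use M1 M2 in \<open>auto simp: le_max_iff_disj\<close>)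
qed

lemma zero_C1_compact [simp]: "(\<lambda>x. 0) \<in> C1_compact S"
 unfolding C1_compact_iff by (intro conjI cont_diff_const compact_support_inI[of "{}"]) auto

lemma C1_compact_add:
 assumes "\<phi> \<in> C1_compact S" "\<psi> \<in> C1_compact S"
 shows "(\<lambda>x. \<phi> x + \<psi> x) \<in> C1_compact S"
proof -
 obtain K where K: "compact K" "K \<subseteq> S" "\<And>x. x \<notin> K \<Longrightarrow> \<phi> x = 0" using C1_compactE[OF assms(1)] by blast
 obtain L where L: "compact L" "L \<subseteq> S" "\<And>x. x \<notin> L \<Longrightarrow> \<psi> x = 0" using C1_compactE[OF assms(2)] by blast
 have "compact_support_in S (\<lambda>x. \<phi> x + \<psi> x)"
  by (rule compact_support_inI[of "K \<union> L"]) (use K L in auto)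
 then show ?thesis
  unfolding C1_compact_iff using cont_diff_add[OF C1_compactD(1)[OF assms(1)] C1_compactD(1)[OF assms(2)]] by blast
qed

lemma C1_compact_sum:
 assumes "finite I" "\<And>i. i \<in> I \<Longrightarrow> \<phi> i \<in> C1_compact S"
 shows "(\<lambda>x. \<Sum>i\<in>I. \<phi> i x) \<in> C1_compact S"
 using assms by (induction I rule: finite_induct) (auto intro: C1_compact_add)

lemma C1_compact_mono: "\<phi> \<in> C1_compact S \<Longrightarrow> S \<subseteq> T \<Longrightarrow> \<phi> \<in> C1_compact T"
 unfolding C1_compact_iff compact_support_in_def by blast

lemma grad_matrix_const_0 [simp]: "grad_matrix (\<lambda>x::real^'n. 0 :: real^'d) x = 0"
 using grad_matrix_eq[OF has_derivative_const[of "0 :: real^'d"], of x] by (simp add: vec_eq_iff)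

lemma rescale_cube:
 fixes \<phi> :: "real^'n \<Rightarrow> real^'d"
 assumes "\<phi> \<in> C1_compact (box 0 1)" "h > 0"
 shows "rescale c h \<phi> \<in> C1_compact (cube c h)"
 using rescale_C1_compact[OF assms(1), of h c] assms(2) by (simp add: image_unit_cube)

lemma sum_cubes:
 fixes T :: "real^'n \<Rightarrow> real^'n \<Rightarrow> 'b::real_vector"
 assumes h: "h > 0" and I: "finite I" "I \<subseteq> grid h" and T: "\<And>c x. c \<in> I \<Longrightarrow> x \<notin> cube c h \<Longrightarrow> T c x = 0"
 shows "c \<in> I \<Longrightarrow> x \<in> cube c h \<Longrightarrow> (\<Sum>c\<in>I. T c x) = T c x"
  and "x \<notin> (\<Union>c\<in>I. cube c h) \<Longrightarrow> (\<Sum>c\<in>I. T c x) = 0"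
proof -
 show "(\<Sum>c\<in>I. T c x) = 0" if "x \<notin> (\<Union>c\<in>I. cube c h)"
  using that T by (intro sum.neutral) auto
 assume c: "c \<in> I" "x \<in> cube c h"
 have "T c' x = (if c' = c then T c x else 0)" if c': "c' \<in> I" for c'
 proof (cases "x \<in> cube c' h")
  case True
  then have "c' = c" using corner_eq[OF h _ True] corner_eq[OF h _ c(2)] c' c(1) I(2) by auto
  then show ?thesis by simp
 next
  case False
  then show ?thesis using T[OF c' False] c(2) by auto
 qed
 then have "(\<Sum>c'\<in>I. T c' x) = (\<Sum>c'\<in>I. if c' = c then T c x else 0)" by (intro sum.cong) auto
 then show "(\<Sum>c\<in>I. T c x) = T c x" using c(1) I(1) by simp
qed

lemma compact_approx_measure:
 fixes \<Omega> :: "'a::euclidean_space set"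
 assumes "open \<Omega>" "bounded \<Omega>" "\<kappa> > 0"
 obtains K where "compact K" "K \<subseteq> \<Omega>" "emeasure lborel (\<Omega> - K) \<le> ennreal \<kappa>"
proof -
 obtain C where C: "\<And>n. compact (C n)" "\<And>n. C n \<subseteq> \<Omega>" "\<And>n. C n \<subseteq> interior (C (Suc n))" "(\<Union>n. C n) = \<Omega>"
  using open_Union_compact_subsets[OF assms(1)] by metis
 have Cs: "C n \<subseteq> C (Suc n)" for n using C(3)[of n] interior_subset by blast
 have "decseq (\<lambda>n. \<Omega> - C n)"
  unfolding decseq_Suc_iff using Cs by blast
 moreover have "\<Omega> - C n \<in> sets lborel" for n
  using assms(1) C(1) by (simp add: compact_imp_closed)
 moreover have "emeasure lborel (\<Omega> - C n) \<noteq> \<infinity>" for n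
  using emeasure_bounded_lt_top[of "\<Omega> - C n"] assms(2) by (auto simp: bounded_diff)
 ultimately have "(\<lambda>n. emeasure lborel (\<Omega> - C n)) \<longlonglongrightarrow> emeasure lborel (\<Inter>n. \<Omega> - C n)"
  by (intro Lim_emeasure_decseq) auto
 moreover have "(\<Inter>n. \<Omega> - C n) = {}" using C(4) by blast
 ultimately have "(\<lambda>n. emeasure lborel (\<Omega> - C n)) \<longlonglongrightarrow> 0" by (simp only: emeasure_empty)
 from ennreal_tendsto_0_le[OF this assms(3)] obtain n where "emeasure lborel (\<Omega> - C n) \<le> ennreal \<kappa>" by blast
 then show ?thesis by (intro that[of "C n"] C)
qed

lemma Lindelof_image:
 fixes G :: "'b \<Rightarrow> 'a::second_countable_topology set"
 assumes "\<And>p. p \<in> P \<Longrightarrow> open (G p)"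
 shows "\<exists>P'\<subseteq>P. countable P' \<and> (\<Union>p\<in>P'. G p) = (\<Union>p\<in>P. G p)"
proof -
 have "\<And>S. S \<in> G ` P \<Longrightarrow> open S" using assms by blast
 then obtain F' where F': "F' \<subseteq> G ` P" "countable F'" "\<Union>F' = \<Union>(G ` P)"
  by (rule Lindelof)
 then obtain P' where P': "countable P'" "P' \<subseteq> P" "F' = G ` P'"
  using countable_subset_image[THEN iffD1, OF conjI[OF F'(2,1)]] by blast
 show ?thesis
  by (rule exI[of _ P']) (use P' F'(3) in simp)
qed

text \<open>Only continuity and the upper growth bound enter the theory of the envelope. Coercivity
  belongs to the energy, where it bounds the fields B_n in L^2.\<close>

locale integrand =
 fixes f :: "real^'n^'d \<Rightarrow> real" and C :: real
 assumes cont: "continuous_on UNIV f" and nonneg: "\<And>\<eta>. 0 \<le> f \<eta>" and C_pos: "C > 0"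
  and growth: "\<And>\<eta>. f \<eta> \<le> C * (1 + (norm \<eta>)\<^sup>2)"
begin

lemma f_measurable [measurable]: "f \<in> borel_measurable borel"
 by (rule borel_measurable_continuous_onI[OF cont])

section \<open>Cell integrals and their infimum\<close>

definition qint :: "(real^'n \<Rightarrow> real^'d) \<Rightarrow> real^'n^'d \<Rightarrow> ennreal" where
 "qint \<phi> \<eta> = (NNINT x:box 0 1. ennreal (f (\<eta> + grad_matrix \<phi> x)))"

definition Z :: "real^'n^'d \<Rightarrow> ennreal" where
 "Z \<eta> = (INF \<phi>\<in>C1_compact (box 0 1). qint \<phi> \<eta>)"

lemma growth_add: "f (a + v) \<le> C * (1 + 2 * (norm a)\<^sup>2 + 2 * (norm v)\<^sup>2)"
proof -
 have "f (a + v) \<le> C * (1 + (norm (a + v))\<^sup>2)" by (rule growth)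
 also have "\<dots> \<le> C * (1 + (2 * (norm a)\<^sup>2 + 2 * (norm v)\<^sup>2))"
  using C_pos norm_add_sq_le[of a v] by (intro mult_left_mono add_left_mono) auto
 finally show ?thesis by (simp add: algebra_simps)
qed

lemma qint_zero: "qint (\<lambda>x. 0) \<eta> = ennreal (f \<eta>)"
 by (simp add: qint_def nn_integral_cmult_indicator emeasure_unit_cube)

lemma Z_le_qint: "\<phi> \<in> C1_compact (box 0 1) \<Longrightarrow> Z \<eta> \<le> qint \<phi> \<eta>"
 unfolding Z_def by (rule INF_lower)

lemma Z_le_f: "Z \<eta> \<le> ennreal (f \<eta>)"
 using Z_le_qint[of "\<lambda>x. 0" \<eta>] by (simp add: qint_zero)

lemma qint_cube:
 assumes "cont_diff 1 \<phi>" "h > 0"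
 shows "(NNINT x:cube c h. ennreal (f (\<eta> + grad_matrix (rescale c h \<phi>) x))) = ennreal (h ^ CARD('n)) * qint \<phi> \<eta>"
proof -
 have [measurable]: "grad_matrix \<phi> \<in> borel_measurable borel" by (rule grad_matrix_measurable[OF assms(1)])
 have "(NNINT x:cube c h. ennreal (f (\<eta> + grad_matrix (rescale c h \<phi>) x))) =
   (NNINT x:cube c h. ennreal (f (\<eta> + grad_matrix \<phi> ((1 / h) *\<^sub>R (x - c)))))"
  using assms by (simp add: grad_matrix_rescale)
 also have "\<dots> = ennreal (h ^ CARD('n)) * qint \<phi> \<eta>"
  unfolding qint_def by (rule nn_integral_cube[OF assms(2)]) simp
 finally show ?thesis .
qed

text \<open>Dominated convergence, with the growth bound and a bound on the gradient of \<phi>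
  supplying the dominating constant. It makes the sublevel sets {qint \<phi> < q} open, so that
  countable subcovers exist.\<close>

lemma continuous_qint:
 assumes \<phi>: "\<phi> \<in> C1_compact (box 0 1)"
 shows "continuous_on UNIV (qint \<phi>)"
proof -
 obtain M where M: "M > 0" "\<And>x. norm (grad_matrix \<phi> x) \<le> M" using C1_compact_bounded[OF \<phi>] by metis
 have [measurable]: "grad_matrix \<phi> \<in> borel_measurable borel"
  by (rule grad_matrix_measurable[OF C1_compactD(1)[OF \<phi>]])
 have "(\<lambda>k. qint \<phi> (u k)) \<longlonglongrightarrow> qint \<phi> \<eta>" if u: "u \<longlonglongrightarrow> \<eta>" for u \<eta>
 proof -
  obtain R where R: "R > 0" "\<And>k. norm (u k) \<le> R"
   using convergent_imp_Bseq[of u] u by (auto simp: convergent_def Bseq_def)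
  define D where "D = C * (1 + 2 * R\<^sup>2 + 2 * M\<^sup>2)"
  show ?thesis
   unfolding qint_def
  proof (rule nn_integral_dominated_convergence[where w="\<lambda>x. ennreal D * indicator (box 0 1) x"])
   show "AE x in lborel. ennreal (f (u j + grad_matrix \<phi> x)) * indicator (box 0 1) x \<le> ennreal D * indicator (box 0 1) x" for j
   proof (intro AE_I2 mult_right_mono ennreal_leI)
    fix x
    have "f (u j + grad_matrix \<phi> x) \<le> C * (1 + 2 * (norm (u j))\<^sup>2 + 2 * (norm (grad_matrix \<phi> x))\<^sup>2)"
     by (rule growth_add)
    also have "\<dots> \<le> D"
     unfolding D_def using C_pos R(2)[of j] M(2)[of x]
     by (intro mult_left_mono add_mono power_mono) auto
    finally show "f (u j + grad_matrix \<phi> x) \<le> D" .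
   qed simp
   show "(NNINT x. ennreal D * indicator (box 0 (1::real^'n)) x) < \<infinity>"
    by (simp add: nn_integral_cmult_indicator emeasure_unit_cube)
   have "(\<lambda>i. f (u i + grad_matrix \<phi> x)) \<longlonglongrightarrow> f (\<eta> + grad_matrix \<phi> x)" for x
    by (rule continuous_on_tendsto_compose[OF cont]) (auto intro!: tendsto_intros u)
   then have "(\<lambda>i. ennreal (f (u i + grad_matrix \<phi> x))) \<longlonglongrightarrow> ennreal (f (\<eta> + grad_matrix \<phi> x))" for x
    by (intro tendsto_ennrealI)
   then show "AE x in lborel. (\<lambda>i. ennreal (f (u i + grad_matrix \<phi> x)) * indicator (box 0 1) x)
     \<longlonglongrightarrow> ennreal (f (\<eta> + grad_matrix \<phi> x)) * indicator (box 0 1) x"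
    by (intro AE_I2) (auto simp: indicator_def)
  qed measurable
 qed
 then show ?thesis by (simp add: continuous_on_sequentially comp_def)
qed

lemma qint_measurable:
 "\<phi> \<in> C1_compact (box 0 1) \<Longrightarrow> qint \<phi> \<in> borel_measurable borel"
 by (rule borel_measurable_continuous_onI[OF continuous_qint])

text \<open>By Lindelof's theorem countably many test functions suffice.\<close>

lemma Z_countable:
 obtains \<Phi> :: "nat \<Rightarrow> real^'n \<Rightarrow> real^'d" where "\<Phi> 0 = (\<lambda>x. 0)" "\<And>j. \<Phi> j \<in> C1_compact (box 0 1)"
  "\<And>\<eta>. Z \<eta> = (INF j. qint (\<Phi> j) \<eta>)"
proof -
 obtain Q :: "ennreal set" where Q: "countable Q" "\<And>X. open X \<Longrightarrow> X \<noteq> {} \<Longrightarrow> \<exists>d\<in>Q. d \<in> X"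
  using countable_dense_exists by blast
 let ?P = "C1_compact (box 0 1) :: (real^'n \<Rightarrow> real^'d) set"
 have "\<exists>P\<subseteq>?P. countable P \<and> (\<Union>\<phi>\<in>P. {\<eta>. qint \<phi> \<eta> < q}) = (\<Union>\<phi>\<in>?P. {\<eta>. qint \<phi> \<eta> < q})" for q
  by (rule Lindelof_image) (intro open_Collect_less continuous_qint continuous_on_const)
 then obtain P where P: "\<And>q. P q \<subseteq> ?P" "\<And>q. countable (P q)"
  "\<And>q. (\<Union>\<phi>\<in>P q. {\<eta>. qint \<phi> \<eta> < q}) = (\<Union>\<phi>\<in>?P. {\<eta>. qint \<phi> \<eta> < q})"
  by metis
 define T where "T = insert (\<lambda>x. 0) (\<Union>q\<in>Q. P q)"
 have T: "countable T" "T \<subseteq> ?P" "T \<noteq> {}" "(\<lambda>x. 0) \<in> T" using Q(1) P(1,2) by (auto simp: T_def)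
 \<comment> \<open>The zero function is placed at index 0 so that every finite infimum of the list
   stays below f; this provides the integrable bound for truncation and for the limit of the
   infima.\<close>
 define \<Phi> where "\<Phi> j = (case j of 0 \<Rightarrow> (\<lambda>x. 0) | Suc k \<Rightarrow> from_nat_into T k)" for j
 have \<Phi>T: "\<Phi> j \<in> T" for j
  using T from_nat_into[OF T(3)] by (auto simp: \<Phi>_def split: nat.split)
 have surj: "\<exists>j. \<phi> = \<Phi> j" if \<phi>: "\<phi> \<in> T" for \<phi>
  using from_nat_into_surj[OF T(1) \<phi>] by (metis \<Phi>_def nat.simps(5))
 have "Z \<eta> = (INF j. qint (\<Phi> j) \<eta>)" for \<eta>
 proof (rule antisym)
  show "Z \<eta> \<le> (INF j. qint (\<Phi> j) \<eta>)"
   using \<Phi>T T(2) by (intro INF_greatest Z_le_qint) auto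
  show "(INF j. qint (\<Phi> j) \<eta>) \<le> Z \<eta>"
  \<comment> \<open>A dense value q strictly between the two sides puts \<eta> into the sublevel set
    of some test function, hence of one in the countable subfamily for q, which contradicts that q
    is below the infimum of the list.\<close>
  proof (rule ccontr)
   assume "\<not> (INF j. qint (\<Phi> j) \<eta>) \<le> Z \<eta>"
   then have "{Z \<eta><..<(INF j. qint (\<Phi> j) \<eta>)} \<noteq> {}" using dense by (auto simp: not_le)
   then obtain q where q: "q \<in> Q" "Z \<eta> < q" "q < (INF j. qint (\<Phi> j) \<eta>)"
    using Q(2)[of "{Z \<eta><..<(INF j. qint (\<Phi> j) \<eta>)}"] by auto
   then obtain \<phi> where "\<phi> \<in> ?P" "qint \<phi> \<eta> < q" unfolding Z_def by (auto simp: INF_less_iff)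
   then have "\<eta> \<in> (\<Union>\<phi>\<in>P q. {\<eta>. qint \<phi> \<eta> < q})" unfolding P(3) by blast
   then obtain \<psi> where \<psi>: "\<psi> \<in> P q" "qint \<psi> \<eta> < q" by blast
   then obtain j where "\<psi> = \<Phi> j" using surj[of \<psi>] q(1) by (auto simp: T_def)
   then have "(INF j. qint (\<Phi> j) \<eta>) < q" using \<psi>(2) by (auto simp: INF_less_iff)
   with q(3) show False by simp
  qed
 qed
 then show ?thesis
  using \<Phi>T T(2) by (intro that[of \<Phi>]) (auto simp: \<Phi>_def)
qed

lemma Z_measurable [measurable]: "Z \<in> borel_measurable borel"
proof -
 obtain \<Phi> :: "nat \<Rightarrow> real^'n \<Rightarrow> real^'d" where \<Phi>: "\<And>j. \<Phi> j \<in> C1_compact (box 0 1)"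
  "\<And>\<eta>. Z \<eta> = (INF j. qint (\<Phi> j) \<eta>)" using Z_countable by metis
 have "Z = (\<lambda>\<eta>. INF j. qint (\<Phi> j) \<eta>)" using \<Phi>(2) by blast
 then show ?thesis using qint_measurable[OF \<Phi>(1)] by simp
qed

text \<open>Uniform continuity on the ball of radius R + M handles |a - b| < d. For larger distances
  C1 |a - b|^2 already exceeds the maximum of f allowed by growth on that ball. The quadratic
  penalty is what an approximation in L^2 can pay.\<close>

lemma f_modulus:
 assumes "\<tau> > 0"
 obtains C1 where "C1 > 0"
  "\<And>a b v. norm a \<le> R \<Longrightarrow> norm b \<le> R \<Longrightarrow> norm v \<le> M \<Longrightarrow> f (a + v) \<le> f (b + v) + \<tau> + C1 * (norm (a - b))\<^sup>2"
proof -
 let ?S = "cball 0 (R + M) :: (real^'n^'d) set"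
 have "uniformly_continuous_on ?S f"
  by (intro compact_uniformly_continuous continuous_on_subset[OF cont]) auto
 then obtain d where d: "d > 0" "\<And>x y. x \<in> ?S \<Longrightarrow> y \<in> ?S \<Longrightarrow> dist y x < d \<Longrightarrow> dist (f y) (f x) < \<tau>"
  using assms unfolding uniformly_continuous_on_def by blast
 define C1 where "C1 = C * (1 + (R + M)\<^sup>2) / d\<^sup>2"
 have "C1 > 0" using C_pos d(1) by (simp add: C1_def add_pos_nonneg)
 show ?thesis
 proof (rule that[OF \<open>C1 > 0\<close>])
  fix a b v :: "real^'n^'d" assume n: "norm a \<le> R" "norm b \<le> R" "norm v \<le> M"
  have S: "a + v \<in> ?S" "b + v \<in> ?S"
   using norm_triangle_ineq[of a v] norm_triangle_ineq[of b v] n by auto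
  show "f (a + v) \<le> f (b + v) + \<tau> + C1 * (norm (a - b))\<^sup>2"
  proof (cases "dist a b < d")
   case True
   then have "dist (f (a + v)) (f (b + v)) < \<tau>" using d(2)[OF S(2,1)] by simp
   moreover have "C1 * (norm (a - b))\<^sup>2 \<ge> 0" using \<open>C1 > 0\<close> by simp
   ultimately show ?thesis by (simp add: dist_real_def)
  next
   case False
   then have "d\<^sup>2 \<le> (norm (a - b))\<^sup>2" using d(1) by (intro power_mono) (auto simp: dist_norm)
   then have "C1 * d\<^sup>2 \<le> C1 * (norm (a - b))\<^sup>2" using \<open>C1 > 0\<close> by simp
   moreover have "C1 * d\<^sup>2 = C * (1 + (R + M)\<^sup>2)" using d(1) by (simp add: C1_def)
   moreover have "f (a + v) \<le> C * (1 + (R + M)\<^sup>2)"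
    using growth[of "a + v"] S(1) C_pos
    by (elim order_trans) (intro mult_left_mono add_left_mono power_mono, auto)
   ultimately show ?thesis using nonneg[of "b + v"] assms by linarith
  qed
 qed
qed

text \<open>A finite infimum is attained, and finitely many test functions have a common bound M on
  their gradients; this keeps the recovery sequences bounded. The limit in m is postponed until
  after integration.\<close>

definition Fm :: "(nat \<Rightarrow> real^'n \<Rightarrow> real^'d) \<Rightarrow> nat \<Rightarrow> real^'n^'d \<Rightarrow> ennreal" where
 "Fm \<Phi> m \<eta> = (INF j\<in>{..m}. qint (\<Phi> j) \<eta>)"

lemma Fm_attained: obtains j where "j \<le> m" "Fm \<Phi> m \<eta> = qint (\<Phi> j) \<eta>"
proof -
 have "Fm \<Phi> m \<eta> = Min ((\<lambda>j. qint (\<Phi> j) \<eta>) ` {..m})"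
  unfolding Fm_def by (rule cInf_eq_Min) auto
 also have "\<dots> \<in> (\<lambda>j. qint (\<Phi> j) \<eta>) ` {..m}" by (rule Min_in) auto
 finally show ?thesis using that by auto
qed

lemma Fm_measurable:
 "(\<And>j. \<Phi> j \<in> C1_compact (box 0 1)) \<Longrightarrow> Fm \<Phi> m \<in> borel_measurable borel"
 unfolding Fm_def[abs_def] using qint_measurable by (intro borel_measurable_INF) auto

lemma qint_modulus:
 assumes \<phi>: "cont_diff 1 \<phi>" and "\<tau> \<ge> 0" "C1 \<ge> 0"
  and le: "\<And>x. f (a + grad_matrix \<phi> x) \<le> f (b + grad_matrix \<phi> x) + \<tau> + C1 * (norm (a - b))\<^sup>2"
 shows "qint \<phi> a \<le> qint \<phi> b + ennreal (\<tau> + C1 * (norm (a - b))\<^sup>2)"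
proof -
 have [measurable]: "grad_matrix \<phi> \<in> borel_measurable borel" by (rule grad_matrix_measurable[OF \<phi>])
 have "qint \<phi> a \<le> (NNINT x. ennreal (f (b + grad_matrix \<phi> x)) * indicator (box 0 1) x
   + ennreal (\<tau> + C1 * (norm (a - b))\<^sup>2) * indicator (box 0 1) x)"
  unfolding qint_def
 proof (rule nn_integral_mono)
  fix x
  have "ennreal (f (a + grad_matrix \<phi> x)) \<le> ennreal (f (b + grad_matrix \<phi> x) + (\<tau> + C1 * (norm (a - b))\<^sup>2))"
   using le[of x] by (intro ennreal_leI) simp
  also have "\<dots> = ennreal (f (b + grad_matrix \<phi> x)) + ennreal (\<tau> + C1 * (norm (a - b))\<^sup>2)"
   using assms nonneg by (intro ennreal_plus) auto
  finally show "ennreal (f (a + grad_matrix \<phi> x)) * indicator (box 0 1) x \<le>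
    ennreal (f (b + grad_matrix \<phi> x)) * indicator (box 0 1) x
   + ennreal (\<tau> + C1 * (norm (a - b))\<^sup>2) * indicator (box 0 1) x"
   by (auto simp: indicator_def)
 qed
 also have "\<dots> = qint \<phi> b + ennreal (\<tau> + C1 * (norm (a - b))\<^sup>2)"
  unfolding qint_def by (subst nn_integral_add) (simp_all add: nn_integral_cmult_indicator emeasure_unit_cube)
 finally show ?thesis .
qed

end

lemma continuous_grad:
 assumes "cont_diff 1 \<theta>"
 shows "continuous_on UNIV (grad \<theta>)"
 unfolding grad_def partial_def
 by (intro continuous_on_vec_lambda C1_deriv_continuous[OF assms])

lemma grad_eq_0:
 assumes "cont_diff 1 \<theta>" "compact K" "\<And>x. x \<notin> K \<Longrightarrow> \<theta> x = 0" "x \<notin> K"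
 shows "grad \<theta> x = 0"
 using C1_compact_deriv[OF assms] by (simp add: grad_def partial_def vec_eq_iff)

lemma grad_locally_const:
 assumes "cont_diff 1 \<theta>" "open S" "x \<in> S" "\<And>y. y \<in> S \<Longrightarrow> \<theta> y = k"
 shows "grad \<theta> x = 0"
proof -
 have "((\<lambda>y. k) has_derivative frechet_derivative \<theta> (at x)) (at x)"
  by (rule has_derivative_transform_within_open[OF C1_has_derivative[OF assms(1)] assms(2,3)]) (simp add: assms(4))
 then have "frechet_derivative \<theta> (at x) = (\<lambda>v. 0)"
  using has_derivative_unique has_derivative_const by blast
 then show ?thesis by (simp add: grad_def partial_def vec_eq_iff)
qed

lemma cont_diff_matrix: "cont_diff m (\<lambda>x. (A::real^'n^'d) *v x)"
 by (rule cont_diff_bounded_linear[OF matrix_vector_mul_bounded_linear cont_diff_id])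

lemma grad_matrix_linear: "grad_matrix (\<lambda>x. (A::real^'n^'d) *v x) x = A"
 using grad_matrix_eq[OF bounded_linear.has_derivative[OF matrix_vector_mul_bounded_linear[of A] has_derivative_ident], of x]
 by (simp add: matrix_vector_mult_basis column_def vec_eq_iff)

section \<open>Oscillating perturbations that lower the integral\<close>

context integrand
begin

text \<open>On each grid cube inside \<Omega> the index attaining \<open>Fm\<close> at a constant
  value b c is chosen and the corresponding test function pasted in. Replacing B by b c is paid for
  twice, once in f and once in \<open>Fm\<close>, each time by the modulus and by L^2 closeness of B
  to a continuous g. The points not covered have small measure, and f is bounded on the range of
  B.\<close>

lemma oscillating_upper_bounded:
 fixes B :: "real^'n \<Rightarrow> real^'n^'d"
 assumes \<Phi>: "\<And>j. \<Phi> j \<in> C1_compact (box 0 1)" and M: "\<And>j x. j \<le> m \<Longrightarrow> norm (grad_matrix (\<Phi> j) x) \<le> M" "M > 0"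
  and \<Omega>: "open \<Omega>" "bounded \<Omega>" and [measurable]: "B \<in> borel_measurable borel" and B: "\<And>x. norm (B x) \<le> R"
  and \<tau>: "\<tau> > 0"
 obtains \<phi> where "\<phi> \<in> C1_compact \<Omega>" "\<And>x. norm (\<phi> x) \<le> \<tau>" "\<And>x. norm (grad_matrix \<phi> x) \<le> M"
  "(NNINT x:\<Omega>. ennreal (f (B x + grad_matrix \<phi> x))) \<le> (NNINT x:\<Omega>. Fm \<Phi> m (B x)) + ennreal \<tau>"
proof -
 have \<Omega>b[measurable]: "\<Omega> \<in> sets borel" using \<Omega> by simp
 have "R \<ge> 0" using B[of 0] norm_ge_zero order_trans by blast
 note [measurable] = Fm_measurable[of \<Phi>, OF \<Phi>]
 define V where "V = measure lborel \<Omega>"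
 have V: "emeasure lborel \<Omega> = ennreal V"
  using emeasure_bounded_lt_top[OF \<Omega>(2)] by (simp add: V_def emeasure_eq_ennreal_measure)
 have "V \<ge> 0" by (simp add: V_def)
 \<comment> \<open>The constants share the budget \<tau>: \<open>\<tau>1\<close> and e contribute (2
   \<tau>1 + 4 C1 e^2) V \<le> \<tau>/2, while 4 C1 \<sigma> = \<tau>/4 and C (1 + R^2) \<kappa> =
   \<tau>/4. Writing V + 1 avoids division by zero.\<close>
 define \<tau>1 where "\<tau>1 = \<tau> / (8 * (V + 1))"
 have "\<tau>1 > 0" using \<tau> \<open>V \<ge> 0\<close> by (simp add: \<tau>1_def)
 obtain C1 where C1: "C1 > 0"
  "\<And>a b v. norm a \<le> R \<Longrightarrow> norm b \<le> R \<Longrightarrow> norm v \<le> M \<Longrightarrow> f (a + v) \<le> f (b + v) + \<tau>1 + C1 * (norm (a - b))\<^sup>2"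
  using f_modulus[OF \<open>\<tau>1 > 0\<close>] by blast
 have "\<exists>P. \<forall>x. norm (\<Phi> j x) \<le> P" for j using C1_compact_bounded[OF \<Phi>] by metis
 then obtain P where P: "\<And>j x. norm (\<Phi> j x) \<le> P j" by metis
 define Pm where "Pm = 1 + (\<Sum>j\<le>m. P j)"
 have Pj: "P j \<ge> 0" for j using P[of j 0] norm_ge_zero order_trans by blast
 have Pm: "norm (\<Phi> j x) \<le> Pm" if "j \<le> m" for j x
 proof -
  have "P j \<le> (\<Sum>j\<le>m. P j)" using that Pj by (intro member_le_sum) auto
  then show ?thesis using P[of j x] by (simp add: Pm_def)
 qed
 have "Pm > 0" using Pj by (simp add: Pm_def sum_nonneg add_pos_nonneg)
 define \<sigma> where "\<sigma> = \<tau> / (16 * C1)"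
 have "\<sigma> > 0" using \<tau> C1 by (simp add: \<sigma>_def)
 obtain g where g: "continuous_on UNIV g" "\<And>x. norm (g x) \<le> R" "sqn \<Omega> (\<lambda>x. B x - g x) \<le> ennreal \<sigma>"
  using continuous_approx_bounded[of B \<Omega> R \<sigma>] B \<open>\<sigma> > 0\<close> emeasure_bounded_lt_top[OF \<Omega>(2)] by auto
 have [measurable]: "g \<in> borel_measurable borel" using g(1) by (rule borel_measurable_continuous_onI)
 define e where "e = sqrt (\<tau> / (16 * C1 * (V + 1)))"
 have "e > 0" using \<tau> C1 \<open>V \<ge> 0\<close> by (simp add: e_def)
 have "uniformly_continuous_on (closure \<Omega>) g"
  using \<Omega>(2) by (intro compact_uniformly_continuous continuous_on_subset[OF g(1)]) (auto simp: compact_closure)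
 then obtain d where d: "d > 0" "\<And>x y. x \<in> closure \<Omega> \<Longrightarrow> y \<in> closure \<Omega> \<Longrightarrow> dist y x < d \<Longrightarrow> dist (g y) (g x) < e"
  using \<open>e > 0\<close> unfolding uniformly_continuous_on_def by blast
 define \<kappa> where "\<kappa> = \<tau> / (4 * (C * (1 + R\<^sup>2)))"
 have CR: "C * (1 + R\<^sup>2) > 0" using C_pos by (simp add: add_pos_nonneg)
 have "\<kappa> > 0" using \<tau> CR by (simp add: \<kappa>_def)
 obtain K where K: "compact K" "K \<subseteq> \<Omega>" "emeasure lborel (\<Omega> - K) \<le> ennreal \<kappa>"
  using compact_approx_measure[OF \<Omega> \<open>\<kappa> > 0\<close>] by blast
 have [measurable]: "K \<in> sets borel" using K(1) by (simp add: compact_imp_closed)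
 obtain h0 where h0: "h0 > 0"
  "\<And>h. 0 < h \<Longrightarrow> h \<le> h0 \<Longrightarrow> AE x in lborel. x \<in> K \<longrightarrow> x \<in> (\<Union>c\<in>inner_grid h \<Omega>. cube c h)"
  using cubes_cover[OF K(1) \<Omega>(1) K(2)] by blast
 define h where "h = min h0 (min (\<tau> / Pm) (d / (2 * CARD('n))))"
 have h: "h > 0" "h \<le> h0" "h \<le> \<tau> / Pm" "h \<le> d / (2 * CARD('n))"
  using h0(1) \<tau> \<open>Pm > 0\<close> d(1) by (auto simp: h_def)
 define I where "I = inner_grid h \<Omega>"
 have I: "finite I" "I \<subseteq> grid h" "\<And>c. c \<in> I \<Longrightarrow> cube c h \<subseteq> \<Omega>"
  using finite_inner_grid[OF h(1) \<Omega>(2)] by (auto simp: I_def inner_grid_def)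

 \<comment> \<open>The pasted function\<close>
 define b where "b c = g (c + (h/2) *\<^sub>R 1)" for c
 have "\<exists>j\<le>m. Fm \<Phi> m (b c) = qint (\<Phi> j) (b c)" for c using Fm_attained by metis
 then obtain J where J: "\<And>c. J c \<le> m" "\<And>c. Fm \<Phi> m (b c) = qint (\<Phi> (J c)) (b c)" by metis
 define T where "T c = rescale c h (\<Phi> (J c))" for c
 have T: "T c \<in> C1_compact (cube c h)" for c unfolding T_def by (rule rescale_cube[OF \<Phi> h(1)])
 have T0: "x \<notin> cube c h \<Longrightarrow> T c x = 0" for c x using C1_compactD(2)[OF T] .
 have TG0: "x \<notin> cube c h \<Longrightarrow> grad_matrix (T c) x = 0" for c x using C1_compact_grad_0[OF T] .
 have TM: "norm (grad_matrix (T c) x) \<le> M" for c x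
  unfolding T_def using h(1) by (simp add: grad_matrix_rescale[OF C1_compactD(1)[OF \<Phi>]] M(1)[OF J(1)])
 have T\<tau>: "norm (T c x) \<le> \<tau>" for c x
 proof -
  have "norm (T c x) = h * norm (\<Phi> (J c) ((1 / h) *\<^sub>R (x - c)))" using h(1) by (simp add: T_def rescale_def)
  also have "\<dots> \<le> h * Pm" using h(1) by (intro mult_left_mono Pm[OF J(1)]) auto
  also have "\<dots> \<le> \<tau>" using h(3) \<open>Pm > 0\<close> by (simp add: field_simps)
  finally show ?thesis .
 qed
 define \<phi> where "\<phi> x = (\<Sum>c\<in>I. T c x)" for x
 have G: "grad_matrix \<phi> x = (\<Sum>c\<in>I. grad_matrix (T c) x)" for x
  unfolding \<phi>_def[abs_def] by (rule grad_matrix_sum) (rule C1_compactD(1)[OF T])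
 define U where "U = (\<Union>c\<in>I. cube c h)"
 have [measurable]: "U \<in> sets borel" unfolding U_def using I(1) by (intro sets.finite_UN) auto
 have U\<Omega>: "U \<subseteq> \<Omega>" using I(3) by (auto simp: U_def)
 have G1: "grad_matrix \<phi> x = grad_matrix (T c) x" if "c \<in> I" "x \<in> cube c h" for c x
  unfolding G by (rule sum_cubes(1)[OF h(1) I(1,2) TG0 that])
 have G2: "grad_matrix \<phi> x = 0" if "x \<notin> U" for x
  unfolding G by (rule sum_cubes(2)[OF h(1) I(1,2) TG0 that[unfolded U_def]])
 have \<phi>1: "\<phi> x = T c x" if "c \<in> I" "x \<in> cube c h" for c x
  unfolding \<phi>_def by (rule sum_cubes(1)[OF h(1) I(1,2) T0 that])
 have \<phi>2: "\<phi> x = 0" if "x \<notin> U" for x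
  unfolding \<phi>_def by (rule sum_cubes(2)[OF h(1) I(1,2) T0 that[unfolded U_def]])
 have \<phi>C: "\<phi> \<in> C1_compact \<Omega>"
  unfolding \<phi>_def[abs_def] using C1_compact_mono[OF T I(3)] by (intro C1_compact_sum I(1))
 have [measurable]: "grad_matrix \<phi> \<in> borel_measurable borel"
  by (rule grad_matrix_measurable[OF C1_compactD(1)[OF \<phi>C]])
 have [measurable]: "grad_matrix (T c) \<in> borel_measurable borel" for c
  by (rule grad_matrix_measurable[OF C1_compactD(1)[OF T]])

 \<comment> \<open>Estimate on one cube\<close>
 let ?k = "2 * \<tau>1 + 4 * C1 * e\<^sup>2"
 define S where "S x = Fm \<Phi> m (B x) + ennreal ?k + ennreal (4 * C1) * ennreal ((norm (B x - g x))\<^sup>2)" for x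
 have [measurable]: "S \<in> borel_measurable borel" unfolding S_def by measurable
 have close: "(norm (B x - b c))\<^sup>2 \<le> 2 * (norm (B x - g x))\<^sup>2 + 2 * e\<^sup>2" if c: "c \<in> I" "x \<in> cube c h" for c x
 proof -
  let ?y = "c + (h/2) *\<^sub>R 1"
  have y: "?y \<in> cube c h" using cube_nonempty[OF h(1)] .
  have cl: "x \<in> closure \<Omega>" "?y \<in> closure \<Omega>" using y c I(3) closure_subset by blast+
  have "\<bar>x $ i - ?y $ i\<bar> \<le> h" for i
  proof -
   have "c $ i < x $ i" "x $ i < c $ i + h" using c(2) by (auto simp: mem_cube)
   moreover have "c $ i < ?y $ i" "?y $ i < c $ i + h" using y unfolding mem_cube by blast+
   ultimately show ?thesis by linarith
  qed
  then have "norm (x - ?y) \<le> h * CARD('n)" by (rule norm_cube_diff_le)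
  also have "\<dots> \<le> d / 2" using h(4) by (simp add: field_simps)
  also have "\<dots> < d" using d(1) by simp
  finally have "dist (g x) (g ?y) < e" using d(2)[OF cl(2,1)] by (simp add: dist_norm)
  then have "(norm (g x - b c))\<^sup>2 \<le> e\<^sup>2" by (intro power_mono) (auto simp: b_def dist_norm)
  moreover have "(norm ((B x - g x) + (g x - b c)))\<^sup>2 \<le> 2 * (norm (B x - g x))\<^sup>2 + 2 * (norm (g x - b c))\<^sup>2"
   by (rule norm_add_sq_le)
  ultimately show ?thesis by simp
 qed
 have cubeI: "(NNINT x:cube c h. ennreal (f (B x + grad_matrix \<phi> x))) \<le> (NNINT x:cube c h. S x)" if c: "c \<in> I" for c
 proof -
  have bR: "norm (b c) \<le> R" by (simp add: b_def g(2))
  have "(NNINT x:cube c h. ennreal (f (B x + grad_matrix \<phi> x))) \<le>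
    (NNINT x. ennreal (f (b c + grad_matrix (T c) x)) * indicator (cube c h) x
     + ennreal (\<tau>1 + C1 * (norm (B x - b c))\<^sup>2) * indicator (cube c h) x)"
  proof (rule nn_integral_mono)
   fix x
   have "ennreal (f (B x + grad_matrix (T c) x)) \<le> ennreal (f (b c + grad_matrix (T c) x) + (\<tau>1 + C1 * (norm (B x - b c))\<^sup>2))"
    using C1(2)[OF B bR TM] by (intro ennreal_leI) (simp add: add.assoc)
   also have "\<dots> = ennreal (f (b c + grad_matrix (T c) x)) + ennreal (\<tau>1 + C1 * (norm (B x - b c))\<^sup>2)"
    using \<open>\<tau>1 > 0\<close> C1(1) nonneg by (intro ennreal_plus) auto
   finally show "ennreal (f (B x + grad_matrix \<phi> x)) * indicator (cube c h) x \<le>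
    ennreal (f (b c + grad_matrix (T c) x)) * indicator (cube c h) x
     + ennreal (\<tau>1 + C1 * (norm (B x - b c))\<^sup>2) * indicator (cube c h) x"
    using G1[OF c] by (auto simp: indicator_def)
  qed
  also have "\<dots> = (NNINT x:cube c h. ennreal (f (b c + grad_matrix (T c) x)))
    + (NNINT x:cube c h. ennreal (\<tau>1 + C1 * (norm (B x - b c))\<^sup>2))"
   by (rule nn_integral_add) auto
  also have "(NNINT x:cube c h. ennreal (f (b c + grad_matrix (T c) x))) = ennreal (h ^ CARD('n)) * Fm \<Phi> m (b c)"
   unfolding T_def J(2) by (rule qint_cube[OF C1_compactD(1)[OF \<Phi>] h(1)])
  also have "\<dots> = (NNINT x:cube c h. Fm \<Phi> m (b c))"
   by (subst nn_integral_cmult_indicator) (simp_all add: emeasure_cube[OF h(1)] mult.commute)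
  also have "\<dots> + (NNINT x:cube c h. ennreal (\<tau>1 + C1 * (norm (B x - b c))\<^sup>2))
   = (NNINT x. Fm \<Phi> m (b c) * indicator (cube c h) x + ennreal (\<tau>1 + C1 * (norm (B x - b c))\<^sup>2) * indicator (cube c h) x)"
   by (rule nn_integral_add[symmetric]) auto
  also have "\<dots> \<le> (NNINT x:cube c h. S x)"
  proof (rule nn_integral_mono)
   fix x
   have "Fm \<Phi> m (b c) \<le> Fm \<Phi> m (B x) + ennreal (\<tau>1 + C1 * (norm (B x - b c))\<^sup>2)"
   proof -
    \<comment> \<open>The index that is optimal at B x is merely a competitor at b c, which gives
      the inequality in the direction needed.\<close>
    obtain j where j: "j \<le> m" "Fm \<Phi> m (B x) = qint (\<Phi> j) (B x)" using Fm_attained by blast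
    have "Fm \<Phi> m (b c) \<le> qint (\<Phi> j) (b c)" unfolding Fm_def using j(1) by (intro INF_lower) auto
    also have "\<dots> \<le> qint (\<Phi> j) (B x) + ennreal (\<tau>1 + C1 * (norm (b c - B x))\<^sup>2)"
     by (rule qint_modulus[OF C1_compactD(1)[OF \<Phi>]]) (use \<open>\<tau>1 > 0\<close> C1(1) in \<open>auto intro: C1(2)[OF bR B M(1)[OF j(1)]]\<close>)
    finally show ?thesis by (simp add: j(2) norm_minus_commute)
   qed
   then have "Fm \<Phi> m (b c) + ennreal (\<tau>1 + C1 * (norm (B x - b c))\<^sup>2)
     \<le> Fm \<Phi> m (B x) + (ennreal (\<tau>1 + C1 * (norm (B x - b c))\<^sup>2) + ennreal (\<tau>1 + C1 * (norm (B x - b c))\<^sup>2))"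
    by (simp add: add.assoc[symmetric] add_right_mono)
   also have "ennreal (\<tau>1 + C1 * (norm (B x - b c))\<^sup>2) + ennreal (\<tau>1 + C1 * (norm (B x - b c))\<^sup>2)
     = ennreal (2 * \<tau>1 + 2 * C1 * (norm (B x - b c))\<^sup>2)"
    using \<open>\<tau>1 > 0\<close> C1(1) by (subst ennreal_plus[symmetric]) auto
   finally have "Fm \<Phi> m (b c) + ennreal (\<tau>1 + C1 * (norm (B x - b c))\<^sup>2)
     \<le> Fm \<Phi> m (B x) + ennreal (2 * \<tau>1 + 2 * C1 * (norm (B x - b c))\<^sup>2)" .
   also have "\<dots> \<le> S x" if "x \<in> cube c h"
   proof -
    have "2 * \<tau>1 + 2 * C1 * (norm (B x - b c))\<^sup>2 \<le> 2 * \<tau>1 + 2 * C1 * (2 * (norm (B x - g x))\<^sup>2 + 2 * e\<^sup>2)"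
     using C1(1) close[OF c that] by (intro add_left_mono mult_left_mono) auto
    also have "\<dots> = ?k + 4 * C1 * (norm (B x - g x))\<^sup>2" by (simp add: algebra_simps)
    finally have "ennreal (2 * \<tau>1 + 2 * C1 * (norm (B x - b c))\<^sup>2) \<le> ennreal (?k + 4 * C1 * (norm (B x - g x))\<^sup>2)"
     by (rule ennreal_leI)
    also have "\<dots> = ennreal ?k + ennreal (4 * C1) * ennreal ((norm (B x - g x))\<^sup>2)"
     using \<open>\<tau>1 > 0\<close> C1(1) by (simp add: ennreal_mult)
    finally show ?thesis unfolding S_def by (simp add: add.assoc add_left_mono)
   qed
   finally show "Fm \<Phi> m (b c) * indicator (cube c h) x + ennreal (\<tau>1 + C1 * (norm (B x - b c))\<^sup>2) * indicator (cube c h) x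
     \<le> S x * indicator (cube c h) x"
    by (auto simp: indicator_def)
  qed
  finally show ?thesis .
 qed

 \<comment> \<open>Summation over the cubes and the uncovered rest\<close>
 have sumU: "(\<Sum>c\<in>I. (NNINT x:cube c h. H x)) = (NNINT x:U. H x)"
  if [measurable]: "H \<in> borel_measurable borel" for H :: "real^'n \<Rightarrow> ennreal"
 proof -
  have "(\<Sum>c\<in>I. (NNINT x:cube c h. H x)) = (NNINT x. (\<Sum>c\<in>I. H x * indicator (cube c h) x))"
   by (rule nn_integral_sum[symmetric]) simp
  also have "\<dots> = (NNINT x:U. H x)"
   using sum_indicator_cubes[OF h(1) I(1,2), of "\<lambda>_. H _"] by (simp add: U_def)
  finally show ?thesis .
 qed
 have "(NNINT x:\<Omega>. ennreal (f (B x + grad_matrix \<phi> x))) =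
   (NNINT x. ennreal (f (B x + grad_matrix \<phi> x)) * indicator U x + ennreal (f (B x)) * indicator (\<Omega> - U) x)"
  using U\<Omega> G2 by (intro nn_integral_cong) (auto simp: indicator_def)
 also have "\<dots> = (NNINT x:U. ennreal (f (B x + grad_matrix \<phi> x))) + (NNINT x:\<Omega> - U. ennreal (f (B x)))"
  by (rule nn_integral_add) auto
 also have "(NNINT x:U. ennreal (f (B x + grad_matrix \<phi> x))) \<le> (NNINT x:U. S x)"
  by (subst (1 2) sumU[symmetric]) (auto intro!: sum_mono cubeI)
 also have "\<dots> \<le> (NNINT x:\<Omega>. S x)"
  using U\<Omega> by (intro nn_integral_mono) (auto simp: indicator_def)
 also have "\<dots> = (NNINT x. Fm \<Phi> m (B x) * indicator \<Omega> x + (ennreal ?k * indicator \<Omega> x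
   + ennreal (4 * C1) * (ennreal ((norm (B x - g x))\<^sup>2) * indicator \<Omega> x)))"
  by (intro nn_integral_cong) (auto simp: S_def indicator_def add.assoc)
 also have "\<dots> = (NNINT x:\<Omega>. Fm \<Phi> m (B x)) + (ennreal ?k * ennreal V + ennreal (4 * C1) * sqn \<Omega> (\<lambda>x. B x - g x))"
  unfolding sqn_def by (simp add: nn_integral_add nn_integral_cmult nn_integral_cmult_indicator V)
 also have "ennreal ?k * ennreal V \<le> ennreal (\<tau> / 2)"
 proof -
  have "e\<^sup>2 = \<tau> / (16 * C1 * (V + 1))" using \<tau> C1(1) \<open>V \<ge> 0\<close> by (simp add: e_def)
  moreover have "16 * C1 * (V + 1) = (4 * C1) * (4 * (V + 1))" by simp
  ultimately have "4 * C1 * e\<^sup>2 = ((4 * C1) * \<tau>) / ((4 * C1) * (4 * (V + 1)))"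
   by (simp only: times_divide_eq_right)
  also have "\<dots> = \<tau> / (4 * (V + 1))" using C1(1) by (intro mult_divide_mult_cancel_left) simp
  finally have "4 * C1 * e\<^sup>2 = \<tau> / (4 * (V + 1))" .
  moreover have "2 * \<tau>1 = \<tau> / (4 * (V + 1))"
   using \<open>V \<ge> 0\<close> unfolding \<tau>1_def by (simp add: divide_simps)
  ultimately have "?k = \<tau> / (4 * (V + 1)) + \<tau> / (4 * (V + 1))" by linarith
  also have "\<dots> = \<tau> / (2 * (V + 1))" using \<open>V \<ge> 0\<close> by (simp add: divide_simps)
  finally have "?k * V = \<tau> / (2 * (V + 1)) * V" by (simp only:)
  also have "\<dots> = (\<tau> / 2) * (V / (V + 1))" by simp
  also have "\<dots> \<le> (\<tau> / 2) * 1" using \<tau> \<open>V \<ge> 0\<close> by (intro mult_left_mono) auto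
  finally have "?k * V \<le> \<tau> / 2" by simp
  then have "ennreal (?k * V) \<le> ennreal (\<tau> / 2)" by (rule ennreal_leI)
  then show ?thesis using \<open>\<tau>1 > 0\<close> C1(1) \<open>V \<ge> 0\<close> by (subst ennreal_mult[symmetric]) auto
 qed
 also have "ennreal (4 * C1) * sqn \<Omega> (\<lambda>x. B x - g x) \<le> ennreal (4 * C1) * ennreal \<sigma>"
  by (intro mult_left_mono g(3)) simp
 also have "\<dots> = ennreal (\<tau> / 4)" using C1(1) \<open>\<sigma> > 0\<close> by (simp add: ennreal_mult[symmetric] \<sigma>_def)
 also have "(NNINT x:\<Omega> - U. ennreal (f (B x))) \<le> ennreal (\<tau> / 4)"
 proof -
  have "(NNINT x:\<Omega> - U. ennreal (f (B x))) \<le> (NNINT x. ennreal (C * (1 + R\<^sup>2)) * indicator (\<Omega> - K) x)"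
  proof (rule nn_integral_mono_AE)
   show "AE x in lborel. ennreal (f (B x)) * indicator (\<Omega> - U) x \<le> ennreal (C * (1 + R\<^sup>2)) * indicator (\<Omega> - K) x"
    using h0(2)[OF h(1,2)]
   proof eventually_elim
    case (elim x)
    have "f (B x) \<le> C * (1 + R\<^sup>2)"
     using growth[of "B x"] B[of x] C_pos by (elim order_trans) (intro mult_left_mono add_left_mono power_mono, auto)
    then have "ennreal (f (B x)) \<le> ennreal (C * (1 + R\<^sup>2))" by (rule ennreal_leI)
    moreover have "x \<in> \<Omega> - U \<Longrightarrow> x \<in> \<Omega> - K" using elim by (auto simp: U_def I_def)
    ultimately show ?case by (auto simp: indicator_def)
   qed
  qed
  also have "\<dots> = ennreal (C * (1 + R\<^sup>2)) * emeasure lborel (\<Omega> - K)"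
   by (intro nn_integral_cmult_indicator) simp
  also have "\<dots> \<le> ennreal (C * (1 + R\<^sup>2)) * ennreal \<kappa>" by (intro mult_left_mono K(3)) simp
  also have "\<dots> = ennreal (C * (1 + R\<^sup>2) * \<kappa>)"
   using CR \<open>\<kappa> > 0\<close> by (intro ennreal_mult[symmetric]) auto
  also have "C * (1 + R\<^sup>2) * \<kappa> = \<tau> / 4"
  proof -
   have "c * (\<tau> / (4 * c)) = \<tau> / 4" if "c > 0" for c :: real using that by simp
   from this[OF CR] show ?thesis by (simp only: \<kappa>_def)
  qed
  finally show ?thesis .
 qed
 finally have "(NNINT x:\<Omega>. ennreal (f (B x + grad_matrix \<phi> x))) \<le>
   (NNINT x:\<Omega>. Fm \<Phi> m (B x)) + (ennreal (\<tau> / 2) + ennreal (\<tau> / 4)) + ennreal (\<tau> / 4)"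
  by (simp add: add_mono)
 also have "\<dots> = (NNINT x:\<Omega>. Fm \<Phi> m (B x)) + ennreal \<tau>"
  using \<tau> by (simp add: add.assoc ennreal_plus[symmetric] del: ennreal_plus)
 finally have main: "(NNINT x:\<Omega>. ennreal (f (B x + grad_matrix \<phi> x))) \<le> (NNINT x:\<Omega>. Fm \<Phi> m (B x)) + ennreal \<tau>" .
 show ?thesis
 proof (rule that[OF \<phi>C _ _ main])
  fix x
  show "norm (\<phi> x) \<le> \<tau>"
  proof (cases "x \<in> U")
   case True then show ?thesis using \<phi>1 T\<tau> by (auto simp: U_def)
  next
   case False then show ?thesis using \<phi>2 \<tau> by simp
  qed
  show "norm (grad_matrix \<phi> x) \<le> M"
  proof (cases "x \<in> U")
   case True then show ?thesis using G1 TM by (auto simp: U_def)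
  next
   case False then show ?thesis using G2 M(2) by simp
  qed
 qed
qed

text \<open>The perturbation is constructed for the truncation of B. Where |B| exceeds the level,
  every integrand that occurs is at most D, which is integrable, so the change costs twice the tail
  of D. For \<open>Fm\<close> at the truncated value 0 the bound by D comes from \<Phi> 0 =
  0.\<close>

lemma oscillating_upper:
 fixes B :: "real^'n \<Rightarrow> real^'n^'d"
 assumes \<Phi>0: "\<Phi> 0 = (\<lambda>x. 0)" and \<Phi>: "\<And>j. \<Phi> j \<in> C1_compact (box 0 1)"
  and M: "\<And>j x. j \<le> m \<Longrightarrow> norm (grad_matrix (\<Phi> j) x) \<le> M" "M > 0"
  and \<Omega>: "open \<Omega>" "bounded \<Omega>" and Bm[measurable]: "B \<in> borel_measurable borel" and B: "sqn \<Omega> B < \<infinity>"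
  and \<tau>: "\<tau> > 0"
 obtains \<phi> where "\<phi> \<in> C1_compact \<Omega>" "\<And>x. norm (\<phi> x) \<le> \<tau>" "\<And>x. norm (grad_matrix \<phi> x) \<le> M"
  "(NNINT x:\<Omega>. ennreal (f (B x + grad_matrix \<phi> x))) \<le> (NNINT x:\<Omega>. Fm \<Phi> m (B x)) + ennreal \<tau>"
proof -
 have \<Omega>b[measurable]: "\<Omega> \<in> sets borel" using \<Omega> by simp
 note [measurable] = Fm_measurable[of \<Phi>, OF \<Phi>]
 define D where "D x = C * (1 + 2 * (norm (B x))\<^sup>2 + 2 * M\<^sup>2)" for x
 have D0: "D x \<ge> C" "D x \<ge> 0" for x
  using mult_left_mono[of 1 "1 + 2 * (norm (B x))\<^sup>2 + 2 * M\<^sup>2" C] C_pos by (auto simp: D_def)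
 have [measurable]: "D \<in> borel_measurable borel" unfolding D_def[abs_def] by measurable
 have "(NNINT x:\<Omega>. ennreal (D x)) = (NNINT x. ennreal (C * (1 + 2 * M\<^sup>2)) * indicator \<Omega> x
   + ennreal (2 * C) * (ennreal ((norm (B x))\<^sup>2) * indicator \<Omega> x))"
 proof (rule nn_integral_cong)
  fix x
  have "D x = C * (1 + 2 * M\<^sup>2) + 2 * C * (norm (B x))\<^sup>2" by (simp add: D_def algebra_simps)
  then have "ennreal (D x) = ennreal (C * (1 + 2 * M\<^sup>2)) + ennreal (2 * C) * ennreal ((norm (B x))\<^sup>2)"
   using C_pos by (simp add: ennreal_mult ennreal_plus)
  then show "ennreal (D x) * indicator \<Omega> x = ennreal (C * (1 + 2 * M\<^sup>2)) * indicator \<Omega> x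
   + ennreal (2 * C) * (ennreal ((norm (B x))\<^sup>2) * indicator \<Omega> x)"
   by (auto simp: indicator_def)
 qed
 also have "\<dots> = ennreal (C * (1 + 2 * M\<^sup>2)) * emeasure lborel \<Omega> + ennreal (2 * C) * sqn \<Omega> B"
  unfolding sqn_def by (simp add: nn_integral_add nn_integral_cmult nn_integral_cmult_indicator)
 also have "\<dots> < \<infinity>"
  using emeasure_bounded_lt_top[OF \<Omega>(2)] B by (simp add: ennreal_mult_less_top)
 finally have "(\<lambda>n::nat. NNINT x. (ennreal (D x) * indicator \<Omega> x) * indicator {x. norm (B x) > real n} x) \<longlonglongrightarrow> 0"
  by (intro tail_tendsto_0) auto
 from ennreal_tendsto_0_le[OF this, of "\<tau>/4"] \<tau>
 obtain R :: nat where R: "(NNINT x. (ennreal (D x) * indicator \<Omega> x) * indicator {x. norm (B x) > real R} x) \<le> ennreal (\<tau>/4)"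
  by auto
 let ?E = "NNINT x. (ennreal (D x) * indicator \<Omega> x) * indicator {x. norm (B x) > real R} x"
 let ?B = "truncate_fun R B"
 have BR: "norm (?B x) \<le> real R" for x using norm_truncate_fun[of "real R" B x] by simp
 have \<tau>4: "\<tau> / 4 > 0" using \<tau> by simp
 obtain \<phi> where \<phi>: "\<phi> \<in> C1_compact \<Omega>" "\<And>x. norm (\<phi> x) \<le> \<tau>/4" "\<And>x. norm (grad_matrix \<phi> x) \<le> M"
  "(NNINT x:\<Omega>. ennreal (f (?B x + grad_matrix \<phi> x))) \<le> (NNINT x:\<Omega>. Fm \<Phi> m (?B x)) + ennreal (\<tau>/4)"
  by (rule oscillating_upper_bounded[where \<Phi> = \<Phi> and m = m and M = M and \<tau> = "\<tau>/4",
     OF \<Phi> M \<Omega> truncate_fun_measurable[OF Bm] BR \<tau>4]; blast)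
 have [measurable]: "grad_matrix \<phi> \<in> borel_measurable borel"
  by (rule grad_matrix_measurable[OF C1_compactD(1)[OF \<phi>(1)]])
 have 1: "(NNINT x:\<Omega>. ennreal (f (B x + grad_matrix \<phi> x))) \<le> (NNINT x:\<Omega>. ennreal (f (?B x + grad_matrix \<phi> x))) + ?E"
 proof (subst nn_integral_add[symmetric])
  show "(NNINT x:\<Omega>. ennreal (f (B x + grad_matrix \<phi> x))) \<le>
   (NNINT x. ennreal (f (?B x + grad_matrix \<phi> x)) * indicator \<Omega> x + (ennreal (D x) * indicator \<Omega> x) * indicator {x. norm (B x) > real R} x)"
  proof (rule nn_integral_mono)
   fix x
   have "f (B x + grad_matrix \<phi> x) \<le> D x"
   proof -
    have "f (B x + grad_matrix \<phi> x) \<le> C * (1 + 2 * (norm (B x))\<^sup>2 + 2 * (norm (grad_matrix \<phi> x))\<^sup>2)" by (rule growth_add)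
    also have "\<dots> \<le> D x" unfolding D_def using C_pos \<phi>(3)[of x] by (intro mult_left_mono add_left_mono power_mono) auto
    finally show ?thesis .
   qed
   then have "ennreal (f (B x + grad_matrix \<phi> x)) \<le> ennreal (D x)" by (rule ennreal_leI)
   then show "ennreal (f (B x + grad_matrix \<phi> x)) * indicator \<Omega> x \<le>
    ennreal (f (?B x + grad_matrix \<phi> x)) * indicator \<Omega> x + (ennreal (D x) * indicator \<Omega> x) * indicator {x. norm (B x) > real R} x"
    by (cases "norm (B x) > real R") (auto simp: indicator_def truncate_fun_def add_increasing)
  qed
 qed measurable
 have 2: "(NNINT x:\<Omega>. Fm \<Phi> m (?B x)) \<le> (NNINT x:\<Omega>. Fm \<Phi> m (B x)) + ?E"
 proof (subst nn_integral_add[symmetric])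
  show "(NNINT x:\<Omega>. Fm \<Phi> m (?B x)) \<le>
   (NNINT x. Fm \<Phi> m (B x) * indicator \<Omega> x + (ennreal (D x) * indicator \<Omega> x) * indicator {x. norm (B x) > real R} x)"
  proof (rule nn_integral_mono)
   fix x
   have "Fm \<Phi> m 0 \<le> qint (\<Phi> 0) 0" unfolding Fm_def by (rule INF_lower) simp
   also have "\<dots> = ennreal (f 0)" by (simp add: \<Phi>0 qint_zero)
   also have "\<dots> \<le> ennreal (D x)" using growth[of 0] D0(1)[of x] by (intro ennreal_leI) simp
   finally have "Fm \<Phi> m 0 \<le> ennreal (D x)" .
   then show "Fm \<Phi> m (?B x) * indicator \<Omega> x \<le>
    Fm \<Phi> m (B x) * indicator \<Omega> x + (ennreal (D x) * indicator \<Omega> x) * indicator {x. norm (B x) > real R} x"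
    by (cases "norm (B x) > real R") (auto simp: indicator_def truncate_fun_def add_increasing)
  qed
 qed measurable
 have "(NNINT x:\<Omega>. ennreal (f (B x + grad_matrix \<phi> x))) \<le> ((NNINT x:\<Omega>. Fm \<Phi> m (B x)) + ?E + ennreal (\<tau>/4)) + ?E"
  by (intro order_trans[OF 1] add_mono order_trans[OF \<phi>(4)] 2) auto
 also have "\<dots> \<le> ((NNINT x:\<Omega>. Fm \<Phi> m (B x)) + ennreal (\<tau>/4) + ennreal (\<tau>/4)) + ennreal (\<tau>/4)"
  using R by (intro add_mono) auto
 also have "\<dots> = (NNINT x:\<Omega>. Fm \<Phi> m (B x)) + ennreal (3 * (\<tau>/4))"
  using \<tau> by (simp add: add.assoc ennreal_plus[symmetric] del: ennreal_plus)
 also have "\<dots> \<le> (NNINT x:\<Omega>. Fm \<Phi> m (B x)) + ennreal \<tau>"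
  using \<tau> by (intro add_left_mono ennreal_leI) simp
 finally show ?thesis
 proof (intro that[OF \<phi>(1) _ \<phi>(3)])
  show "norm (\<phi> x) \<le> \<tau>" for x using \<phi>(2)[of x] \<tau> by linarith
 qed
qed

section \<open>Passage to the infimum and identification of the envelope\<close>

lemma nn_integral_f_finite:
 assumes \<Omega>: "\<Omega> \<in> sets borel" "bounded \<Omega>" and [measurable]: "B \<in> borel_measurable borel" and B: "sqn \<Omega> B < \<infinity>"
 shows "(NNINT x:\<Omega>. ennreal (f (B x))) < \<infinity>"
proof -
 note [measurable] = \<Omega>(1)
 have "(NNINT x:\<Omega>. ennreal (f (B x))) \<le>
   (NNINT x. ennreal C * indicator \<Omega> x + ennreal C * (ennreal ((norm (B x))\<^sup>2) * indicator \<Omega> x))"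
 proof (rule nn_integral_mono)
  fix x
  have "ennreal (f (B x)) \<le> ennreal (C + C * (norm (B x))\<^sup>2)"
   using growth[of "B x"] by (intro ennreal_leI) (simp add: algebra_simps)
  also have "\<dots> = ennreal C + ennreal C * ennreal ((norm (B x))\<^sup>2)"
   using C_pos by (simp add: ennreal_mult)
  finally show "ennreal (f (B x)) * indicator \<Omega> x \<le>
    ennreal C * indicator \<Omega> x + ennreal C * (ennreal ((norm (B x))\<^sup>2) * indicator \<Omega> x)"
   by (auto simp: indicator_def)
 qed
 also have "\<dots> = ennreal C * emeasure lborel \<Omega> + ennreal C * sqn \<Omega> B"
  unfolding sqn_def by (simp add: nn_integral_add nn_integral_cmult nn_integral_cmult_indicator)
 also have "\<dots> < \<infinity>"
  using emeasure_bounded_lt_top[OF \<Omega>(2)] B by (simp add: ennreal_mult_less_top)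
 finally show ?thesis .
qed

text \<open>Monotone convergence for a decreasing sequence needs a finite starting integral; it is
  available because \<Phi> 0 = 0 puts all \<open>Fm\<close> below f.\<close>

lemma nn_integral_Fm_INF:
 assumes \<Phi>0: "\<Phi> 0 = (\<lambda>x. 0)" and \<Phi>: "\<And>j. \<Phi> j \<in> C1_compact (box 0 1)" and Z: "\<And>\<eta>. Z \<eta> = (INF j. qint (\<Phi> j) \<eta>)"
  and \<Omega>: "\<Omega> \<in> sets borel" "bounded \<Omega>" and [measurable]: "B \<in> borel_measurable borel" and B: "sqn \<Omega> B < \<infinity>"
 shows "(INF m. (NNINT x:\<Omega>. Fm \<Phi> m (B x))) = (NNINT x:\<Omega>. Z (B x))"
proof -
 note [measurable] = \<Omega>(1) Fm_measurable[of \<Phi>, OF \<Phi>]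
 have le: "Fm \<Phi> m \<eta> \<le> ennreal (f \<eta>)" for m \<eta>
 proof -
  have "Fm \<Phi> m \<eta> \<le> qint (\<Phi> 0) \<eta>" unfolding Fm_def by (rule INF_lower) simp
  then show ?thesis by (simp add: \<Phi>0 qint_zero)
 qed
 have anti: "Fm \<Phi> n \<eta> \<le> Fm \<Phi> m \<eta>" if "m \<le> n" for m n \<eta>
  unfolding Fm_def using that by (intro INF_superset_mono) auto
 have inf: "(INF m. Fm \<Phi> m \<eta> * indicator \<Omega> x) = Z \<eta> * indicator \<Omega> x" for \<eta> x
 proof -
  have "(INF m. Fm \<Phi> m \<eta>) = Z \<eta>"
   unfolding Z Fm_def
  proof (rule antisym)
   show "(INF m. INF j\<in>{..m}. qint (\<Phi> j) \<eta>) \<le> (INF j. qint (\<Phi> j) \<eta>)"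
    by (rule INF_greatest, rule INF_lower2[of j for j], simp, rule INF_lower) auto
   show "(INF j. qint (\<Phi> j) \<eta>) \<le> (INF m. INF j\<in>{..m}. qint (\<Phi> j) \<eta>)"
    by (intro INF_greatest INF_lower) auto
  qed
  then show ?thesis by (auto simp: indicator_def)
 qed
 have "(NNINT x. (INF m. Fm \<Phi> m (B x) * indicator \<Omega> x)) = (INF m. (NNINT x:\<Omega>. Fm \<Phi> m (B x)))"
 proof (rule nn_integral_monotone_convergence_INF_decseq)
  show "decseq (\<lambda>m x. Fm \<Phi> m (B x) * indicator \<Omega> x)"
   by (auto simp: decseq_def le_fun_def monotone_def intro!: mult_right_mono anti)
  show "(NNINT x:\<Omega>. Fm \<Phi> 0 (B x)) < \<infinity>"
   by (rule le_less_trans[OF _ nn_integral_f_finite[OF \<Omega> _ B]])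
    (auto intro!: nn_integral_mono mult_right_mono le)
 qed measurable
 then show ?thesis by (simp add: inf)
qed

text \<open>The pasting result on the unit cube is applied to B = \<eta> + \<nabla>\<phi>. The sum
  of \<phi> and the perturbation \<psi> is again admissible at \<eta>, so \<open>Z \<eta>\<close> is
  at most the integral of \<open>Fm\<close> of \<eta> + \<nabla>\<phi>, up to e, for each m; then m
  tends to infinity.\<close>

lemma quasiconvex_Z: "quasiconvex Z"
 unfolding quasiconvex_def
proof (intro conjI allI ballI)
 show "Z \<in> borel_measurable borel" by simp
 fix \<eta> :: "real^'n^'d" and \<phi> :: "real^'n \<Rightarrow> real^'d" assume \<phi>: "\<phi> \<in> C1_compact (box 0 1)"
 let ?Q = "box 0 1 :: (real^'n) set"
 obtain \<Phi> :: "nat \<Rightarrow> real^'n \<Rightarrow> real^'d" where \<Phi>: "\<Phi> 0 = (\<lambda>x. 0)" "\<And>j. \<Phi> j \<in> C1_compact (box 0 1)"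
  "\<And>\<eta>. Z \<eta> = (INF j. qint (\<Phi> j) \<eta>)" using Z_countable by metis
 define B where "B x = \<eta> + grad_matrix \<phi> x" for x
 have [measurable]: "grad_matrix \<phi> \<in> borel_measurable borel" by (rule grad_matrix_measurable[OF C1_compactD(1)[OF \<phi>]])
 have [measurable]: "B \<in> borel_measurable borel" unfolding B_def[abs_def] by measurable
 obtain N where N: "N > 0" "\<And>x. norm (grad_matrix \<phi> x) \<le> N" using C1_compact_bounded[OF \<phi>] by metis
 have "sqn ?Q B \<le> (NNINT x:?Q. ennreal ((norm \<eta> + N)\<^sup>2))"
  unfolding sqn_def B_def using N(2)
  by (intro nn_integral_mono mult_right_mono ennreal_leI power_mono norm_triangle_le) auto
 also have "\<dots> < \<infinity>" by (simp add: nn_integral_cmult_indicator emeasure_unit_cube)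
 finally have sB: "sqn ?Q B < \<infinity>" .
 have "Z \<eta> \<le> (NNINT x:?Q. Fm \<Phi> m (B x))" for m
 proof (rule ennreal_le_epsilon)
  fix e :: real assume "e > 0"
  have "\<exists>M>0. \<forall>x. norm (grad_matrix (\<Phi> j) x) \<le> M" for j using C1_compact_bounded[OF \<Phi>(2)] by metis
  then obtain Mj where Mj: "\<And>j. Mj j > 0" "\<And>j x. norm (grad_matrix (\<Phi> j) x) \<le> Mj j" by metis
  define M where "M = (\<Sum>j\<le>m. Mj j)"
  have M: "norm (grad_matrix (\<Phi> j) x) \<le> M" if "j \<le> m" for j x
  proof -
   have "Mj j \<le> M" unfolding M_def using that Mj(1) by (intro member_le_sum) (auto simp: less_imp_le)
   then show ?thesis using Mj(2)[of j x] by simp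
  qed
  have "M > 0" unfolding M_def using Mj(1) by (intro sum_pos) auto
  obtain \<psi> where \<psi>: "\<psi> \<in> C1_compact ?Q"
   "(NNINT x:?Q. ennreal (f (B x + grad_matrix \<psi> x))) \<le> (NNINT x:?Q. Fm \<Phi> m (B x)) + ennreal e"
   by (rule oscillating_upper[where \<Phi> = \<Phi> and m = m and M = M and \<tau> = e and B = B,
      OF \<Phi>(1,2) M \<open>M > 0\<close> open_box bounded_box \<open>B \<in> borel_measurable borel\<close> sB \<open>e > 0\<close>]; blast)
  have "Z \<eta> \<le> qint (\<lambda>x. \<phi> x + \<psi> x) \<eta>" by (rule Z_le_qint[OF C1_compact_add[OF \<phi> \<psi>(1)]])
  also have "\<dots> = (NNINT x:?Q. ennreal (f (B x + grad_matrix \<psi> x)))"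
   unfolding qint_def B_def
   by (simp add: grad_matrix_add[OF C1_compactD(1)[OF \<phi>] C1_compactD(1)[OF \<psi>(1)]] add.assoc)
  finally show "Z \<eta> \<le> (NNINT x:?Q. Fm \<Phi> m (B x)) + ennreal e" using \<psi>(2) by (rule order_trans)
 qed
 then have "Z \<eta> \<le> (INF m. (NNINT x:?Q. Fm \<Phi> m (B x)))" by (rule INF_greatest)
 also have "\<dots> = (NNINT x:?Q. Z (B x))"
  by (rule nn_integral_Fm_INF[OF \<Phi> _ _ _ sB]) auto
 also have "\<dots> = (\<integral>\<^sup>+x. Z (\<eta> + grad_matrix \<phi> x) \<partial>lebesgue_on ?Q)"
  by (subst nn_integral_lebesgue_on) (auto simp: B_def)
 finally show "Z \<eta> \<le> (\<integral>\<^sup>+x. Z (\<eta> + grad_matrix \<phi> x) \<partial>lebesgue_on ?Q)" .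
qed

text \<open>\<open>Z\<close> itself competes in the supremum, and a quasiconvex g below f is below
  every cell integral of f.\<close>

lemma quasiconvex_envelope_eq: "quasiconvex_envelope (\<lambda>\<zeta>. ennreal (f \<zeta>)) \<eta> = Z \<eta>"
proof (rule antisym)
 show "Z \<eta> \<le> quasiconvex_envelope (\<lambda>\<zeta>. ennreal (f \<zeta>)) \<eta>"
  unfolding quasiconvex_envelope_def using quasiconvex_Z Z_le_f by (intro Sup_upper) blast
 show "quasiconvex_envelope (\<lambda>\<zeta>. ennreal (f \<zeta>)) \<eta> \<le> Z \<eta>"
  unfolding quasiconvex_envelope_def
 proof (rule Sup_least, clarify)
  fix g :: "real^'n^'d \<Rightarrow> ennreal" assume g: "quasiconvex g" "\<forall>\<zeta>. g \<zeta> \<le> ennreal (f \<zeta>)"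
  show "g \<eta> \<le> Z \<eta>"
   unfolding Z_def
  proof (rule INF_greatest)
   fix \<phi> :: "real^'n \<Rightarrow> real^'d" assume \<phi>: "\<phi> \<in> C1_compact (box 0 1)"
   have "g \<eta> \<le> (\<integral>\<^sup>+x. g (\<eta> + grad_matrix \<phi> x) \<partial>lebesgue_on (box 0 1))"
    using g(1) \<phi> unfolding quasiconvex_def by blast
   also have "\<dots> = (NNINT x:box 0 1. g (\<eta> + grad_matrix \<phi> x))"
    by (rule nn_integral_lebesgue_on) simp
   also have "\<dots> \<le> qint \<phi> \<eta>"
    unfolding qint_def using g(2) by (intro nn_integral_mono mult_right_mono) auto
   finally show "g \<eta> \<le> qint \<phi> \<eta>" .
  qed
 qed
qed

section \<open>Regularity of the envelope and its lower estimate on a cube\<close>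

definition zr :: "real^'n^'d \<Rightarrow> real" where "zr \<eta> = enn2real (Z \<eta>)"

lemma Z_eq_zr: "Z \<eta> = ennreal (zr \<eta>)"
 using Z_le_f[of \<eta>] unfolding zr_def
 by (subst ennreal_enn2real) (auto intro: le_less_trans)

lemma zr_nonneg [simp]: "zr \<eta> \<ge> 0" by (simp add: zr_def)

lemma zr_le_f: "zr \<eta> \<le> f \<eta>"
 using Z_le_f[of \<eta>] nonneg[of \<eta>] by (simp add: Z_eq_zr)

lemma zr_measurable [measurable]: "zr \<in> borel_measurable borel"
 unfolding zr_def[abs_def] by measurable

text \<open>The test function for \<open>a\<close> is affine with gradient \<open>b - a\<close> on an inner cube, where
 a rescaled test function for \<open>b\<close> is added, and is cut off near the boundary.\<close>

lemma zr_almost_lipschitz: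
 assumes "\<delta> > 0"
 obtains K where "K > 0" "\<And>a b. zr a \<le> zr b + \<delta> * (1 + (norm a)\<^sup>2) + K * (norm (b - a))\<^sup>2"
proof -
 let ?n = "CARD('n)"
 \<comment> \<open>The frame between the inner cube of side 1 - 2 s and the unit cube has volume 1 -
   (1 - 2 s)^n. Once this is below \<delta>/(2 C), the growth bound on the frame costs at most
   \<delta> (1 + |a|^2) and a multiple of |b - a|^2.\<close>
 have "((\<lambda>s::real. (1 - (1 - 2 * s) ^ ?n) * (2 * C)) \<longlongrightarrow> (1 - (1 - 2 * 0) ^ ?n) * (2 * C)) (at_right 0)"
  by (intro tendsto_intros)
 then have "eventually (\<lambda>s::real. (1 - (1 - 2 * s) ^ ?n) * (2 * C) < \<delta>) (at_right 0)"
  using assms by (intro order_tendstoD(2)) auto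
 moreover have "eventually (\<lambda>s::real. s < 1/4) (at_right 0)" "eventually (\<lambda>s::real. s > 0) (at_right 0)"
  by (auto simp: eventually_at_right_field intro: exI[of _ "1/4"])
 ultimately have "eventually (\<lambda>s::real. (1 - (1 - 2 * s) ^ ?n) * (2 * C) < \<delta> \<and> s < 1/4 \<and> s > 0) (at_right 0)"
  by eventually_elim auto
 then obtain s :: real where s: "(1 - (1 - 2 * s) ^ ?n) * (2 * C) < \<delta>" "s < 1/4" "s > 0"
  using eventually_happens' trivial_limit_at_right_real by blast
 define r where "r = 1 - 2 * s"
 have r: "r > 0" "r \<le> 1" using s by (auto simp: r_def)
 define c where "c = s *\<^sub>R (1::real^'n)"
 let ?Q = "box 0 1 :: (real^'n) set"
 let ?Q' = "cube c r"
 define K0 where "K0 = cbox c (c + r *\<^sub>R 1)"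
 have K0: "compact K0" "K0 \<subseteq> ?Q" "?Q' \<subseteq> K0"
 proof -
  show "compact K0" by (simp add: K0_def)
  show "K0 \<subseteq> ?Q"
  proof
   fix x assume "x \<in> K0"
   then have "s \<le> x $ i \<and> x $ i \<le> 1 - s" for i by (auto simp: K0_def c_def r_def mem_box_cart)
   then have "0 < x $ i \<and> x $ i < 1" for i using s(3) by (smt (verit))
   then show "x \<in> ?Q" by (simp add: mem_unit_cube)
  qed
  show "?Q' \<subseteq> K0" by (simp add: K0_def cube_def box_subset_cbox)
 qed
 obtain \<theta> :: "real^'n \<Rightarrow> real" and L where \<theta>: "cont_diff 1 \<theta>" "\<And>x. 0 \<le> \<theta> x" "\<And>x. \<theta> x \<le> 1"
  "\<And>x. x \<in> K0 \<Longrightarrow> \<theta> x = 1" "compact L" "L \<subseteq> ?Q" "\<And>x. x \<notin> L \<Longrightarrow> \<theta> x = 0"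
  using smooth_cutoff[OF K0(1) open_box K0(2)] by blast
 obtain D where D: "D > 0" "\<And>x. norm (grad \<theta> x) \<le> D"
  using compact_support_cont_bounded[OF continuous_grad[OF \<theta>(1)] \<theta>(5) grad_eq_0[OF \<theta>(1,5,7)]] by blast
 \<comment> \<open>Bound for the gradient of the cut off affine function relative to |A|: the term
   \<theta> A gives 1, and A x times the gradient of \<theta> gives n D, because |x| \<le> n on the
   unit cube.\<close>
 define E where "E = 1 + ?n * D"
 have "E > 0" using D(1) by (simp add: E_def add_pos_nonneg)
 define K where "K = 2 * C * E\<^sup>2"
 have "K > 0" using C_pos \<open>E > 0\<close> by (simp add: K_def)
 have Q'Q: "?Q' \<subseteq> ?Q" using K0 by blast
 have rn: "0 \<le> r ^ ?n" "r ^ ?n \<le> 1" using r by (auto simp: power_le_one)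
 have em: "emeasure lborel (?Q - ?Q') = ennreal (1 - r ^ ?n)"
  using emeasure_Diff[of lborel ?Q' ?Q] Q'Q rn
  by (simp add: emeasure_cube[OF r(1)] emeasure_unit_cube ennreal_minus flip: ennreal_1)
 show ?thesis
 proof (rule that[OF \<open>K > 0\<close>])
  fix a b :: "real^'n^'d"
  define A where "A = b - a"
  define c0 where "c0 = \<delta> * (1 + (norm a)\<^sup>2) + K * (norm A)\<^sup>2"
  have "c0 \<ge> 0" using assms \<open>K > 0\<close> by (simp add: c0_def)
  define X where "X = C * (1 + 2 * (norm a)\<^sup>2 + 2 * (E * norm A)\<^sup>2)"
  have "X \<ge> 0" using C_pos by (simp add: X_def)
  have Xc0: "(1 - r ^ ?n) * X \<le> c0"
  proof -
   have "(1 - r ^ ?n) * X = (1 - r ^ ?n) * C + ((1 - r ^ ?n) * (2 * C)) * (norm a)\<^sup>2 + (1 - r ^ ?n) * (K * (norm A)\<^sup>2)"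
    by (simp add: X_def K_def power_mult_distrib algebra_simps)
   also have "\<dots> \<le> \<delta> + \<delta> * (norm a)\<^sup>2 + 1 * (K * (norm A)\<^sup>2)"
   proof (intro add_mono mult_right_mono)
    have "(1 - r ^ ?n) * C \<le> (1 - r ^ ?n) * (2 * C)" using rn C_pos by (intro mult_left_mono) auto
    then show "(1 - r ^ ?n) * C \<le> \<delta>" using s(1)[folded r_def] by linarith
    show "(1 - r ^ ?n) * (2 * C) \<le> \<delta>" using s(1) by (simp add: r_def)
   qed (use rn \<open>K > 0\<close> in auto)
   finally show ?thesis by (simp add: c0_def algebra_simps)
  qed
  have main: "ennreal (zr a) \<le> qint \<psi> b + ennreal c0" if \<psi>: "\<psi> \<in> C1_compact ?Q" for \<psi>
  proof -
   have w: "cont_diff 1 (\<lambda>x. A *v x)" by (rule cont_diff_matrix)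
   define \<phi>1 where "\<phi>1 x = \<theta> x *\<^sub>R (A *v x)" for x
   define \<phi>2 where "\<phi>2 = rescale c r \<psi>"
   have c1: "\<phi>1 \<in> C1_compact ?Q"
    unfolding C1_compact_iff \<phi>1_def[abs_def]
    by (intro conjI cont_diff_scaleR \<theta>(1) w compact_support_inI[OF \<theta>(5,6)]) (simp add: \<theta>(7))
   have c2': "\<phi>2 \<in> C1_compact ?Q'" unfolding \<phi>2_def by (rule rescale_cube[OF \<psi> r(1)])
   have c2: "\<phi>2 \<in> C1_compact ?Q" by (rule C1_compact_mono[OF c2' Q'Q])
   define \<phi> where "\<phi> x = \<phi>1 x + \<phi>2 x" for x
   have \<phi>: "\<phi> \<in> C1_compact ?Q" unfolding \<phi>_def[abs_def] by (rule C1_compact_add[OF c1 c2])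
   have g: "grad_matrix \<phi> x = \<theta> x *\<^sub>R A + (\<chi> i j. (A *v x) $ i * grad \<theta> x $ j) + grad_matrix \<phi>2 x" for x
    unfolding \<phi>_def[abs_def]
    by (simp add: grad_matrix_add[OF C1_compactD(1)[OF c1] C1_compactD(1)[OF c2]])
     (simp add: \<phi>1_def[abs_def] grad_matrix_cutoff[OF \<theta>(1) w] grad_matrix_linear)
   have in1: "a + grad_matrix \<phi> x = b + grad_matrix \<phi>2 x" if x: "x \<in> ?Q'" for x
   proof -
    have "grad \<theta> x = 0"
     by (rule grad_locally_const[OF \<theta>(1), of ?Q' _ 1]) (use K0(3) \<theta>(4) x in \<open>auto simp: cube_def\<close>)
    moreover have "\<theta> x = 1" using x K0(3) \<theta>(4) by blast
    ultimately show ?thesis by (simp add: g A_def vec_eq_iff)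
   qed
   have in2: "f (a + grad_matrix \<phi> x) \<le> X" if x: "x \<in> ?Q - ?Q'" for x
   proof -
    have "\<bar>x $ i - 0 $ i\<bar> \<le> 1" for i
    proof -
     have "0 < x $ i \<and> x $ i < 1" using x unfolding Diff_iff mem_unit_cube by blast
     then show ?thesis by simp
    qed
    then have nx: "norm x \<le> ?n" using norm_cube_diff_le[of x 0 1] by simp
    have "grad_matrix \<phi>2 x = 0" using C1_compact_grad_0[OF c2'] x by blast
    then have "norm (grad_matrix \<phi> x) \<le> norm (\<theta> x *\<^sub>R A) + norm ((\<chi> i j. (A *v x) $ i * grad \<theta> x $ j) :: real^'n^'d)"
     unfolding g by (simp only: add_0_right norm_triangle_ineq)
    also have "\<dots> \<le> 1 * norm A + (norm A * ?n) * D"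
    proof (intro add_mono)
     show "norm (\<theta> x *\<^sub>R A) \<le> 1 * norm A" using \<theta>(2,3)[of x] by (simp add: mult_left_le_one_le)
     have "norm (A *v x) \<le> norm A * ?n"
      using norm_matrix_vector_le[of A x] nx by (meson mult_left_mono norm_ge_zero order_trans)
     then have "norm (A *v x) * norm (grad \<theta> x) \<le> (norm A * ?n) * D"
      using D by (intro mult_mono) auto
     then show "norm ((\<chi> i j. (A *v x) $ i * grad \<theta> x $ j) :: real^'n^'d) \<le> (norm A * ?n) * D"
      using norm_outer_le[of "A *v x" "grad \<theta> x"] by (rule order_trans[rotated])
    qed
    also have "\<dots> = E * norm A" by (simp add: E_def algebra_simps)
    finally have gn: "norm (grad_matrix \<phi> x) \<le> E * norm A" .
    have "f (a + grad_matrix \<phi> x) \<le> C * (1 + 2 * (norm a)\<^sup>2 + 2 * (norm (grad_matrix \<phi> x))\<^sup>2)" by (rule growth_add)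
    also have "\<dots> \<le> X" unfolding X_def using C_pos gn by (intro mult_left_mono add_left_mono power_mono) auto
    finally show ?thesis .
   qed
   have [measurable]: "grad_matrix \<phi>2 \<in> borel_measurable borel"
    by (rule grad_matrix_measurable[OF C1_compactD(1)[OF c2]])
   have "ennreal (zr a) = Z a" by (simp add: Z_eq_zr)
   also have "\<dots> \<le> qint \<phi> a" by (rule Z_le_qint[OF \<phi>])
   also have "\<dots> \<le> (NNINT x. ennreal (f (b + grad_matrix \<phi>2 x)) * indicator ?Q' x + ennreal X * indicator (?Q - ?Q') x)"
    unfolding qint_def
   proof (rule nn_integral_mono)
    fix x
    show "ennreal (f (a + grad_matrix \<phi> x)) * indicator ?Q x \<le>
     ennreal (f (b + grad_matrix \<phi>2 x)) * indicator ?Q' x + ennreal X * indicator (?Q - ?Q') x"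
    proof (cases "x \<in> ?Q'")
     case True
     then show ?thesis using in1[OF True] Q'Q by (simp add: indicator_def)
    next
     case False
     show ?thesis
     proof (cases "x \<in> ?Q")
      case True
      with False in2[of x] show ?thesis by (simp add: ennreal_leI)
     qed simp
    qed
   qed
   also have "\<dots> = ennreal (r ^ ?n) * qint \<psi> b + ennreal X * ennreal (1 - r ^ ?n)"
   proof -
    have "(NNINT x:?Q'. ennreal (f (b + grad_matrix \<phi>2 x))) = ennreal (r ^ ?n) * qint \<psi> b"
     unfolding \<phi>2_def by (rule qint_cube[OF C1_compactD(1)[OF \<psi>] r(1)])
    moreover have "(NNINT x. ennreal X * indicator (?Q - ?Q') x) = ennreal X * ennreal (1 - r ^ ?n)"
     by (subst nn_integral_cmult_indicator) (auto simp: em)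
    ultimately show ?thesis by (subst nn_integral_add) auto
   qed
   also have "\<dots> \<le> 1 * qint \<psi> b + ennreal c0"
   proof (intro add_mono mult_right_mono)
    show "ennreal (r ^ ?n) \<le> 1" using rn(2) by (simp flip: ennreal_1)
    show "ennreal X * ennreal (1 - r ^ ?n) \<le> ennreal c0"
     using Xc0 \<open>X \<ge> 0\<close> rn by (simp add: ennreal_mult[symmetric] mult.commute ennreal_leI)
   qed simp
   finally show ?thesis by simp
  qed
  have "ennreal (zr a) \<le> ennreal (zr b + c0)"
  proof (rule ennreal_le_epsilon)
   fix e :: real assume "e > 0"
   have "Z b < ennreal (zr b + e)" using \<open>e > 0\<close> by (simp add: Z_eq_zr ennreal_less_iff)
   then obtain \<psi> where \<psi>: "\<psi> \<in> C1_compact ?Q" "qint \<psi> b < ennreal (zr b + e)"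
    unfolding Z_def by (auto simp: INF_less_iff)
   have "ennreal (zr a) \<le> ennreal (zr b + e) + ennreal c0"
    using main[OF \<psi>(1)] \<psi>(2) by (meson add_right_mono less_imp_le order_trans)
   also have "\<dots> = ennreal (zr b + c0) + ennreal e"
    using \<open>e > 0\<close> \<open>c0 \<ge> 0\<close> by (simp add: ennreal_plus[symmetric] add_ac del: ennreal_plus)
   finally show "ennreal (zr a) \<le> ennreal (zr b + c0) + ennreal e" .
  qed
  then have "zr a \<le> zr b + c0"
   using \<open>c0 \<ge> 0\<close> by (subst (asm) ennreal_le_iff) (auto intro: add_nonneg_nonneg)
  then show "zr a \<le> zr b + \<delta> * (1 + (norm a)\<^sup>2) + K * (norm (b - a))\<^sup>2"
   by (simp add: c0_def A_def)
 qed
qed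

end

context integrand
begin

text \<open>The average over the \<open>M\<close> cutoffs \<open>\<theta> l\<close> in nested layers keeps the contribution of \<open>\<nabla>u\<close> in
 the layers below \<open>1 / M\<close> of its total.\<close>

lemma zr_unit_cube_le:
 assumes "\<delta> > 0"
 obtains C' where "C' > 0"
  "\<And>\<eta> u b. cont_diff 1 u \<Longrightarrow> b \<in> borel_measurable borel \<Longrightarrow>
   Z \<eta> \<le> (NNINT y:box 0 1. ennreal (zr (b y) + \<delta> * (1 + (norm \<eta>)\<^sup>2 + (norm (grad_matrix u y))\<^sup>2)
     + C' * ((norm (b y - \<eta> - grad_matrix u y))\<^sup>2 + (norm (u y))\<^sup>2)))"
proof -
 let ?n = "CARD('n)"
 let ?Q = "box 0 1 :: (real^'n) set"
 obtain K1 where K1: "K1 > 0" "\<And>a b. zr a \<le> zr b + \<delta>/8 * (1 + (norm a)\<^sup>2) + K1 * (norm (b - a))\<^sup>2"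
  using zr_almost_lipschitz[of "\<delta>/8"] assms by auto
 \<comment> \<open>A layer costs up to 4 C |\<nabla>u|^2. As the layers are disjoint, the average
   over M cutoffs costs 4 C / M times |\<nabla>u|^2 in all, which this choice keeps below \<delta>/2
   times |\<nabla>u|^2.\<close>
 obtain M :: nat where M: "real M > 8 * C / \<delta>" using reals_Archimedean2 by blast
 have "8 * C / \<delta> > 0" using assms C_pos by simp
 then have "M > 0" using M by (metis gr0I of_nat_0 order_less_asym)
 have MC: "4 * C \<le> \<delta> / 2 * real M" using M assms by (simp add: field_simps)
 \<comment> \<open>Outside the innermost cube \<open>A 0\<close> the constant \<kappa> = 2 C (1 +
   |\<eta>|^2) is paid. The volume of that frame is made so small that the total is at most
   \<delta>/4 (1 + |\<eta>|^2).\<close>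
 have "((\<lambda>s::real. (1 - (1 - 2 * s) ^ ?n) * (2 * C)) \<longlongrightarrow> (1 - (1 - 2 * 0) ^ ?n) * (2 * C)) (at_right 0)"
  by (intro tendsto_intros)
 then have "eventually (\<lambda>s::real. (1 - (1 - 2 * s) ^ ?n) * (2 * C) < \<delta> / 4) (at_right 0)"
  using assms by (intro order_tendstoD(2)) auto
 moreover have "eventually (\<lambda>s::real. s < 1/4) (at_right 0)" "eventually (\<lambda>s::real. s > 0) (at_right 0)"
  by (auto simp: eventually_at_right_field intro: exI[of _ "1/4"])
 ultimately have "eventually (\<lambda>s::real. (1 - (1 - 2 * s) ^ ?n) * (2 * C) < \<delta> / 4 \<and> s < 1/4 \<and> s > 0) (at_right 0)"
  by eventually_elim auto
 then obtain \<sigma> :: real where \<sigma>: "(1 - (1 - 2 * \<sigma>) ^ ?n) * (2 * C) < \<delta> / 4" "\<sigma> < 1/4" "\<sigma> > 0"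
  using eventually_happens' trivial_limit_at_right_real by blast
 \<comment> \<open>A strictly decreasing positive sequence: the closed cubes \<open>A l\<close>
   increase, each lies in the interior \<open>A' (Suc l)\<close> of the next, and all lie in the
   open unit cube. The innermost cube does not depend on M.\<close>
 define s where "s l = \<sigma> / real (Suc l)" for l
 have s: "s l > 0" "s (Suc l) < s l" "s l \<le> \<sigma>" for l
  using \<sigma>(3) by (auto simp: s_def field_simps)
 define A where "A l = {x::real^'n. \<forall>i. s l \<le> x $ i \<and> x $ i \<le> 1 - s l}" for l
 define A' where "A' l = {x::real^'n. \<forall>i. s l < x $ i \<and> x $ i < 1 - s l}" for l
 have A_cbox: "A l = cbox (s l *\<^sub>R 1) ((1 - s l) *\<^sub>R 1)" for l by (auto simp: A_def mem_box_cart)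
 have A'_box: "A' l = box (s l *\<^sub>R 1) ((1 - s l) *\<^sub>R 1)" for l by (auto simp: A'_def mem_box_cart)
 have AA': "A l \<subseteq> A' (Suc l)" for l
 proof
  fix x assume x: "x \<in> A l"
  have "s (Suc l) < x $ i \<and> x $ i < 1 - s (Suc l)" for i
  proof -
   have "s l \<le> x $ i \<and> x $ i \<le> 1 - s l" using x by (simp add: A_def)
   then show ?thesis using s(2)[of l] by linarith
  qed
  then show "x \<in> A' (Suc l)" by (simp add: A'_def)
 qed
 have A'A: "A' l \<subseteq> A l" for l by (auto simp: A_def A'_def less_imp_le)
 have AQ: "A l \<subseteq> ?Q" for l
 proof
  fix x assume x: "x \<in> A l"
  have "0 < x $ i \<and> x $ i < 1" for i
  proof -
   have "s l \<le> x $ i \<and> x $ i \<le> 1 - s l" using x by (simp add: A_def)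
   then show ?thesis using s(1)[of l] by linarith
  qed
  then show "x \<in> ?Q" by (simp add: mem_unit_cube)
 qed
 have Amono: "A k \<subseteq> A l" if "k \<le> l" for k l
  using that by (induction rule: dec_induct) (use AA' A'A in blast)+
 have Ab[measurable]: "A l \<in> sets borel" "A' l \<in> sets borel" for l by (auto simp: A_cbox A'_box)
 have "\<exists>\<theta> L D. cont_diff 1 \<theta> \<and> (\<forall>x. 0 \<le> \<theta> x \<and> \<theta> x \<le> 1) \<and> (\<forall>x\<in>A l. \<theta> x = 1) \<and> compact L \<and> L \<subseteq> A' (Suc l)
   \<and> (\<forall>x. x \<notin> L \<longrightarrow> \<theta> x = 0) \<and> (\<forall>x. norm (grad \<theta> x) \<le> D) \<and> D > 0" for l
 proof -
  have "compact (A l)" "open (A' (Suc l))" by (auto simp: A_cbox A'_box)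
  from smooth_cutoff[OF this AA'] obtain \<theta> :: "real^'n \<Rightarrow> real" and L where \<theta>: "cont_diff 1 \<theta>" "\<And>x. 0 \<le> \<theta> x" "\<And>x. \<theta> x \<le> 1"
   "\<And>x. x \<in> A l \<Longrightarrow> \<theta> x = 1" "compact L" "L \<subseteq> A' (Suc l)" "\<And>x. x \<notin> L \<Longrightarrow> \<theta> x = 0" by blast
  obtain D where D: "D > 0" "\<And>x. norm (grad \<theta> x) \<le> D"
   using compact_support_cont_bounded[OF continuous_grad[OF \<theta>(1)] \<theta>(5) grad_eq_0[OF \<theta>(1,5,7)]] by blast
  show ?thesis using \<theta> D by blast
 qed
 then obtain \<theta> :: "nat \<Rightarrow> real^'n \<Rightarrow> real" and L D where \<theta>: "\<And>l. cont_diff 1 (\<theta> l)"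
  "\<And>l x. 0 \<le> \<theta> l x \<and> \<theta> l x \<le> 1" "\<And>l x. x \<in> A l \<Longrightarrow> \<theta> l x = 1"
  "\<And>l. compact (L l)" "\<And>l. L l \<subseteq> A' (Suc l)" "\<And>l x. x \<notin> L l \<Longrightarrow> \<theta> l x = 0"
  "\<And>l x. norm (grad (\<theta> l) x) \<le> D l" "\<And>l. D l > 0"
  by metis
 define Dm where "Dm = (\<Sum>l<M. D l)"
 have D: "norm (grad (\<theta> l) x) \<le> Dm" if "l < M" for l x
 proof -
  have "D l \<le> Dm" unfolding Dm_def using that \<theta>(8) by (intro member_le_sum) (auto simp: less_imp_le)
  then show ?thesis using \<theta>(7)[of l x] by simp
 qed
 have "Dm \<ge> 0" unfolding Dm_def using \<theta>(8) by (intro sum_nonneg) (auto simp: less_imp_le)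
 define C' where "C' = K1 + 4 * C * Dm\<^sup>2 + 1"
 have "C' > 0" using K1(1) C_pos by (simp add: C'_def add_pos_nonneg add_nonneg_pos)
 show ?thesis
 proof (rule that[OF \<open>C' > 0\<close>])
  fix \<eta> :: "real^'n^'d" and u :: "real^'n \<Rightarrow> real^'d" and b :: "real^'n \<Rightarrow> real^'n^'d"
  assume u: "cont_diff 1 u" and [measurable]: "b \<in> borel_measurable borel"
  have [measurable]: "grad_matrix u \<in> borel_measurable borel" "u \<in> borel_measurable borel"
   by (rule grad_matrix_measurable[OF u]) (rule cont_diff_measurable[OF u])

  \<comment> \<open>Pointwise estimate for one cutoff\<close>
  define \<psi> where "\<psi> l y = \<theta> l y *\<^sub>R u y" for l y
  have \<psi>: "\<psi> l \<in> C1_compact ?Q" for l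
   unfolding C1_compact_iff \<psi>_def[abs_def]
   by (intro conjI cont_diff_scaleR \<theta>(1) u compact_support_inI[OF \<theta>(4)[of l]])
    (use \<theta>(5)[of l] A'A[of "Suc l"] AQ[of "Suc l"] \<theta>(6) in auto)
  have g: "grad_matrix (\<psi> l) y = \<theta> l y *\<^sub>R grad_matrix u y + (\<chi> i j. u y $ i * grad (\<theta> l) y $ j)" for l y
   unfolding \<psi>_def[abs_def] by (rule grad_matrix_cutoff[OF \<theta>(1) u])
  have [measurable]: "grad_matrix (\<psi> l) \<in> borel_measurable borel" for l
   by (rule grad_matrix_measurable[OF C1_compactD(1)[OF \<psi>]])
  define \<Gamma> where "\<Gamma> y = (norm (grad_matrix u y))\<^sup>2" for y
  define T where "T y = zr (b y) + \<delta>/4 * (1 + (norm \<eta>)\<^sup>2 + \<Gamma> y) + K1 * (norm (b y - \<eta> - grad_matrix u y))\<^sup>2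
    + 4 * C * Dm\<^sup>2 * (norm (u y))\<^sup>2" for y
  define \<kappa> where "\<kappa> = 2 * C * (1 + (norm \<eta>)\<^sup>2)"
  have "\<kappa> \<ge> 0" using C_pos by (simp add: \<kappa>_def)
  have \<Gamma>0: "\<Gamma> y \<ge> 0" for y by (simp add: \<Gamma>_def)
  have T0: "T y \<ge> 0" for y
   unfolding T_def using assms K1(1) C_pos \<Gamma>0[of y] by (intro add_nonneg_nonneg mult_nonneg_nonneg) auto
  have pt: "zr (\<eta> + grad_matrix (\<psi> l) y) \<le> T y + \<kappa> * indicator (- A 0) y + 4 * C * \<Gamma> y * indicator (A (Suc l) - A l) y"
   if l: "l < M" for l y
  proof -
   \<comment> \<open>Inside \<open>A l\<close> the gradient is that of u and the almost Lipschitz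
     estimate compares with b. Outside \<open>A (Suc l)\<close> the function vanishes and the value
     at \<eta> is charged to \<kappa>. In between only growth is available, whence the term 4 C
     \<Gamma>.\<close>
   consider "y \<in> A l" | "y \<notin> A l" "y \<notin> A (Suc l)" | "y \<in> A (Suc l) - A l" by blast
   then show ?thesis
   proof cases
    case 1
    have y': "y \<in> A' (Suc l)" using 1 AA' by blast
    have "grad (\<theta> l) y = 0"
    proof (rule ccontr)
     assume "grad (\<theta> l) y \<noteq> 0"
     \<comment> \<open>At a point of the closed cube \<theta> attains its maximum 1, so its
       derivative vanishes there, boundary points included.\<close>
     have "frechet_derivative (\<theta> l) (at y) = (\<lambda>v. 0)"
      by (rule differential_zero_maxmin[of y UNIV "\<theta> l"])
       (use C1_has_derivative[OF \<theta>(1)[of l], of y] \<theta>(2)[of l] \<theta>(3)[OF 1] in auto)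
     then have "grad (\<theta> l) y = 0" by (simp add: grad_def partial_def vec_eq_iff)
     with \<open>grad (\<theta> l) y \<noteq> 0\<close> show False by simp
    qed
    then have e: "grad_matrix (\<psi> l) y = grad_matrix u y" using \<theta>(3)[OF 1] by (simp add: g vec_eq_iff)
    have "(norm (\<eta> + grad_matrix u y))\<^sup>2 \<le> 2 * (norm \<eta>)\<^sup>2 + 2 * \<Gamma> y" unfolding \<Gamma>_def by (rule norm_add_sq_le)
    then have "1 + (norm (\<eta> + grad_matrix u y))\<^sup>2 \<le> 2 * (1 + (norm \<eta>)\<^sup>2 + \<Gamma> y)" by simp
    then have "\<delta>/8 * (1 + (norm (\<eta> + grad_matrix u y))\<^sup>2) \<le> \<delta>/8 * (2 * (1 + (norm \<eta>)\<^sup>2 + \<Gamma> y))"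
     using assms by (intro mult_left_mono) auto
    moreover have "zr (\<eta> + grad_matrix u y) \<le> zr (b y) + \<delta>/8 * (1 + (norm (\<eta> + grad_matrix u y))\<^sup>2)
      + K1 * (norm (b y - \<eta> - grad_matrix u y))\<^sup>2"
     using K1(2)[of "\<eta> + grad_matrix u y" "b y"] by (simp add: diff_diff_eq)
    moreover have "0 \<le> 4 * C * Dm\<^sup>2 * (norm (u y))\<^sup>2" using C_pos by simp
    ultimately have "zr (\<eta> + grad_matrix (\<psi> l) y) \<le> T y" unfolding e T_def by linarith
    moreover have "0 \<le> \<kappa> * indicator (- A 0) y" "0 \<le> 4 * C * \<Gamma> y * indicator (A (Suc l) - A l) y"
     using \<open>\<kappa> \<ge> 0\<close> C_pos \<Gamma>0[of y] by auto
    ultimately show ?thesis by linarith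
   next
    case 2
    have "y \<notin> L l" using 2(2) \<theta>(5)[of l] A'A[of "Suc l"] by blast
    then have "grad_matrix (\<psi> l) y = 0"
     using grad_matrix_eq_0[OF C1_compactD(1)[OF \<psi>[of l]] \<theta>(4)[of l], of y] \<theta>(6)[of _ l] by (simp add: \<psi>_def)
    then have "zr (\<eta> + grad_matrix (\<psi> l) y) \<le> C * (1 + (norm \<eta>)\<^sup>2)"
     using zr_le_f[of \<eta>] growth[of \<eta>] by simp
    moreover have "C * (1 + (norm \<eta>)\<^sup>2) \<le> \<kappa>" unfolding \<kappa>_def using C_pos by simp
    moreover have "y \<notin> A 0" using Amono[of 0 l] 2(1) by blast
    moreover have "0 \<le> 4 * C * \<Gamma> y * indicator (A (Suc l) - A l) y" using C_pos \<Gamma>0[of y] by simp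
    ultimately show ?thesis using T0[of y] by simp
   next
    case 3
    have "norm (grad_matrix (\<psi> l) y) \<le> norm (\<theta> l y *\<^sub>R grad_matrix u y) + norm ((\<chi> i j. u y $ i * grad (\<theta> l) y $ j) :: real^'n^'d)"
     unfolding g by (rule norm_triangle_ineq)
    also have "\<dots> \<le> 1 * norm (grad_matrix u y) + norm (u y) * Dm"
    proof (intro add_mono)
     show "norm (\<theta> l y *\<^sub>R grad_matrix u y) \<le> 1 * norm (grad_matrix u y)"
      using \<theta>(2)[of l y] by (simp add: mult_left_le_one_le)
     have "norm (u y) * norm (grad (\<theta> l) y) \<le> norm (u y) * Dm" using D[OF l, of y] by (intro mult_left_mono) auto
     then show "norm ((\<chi> i j. u y $ i * grad (\<theta> l) y $ j) :: real^'n^'d) \<le> norm (u y) * Dm"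
      using norm_outer_le[of "u y" "grad (\<theta> l) y"] by (rule order_trans[rotated])
    qed
    finally have "(norm (grad_matrix (\<psi> l) y))\<^sup>2 \<le> (norm (grad_matrix u y) + norm (u y) * Dm)\<^sup>2"
     by (intro power_mono) auto
    also have "\<dots> \<le> 2 * \<Gamma> y + 2 * (Dm\<^sup>2 * (norm (u y))\<^sup>2)"
     using norm_add_sq_le[of "norm (grad_matrix u y)" "norm (u y) * Dm"] by (simp add: \<Gamma>_def power_mult_distrib mult.commute)
    finally have gn: "(norm (grad_matrix (\<psi> l) y))\<^sup>2 \<le> 2 * \<Gamma> y + 2 * (Dm\<^sup>2 * (norm (u y))\<^sup>2)" .
    have "zr (\<eta> + grad_matrix (\<psi> l) y) \<le> C * (1 + 2 * (norm \<eta>)\<^sup>2 + 2 * (norm (grad_matrix (\<psi> l) y))\<^sup>2)"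
     using zr_le_f growth_add order_trans by blast
    also have "\<dots> \<le> C * (1 + 2 * (norm \<eta>)\<^sup>2 + 2 * (2 * \<Gamma> y + 2 * (Dm\<^sup>2 * (norm (u y))\<^sup>2)))"
     using C_pos gn by (intro mult_left_mono add_left_mono) auto
    also have "\<dots> = C * (1 + 2 * (norm \<eta>)\<^sup>2) + 4 * C * \<Gamma> y + 4 * C * Dm\<^sup>2 * (norm (u y))\<^sup>2"
     by (simp add: algebra_simps)
    finally have "zr (\<eta> + grad_matrix (\<psi> l) y) \<le> \<dots>" .
    moreover have "C * (1 + 2 * (norm \<eta>)\<^sup>2) \<le> \<kappa>" unfolding \<kappa>_def using C_pos by (simp add: algebra_simps)
    moreover have "4 * C * Dm\<^sup>2 * (norm (u y))\<^sup>2 \<le> T y"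
    proof -
     have "0 \<le> zr (b y) + \<delta>/4 * (1 + (norm \<eta>)\<^sup>2 + \<Gamma> y) + K1 * (norm (b y - \<eta> - grad_matrix u y))\<^sup>2"
      using assms K1(1) \<Gamma>0[of y] by (intro add_nonneg_nonneg mult_nonneg_nonneg) auto
     then show ?thesis unfolding T_def by linarith
    qed
    moreover have "y \<notin> A 0" using Amono[of 0 l] 3 by blast
    ultimately show ?thesis using 3 by simp
   qed
  qed
  \<comment> \<open>The sum telescopes: the layers are successive differences of the increasing
    cubes.\<close>
  have layers: "(\<Sum>l<M. indicator (A (Suc l) - A l) y :: real) \<le> 1" for y
  proof -
   have "(\<Sum>l<m. indicator (A (Suc l) - A l) y :: real) \<le> indicator (A m) y" for m
   proof (induction m)
    case (Suc m)
    have "indicator (A m) y + indicator (A (Suc m) - A m) y \<le> (indicator (A (Suc m)) y :: real)"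
     using Amono[of m "Suc m"] by (auto simp: indicator_def)
    then show ?case using Suc by simp
   qed simp
   also have "indicator (A M) y \<le> (1 :: real)" by (simp add: indicator_def)
   finally show ?thesis .
  qed

  \<comment> \<open>Averaging over the cutoffs\<close>
  define R where "R y = T y + \<kappa> * indicator (- A 0) y + \<delta>/2 * \<Gamma> y" for y
  have R0: "R y \<ge> 0" for y
   unfolding R_def using T0[of y] \<open>\<kappa> \<ge> 0\<close> assms \<Gamma>0[of y] by (intro add_nonneg_nonneg mult_nonneg_nonneg) auto
  have [measurable]: "\<Gamma> \<in> borel_measurable borel" unfolding \<Gamma>_def[abs_def] by measurable
  have [measurable]: "T \<in> borel_measurable borel" unfolding T_def[abs_def] by measurable
  have [measurable]: "R \<in> borel_measurable borel" unfolding R_def[abs_def] by measurable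
  have sum: "(\<Sum>l<M. zr (\<eta> + grad_matrix (\<psi> l) y)) \<le> real M * R y" for y
  proof -
   have "(\<Sum>l<M. zr (\<eta> + grad_matrix (\<psi> l) y)) \<le>
     (\<Sum>l<M. T y + \<kappa> * indicator (- A 0) y + 4 * C * \<Gamma> y * indicator (A (Suc l) - A l) y)"
    by (intro sum_mono pt) auto
   also have "\<dots> = real M * (T y + \<kappa> * indicator (- A 0) y) + 4 * C * \<Gamma> y * (\<Sum>l<M. indicator (A (Suc l) - A l) y)"
    by (simp add: sum.distrib sum_distrib_left algebra_simps)
   also have "\<dots> \<le> real M * (T y + \<kappa> * indicator (- A 0) y) + 4 * C * \<Gamma> y * 1"
    using layers[of y] C_pos \<Gamma>0[of y] by (intro add_left_mono mult_left_mono) auto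
   also have "4 * C * \<Gamma> y * 1 \<le> \<delta>/2 * real M * \<Gamma> y" using mult_right_mono[OF MC \<Gamma>0[of y]] by simp
   finally show ?thesis by (simp add: R_def algebra_simps)
  qed
  have "ennreal (real M) * Z \<eta> = (\<Sum>l<M. Z \<eta>)" by (simp add: ennreal_of_nat_eq_real_of_nat)
  \<comment> \<open>Quasiconvexity of \<open>Z\<close> is used rather than its definition through f:
    the integrands are then values of \<open>Z\<close>, for which the almost Lipschitz estimate
    holds without restriction on the argument.\<close>
  also have "\<dots> \<le> (\<Sum>l<M. (NNINT y:?Q. Z (\<eta> + grad_matrix (\<psi> l) y)))"
  proof (rule sum_mono)
   fix l
   show "Z \<eta> \<le> (NNINT y:?Q. Z (\<eta> + grad_matrix (\<psi> l) y))"
    using quasiconvex_Z \<psi>[of l] unfolding quasiconvex_def by (simp add: nn_integral_lebesgue_on)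
  qed
  also have "\<dots> = (NNINT y. (\<Sum>l<M. Z (\<eta> + grad_matrix (\<psi> l) y) * indicator ?Q y))"
   by (rule nn_integral_sum[symmetric]) simp
  also have "\<dots> \<le> (NNINT y. ennreal (real M) * (ennreal (R y) * indicator ?Q y))"
  proof (rule nn_integral_mono)
   fix y
   have "(\<Sum>l<M. Z (\<eta> + grad_matrix (\<psi> l) y)) = ennreal (\<Sum>l<M. zr (\<eta> + grad_matrix (\<psi> l) y))"
    by (simp add: Z_eq_zr sum_ennreal)
   also have "\<dots> \<le> ennreal (real M * R y)" by (rule ennreal_leI[OF sum])
   also have "\<dots> = ennreal (real M) * ennreal (R y)" using R0[of y] by (simp add: ennreal_mult)
   finally show "(\<Sum>l<M. Z (\<eta> + grad_matrix (\<psi> l) y) * indicator ?Q y) \<le> ennreal (real M) * (ennreal (R y) * indicator ?Q y)"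
    by (auto simp: indicator_def)
  qed
  also have "\<dots> = ennreal (real M) * (NNINT y:?Q. ennreal (R y))"
   by (rule nn_integral_cmult) simp
  finally have "Z \<eta> \<le> (NNINT y:?Q. ennreal (R y))"
   using \<open>M > 0\<close> by (simp add: ennreal_mult_le_mult_iff)
  also have "\<dots> = (NNINT y. ennreal (T y + \<delta>/2 * \<Gamma> y) * indicator ?Q y + ennreal \<kappa> * indicator (?Q - A 0) y)"
  proof (rule nn_integral_cong)
   fix y
   have "ennreal (R y) = ennreal (T y + \<delta>/2 * \<Gamma> y) + ennreal (\<kappa> * indicator (- A 0) y)"
    using T0[of y] \<Gamma>0[of y] assms \<open>\<kappa> \<ge> 0\<close>
    by (subst ennreal_plus[symmetric]) (auto simp: R_def algebra_simps)
   then show "ennreal (R y) * indicator ?Q y = ennreal (T y + \<delta>/2 * \<Gamma> y) * indicator ?Q y + ennreal \<kappa> * indicator (?Q - A 0) y"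
    by (auto simp: indicator_def)
  qed
  also have "\<dots> = (NNINT y:?Q. ennreal (T y + \<delta>/2 * \<Gamma> y)) + ennreal \<kappa> * emeasure lborel (?Q - A 0)"
   by (subst nn_integral_add) (simp_all add: nn_integral_cmult_indicator)
  also have "ennreal \<kappa> * emeasure lborel (?Q - A 0) \<le> ennreal (\<delta>/4 * (1 + (norm \<eta>)\<^sup>2))"
  proof -
   define r where "r = 1 - 2 * \<sigma>"
   have r: "r > 0" "r \<le> 1" using \<sigma> by (auto simp: r_def)
   have rn: "0 \<le> r ^ ?n" "r ^ ?n \<le> 1" using r by (auto simp: power_le_one)
   have c1: "cube (\<sigma> *\<^sub>R 1) r \<subseteq> A 0"
    using \<sigma> by (auto simp: mem_cube A_def s_def r_def less_imp_le)
   have "emeasure lborel (?Q - A 0) \<le> emeasure lborel (?Q - cube (\<sigma> *\<^sub>R 1) r)"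
    using c1 by (intro emeasure_mono) auto
   also have "\<dots> = ennreal (1 - r ^ ?n)"
    using emeasure_Diff[of lborel "cube (\<sigma> *\<^sub>R 1) r" ?Q] c1 AQ[of 0] rn
    by (simp add: emeasure_cube[OF r(1)] emeasure_unit_cube ennreal_minus flip: ennreal_1)
   finally have "ennreal \<kappa> * emeasure lborel (?Q - A 0) \<le> ennreal \<kappa> * ennreal (1 - r ^ ?n)"
    by (rule mult_left_mono) simp
   also have "\<dots> = ennreal (\<kappa> * (1 - r ^ ?n))" using \<open>\<kappa> \<ge> 0\<close> rn by (simp add: ennreal_mult)
   also have "\<dots> \<le> ennreal (\<delta>/4 * (1 + (norm \<eta>)\<^sup>2))"
   proof (rule ennreal_leI)
    have "\<kappa> * (1 - r ^ ?n) = ((1 - r ^ ?n) * (2 * C)) * (1 + (norm \<eta>)\<^sup>2)" by (simp add: \<kappa>_def)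
    also have "\<dots> \<le> \<delta>/4 * (1 + (norm \<eta>)\<^sup>2)" using \<sigma>(1) by (intro mult_right_mono) (auto simp: r_def)
    finally show "\<kappa> * (1 - r ^ ?n) \<le> \<delta>/4 * (1 + (norm \<eta>)\<^sup>2)" .
   qed
   finally show ?thesis .
  qed
  also have "(NNINT y:?Q. ennreal (T y + \<delta>/2 * \<Gamma> y)) + ennreal (\<delta>/4 * (1 + (norm \<eta>)\<^sup>2)) =
    (NNINT y. ennreal (T y + \<delta>/2 * \<Gamma> y) * indicator ?Q y + ennreal (\<delta>/4 * (1 + (norm \<eta>)\<^sup>2)) * indicator ?Q y)"
   by (subst nn_integral_add) (simp_all add: nn_integral_cmult_indicator emeasure_unit_cube)
  also have "\<dots> \<le> (NNINT y:?Q. ennreal (zr (b y) + \<delta> * (1 + (norm \<eta>)\<^sup>2 + (norm (grad_matrix u y))\<^sup>2)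
     + C' * ((norm (b y - \<eta> - grad_matrix u y))\<^sup>2 + (norm (u y))\<^sup>2)))"
  proof (rule nn_integral_mono)
   fix y
   let ?X = "(norm (b y - \<eta> - grad_matrix u y))\<^sup>2" and ?U = "(norm (u y))\<^sup>2" and ?E = "1 + (norm \<eta>)\<^sup>2"
   have "T y + \<delta>/2 * \<Gamma> y + \<delta>/4 * ?E \<le> zr (b y) + \<delta> * (?E + \<Gamma> y) + C' * (?X + ?U)"
   proof -
    have "K1 * ?X \<le> C' * ?X" "4 * C * Dm\<^sup>2 * ?U \<le> C' * ?U"
     unfolding C'_def using K1(1) C_pos by (intro mult_right_mono; simp)+
    moreover have "\<delta>/4 * (?E + \<Gamma> y) + \<delta>/2 * \<Gamma> y + \<delta>/4 * ?E \<le> \<delta> * (?E + \<Gamma> y)"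
    proof -
     have "0 \<le> \<delta> * \<Gamma> y" "0 \<le> \<delta> * (norm \<eta>)\<^sup>2" using assms \<Gamma>0[of y] by auto
     then show ?thesis using assms unfolding distrib_left by linarith
    qed
    ultimately show ?thesis unfolding T_def by (simp add: algebra_simps)
   qed
   then have "ennreal (T y + \<delta>/2 * \<Gamma> y + \<delta>/4 * ?E) \<le> ennreal (zr (b y) + \<delta> * (?E + \<Gamma> y) + C' * (?X + ?U))"
    by (rule ennreal_leI)
   moreover have "ennreal (T y + \<delta>/2 * \<Gamma> y + \<delta>/4 * ?E) = ennreal (T y + \<delta>/2 * \<Gamma> y) + ennreal (\<delta>/4 * ?E)"
    using T0[of y] \<Gamma>0[of y] assms by (intro ennreal_plus) auto
   ultimately show "ennreal (T y + \<delta>/2 * \<Gamma> y) * indicator ?Q y + ennreal (\<delta>/4 * ?E) * indicator ?Q y \<le>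
     ennreal (zr (b y) + \<delta> * (1 + (norm \<eta>)\<^sup>2 + (norm (grad_matrix u y))\<^sup>2) + C' * (?X + ?U)) * indicator ?Q y"
    by (auto simp: indicator_def \<Gamma>_def)
  qed
  finally show "Z \<eta> \<le> (NNINT y:?Q. ennreal (zr (b y) + \<delta> * (1 + (norm \<eta>)\<^sup>2 + (norm (grad_matrix u y))\<^sup>2)
     + C' * ((norm (b y - \<eta> - grad_matrix u y))\<^sup>2 + (norm (u y))\<^sup>2)))"
   by (simp add: add_right_mono add_left_mono)
 qed
qed

text \<open>The unit cube estimate for y \<mapsto> u(c + h y)/h and y \<mapsto> b(c + h y).
  Gradients are unchanged, and |u|^2 acquires the factor 1/h^2, which is harmless since u becomes
  small while h is kept fixed.\<close>

lemma zr_cube_le: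
 assumes "\<delta> > 0"
 obtains C' where "C' > 0"
  "\<And>c h \<eta> u b. 0 < h \<Longrightarrow> cont_diff 1 u \<Longrightarrow> b \<in> borel_measurable borel \<Longrightarrow>
   (NNINT x:cube c h. Z \<eta>) \<le> (NNINT x:cube c h. ennreal (zr (b x) + \<delta> * (1 + (norm \<eta>)\<^sup>2 + (norm (grad_matrix u x))\<^sup>2)
     + C' * ((norm (b x - \<eta> - grad_matrix u x))\<^sup>2 + (norm (u x))\<^sup>2 / h\<^sup>2)))"
proof -
 obtain C' where C': "C' > 0"
  "\<And>\<eta> u b. cont_diff 1 u \<Longrightarrow> b \<in> borel_measurable borel \<Longrightarrow>
   Z \<eta> \<le> (NNINT y:box 0 1. ennreal (zr (b y) + \<delta> * (1 + (norm \<eta>)\<^sup>2 + (norm (grad_matrix u y))\<^sup>2)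
     + C' * ((norm (b y - \<eta> - grad_matrix u y))\<^sup>2 + (norm (u y))\<^sup>2)))"
  using zr_unit_cube_le[OF assms] by blast
 show ?thesis
 proof (rule that[OF C'(1)])
  fix c :: "real^'n" and h :: real and \<eta> :: "real^'n^'d" and u :: "real^'n \<Rightarrow> real^'d" and b :: "real^'n \<Rightarrow> real^'n^'d"
  assume h: "0 < h" and u: "cont_diff 1 u" and [measurable]: "b \<in> borel_measurable borel"
  define u' where "u' = rescale (- ((1 / h) *\<^sub>R c)) (1 / h) u"
  define b' where "b' y = b (c + h *\<^sub>R y)" for y
  have u': "cont_diff 1 u'" unfolding u'_def by (rule cont_diff_rescale[OF u])
  have [measurable]: "b' \<in> borel_measurable borel" unfolding b'_def[abs_def] by measurable
  have [measurable]: "grad_matrix u' \<in> borel_measurable borel" "u' \<in> borel_measurable borel"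
   by (rule grad_matrix_measurable[OF u']) (rule cont_diff_measurable[OF u'])
  have u'x: "u' ((1 / h) *\<^sub>R (x - c)) = (1 / h) *\<^sub>R u x" for x
   using h by (simp add: u'_def rescale_def scaleR_add_right)
  have gx: "grad_matrix u' ((1 / h) *\<^sub>R (x - c)) = grad_matrix u x" for x
   unfolding u'_def using h by (subst grad_matrix_rescale[OF u]) (auto simp: scaleR_add_right)
  have bx: "b' ((1 / h) *\<^sub>R (x - c)) = b x" for x using h by (simp add: b'_def)
  let ?G = "\<lambda>y. ennreal (zr (b' y) + \<delta> * (1 + (norm \<eta>)\<^sup>2 + (norm (grad_matrix u' y))\<^sup>2)
     + C' * ((norm (b' y - \<eta> - grad_matrix u' y))\<^sup>2 + (norm (u' y))\<^sup>2))"
  have "(NNINT x:cube c h. Z \<eta>) = ennreal (h ^ CARD('n)) * Z \<eta>"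
   by (subst nn_integral_cmult_indicator) (simp_all add: emeasure_cube[OF h] mult.commute)
  also have "\<dots> \<le> ennreal (h ^ CARD('n)) * (NNINT y:box 0 1. ?G y)"
   by (intro mult_left_mono C'(2) u') auto
  also have "\<dots> = (NNINT x:cube c h. ?G ((1 / h) *\<^sub>R (x - c)))"
   by (rule nn_integral_cube[OF h, symmetric]) measurable
  also have "\<dots> = (NNINT x:cube c h. ennreal (zr (b x) + \<delta> * (1 + (norm \<eta>)\<^sup>2 + (norm (grad_matrix u x))\<^sup>2)
     + C' * ((norm (b x - \<eta> - grad_matrix u x))\<^sup>2 + (norm (u x))\<^sup>2 / h\<^sup>2)))"
   using h by (simp only: gx bx u'x) (simp add: power_divide)
  finally show "(NNINT x:cube c h. Z \<eta>) \<le> (NNINT x:cube c h. ennreal (zr (b x) + \<delta> * (1 + (norm \<eta>)\<^sup>2 + (norm (grad_matrix u x))\<^sup>2)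
     + C' * ((norm (b x - \<eta> - grad_matrix u x))\<^sup>2 + (norm (u x))\<^sup>2 / h\<^sup>2)))" .
 qed
qed

end

section \<open>Decomposition into a gradient and a small remainder\<close>

text \<open>Expansion of the first argument in a basis reduces this to scalar kernels. It is applied
  to the product of a matrix field with the direction of a shift.\<close>

lemma bilinear_average:
 fixes prod :: "'e::euclidean_space \<Rightarrow> 'f::euclidean_space \<Rightarrow> 'b::euclidean_space" and \<kappa> :: "'a::euclidean_space \<Rightarrow> 'e"
 assumes prod: "bounded_bilinear prod" and \<kappa>: "cont_diff 1 \<kappa>" "compact K" "\<And>x. x \<notin> K \<Longrightarrow> \<kappa> x = 0"
  and a: "a \<in> borel_measurable M" and w: "integrable M w"
 shows "cont_diff 1 (\<lambda>x. \<integral>p. prod (\<kappa> (x - a p)) (w p) \<partial>M)"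
  and "((\<lambda>x. \<integral>p. prod (\<kappa> (x - a p)) (w p) \<partial>M) has_derivative
   (\<lambda>h. \<integral>p. prod (frechet_derivative \<kappa> (at (x - a p)) h) (w p) \<partial>M)) (at x)"
proof -
 interpret bounded_bilinear prod by (rule prod)
 have exp: "prod y z = (\<Sum>b\<in>Basis. (y \<bullet> b) *\<^sub>R prod b z)" for y z
  using linear_euclidean[OF bounded_linear.linear[OF bounded_linear_left], of y z] by simp
 have \<kappa>b: "cont_diff 1 (\<lambda>x. \<kappa> x \<bullet> b)" for b by (rule cont_diff_bounded_linear[OF bounded_linear_inner_left \<kappa>(1)])
 have \<kappa>b0: "x \<notin> K \<Longrightarrow> \<kappa> x \<bullet> b = 0" for x b by (simp add: \<kappa>(3))
 have wb: "integrable M (\<lambda>p. prod b (w p))" for b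
  by (rule integrable_bounded_linear[OF bounded_linear_right w])
 have fd: "frechet_derivative (\<lambda>x. \<kappa> x \<bullet> b) (at z) h = frechet_derivative \<kappa> (at z) h \<bullet> b" for z h b
 proof -
  have "((\<lambda>x. \<kappa> x \<bullet> b) has_derivative (\<lambda>h. frechet_derivative \<kappa> (at z) h \<bullet> b)) (at z)"
   by (rule has_derivative_inner_left[OF C1_has_derivative[OF \<kappa>(1)]])
  from fun_cong[OF frechet_derivative_at[OF this], of h] show ?thesis by simp
 qed
 note i1 = integrable_average[OF cont_diff_continuous[OF \<kappa>b] \<kappa>(2) \<kappa>b0 a wb]
 have i2: "integrable M (\<lambda>p. (frechet_derivative \<kappa> (at (x - a p)) h \<bullet> b) *\<^sub>R prod b (w p))" for x h b
  unfolding fd[symmetric]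
  by (rule integrable_average[OF C1_deriv_continuous[OF \<kappa>b] \<kappa>(2) C1_compact_deriv[OF \<kappa>b \<kappa>(2) \<kappa>b0] a wb])
 have e1: "(\<integral>p. prod (\<kappa> (x - a p)) (w p) \<partial>M) = (\<Sum>b\<in>Basis. \<integral>p. (\<kappa> (x - a p) \<bullet> b) *\<^sub>R prod b (w p) \<partial>M)" for x
  by (subst exp, rule Bochner_Integration.integral_sum, rule i1)
 have e2: "(\<integral>p. prod (frechet_derivative \<kappa> (at (x - a p)) h) (w p) \<partial>M) =
   (\<Sum>b\<in>Basis. \<integral>p. (frechet_derivative \<kappa> (at (x - a p)) h \<bullet> b) *\<^sub>R prod b (w p) \<partial>M)" for x h
  by (subst exp, rule Bochner_Integration.integral_sum, rule i2)
 show "cont_diff 1 (\<lambda>x. \<integral>p. prod (\<kappa> (x - a p)) (w p) \<partial>M)"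
  unfolding e1 by (intro cont_diff_sum cont_diff_average[OF \<kappa>b \<kappa>(2) \<kappa>b0 a wb])
 show "((\<lambda>x. \<integral>p. prod (\<kappa> (x - a p)) (w p) \<partial>M) has_derivative
   (\<lambda>h. \<integral>p. prod (frechet_derivative \<kappa> (at (x - a p)) h) (w p) \<partial>M)) (at x)"
  unfolding e1 e2
  by (rule has_derivative_sum) (use has_derivative_average[OF \<kappa>b \<kappa>(2) \<kappa>b0 a wb] fd in simp)
qed

text \<open>A bound by a mean over shifts passes to square integrals: the Cauchy-Schwarz inequality
  on S, which has measure 1, then Fubini's theorem and translation invariance.\<close>

lemma sqn_average_le:
 fixes F :: "'a::euclidean_space \<Rightarrow> 'b::euclidean_space" and g :: "'a \<Rightarrow> 'c::euclidean_space"
  and S :: "'p::euclidean_space set"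
 assumes [measurable]: "S \<in> sets borel" "K \<in> sets borel" "T \<in> sets borel" "a \<in> borel_measurable borel" "g \<in> borel_measurable borel"
  and S1: "emeasure lborel S = 1" and k: "k \<ge> 0"
  and le: "\<And>x. x \<in> K \<Longrightarrow> ennreal (norm (F x)) \<le> ennreal k * (NNINT p:S. ennreal (norm (g (x - a p))))"
  and T: "\<And>x p. x \<in> K \<Longrightarrow> p \<in> S \<Longrightarrow> x - a p \<in> T"
 shows "sqn K F \<le> ennreal (k\<^sup>2) * sqn T g"
proof -
 have cs: "(NNINT p:S. ennreal (norm (g (x - a p))))\<^sup>2 \<le> (NNINT p:S. ennreal ((norm (g (x - a p)))\<^sup>2))" for x
 proof -
  have "(NNINT p:S. ennreal (norm (g (x - a p)))) =
    (NNINT p. (ennreal (norm (g (x - a p))) * indicator S p) * indicator S p)"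
   by (intro nn_integral_cong) (auto simp: indicator_def)
  also have "\<dots>\<^sup>2 \<le> (NNINT p. (ennreal (norm (g (x - a p))) * indicator S p)\<^sup>2) * (NNINT p. (indicator S p)\<^sup>2)"
   by (rule Cauchy_Schwarz_nn_integral) auto
  also have "(NNINT p. (indicator S p)\<^sup>2) = (NNINT p. indicator S p)"
   by (intro nn_integral_cong) (auto simp: indicator_def)
  also have "(NNINT p. indicator S p) = 1" using S1 by simp
  also have "(NNINT p. (ennreal (norm (g (x - a p))) * indicator S p)\<^sup>2) = (NNINT p:S. ennreal ((norm (g (x - a p)))\<^sup>2))"
   by (intro nn_integral_cong) (auto simp: indicator_def ennreal_power)
  finally show ?thesis by simp
 qed
 have "sqn K F \<le> (NNINT x. (NNINT p. ennreal (k\<^sup>2) * (ennreal ((norm (g (x - a p)))\<^sup>2) * indicator T (x - a p) * indicator S p)))"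
  unfolding sqn_def
 proof (rule nn_integral_mono)
  fix x
  show "ennreal ((norm (F x))\<^sup>2) * indicator K x \<le>
   (NNINT p. ennreal (k\<^sup>2) * (ennreal ((norm (g (x - a p)))\<^sup>2) * indicator T (x - a p) * indicator S p))"
  proof (cases "x \<in> K")
   case True
   have "ennreal ((norm (F x))\<^sup>2) = (ennreal (norm (F x)))\<^sup>2" by (simp add: ennreal_power)
   also have "\<dots> \<le> (ennreal k * (NNINT p:S. ennreal (norm (g (x - a p)))))\<^sup>2"
    by (intro power_mono le[OF True]) simp
   also have "\<dots> = ennreal (k\<^sup>2) * (NNINT p:S. ennreal (norm (g (x - a p))))\<^sup>2"
    using k by (simp add: power_mult_distrib ennreal_power)
   also have "\<dots> \<le> ennreal (k\<^sup>2) * (NNINT p:S. ennreal ((norm (g (x - a p)))\<^sup>2))"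
    by (intro mult_left_mono cs) simp
   also have "\<dots> = ennreal (k\<^sup>2) * (NNINT p. ennreal ((norm (g (x - a p)))\<^sup>2) * indicator T (x - a p) * indicator S p)"
   proof -
    have "(NNINT p:S. ennreal ((norm (g (x - a p)))\<^sup>2)) =
      (NNINT p. ennreal ((norm (g (x - a p)))\<^sup>2) * indicator T (x - a p) * indicator S p)"
    proof (rule nn_integral_cong)
     fix p
     show "ennreal ((norm (g (x - a p)))\<^sup>2) * indicator S p =
       ennreal ((norm (g (x - a p)))\<^sup>2) * indicator T (x - a p) * indicator S p"
      using T[OF True, of p] by (cases "p \<in> S") auto
    qed
    then show ?thesis by simp
   qed
   also have "\<dots> = (NNINT p. ennreal (k\<^sup>2) * (ennreal ((norm (g (x - a p)))\<^sup>2) * indicator T (x - a p) * indicator S p))"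
    by (rule nn_integral_cmult[symmetric]) measurable
   finally show ?thesis using True by simp
  qed simp
 qed
 also have "\<dots> = (NNINT p. (NNINT x. ennreal (k\<^sup>2) * (ennreal ((norm (g (x - a p)))\<^sup>2) * indicator T (x - a p) * indicator S p)))"
  by (rule lborel_pair.Fubini') measurable
 also have "\<dots> = (NNINT p. ennreal (k\<^sup>2) * sqn T g * indicator S p)"
 proof (rule nn_integral_cong)
  fix p
  have "(NNINT x. ennreal (k\<^sup>2) * (ennreal ((norm (g (x - a p)))\<^sup>2) * indicator T (x - a p) * indicator S p))
    = ennreal (k\<^sup>2) * indicator S p * (NNINT x. ennreal ((norm (g (x - a p)))\<^sup>2) * indicator T (x - a p))"
   by (subst nn_integral_cmult[symmetric]) (auto intro!: nn_integral_cong simp: mult_ac)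
  also have "(NNINT x. ennreal ((norm (g (x - a p)))\<^sup>2) * indicator T (x - a p)) =
    (\<integral>\<^sup>+x. ennreal ((norm (g x))\<^sup>2) * indicator T x \<partial>distr lborel borel ((+) (- a p)))"
   by (subst nn_integral_distr) auto
  also have "\<dots> = sqn T g" by (simp add: lborel_distr_plus sqn_def)
  finally show "(NNINT x. ennreal (k\<^sup>2) * (ennreal ((norm (g (x - a p)))\<^sup>2) * indicator T (x - a p) * indicator S p)) =
    ennreal (k\<^sup>2) * sqn T g * indicator S p" by (simp add: mult_ac)
 qed
 also have "\<dots> = ennreal (k\<^sup>2) * sqn T g" using S1 by (simp add: nn_integral_cmult_indicator)
 finally show ?thesis .
qed

lemma mollify_eq_0:
 assumes "s > 0" and F: "\<And>z. norm z > R \<Longrightarrow> F z = 0" and x: "x \<notin> cball 0 (R + s)"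
 shows "mollify s F x = 0"
proof -
 have "(\<lambda>z. moll s (x - z) *\<^sub>R F z) = (\<lambda>z. 0)"
 proof
  fix z
  show "moll s (x - z) *\<^sub>R F z = 0"
  proof (cases "norm z > R")
   case False
   then have "norm (x - z) \<ge> s" using x norm_triangle_sub[of x z] by auto
   then show ?thesis by (simp add: moll_eq_0[OF assms(1)])
  qed (simp add: F)
 qed
 then show ?thesis by (simp add: mollify_def)
qed

lemma frechet_derivative_mollify:
 fixes F :: "'a::euclidean_space \<Rightarrow> 'b::euclidean_space"
 assumes "s > 0" "integrable lborel F"
 shows "frechet_derivative (mollify s F) (at x) h = (LBINT z. frechet_derivative (moll s) (at (x - z)) h *\<^sub>R F z)"
proof -
 have "(mollify s F has_derivative (\<lambda>h. LBINT z. frechet_derivative (moll s) (at (x - z)) h *\<^sub>R F z)) (at x)"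
  unfolding mollify_def[abs_def]
  by (rule has_derivative_average[OF cont_diff_moll compact_cball[of 0 s] moll_supp]) (use assms in auto)
 from fun_cong[OF frechet_derivative_at[OF this], of h] show ?thesis by simp
qed

lemma grad_moll_reflect:
 fixes x z :: "real^'n"
 shows "grad (\<lambda>z. moll s (x - z)) z = - grad (moll s) (x - z)"
proof -
 have "((\<lambda>z. x - z) has_derivative (\<lambda>h. - h)) (at z)" by (auto intro!: derivative_eq_intros)
 from has_derivative_compose[OF this C1_has_derivative[OF cont_diff_moll]]
 have d: "((\<lambda>z. moll s (x - z)) has_derivative (\<lambda>h. frechet_derivative (moll s) (at (x - z)) (- h))) (at z)" .
 have l: "linear (frechet_derivative (moll s) (at (x - z)))"
  using C1_has_derivative[OF cont_diff_moll] has_derivative_linear by blast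
 show ?thesis
  unfolding grad_eq[OF d] using linear_neg[OF l] by (simp add: grad_def partial_def vec_eq_iff)
qed

definition shift_box :: "((real^'n) \<times> real) set" where
 "shift_box = cbox 0 1 \<times> {0..1}"

definition shift :: "real \<Rightarrow> (real^'n) \<times> real \<Rightarrow> real^'n" where
 "shift \<delta> p = (\<delta> * snd p) *\<^sub>R fst p"

text \<open>With p = (y, t) this is the mean over y in the unit cube of the line integrals of v
  along the segments from x - \<delta> y to x: the field at x - \<delta> t y applied to the
  direction \<delta> y. A single base point would give no L^2 bound; the mean over translations
  does. The base points move with x, so derivatives fall on v alone.\<close>

definition potential :: "real \<Rightarrow> (real^'n \<Rightarrow> real^'n^'n) \<Rightarrow> real^'n \<Rightarrow> real^'n" where
 "potential \<delta> v x = (LBINT p. v (x - shift \<delta> p) *v (indicator shift_box p *\<^sub>R (\<delta> *\<^sub>R fst p)))"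

definition shift_mean :: "real \<Rightarrow> (real^'n \<Rightarrow> 'b::euclidean_space) \<Rightarrow> real^'n \<Rightarrow> 'b" where
 "shift_mean \<delta> v x = (LBINT y. indicator (cbox 0 1) y *\<^sub>R v (x - \<delta> *\<^sub>R y))"

lemma emeasure_unit_cbox: "emeasure lborel (cbox 0 (1::real^'n)) = 1"
proof -
 have "emeasure lborel (cbox 0 (1::real^'n)) = emeasure lborel (box 0 (1::real^'n))"
  by (simp add: emeasure_lborel_cbox_eq emeasure_lborel_box_eq)
 then show ?thesis by (simp add: emeasure_unit_cube)
qed

lemma shift_box_borel [measurable]: "shift_box \<in> sets borel"
 unfolding shift_box_def by (intro borel_closed closed_Times) auto

lemma shift_measurable [measurable]: "shift \<delta> \<in> borel_measurable borel"
 unfolding shift_def[abs_def] by (intro borel_measurable_continuous_onI continuous_intros)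

lemma emeasure_shift_box: "emeasure lborel (shift_box :: ((real^'n) \<times> real) set) = 1"
proof -
 have "emeasure (lborel \<Otimes>\<^sub>M lborel) (cbox 0 (1::real^'n) \<times> {0..1::real}) = emeasure lborel (cbox 0 (1::real^'n)) * emeasure lborel {0..1::real}"
  by (rule lborel.emeasure_pair_measure_Times) auto
 then show ?thesis unfolding shift_box_def lborel_prod by (simp add: emeasure_unit_cbox)
qed

lemma norm_unit_cbox: "y \<in> cbox 0 (1::real^'n) \<Longrightarrow> norm y \<le> CARD('n)"
 using norm_cube_diff_le[of y 0 1] by (simp add: mem_box_cart)

lemma norm_shift:
 assumes "p \<in> shift_box" "\<delta> \<ge> 0"
 shows "norm (shift \<delta> (p :: (real^'n) \<times> real)) \<le> \<delta> * CARD('n)"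
proof -
 have p: "fst p \<in> cbox 0 1" "0 \<le> snd p" "snd p \<le> 1" using assms(1) by (auto simp: shift_box_def)
 have "norm (shift \<delta> p) = \<delta> * (snd p * norm (fst p))" using p assms(2) by (simp add: shift_def mult.assoc)
 also have "snd p * norm (fst p) \<le> 1 * real CARD('n)" using p by (intro mult_mono norm_unit_cbox) auto
 finally show ?thesis using assms(2) by (simp add: mult_left_mono)
qed

lemma compact_shift_box: "compact shift_box"
 unfolding shift_box_def by (intro compact_Times) auto

lemma bounded_bilinear_matrix_vector: "bounded_bilinear ((*v) :: real^'n^'d \<Rightarrow> real^'n \<Rightarrow> real^'d)"
proof
 show "\<exists>K. \<forall>(A::real^'n^'d) x. norm (A *v x) \<le> norm A * norm x * K"
  by (intro exI[of _ 1]) (simp add: norm_matrix_vector_le)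
qed (simp_all add: matrix_vector_mult_def vec_eq_iff algebra_simps sum.distrib sum_distrib_left)

lemma integrable_shift_weight:
 "integrable lborel (\<lambda>p::(real^'n) \<times> real. indicator shift_box p *\<^sub>R (\<delta> *\<^sub>R fst p))"
 by (intro borel_integrable_compact compact_shift_box continuous_intros)

lemma potential_C1:
 assumes "cont_diff 1 v" "compact K" "\<And>x. x \<notin> K \<Longrightarrow> v x = 0"
 shows "cont_diff 1 (potential \<delta> v)"
 unfolding potential_def[abs_def]
 by (rule bilinear_average(1)[OF bounded_bilinear_matrix_vector assms _ integrable_shift_weight]) auto

lemma integral_vec_nth:
 fixes f :: "'a \<Rightarrow> 'b::euclidean_space^'n"
 assumes "integrable M f"
 shows "(\<integral>x. f x \<partial>M) $ i = (\<integral>x. f x $ i \<partial>M)" and "integrable M (\<lambda>x. f x $ i)"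
 using integral_bounded_linear[OF bounded_linear_vec_nth assms] integrable_bounded_linear[OF bounded_linear_vec_nth assms]
 by auto

lemma norm_potential_le:
 fixes v :: "real^'n \<Rightarrow> real^'n^'n"
 assumes v: "continuous_on UNIV v" and "\<delta> \<ge> 0"
 shows "ennreal (norm (potential \<delta> v x)) \<le> ennreal (\<delta> * CARD('n)) *
   (NNINT p:shift_box. ennreal (norm (v (x - shift \<delta> p))))"
proof -
 have [measurable]: "v \<in> borel_measurable borel" by (rule borel_measurable_continuous_onI[OF v])
 have cs: "continuous_on S (\<lambda>p. v (x - shift \<delta> p))" for S
  unfolding shift_def by (intro continuous_on_compose2[OF v] continuous_intros) auto
 have eq: "v (x - shift \<delta> p) *v (indicator shift_box p *\<^sub>R (\<delta> *\<^sub>R fst p)) =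
   indicator shift_box p *\<^sub>R (v (x - shift \<delta> p) *v (\<delta> *\<^sub>R fst p))" for p
  by (simp add: bounded_bilinear.scaleR_right[OF bounded_bilinear_matrix_vector])
 have int: "integrable lborel (\<lambda>p. v (x - shift \<delta> p) *v (indicator shift_box p *\<^sub>R (\<delta> *\<^sub>R fst p)))"
  unfolding eq
  by (intro borel_integrable_compact compact_shift_box bounded_bilinear.continuous_on[OF bounded_bilinear_matrix_vector] cs continuous_intros)
 have "ennreal (norm (potential \<delta> v x)) \<le> (NNINT p. ennreal (norm (v (x - shift \<delta> p) *v (indicator shift_box p *\<^sub>R (\<delta> *\<^sub>R fst p)))))"
  unfolding potential_def by (rule integral_norm_bound_ennreal[OF int])
 also have "\<dots> \<le> (NNINT p. ennreal (\<delta> * CARD('n)) * (ennreal (norm (v (x - shift \<delta> p))) * indicator shift_box p))"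
 proof (rule nn_integral_mono)
  fix p :: "(real^'n) \<times> real"
  show "ennreal (norm (v (x - shift \<delta> p) *v (indicator shift_box p *\<^sub>R (\<delta> *\<^sub>R fst p)))) \<le>
    ennreal (\<delta> * CARD('n)) * (ennreal (norm (v (x - shift \<delta> p))) * indicator shift_box p)"
  proof (cases "p \<in> shift_box")
   case True
   then have "norm (fst p) \<le> CARD('n)" by (intro norm_unit_cbox) (auto simp: shift_box_def)
   have "norm (v (x - shift \<delta> p) *v (\<delta> *\<^sub>R fst p)) \<le> norm (v (x - shift \<delta> p)) * norm (\<delta> *\<^sub>R fst p)"
    using norm_matrix_vector_le by blast
   also have "\<dots> \<le> norm (v (x - shift \<delta> p)) * (\<delta> * CARD('n))"
    using \<open>norm (fst p) \<le> CARD('n)\<close> assms(2) by (intro mult_left_mono) (auto intro: mult_left_mono)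
   finally have "norm (v (x - shift \<delta> p) *v (\<delta> *\<^sub>R fst p)) \<le> (\<delta> * CARD('n)) * norm (v (x - shift \<delta> p))"
    by (simp add: mult.commute)
   then have "ennreal (norm (v (x - shift \<delta> p) *v (\<delta> *\<^sub>R fst p))) \<le> ennreal (\<delta> * CARD('n)) * ennreal (norm (v (x - shift \<delta> p)))"
    using assms(2) by (simp add: ennreal_leI flip: ennreal_mult)
   then show ?thesis using True by simp
  qed (simp add: bounded_bilinear.zero_right[OF bounded_bilinear_matrix_vector])
 qed
 also have "\<dots> = ennreal (\<delta> * CARD('n)) * (NNINT p:shift_box. ennreal (norm (v (x - shift \<delta> p))))"
  by (rule nn_integral_cmult) measurable
 finally show ?thesis .
qed

text \<open>The fundamental theorem along the segment t \<mapsto> x - \<delta> t y, then the mean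
  over y. The mean of v over the end points is the price for base points that move with x.\<close>

lemma shift_mean_FTC:
 fixes v :: "real^'n \<Rightarrow> 'b::euclidean_space"
 assumes v: "cont_diff 1 v"
 shows "v x - shift_mean \<delta> v x =
  (LBINT p. indicator shift_box p *\<^sub>R frechet_derivative v (at (x - shift \<delta> p)) (\<delta> *\<^sub>R fst p))"
proof -
 let ?D = "\<lambda>z. frechet_derivative v (at z)"
 have cv: "continuous_on UNIV v" by (rule cont_diff_continuous[OF v])
 have lD: "linear (?D z)" for z using C1_has_derivative[OF v] has_derivative_linear by blast
 have Dsum: "?D z h = (\<Sum>b\<in>Basis. (h \<bullet> b) *\<^sub>R ?D z b)" for z h by (rule linear_euclidean[OF lD])
 have cD: "continuous_on S (\<lambda>q. ?D (f q) (g q))" if "continuous_on S f" "continuous_on S g" for S f and g :: "_ \<Rightarrow> real^'n"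
  by (subst Dsum) (intro continuous_intros that continuous_on_compose2[OF C1_deriv_continuous[OF v] that(1)], auto)
 have ftc: "(LBINT t. indicator {0..1} t *\<^sub>R ?D (x - (\<delta> * t) *\<^sub>R y) (\<delta> *\<^sub>R y)) = v x - v (x - \<delta> *\<^sub>R y)" for y
 proof -
  define q where "q t = - v (x - (\<delta> * t) *\<^sub>R y)" for t
  have "(LBINT t. indicator {0..1} t *\<^sub>R ?D (x - (\<delta> * t) *\<^sub>R y) (\<delta> *\<^sub>R y)) = q 1 - q 0"
  proof (rule integral_FTC_Icc)
   fix t :: real
   have "((\<lambda>t. x - (\<delta> * t) *\<^sub>R y) has_derivative (\<lambda>h. - ((\<delta> * h) *\<^sub>R y))) (at t)"
    by (auto intro!: derivative_eq_intros)
   from has_derivative_minus[OF has_derivative_compose[OF this C1_has_derivative[OF v]]]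
   have "(q has_derivative (\<lambda>h. - ?D (x - (\<delta> * t) *\<^sub>R y) (- ((\<delta> * h) *\<^sub>R y)))) (at t)"
    unfolding q_def[abs_def] .
   moreover have "- ?D (x - (\<delta> * t) *\<^sub>R y) (- ((\<delta> * h) *\<^sub>R y)) = h *\<^sub>R ?D (x - (\<delta> * t) *\<^sub>R y) (\<delta> *\<^sub>R y)" for h
    by (simp add: linear_neg[OF lD] linear_scale[OF lD])
   ultimately have "(q has_vector_derivative ?D (x - (\<delta> * t) *\<^sub>R y) (\<delta> *\<^sub>R y)) (at t)"
    by (simp add: has_vector_derivative_def)
   then show "(q has_vector_derivative ?D (x - (\<delta> * t) *\<^sub>R y) (\<delta> *\<^sub>R y)) (at t within {0..1})"
    by (rule has_vector_derivative_at_within)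
  qed (auto intro!: cD continuous_intros)
  then show ?thesis by (simp add: q_def)
 qed
 have i1: "integrable lborel (\<lambda>y. indicator (cbox 0 (1::real^'n)) y *\<^sub>R v x)"
  by (intro borel_integrable_compact) auto
 have i2: "integrable lborel (\<lambda>y. indicator (cbox 0 1) y *\<^sub>R v (x - \<delta> *\<^sub>R y))"
  by (intro borel_integrable_compact continuous_on_compose2[OF cv] continuous_intros) auto
 have ip: "integrable lborel (\<lambda>p. indicator shift_box p *\<^sub>R ?D (x - shift \<delta> p) (\<delta> *\<^sub>R fst p))"
  unfolding shift_def by (intro borel_integrable_compact compact_shift_box cD continuous_intros)
 have "(LBINT y. indicator (cbox 0 (1::real^'n)) y *\<^sub>R v x) = v x"
  using emeasure_unit_cbox[where 'n='n] by (simp add: measure_def)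
 then have "v x - shift_mean \<delta> v x = (LBINT y. indicator (cbox 0 (1::real^'n)) y *\<^sub>R v x) - (LBINT y. indicator (cbox 0 1) y *\<^sub>R v (x - \<delta> *\<^sub>R y))"
  unfolding shift_mean_def by simp
 also have "\<dots> = (LBINT y. indicator (cbox 0 1) y *\<^sub>R (v x - v (x - \<delta> *\<^sub>R y)))"
  unfolding scaleR_diff_right by (rule Bochner_Integration.integral_diff[OF i1 i2, symmetric])
 also have "\<dots> = (LBINT y. (LBINT t. indicator (cbox 0 1) y *\<^sub>R (indicator {0..1} t *\<^sub>R ?D (x - (\<delta> * t) *\<^sub>R y) (\<delta> *\<^sub>R y))))"
  by (simp only: ftc[symmetric] integral_scaleR_right)
 also have "\<dots> = (LBINT y. (LBINT t. indicator shift_box (y, t) *\<^sub>R ?D (x - shift \<delta> (y, t)) (\<delta> *\<^sub>R fst (y, t))))"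
  by (intro Bochner_Integration.integral_cong refl) (auto simp: shift_box_def shift_def indicator_def)
 also have "\<dots> = (\<integral>p. indicator shift_box p *\<^sub>R ?D (x - shift \<delta> p) (\<delta> *\<^sub>R fst p) \<partial>(lborel \<Otimes>\<^sub>M lborel))"
  by (rule lborel_pair.integral_fst') (use ip in \<open>simp add: lborel_prod\<close>)
 finally show ?thesis by (simp add: lborel_prod)
qed

text \<open>The last assumption, Lagrange's formula, expresses the antisymmetric part of the gradient of a row
 through its curl.\<close>

locale curl_product =
 fixes X :: "real^'n \<Rightarrow> real^'n \<Rightarrow> 'c::euclidean_space" and Y :: "'c \<Rightarrow> real^'n \<Rightarrow> real^'n"
 assumes X: "bounded_bilinear X" and Y: "bounded_bilinear Y" and X_self: "X a a = 0"
  and XY: "(b \<bullet> y) *\<^sub>R a - (a \<bullet> y) *\<^sub>R b = Y (X a b) y"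
begin

definition row_curl :: "(real^'n \<Rightarrow> real^'n^'n) \<Rightarrow> 'n \<Rightarrow> real^'n \<Rightarrow> 'c" where
 "row_curl v i z = (\<Sum>a\<in>UNIV. X (axis a 1) (frechet_derivative v (at z) (axis a 1) $ i))"

lemma X_expand: "X g w = (\<Sum>a\<in>UNIV. g $ a *\<^sub>R X (axis a 1) w)"
proof -
 have "X g w = X (\<Sum>a\<in>UNIV. g $ a *\<^sub>R axis a 1) w"
  by (simp add: basis_expansion scalar_mult_eq_scaleR[symmetric])
 then show ?thesis
  by (simp add: bounded_bilinear.sum_left[OF X] bounded_bilinear.scaleR_left[OF X])
qed

text \<open>The weak curl is tested with z \<mapsto> moll s (x - z), whose gradient is the reflected
  one with opposite sign, so the two signs cancel. The kernel must have its support in \<Omega>,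
  hence the condition on the ball.\<close>

lemma mollify_row_curl:
 assumes v: "integrable lborel v" and c: "integrable lborel c" and s: "s > 0" and x: "cball x s \<subseteq> \<Omega>"
  and curl: "\<And>\<phi> i. \<phi> \<in> Cinf_compact \<Omega> \<Longrightarrow> (LBINT z. \<phi> z *\<^sub>R (c z $ i)) = - (LBINT z. X (grad \<phi> z) (v z $ i))"
 shows "mollify s c x $ i = row_curl (mollify s v) i x"
proof -
 let ?d = "\<lambda>a z. frechet_derivative (moll s) (at (x - z)) (axis a 1)"
 have i1: "integrable lborel (\<lambda>z. ?d a z *\<^sub>R v z)" for a
  by (rule integrable_average[OF C1_deriv_continuous[OF cont_diff_moll] compact_cball[of 0 s]
     C1_compact_deriv[OF cont_diff_moll compact_cball[of 0 s] moll_supp[OF s]] _ v]) auto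
 have bl: "bounded_linear (\<lambda>A::real^'n^'n. X (axis a 1) (A $ i))" for a
  by (rule bounded_linear_compose[OF bounded_bilinear.bounded_linear_right[OF X] bounded_linear_vec_nth])
 have i2: "integrable lborel (\<lambda>z. X (axis a 1) ((?d a z *\<^sub>R v z) $ i))" for a
  by (rule integrable_bounded_linear[OF bl i1])
 have "mollify s c x $ i = (LBINT z. moll s (x - z) *\<^sub>R (c z $ i))"
  unfolding mollify_def by (subst integral_vec_nth(1)[OF integrable_moll_mult[OF s c]]) simp
 also have "\<dots> = - (LBINT z. X (grad (\<lambda>z. moll s (x - z)) z) (v z $ i))"
  by (rule curl[OF moll_test[OF s x]])
 also have "\<dots> = (LBINT z. X (grad (moll s) (x - z)) (v z $ i))"
  by (simp add: grad_moll_reflect bounded_bilinear.minus_left[OF X])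
 also have "\<dots> = (LBINT z. (\<Sum>a\<in>UNIV. X (axis a 1) ((?d a z *\<^sub>R v z) $ i)))"
  by (intro Bochner_Integration.integral_cong refl, subst X_expand)
   (simp add: grad_def partial_def bounded_bilinear.scaleR_right[OF X])
 also have "\<dots> = (\<Sum>a\<in>UNIV. LBINT z. X (axis a 1) ((?d a z *\<^sub>R v z) $ i))"
  by (rule Bochner_Integration.integral_sum) (rule i2)
 also have "\<dots> = row_curl (mollify s v) i x"
  unfolding row_curl_def frechet_derivative_mollify[OF s v]
  by (intro sum.cong refl) (rule integral_bounded_linear[OF bl i1])
 finally show ?thesis .
qed

text \<open>A row of v minus its mean is the integral of its derivative in the direction w =
  \<delta> y, called A; the gradient of the potential is the integral of B, whose component a is the
  a-th partial derivative of the row paired with w. Their difference is antisymmetric in the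
  gradient of the row and is thus given by the curl through Lagrange's formula.\<close>

lemma homotopy_row:
 assumes v: "cont_diff 1 v" "compact K" "\<And>x. x \<notin> K \<Longrightarrow> v x = 0"
 shows "(v x - shift_mean \<delta> v x - grad_matrix (potential \<delta> v) x) $ i =
  - (LBINT p. indicator shift_box p *\<^sub>R Y (row_curl v i (x - shift \<delta> p)) (\<delta> *\<^sub>R fst p))"
proof -
 let ?G = "\<lambda>a z. frechet_derivative v (at z) (axis a 1)"
 have lD: "linear (frechet_derivative v (at z))" for z using C1_has_derivative[OF v(1)] has_derivative_linear by blast
 have D: "frechet_derivative v (at z) h = (\<Sum>a\<in>UNIV. h $ a *\<^sub>R ?G a z)" for z h
 proof -
  have "frechet_derivative v (at z) h = frechet_derivative v (at z) (\<Sum>a\<in>UNIV. h $ a *\<^sub>R axis a 1)"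
   by (simp add: basis_expansion scalar_mult_eq_scaleR[symmetric])
  then show ?thesis by (simp add: linear_sum[OF lD] linear_scale[OF lD])
 qed
 have Dp: "frechet_derivative v (at (x - shift \<delta> p)) (\<delta> *\<^sub>R fst p) =
   (\<Sum>a\<in>UNIV. (\<delta> *\<^sub>R fst p) $ a *\<^sub>R ?G a (x - shift \<delta> p))" for p by (rule D)
 have cG: "continuous_on S (\<lambda>p. ?G a (x - shift \<delta> p))" for S a
  unfolding shift_def by (intro continuous_on_compose2[OF C1_deriv_continuous[OF v(1)]] continuous_intros) auto
 define A where "A p = (\<Sum>a\<in>UNIV. (\<delta> *\<^sub>R fst p) $ a *\<^sub>R (?G a (x - shift \<delta> p) $ i))" for p :: "(real^'n) \<times> real"
 define B where "B p = (\<Sum>a\<in>UNIV. ((?G a (x - shift \<delta> p) $ i) \<bullet> (\<delta> *\<^sub>R fst p)) *\<^sub>R axis a (1::real))" for p :: "(real^'n) \<times> real"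
 have AB: "B p - A p = Y (row_curl v i (x - shift \<delta> p)) (\<delta> *\<^sub>R fst p)" for p
 proof -
  let ?w = "\<delta> *\<^sub>R fst p"
  have "B p - A p = (\<Sum>a\<in>UNIV. ((?G a (x - shift \<delta> p) $ i) \<bullet> ?w) *\<^sub>R axis a 1 - (axis a 1 \<bullet> ?w) *\<^sub>R (?G a (x - shift \<delta> p) $ i))"
   by (simp add: A_def B_def sum_subtractf inner_axis')
  also have "\<dots> = (\<Sum>a\<in>UNIV. Y (X (axis a 1) (?G a (x - shift \<delta> p) $ i)) ?w)" by (simp only: XY)
  also have "\<dots> = Y (row_curl v i (x - shift \<delta> p)) ?w"
   unfolding row_curl_def by (rule bounded_bilinear.sum_left[OF Y, symmetric])
  finally show ?thesis .
 qed
 have iA: "integrable lborel (\<lambda>p. indicator shift_box p *\<^sub>R A p)"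
  unfolding A_def by (intro borel_integrable_compact compact_shift_box continuous_intros continuous_on_component cG)
 have iB: "integrable lborel (\<lambda>p. indicator shift_box p *\<^sub>R B p)"
  unfolding B_def by (intro borel_integrable_compact compact_shift_box continuous_intros continuous_on_component cG)
 have iD: "integrable lborel (\<lambda>p. indicator shift_box p *\<^sub>R frechet_derivative v (at (x - shift \<delta> p)) (\<delta> *\<^sub>R fst p))"
  unfolding Dp by (intro borel_integrable_compact compact_shift_box continuous_intros continuous_on_component cG)
 have "(v x - shift_mean \<delta> v x) $ i = (LBINT p. indicator shift_box p *\<^sub>R A p)"
  unfolding shift_mean_FTC[OF v(1)] integral_vec_nth(1)[OF iD]
  by (intro Bochner_Integration.integral_cong refl) (simp add: Dp A_def)
 moreover have "grad_matrix (potential \<delta> v) x $ i = (LBINT p. indicator shift_box p *\<^sub>R B p)"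
 proof -
  let ?w = "\<lambda>p::(real^'n) \<times> real. indicator shift_box p *\<^sub>R (\<delta> *\<^sub>R fst p)"
  have d: "(potential \<delta> v has_derivative (\<lambda>h. LBINT p. frechet_derivative v (at (x - shift \<delta> p)) h *v ?w p)) (at x)"
   unfolding potential_def[abs_def]
   by (rule bilinear_average(2)[OF bounded_bilinear_matrix_vector v _ integrable_shift_weight]) auto
  have e: "?G a (x - shift \<delta> p) *v ?w p = indicator shift_box p *\<^sub>R (?G a (x - shift \<delta> p) *v (\<delta> *\<^sub>R fst p))" for a p
   by (simp add: bounded_bilinear.scaleR_right[OF bounded_bilinear_matrix_vector])
  have iG: "integrable lborel (\<lambda>p. ?G a (x - shift \<delta> p) *v ?w p)" for a
   unfolding e by (intro borel_integrable_compact compact_shift_box bounded_bilinear.continuous_on[OF bounded_bilinear_matrix_vector] cG continuous_intros)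
  have "grad_matrix (potential \<delta> v) x $ i $ k = (LBINT p. indicator shift_box p *\<^sub>R B p) $ k" for k
  proof -
   have "grad_matrix (potential \<delta> v) x $ i $ k = (LBINT p. ?G k (x - shift \<delta> p) *v ?w p) $ i"
    by (simp add: grad_matrix_eq[OF d])
   also have "\<dots> = (LBINT p. (?G k (x - shift \<delta> p) *v ?w p) $ i)" by (rule integral_vec_nth(1)[OF iG])
   also have "\<dots> = (LBINT p. (indicator shift_box p *\<^sub>R B p) $ k)"
    by (intro Bochner_Integration.integral_cong refl)
     (simp add: B_def matrix_vector_mul_component axis_def if_distrib cong: if_cong)
   also have "\<dots> = (LBINT p. indicator shift_box p *\<^sub>R B p) $ k" by (rule integral_vec_nth(1)[OF iB, symmetric])
   finally show ?thesis .
  qed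
  then show ?thesis by (simp add: vec_eq_iff)
 qed
 ultimately have "(v x - shift_mean \<delta> v x - grad_matrix (potential \<delta> v) x) $ i =
   (LBINT p. indicator shift_box p *\<^sub>R A p) - (LBINT p. indicator shift_box p *\<^sub>R B p)"
  by simp
 also have "\<dots> = - (LBINT p. indicator shift_box p *\<^sub>R B p - indicator shift_box p *\<^sub>R A p)"
  by (simp add: Bochner_Integration.integral_diff[OF iB iA])
 also have "\<dots> = - (LBINT p. indicator shift_box p *\<^sub>R Y (row_curl v i (x - shift \<delta> p)) (\<delta> *\<^sub>R fst p))"
  by (simp add: AB[symmetric] scaleR_diff_right)
 finally show ?thesis .
qed

end

lemma norm_integral_le_nn:
 fixes f :: "'a \<Rightarrow> 'b::euclidean_space"
 shows "ennreal (norm (\<integral>x. f x \<partial>M)) \<le> (\<integral>\<^sup>+x. ennreal (norm (f x)) \<partial>M)"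
 by (cases "integrable M f") (auto simp: integral_norm_bound_ennreal not_integrable_integral_eq)

lemma integrable_bounded_mult:
 fixes F :: "'a::euclidean_space \<Rightarrow> 'b::euclidean_space"
 assumes F: "integrable lborel F" and [measurable]: "\<psi> \<in> borel_measurable borel" and C: "\<And>x. \<bar>\<psi> x\<bar> \<le> (C::real)"
 shows "integrable lborel (\<lambda>x. \<psi> x *\<^sub>R F x)"
proof (rule Bochner_Integration.integrable_bound[of _ "\<lambda>x. C *\<^sub>R F x"])
 have [measurable]: "F \<in> borel_measurable borel" using F by simp
 have "C \<ge> 0" using C[of 0] by linarith
 show "integrable lborel (\<lambda>x. C *\<^sub>R F x)" using F by simp
 show "AE x in lborel. norm (\<psi> x *\<^sub>R F x) \<le> norm (C *\<^sub>R F x)"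
  using C \<open>C \<ge> 0\<close> by (auto intro!: mult_right_mono)
 show "(\<lambda>x. \<psi> x *\<^sub>R F x) \<in> borel_measurable lborel" by simp
qed

text \<open>The substitution z = x - \<delta> y turns \<open>shift_mean\<close> into integration
  against this bounded function, the form to which weak convergence applies at each x.\<close>

definition shift_kernel :: "real \<Rightarrow> real^'n \<Rightarrow> real^'n \<Rightarrow> real" where
 "shift_kernel \<delta> x z = (1 / \<delta> ^ CARD('n)) * indicator (cbox 0 1) ((1 / \<delta>) *\<^sub>R (x - z))"

lemma shift_kernel_measurable [measurable]: "shift_kernel \<delta> x \<in> borel_measurable borel"
 unfolding shift_kernel_def[abs_def] by measurable

lemma shift_kernel_bounds:
 "\<delta> > 0 \<Longrightarrow> 0 \<le> shift_kernel \<delta> (x::real^'n) z" "\<delta> > 0 \<Longrightarrow> shift_kernel \<delta> x z \<le> 1 / \<delta> ^ CARD('n)"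
 by (auto simp: shift_kernel_def indicator_def)

lemma shift_mean_eq:
 fixes F :: "real^'n \<Rightarrow> 'b::euclidean_space"
 assumes \<delta>: "\<delta> > 0" and [measurable]: "F \<in> borel_measurable borel"
 shows "shift_mean \<delta> F x = (LBINT z. shift_kernel \<delta> x z *\<^sub>R F z)"
proof -
 have "(LBINT z. shift_kernel \<delta> x z *\<^sub>R F z) =
   (\<integral>z. shift_kernel \<delta> x z *\<^sub>R F z \<partial>density (distr lborel borel (\<lambda>y. x + (- \<delta>) *\<^sub>R y)) (\<lambda>_. ennreal (\<delta> ^ CARD('n))))"
  using lborel_affine[of "- \<delta>" x] \<delta> by simp
 also have "\<dots> = (LBINT y. \<delta> ^ CARD('n) *\<^sub>R (shift_kernel \<delta> x (x - \<delta> *\<^sub>R y) *\<^sub>R F (x - \<delta> *\<^sub>R y)))"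
  using \<delta> by (subst integral_density) (auto simp: integral_distr)
 also have "\<dots> = shift_mean \<delta> F x"
  unfolding shift_mean_def using \<delta>
  by (intro Bochner_Integration.integral_cong refl) (simp add: shift_kernel_def)
 finally show ?thesis by simp
qed

lemma shift_mean_measurable [measurable]:
 fixes F :: "real^'n \<Rightarrow> 'b::euclidean_space"
 assumes [measurable]: "F \<in> borel_measurable borel"
 shows "shift_mean \<delta> F \<in> borel_measurable borel"
 unfolding shift_mean_def[abs_def] by measurable

text \<open>For fixed \<delta> weak convergence gives pointwise convergence of the means, and the
  L^2 bound gives a uniform bound D on K, so dominated convergence applies. Here weak convergence is
  turned into strong convergence.\<close>

lemma shift_mean_tendsto_0:
 fixes v :: "nat \<Rightarrow> real^'n \<Rightarrow> 'b::euclidean_space"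
 assumes \<delta>: "\<delta> > 0" and v: "\<And>n. L2c (v n)" and A: "\<And>n. sqn UNIV (v n) \<le> ennreal A" "A \<ge> 0"
  and weak: "\<And>\<psi> C. \<psi> \<in> borel_measurable borel \<Longrightarrow> (\<And>x. \<bar>\<psi> x\<bar> \<le> (C::real)) \<Longrightarrow> (\<lambda>n. LBINT x. \<psi> x *\<^sub>R v n x) \<longlonglongrightarrow> 0"
  and K: "K \<in> sets borel" "bounded K"
 shows "(\<lambda>n. sqn K (shift_mean \<delta> (v n))) \<longlonglongrightarrow> 0"
proof -
 note [measurable] = L2c_measurable[OF v] K(1)
 define d where "d = 1 / \<delta> ^ CARD('n)"
 have "d > 0" using \<delta> by (simp add: d_def)
 obtain R where R: "R > 0" "\<And>x. x \<in> K \<Longrightarrow> norm x \<le> R" using K(2) by (auto simp: bounded_pos)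
 define r where "r = R + \<delta> * CARD('n)"
 define V where "V = measure lborel (cball (0::real^'n) r)"
 have V: "emeasure lborel (cball (0::real^'n) r) = ennreal V"
  using emeasure_lborel_cball_finite[of "0::real^'n" r] by (simp add: V_def emeasure_eq_ennreal_measure)
 define D where "D = d * (V + A)"
 have "D \<ge> 0" using \<open>d > 0\<close> A(2) by (simp add: D_def V_def)
 have bound: "norm (shift_mean \<delta> (v n) x) \<le> D" if x: "x \<in> K" for n x
 proof -
  have "ennreal (norm (shift_mean \<delta> (v n) x)) \<le> (NNINT z. ennreal (norm (shift_kernel \<delta> x z *\<^sub>R v n z)))"
   unfolding shift_mean_eq[OF \<delta> L2c_measurable[OF v]] by (rule norm_integral_le_nn)
  also have "\<dots> \<le> (NNINT z. ennreal d * (indicator (cball 0 r) z + ennreal ((norm (v n z))\<^sup>2)))"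
  proof (rule nn_integral_mono)
   fix z
   show "ennreal (norm (shift_kernel \<delta> x z *\<^sub>R v n z)) \<le> ennreal d * (indicator (cball 0 r) z + ennreal ((norm (v n z))\<^sup>2))"
   proof (cases "z \<in> cball 0 r")
    case True
    have "norm (v n z) \<le> 1 + (norm (v n z))\<^sup>2"
     using sum_squares_ge_zero[of "norm (v n z) - 1/2" 0] by (simp add: power2_eq_square algebra_simps)
    then have "norm (shift_kernel \<delta> x z *\<^sub>R v n z) \<le> d * (1 + (norm (v n z))\<^sup>2)"
    proof -
     have "norm (shift_kernel \<delta> x z *\<^sub>R v n z) = shift_kernel \<delta> x z * norm (v n z)"
      using shift_kernel_bounds(1)[OF \<delta>, of x z] by simp
     also have "\<dots> \<le> d * (1 + (norm (v n z))\<^sup>2)"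
      using shift_kernel_bounds[OF \<delta>, of x z] \<open>norm (v n z) \<le> _\<close> \<open>d > 0\<close>
      unfolding d_def[symmetric] by (intro mult_mono) auto
     finally show ?thesis .
    qed
    then have "ennreal (norm (shift_kernel \<delta> x z *\<^sub>R v n z)) \<le> ennreal (d * (1 + (norm (v n z))\<^sup>2))" by (rule ennreal_leI)
    also have "\<dots> = ennreal d * (1 + ennreal ((norm (v n z))\<^sup>2))" using \<open>d > 0\<close> by (simp add: ennreal_mult)
    finally show ?thesis using True by simp
   next
    case False
    have "(1 / \<delta>) *\<^sub>R (x - z) \<notin> cbox 0 1"
    proof
     assume "(1 / \<delta>) *\<^sub>R (x - z) \<in> cbox 0 1"
     then have "norm ((1 / \<delta>) *\<^sub>R (x - z)) \<le> CARD('n)" by (rule norm_unit_cbox)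
     then have "norm (x - z) / \<delta> \<le> CARD('n)" using \<delta> unfolding norm_scaleR by simp
     then have "norm (x - z) \<le> \<delta> * CARD('n)" using \<delta> by (simp add: field_simps)
     then have "norm z \<le> r" using R(2)[OF x] norm_triangle_sub[of z x] by (simp add: r_def norm_minus_commute)
     with False show False by simp
    qed
    then show ?thesis by (simp add: shift_kernel_def)
   qed
  qed
  also have "\<dots> = ennreal d * (emeasure lborel (cball (0::real^'n) r) + sqn UNIV (v n))"
  proof -
   have [measurable]: "cball (0::real^'n) r \<in> sets borel" by simp
   have "(NNINT z. ennreal d * (indicator (cball 0 r) z + ennreal ((norm (v n z))\<^sup>2))) =
     ennreal d * (NNINT z. indicator (cball 0 r) z + ennreal ((norm (v n z))\<^sup>2))"
    by (rule nn_integral_cmult) measurable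
   also have "(NNINT z. indicator (cball 0 r) z + ennreal ((norm (v n z))\<^sup>2)) =
     (NNINT z. indicator (cball (0::real^'n) r) z) + (NNINT z. ennreal ((norm (v n z))\<^sup>2))"
    by (rule nn_integral_add) measurable
   finally show ?thesis by (simp add: sqn_def)
  qed
  also have "\<dots> \<le> ennreal d * (ennreal V + ennreal A)" by (intro mult_left_mono add_mono A(1)) (simp_all add: V)
  also have "\<dots> = ennreal D" using \<open>d > 0\<close> A(2) by (simp add: D_def V_def ennreal_mult ennreal_plus[symmetric] del: ennreal_plus)
  finally show ?thesis using \<open>D \<ge> 0\<close> by simp
 qed
 have "(\<lambda>n. sqn K (shift_mean \<delta> (v n))) \<longlonglongrightarrow> (NNINT x:K. 0)"
  unfolding sqn_def
 proof (rule nn_integral_dominated_convergence[where w="\<lambda>x. ennreal (D\<^sup>2) * indicator K x"])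
  show "AE x in lborel. ennreal ((norm (shift_mean \<delta> (v j) x))\<^sup>2) * indicator K x \<le> ennreal (D\<^sup>2) * indicator K x" for j
   using bound by (intro AE_I2) (auto simp: indicator_def intro!: ennreal_leI power_mono)
  show "(NNINT x. ennreal (D\<^sup>2) * indicator K x) < \<infinity>"
   using emeasure_bounded_lt_top[OF K(2)] by (simp add: nn_integral_cmult_indicator ennreal_mult_less_top)
  show "AE x in lborel. (\<lambda>i. ennreal ((norm (shift_mean \<delta> (v i) x))\<^sup>2) * indicator K x) \<longlonglongrightarrow> 0 * indicator K x"
  proof (rule AE_I2)
   fix x
   have "(\<lambda>i. shift_mean \<delta> (v i) x) \<longlonglongrightarrow> 0"
    unfolding shift_mean_eq[OF \<delta> L2c_measurable[OF v]]
    by (rule weak[of _ d]) (use shift_kernel_bounds[OF \<delta>, of x] in \<open>auto simp: d_def\<close>)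
   then have "(\<lambda>i. (norm (shift_mean \<delta> (v i) x))\<^sup>2) \<longlonglongrightarrow> (norm (0::'b))\<^sup>2" by (intro tendsto_intros)
   then have "(\<lambda>i. ennreal ((norm (shift_mean \<delta> (v i) x))\<^sup>2)) \<longlonglongrightarrow> ennreal 0" by (intro tendsto_ennrealI) simp
   then show "(\<lambda>i. ennreal ((norm (shift_mean \<delta> (v i) x))\<^sup>2) * indicator K x) \<longlonglongrightarrow> 0 * indicator K x"
    by (cases "x \<in> K") auto
  qed
 qed measurable
 then show ?thesis by simp
qed

lemma sqn_shift_mean_le:
 fixes F :: "real^'n \<Rightarrow> 'b::euclidean_space"
 assumes [measurable]: "F \<in> borel_measurable borel" and K: "K \<in> sets borel" "T \<in> sets borel"
  and T: "\<And>x y. x \<in> K \<Longrightarrow> y \<in> cbox 0 1 \<Longrightarrow> x - \<delta> *\<^sub>R y \<in> T"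
 shows "sqn K (shift_mean \<delta> F) \<le> sqn T F"
proof -
 have "sqn K (shift_mean \<delta> F) \<le> ennreal (1\<^sup>2) * sqn T F"
 proof (rule sqn_average_le[where S="cbox 0 1" and a="\<lambda>y. \<delta> *\<^sub>R y"])
  fix x
  have "ennreal (norm (shift_mean \<delta> F x)) \<le> (NNINT y. ennreal (norm (indicator (cbox 0 1) y *\<^sub>R F (x - \<delta> *\<^sub>R y))))"
   unfolding shift_mean_def by (rule norm_integral_le_nn)
  also have "\<dots> = ennreal 1 * (NNINT y:cbox 0 1. ennreal (norm (F (x - \<delta> *\<^sub>R y))))"
   by (simp, intro nn_integral_cong) (auto simp: indicator_def)
  finally show "ennreal (norm (shift_mean \<delta> F x)) \<le> ennreal 1 * (NNINT y:cbox 0 1. ennreal (norm (F (x - \<delta> *\<^sub>R y))))" .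
 qed (use K T in \<open>auto simp: emeasure_unit_cbox\<close>)
 then show ?thesis by simp
qed

lemma C1_compact_integrable:
 fixes v :: "'a::euclidean_space \<Rightarrow> 'b::euclidean_space"
 shows "cont_diff 1 v \<Longrightarrow> compact K \<Longrightarrow> (\<And>x. x \<notin> K \<Longrightarrow> v x = 0) \<Longrightarrow> integrable lborel v"
 by (rule integrable_compact_support[OF cont_diff_continuous])

context curl_product
begin

text \<open>The factor \<delta> comes from the direction \<delta> y in Lagrange's formula. The
  dominating c has to control the curl at the shifted points only, because the mollified weak curl
  is the curl of the mollified field only away from the boundary.\<close>

lemma homotopy_bound:
 obtains k where "k > 0"
  "\<And>v K \<delta> x c. cont_diff 1 v \<Longrightarrow> compact K \<Longrightarrow> (\<And>x. x \<notin> K \<Longrightarrow> v x = 0) \<Longrightarrow> \<delta> \<ge> 0 \<Longrightarrow> c \<in> borel_measurable borel \<Longrightarrow>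
   (\<And>p i. p \<in> shift_box \<Longrightarrow> norm (row_curl v i (x - shift \<delta> p)) \<le> norm (c (x - shift \<delta> p) :: 'c^'n)) \<Longrightarrow>
   ennreal (norm (v x - shift_mean \<delta> v x - grad_matrix (potential \<delta> v) x)) \<le>
    ennreal (k * \<delta>) * (NNINT p:shift_box. ennreal (norm (c (x - shift \<delta> p))))"
proof -
 obtain k0 where k0: "k0 > 0" "\<And>a b. norm (Y a b) \<le> norm a * norm b * k0"
  using bounded_bilinear.pos_bounded[OF Y] by blast
 define n where "n = real CARD('n)"
 have "n > 0" by (simp add: n_def)
 define k where "k = n * (n * k0)"
 have "k > 0" using k0 \<open>n > 0\<close> by (simp add: k_def)
 show ?thesis
 proof (rule that[OF \<open>k > 0\<close>])
  fix v :: "real^'n \<Rightarrow> real^'n^'n" and K \<delta> x and c :: "real^'n \<Rightarrow> 'c^'n"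
  assume v: "cont_diff 1 v" "compact K" "\<And>x. x \<notin> K \<Longrightarrow> v x = 0" and \<delta>: "\<delta> \<ge> 0" and [measurable]: "c \<in> borel_measurable borel"
   and le: "\<And>p i. p \<in> shift_box \<Longrightarrow> norm (row_curl v i (x - shift \<delta> p)) \<le> norm (c (x - shift \<delta> p))"
  let ?I = "NNINT p:shift_box. ennreal (norm (c (x - shift \<delta> p)))"
  let ?E = "v x - shift_mean \<delta> v x - grad_matrix (potential \<delta> v) x"
  have row: "ennreal (norm (?E $ i)) \<le> ennreal (n * k0 * \<delta>) * ?I" for i
  proof -
   have "ennreal (norm (?E $ i)) \<le> (NNINT p. ennreal (norm (indicator shift_box p *\<^sub>R Y (row_curl v i (x - shift \<delta> p)) (\<delta> *\<^sub>R fst p))))"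
   proof -
    have e: "?E $ i = - (LBINT p. indicator shift_box p *\<^sub>R Y (row_curl v i (x - shift \<delta> p)) (\<delta> *\<^sub>R fst p))"
     by (rule homotopy_row[OF v])
    show ?thesis unfolding e norm_minus_cancel by (rule norm_integral_le_nn)
   qed
   also have "\<dots> \<le> (NNINT p. ennreal (n * k0 * \<delta>) * (ennreal (norm (c (x - shift \<delta> p))) * indicator shift_box p))"
   proof (rule nn_integral_mono)
    fix p :: "(real^'n) \<times> real"
    show "ennreal (norm (indicator shift_box p *\<^sub>R Y (row_curl v i (x - shift \<delta> p)) (\<delta> *\<^sub>R fst p))) \<le>
      ennreal (n * k0 * \<delta>) * (ennreal (norm (c (x - shift \<delta> p))) * indicator shift_box p)"
    proof (cases "p \<in> shift_box")
     case True
     then have fp: "norm (fst p) \<le> n" unfolding n_def by (intro norm_unit_cbox) (auto simp: shift_box_def)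
     have "norm (Y (row_curl v i (x - shift \<delta> p)) (\<delta> *\<^sub>R fst p)) \<le> norm (row_curl v i (x - shift \<delta> p)) * norm (\<delta> *\<^sub>R fst p) * k0"
      by (rule k0(2))
     also have "\<dots> \<le> norm (c (x - shift \<delta> p)) * (\<delta> * n) * k0"
      using le[OF True, of i] fp \<delta> k0(1) by (intro mult_right_mono mult_mono) (auto intro: mult_left_mono)
     also have "\<dots> = (n * k0 * \<delta>) * norm (c (x - shift \<delta> p))" by simp
     finally have "ennreal (norm (Y (row_curl v i (x - shift \<delta> p)) (\<delta> *\<^sub>R fst p))) \<le> ennreal ((n * k0 * \<delta>) * norm (c (x - shift \<delta> p)))"
      by (rule ennreal_leI)
     also have "\<dots> = ennreal (n * k0 * \<delta>) * ennreal (norm (c (x - shift \<delta> p)))"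
      using k0(1) \<delta> \<open>n > 0\<close> by (intro ennreal_mult) auto
     finally show ?thesis using True by simp
    qed simp
   qed
   also have "\<dots> = ennreal (n * k0 * \<delta>) * ?I" by (rule nn_integral_cmult) measurable
   finally show ?thesis .
  qed
  have "ennreal (norm ?E) \<le> ennreal (\<Sum>i\<in>UNIV. norm (?E $ i))" by (intro ennreal_leI norm_vec_le)
  also have "\<dots> = (\<Sum>i\<in>UNIV. ennreal (norm (?E $ i)))" by (intro sum_ennreal[symmetric]) auto
  also have "\<dots> \<le> (\<Sum>i\<in>(UNIV::'n set). ennreal (n * k0 * \<delta>) * ?I)" by (intro sum_mono row)
  also have "\<dots> = ennreal n * (ennreal (n * k0 * \<delta>) * ?I)" by (simp add: n_def ennreal_of_nat_eq_real_of_nat)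
  also have "\<dots> = ennreal (k * \<delta>) * ?I"
   using k0(1) \<delta> \<open>n > 0\<close> by (simp add: k_def mult.assoc[symmetric] ennreal_mult[symmetric])
  finally show "ennreal (norm ?E) \<le> ennreal (k * \<delta>) * ?I" .
 qed
qed

text \<open>With u the potential of the mollified field, v_n - \<nabla>u consists of the
  mollification error, the homotopy error of size k \<delta> times the curl, the local mean of the
  mollification error, and the local mean of v_n. The last tends to 0 for fixed \<delta>, and u
  itself is of size \<delta> times v_n.\<close>

theorem gradient_decomposition:
 fixes v :: "nat \<Rightarrow> real^'n \<Rightarrow> real^'n^'n" and c :: "nat \<Rightarrow> real^'n \<Rightarrow> 'c^'n"
 assumes \<Omega>: "open \<Omega>" "bounded \<Omega>" and v: "\<And>n. L2c (v n)" and c: "\<And>n. L2c (c n)"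
  and A: "\<And>n. sqn UNIV (v n) \<le> ennreal A" "\<And>n. sqn UNIV (c n) \<le> ennreal A" "A \<ge> 0"
  and curl: "\<And>n \<phi> i. \<phi> \<in> Cinf_compact \<Omega> \<Longrightarrow> (LBINT z. \<phi> z *\<^sub>R (c n z $ i)) = - (LBINT z. X (grad \<phi> z) (v n z $ i))"
  and weak: "\<And>\<psi> C. \<psi> \<in> borel_measurable borel \<Longrightarrow> (\<And>x. \<bar>\<psi> x\<bar> \<le> (C::real)) \<Longrightarrow> (\<lambda>n. LBINT x. \<psi> x *\<^sub>R v n x) \<longlonglongrightarrow> 0"
  and K: "compact K" "K \<subseteq> \<Omega>" and \<tau>: "\<tau> > 0"
 shows "\<exists>N. \<forall>n\<ge>N. \<exists>u. cont_diff 1 u \<and> sqn K u \<le> ennreal \<tau> \<and> sqn K (\<lambda>x. v n x - grad_matrix u x) \<le> ennreal \<tau>"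
proof -
 note [measurable] = L2c_measurable[OF v] L2c_measurable[OF c]
 have \<Omega>b[measurable]: "\<Omega> \<in> sets borel" using \<Omega> by simp
 have Kb[measurable]: "K \<in> sets borel" using K(1) by (simp add: compact_imp_closed)
 obtain s0 where s0: "s0 > 0" "\<And>x s. x \<in> K \<Longrightarrow> s \<le> s0 \<Longrightarrow> cball x s \<subseteq> \<Omega>"
  using compact_cball_subset[OF K(1) \<Omega>(1) K(2)] by blast
 obtain k where k: "k > 0"
  "\<And>v K \<delta> x c. cont_diff 1 v \<Longrightarrow> compact K \<Longrightarrow> (\<And>x. x \<notin> K \<Longrightarrow> v x = 0) \<Longrightarrow> \<delta> \<ge> 0 \<Longrightarrow> c \<in> borel_measurable borel \<Longrightarrow>
   (\<And>p i. p \<in> shift_box \<Longrightarrow> norm (row_curl v i (x - shift \<delta> p)) \<le> norm (c (x - shift \<delta> p) :: 'c^'n)) \<Longrightarrow>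
   ennreal (norm (v x - shift_mean \<delta> v x - grad_matrix (potential \<delta> v) x)) \<le>
    ennreal (k * \<delta>) * (NNINT p:shift_box. ennreal (norm (c (x - shift \<delta> p))))"
  using homotopy_bound by blast
 define m where "m = real CARD('n)"
 have "m > 0" by (simp add: m_def)
 define q where "q = m + k"
 have q: "q > 0" "m \<le> q" "k \<le> q" using \<open>m > 0\<close> k(1) by (auto simp: q_def)
 \<comment> \<open>The first entry keeps shifts below s0/2, the other half of s0 being reserved for
   mollification. The second gives (\<delta> q)^2 A \<le> \<tau>/8, where q bounds both constants m
   and k; A + 1 covers A = 0.\<close>
 define \<delta> where "\<delta> = min (s0 / (2 * m)) (sqrt (\<tau> / (8 * (A + 1))) / q)"
 have \<delta>: "\<delta> > 0" using s0(1) \<open>m > 0\<close> \<tau> A(3) q(1) by (simp add: \<delta>_def)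
 have \<delta>m: "\<delta> * m \<le> s0 / 2"
 proof -
  have "\<delta> * m \<le> s0 / (2 * m) * m" using \<open>m > 0\<close> by (intro mult_right_mono) (auto simp: \<delta>_def)
  then show ?thesis using \<open>m > 0\<close> by simp
 qed
 have small: "(\<delta> * r)\<^sup>2 * A \<le> \<tau> / 8" if r: "0 \<le> r" "r \<le> q" for r
 proof -
  have "\<delta> * r \<le> sqrt (\<tau> / (8 * (A + 1))) / q * q" using r \<delta> q(1) by (intro mult_mono) (auto simp: \<delta>_def)
  then have "\<delta> * r \<le> sqrt (\<tau> / (8 * (A + 1)))" using q(1) by simp
  then have "(\<delta> * r)\<^sup>2 \<le> (sqrt (\<tau> / (8 * (A + 1))))\<^sup>2" using r \<delta> by (intro power_mono) auto
  also have "\<dots> = \<tau> / (8 * (A + 1))" using \<tau> A(3) by simp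
  finally have "(\<delta> * r)\<^sup>2 * A \<le> \<tau> / (8 * (A + 1)) * A" using A(3) by (intro mult_right_mono)
  also have "\<dots> = \<tau> / 8 * (A / (A + 1))" by simp
  also have "\<dots> \<le> \<tau> / 8 * 1" using \<tau> A(3) by (intro mult_left_mono) auto
  finally show ?thesis by simp
 qed
 have "(\<lambda>n. sqn K (shift_mean \<delta> (v n))) \<longlonglongrightarrow> 0"
  by (rule shift_mean_tendsto_0[OF \<delta> v A(1,3) weak Kb compact_imp_bounded[OF K(1)]])
 from ennreal_tendsto_0_le[OF this, of "\<tau>/64"] \<tau>
 obtain N where N: "\<And>n. n \<ge> N \<Longrightarrow> sqn K (shift_mean \<delta> (v n)) \<le> ennreal (\<tau>/64)" by auto
 have "\<exists>u. cont_diff 1 u \<and> sqn K u \<le> ennreal \<tau> \<and> sqn K (\<lambda>x. v n x - grad_matrix u x) \<le> ennreal \<tau>" if n: "n \<ge> N" for n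
 proof -
  have \<tau>64: "\<tau> / 64 > 0" using \<tau> by simp
  \<comment> \<open>The mollification scale may depend on n: neither \<delta> nor N refers to it, so
    no common modulus for the sequence is needed.\<close>
  obtain s1 where s1: "s1 > 0" "\<And>s. 0 < s \<Longrightarrow> s \<le> s1 \<Longrightarrow> sqn \<Omega> (\<lambda>x. mollify s (v n) x - v n x) \<le> ennreal (\<tau>/64)"
   using mollify_tendsto[OF v \<Omega>b \<Omega>(2) \<tau>64] by blast
  define s where "s = min s1 (s0 / 2)"
  have s: "s > 0" "s \<le> s1" "s \<le> s0 / 2" using s1 s0 by (auto simp: s_def)
  define v' where "v' = mollify s (v n)"
  define c' where "c' = mollify s (c n)"
  obtain R where R: "\<And>z. norm z > R \<Longrightarrow> v n z = 0" using v[of n] by (auto simp: L2c_def)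
  have v'1: "cont_diff 1 v'" unfolding v'_def by (rule cont_diff_mollify[OF s(1) L2c_integrable[OF v]])
  have v'2: "v' x = 0" if "x \<notin> cball 0 (R + s)" for x unfolding v'_def by (rule mollify_eq_0[OF s(1) R that])
  note v' = v'1 compact_cball[of 0 "R + s"] v'2
  have [measurable]: "v' \<in> borel_measurable borel" "c' \<in> borel_measurable borel"
   unfolding v'_def c'_def by (rule mollify_measurable[OF s(1) L2c_integrable[OF v]], rule mollify_measurable[OF s(1) L2c_integrable[OF c]])
  define u where "u = potential \<delta> v'"
  have u: "cont_diff 1 u" unfolding u_def by (rule potential_C1[OF v'])
  have [measurable]: "grad_matrix u \<in> borel_measurable borel" by (rule grad_matrix_measurable[OF u])
  have sv': "sqn UNIV v' \<le> ennreal A"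
   unfolding v'_def using sqn_mollify_le[OF s(1) L2c_integrable[OF v], of UNIV UNIV n] A(1)[of n] by (auto intro: order_trans)
  have sc': "sqn UNIV c' \<le> ennreal A"
   unfolding c'_def using sqn_mollify_le[OF s(1) L2c_integrable[OF c], of UNIV UNIV n] A(2)[of n] by (auto intro: order_trans)
  have 1: "sqn K u \<le> ennreal \<tau>"
  proof -
   have "sqn K u \<le> ennreal ((\<delta> * m)\<^sup>2) * sqn UNIV v'"
    by (rule sqn_average_le[where S=shift_box and a="shift \<delta>"])
     (use \<delta> \<open>m > 0\<close> norm_potential_le[OF cont_diff_continuous[OF v'(1)], of \<delta>] in \<open>auto simp: emeasure_shift_box u_def m_def\<close>)
   also have "\<dots> \<le> ennreal ((\<delta> * m)\<^sup>2) * ennreal A" by (intro mult_left_mono sv') simp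
   also have "\<dots> = ennreal ((\<delta> * m)\<^sup>2 * A)" using A(3) by (simp add: ennreal_mult)
   also have "\<dots> \<le> ennreal \<tau>" using small[of m] \<open>m > 0\<close> q \<tau> by (intro ennreal_leI) simp
   finally show ?thesis .
  qed
  define E where "E x = v' x - shift_mean \<delta> v' x - grad_matrix u x" for x
  have [measurable]: "E \<in> borel_measurable borel" unfolding E_def[abs_def] by measurable
  have 2: "sqn K E \<le> ennreal (\<tau>/8)"
  proof -
   have "sqn K E \<le> ennreal ((k * \<delta>)\<^sup>2) * sqn UNIV c'"
   proof (rule sqn_average_le[where S=shift_box and a="shift \<delta>"])
    fix x assume x: "x \<in> K"
    show "ennreal (norm (E x)) \<le> ennreal (k * \<delta>) * (NNINT p:shift_box. ennreal (norm (c' (x - shift \<delta> p))))"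
     unfolding E_def u_def
    proof (rule k(2)[OF v'])
     fix p :: "(real^'n) \<times> real" and i assume p: "p \<in> shift_box"
     have "cball (x - shift \<delta> p) s \<subseteq> cball x s0"
     proof
      fix y assume "y \<in> cball (x - shift \<delta> p) s"
      then have "norm (x - shift \<delta> p - y) \<le> s0 / 2" using s(3) by (simp add: dist_norm)
      moreover have "norm (shift \<delta> p) \<le> s0 / 2" using norm_shift[OF p, of \<delta>] \<delta> \<delta>m by (simp add: m_def)
      ultimately have "norm (x - y) \<le> s0" using norm_triangle_ineq[of "x - shift \<delta> p - y" "shift \<delta> p"] by simp
      then show "y \<in> cball x s0" by (simp add: dist_norm)
     qed
     then have "cball (x - shift \<delta> p) s \<subseteq> \<Omega>" using s0(2)[OF x order_refl] by blast
     then have "c' (x - shift \<delta> p) $ i = row_curl v' i (x - shift \<delta> p)"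
      unfolding c'_def v'_def by (intro mollify_row_curl[OF L2c_integrable[OF v] L2c_integrable[OF c] s(1) _ curl])
     then show "norm (row_curl v' i (x - shift \<delta> p)) \<le> norm (c' (x - shift \<delta> p))"
      using Finite_Cartesian_Product.norm_nth_le[where x = "c' (x - shift \<delta> p)" and i = i] by simp
    qed (use \<delta> in auto)
   qed (use \<delta> k(1) in \<open>auto simp: emeasure_shift_box\<close>)
   also have "\<dots> \<le> ennreal ((k * \<delta>)\<^sup>2) * ennreal A" by (intro mult_left_mono sc') simp
   also have "\<dots> = ennreal ((\<delta> * k)\<^sup>2 * A)" using A(3) by (simp add: ennreal_mult mult.commute)
   also have "\<dots> \<le> ennreal (\<tau>/8)" using small[of k] k(1) q by (intro ennreal_leI) simp
   finally show ?thesis .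
  qed
  have 3: "sqn \<Omega> (\<lambda>x. v' x - v n x) \<le> ennreal (\<tau>/64)" unfolding v'_def by (rule s1(2)[OF s(1,2)])
  have 4: "sqn K (shift_mean \<delta> (\<lambda>x. v' x - v n x)) \<le> ennreal (\<tau>/64)"
  proof (rule order_trans[OF sqn_shift_mean_le 3])
   fix x y assume x: "x \<in> K" and y: "y \<in> cbox 0 (1::real^'n)"
   have "norm (\<delta> *\<^sub>R y) \<le> \<delta> * m" using norm_unit_cbox[OF y] \<delta> by (simp add: m_def)
   then have "x - \<delta> *\<^sub>R y \<in> cball x s0" using \<delta>m s0(1) by (simp add: dist_norm)
   then show "x - \<delta> *\<^sub>R y \<in> \<Omega>" using s0(2)[OF x order_refl] by blast
  qed auto
  have sm: "shift_mean \<delta> v' x = shift_mean \<delta> (\<lambda>x. v' x - v n x) x + shift_mean \<delta> (v n) x" for x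
  proof -
   have ker: "\<bar>shift_kernel \<delta> x z\<bar> \<le> 1 / \<delta> ^ CARD('n)" for z using shift_kernel_bounds[OF \<delta>, of x z] by simp
   note i1 = integrable_bounded_mult[OF C1_compact_integrable[OF v'] shift_kernel_measurable ker]
   note i2 = integrable_bounded_mult[OF L2c_integrable[OF v] shift_kernel_measurable ker]
   show ?thesis
    using Bochner_Integration.integral_diff[OF i1 i2] by (simp add: shift_mean_eq[OF \<delta>] scaleR_diff_right)
  qed
  have "sqn K (\<lambda>x. v n x - grad_matrix u x) =
    sqn K (\<lambda>x. - (v' x - v n x) + (E x + (shift_mean \<delta> (\<lambda>x. v' x - v n x) x + shift_mean \<delta> (v n) x)))"
   by (simp add: E_def sm)
  also have "\<dots> \<le> 2 * sqn K (\<lambda>x. - (v' x - v n x)) +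
    2 * (2 * sqn K E + 2 * (2 * sqn K (shift_mean \<delta> (\<lambda>x. v' x - v n x)) + 2 * sqn K (shift_mean \<delta> (v n))))"
   \<comment> \<open>Three nested uses of the squared triangle inequality. In units of \<tau>/64 the
     terms contribute 2 + 32 + 8 + 8 = 50.\<close>
   by (intro order_trans[OF sqn_add_le] add_mono mult_left_mono order_refl) auto
  also have "sqn K (\<lambda>x. - (v' x - v n x)) = sqn K (\<lambda>x. v' x - v n x)" by (rule sqn_uminus)
  also have "2 * sqn K (\<lambda>x. v' x - v n x) +
    2 * (2 * sqn K E + 2 * (2 * sqn K (shift_mean \<delta> (\<lambda>x. v' x - v n x)) + 2 * sqn K (shift_mean \<delta> (v n)))) \<le>
    2 * ennreal (\<tau>/64) + 2 * (2 * ennreal (\<tau>/8) + 2 * (2 * ennreal (\<tau>/64) + 2 * ennreal (\<tau>/64)))"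
   by (intro add_mono mult_left_mono order_trans[OF sqn_mono[OF K(2)] 3] 2 4 N[OF n]) auto
  also have "\<dots> = ennreal (50 * (\<tau>/64))"
   using \<tau> by (simp add: ennreal_mult[symmetric] ennreal_plus[symmetric] flip: ennreal_numeral del: ennreal_plus)
  also have "\<dots> \<le> ennreal \<tau>" using \<tau> by (intro ennreal_leI) simp
  finally show ?thesis using u 1 by blast
 qed
 then show ?thesis by blast
qed

end

context integrand
begin

text \<open>On small cubes \<open>B\<close> is nearly a constant \<open>g c\<close>; there \<open>Bn\<close> is \<open>g c + \<nabla>u\<close> up to an error that is
 small in \<open>L\<^sup>2\<close>.\<close>

lemma lower_semicontinuity:
 fixes B :: "real^'n \<Rightarrow> real^'n^'d" and Bn :: "nat \<Rightarrow> real^'n \<Rightarrow> real^'n^'d"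
 assumes \<Omega>: "open \<Omega>" "bounded \<Omega>" and B[measurable]: "B \<in> borel_measurable borel" and Bn[measurable]: "\<And>n. Bn n \<in> borel_measurable borel"
  and A: "sqn \<Omega> B \<le> ennreal A" "\<And>n. sqn \<Omega> (\<lambda>x. Bn n x - B x) \<le> ennreal A" "A \<ge> 0"
  and decomp: "\<And>K \<tau>. compact K \<Longrightarrow> K \<subseteq> \<Omega> \<Longrightarrow> \<tau> > 0 \<Longrightarrow>
   \<exists>N. \<forall>n\<ge>N. \<exists>u. cont_diff 1 u \<and> sqn K u \<le> ennreal \<tau> \<and> sqn K (\<lambda>x. (Bn n x - B x) - grad_matrix u x) \<le> ennreal \<tau>"
 shows "(NNINT x:\<Omega>. Z (B x)) \<le> liminf (\<lambda>n. NNINT x:\<Omega>. ennreal (f (Bn n x)))"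
proof (rule nn_integral_open_le[OF \<Omega>(1)])
 have \<Omega>b[measurable]: "\<Omega> \<in> sets borel" using \<Omega> by simp
 define V where "V = measure lborel \<Omega>"
 have V: "emeasure lborel \<Omega> = ennreal V"
  using emeasure_bounded_lt_top[OF \<Omega>(2)] by (simp add: V_def emeasure_eq_ennreal_measure)
 have "V \<ge> 0" by (simp add: V_def)
 fix K0 :: "(real^'n) set" assume K0: "compact K0" "K0 \<subseteq> \<Omega>"
 have [measurable]: "K0 \<in> sets borel" using K0(1) by (simp add: compact_imp_closed)
 let ?L = "liminf (\<lambda>n. NNINT x:\<Omega>. ennreal (f (Bn n x)))"
 show "(NNINT x:K0. Z (B x)) \<le> ?L"
 proof (cases "K0 = {}")
  case False
  obtain d where d: "d > 0" "{x. infdist x K0 \<le> d} \<subseteq> \<Omega>"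
   using compact_in_open_separated[OF False K0(1) \<Omega>(1) K0(2)] by blast
  \<comment> \<open>Cubes are taken inside the open set \<Omega>1, so that all of them lie in the
    compact set K1, where the gradient decomposition and uniform continuity of g are
    available.\<close>
  define \<Omega>1 where "\<Omega>1 = {x. infdist x K0 < d}"
  define K1 where "K1 = {x. infdist x K0 \<le> d}"
  have K1: "compact K1" "K1 \<subseteq> \<Omega>" using compact_infdist_le[OF False K0(1) d(1)] d(2) by (auto simp: K1_def)
  have \<Omega>1: "open \<Omega>1" "K0 \<subseteq> \<Omega>1" "\<Omega>1 \<subseteq> K1"
   using d(1) by (auto simp: \<Omega>1_def K1_def intro!: open_Collect_less continuous_intros)
  have [measurable]: "K1 \<in> sets borel" using K1(1) by (simp add: compact_imp_closed)
  show ?thesis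
  proof (rule ennreal_le_epsilon)
   fix e :: real assume e: "e > 0"
   \<comment> \<open>The chain of choices: \<delta>; the constants Kc and C' it produces; g and the
     cube size h through \<sigma>2 and \<sigma>; finally \<tau>, which has to beat M3 = C'/h^2. The
     denominators make the four groups of errors at most e/4, e/8, e/8 and e/8.\<close>
   define \<delta> where "\<delta> = e / (4 * (2 * V + 5 * A + 1))"
   have D0: "2 * V + 5 * A + 1 > 0" using \<open>V \<ge> 0\<close> A(3) by simp
   have \<delta>: "\<delta> > 0" using e D0 by (simp add: \<delta>_def)
   obtain Kc where Kc: "Kc > 0" "\<And>a b. zr a \<le> zr b + \<delta> * (1 + (norm a)\<^sup>2) + Kc * (norm (b - a))\<^sup>2"
    using zr_almost_lipschitz[OF \<delta>] by blast
   obtain C' where C': "C' > 0"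
    "\<And>c h \<eta> u b. 0 < h \<Longrightarrow> cont_diff 1 u \<Longrightarrow> b \<in> borel_measurable borel \<Longrightarrow>
     (NNINT x:cube c h. Z \<eta>) \<le> (NNINT x:cube c h. ennreal (zr (b x) + \<delta> * (1 + (norm \<eta>)\<^sup>2 + (norm (grad_matrix u x))\<^sup>2)
     + C' * ((norm (b x - \<eta> - grad_matrix u x))\<^sup>2 + (norm (u x))\<^sup>2 / h\<^sup>2)))"
    using zr_cube_le[OF \<delta>] by blast
   define M1 where "M1 = Kc + 2 * \<delta> + 2 * C'"
   define M2 where "M2 = 2 * \<delta> + 2 * C'"
   have M: "M1 > 0" "M2 > 0" using Kc(1) \<delta> C'(1) by (auto simp: M1_def M2_def)
   define \<sigma> where "\<sigma> = e / (8 * M1 * (V + 1))"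
   have \<sigma>: "\<sigma> > 0" using e M \<open>V \<ge> 0\<close> by (simp add: \<sigma>_def)
   define \<sigma>2 where "\<sigma>2 = e / (16 * M1)"
   have \<sigma>2: "\<sigma>2 > 0" using e M by (simp add: \<sigma>2_def)
   have "sqn \<Omega> B < \<infinity>" using A(1) by (auto intro: le_less_trans)
   then obtain g where g: "continuous_on UNIV g" "sqn \<Omega> (\<lambda>x. B x - g x) \<le> ennreal \<sigma>2"
    using continuous_approx[OF B \<Omega>b emeasure_bounded_lt_top[OF \<Omega>(2)] _ \<sigma>2] by blast
   have [measurable]: "g \<in> borel_measurable borel" using g(1) by (rule borel_measurable_continuous_onI)
   have "uniformly_continuous_on K1 g"
    using K1(1) by (intro compact_uniformly_continuous continuous_on_subset[OF g(1)]) auto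
   then obtain r where r: "r > 0" "\<And>x y. x \<in> K1 \<Longrightarrow> y \<in> K1 \<Longrightarrow> dist y x < r \<Longrightarrow> dist (g y) (g x) < sqrt (\<sigma> / 2)"
    using \<sigma> unfolding uniformly_continuous_on_def by (metis half_gt_zero real_sqrt_gt_zero)
   obtain h0 where h0: "h0 > 0"
    "\<And>h. 0 < h \<Longrightarrow> h \<le> h0 \<Longrightarrow> AE x in lborel. x \<in> K0 \<longrightarrow> x \<in> (\<Union>c\<in>inner_grid h \<Omega>1. cube c h)"
    using cubes_cover[OF K0(1) \<Omega>1(1,2)] by blast
   define h where "h = min h0 (r / (2 * CARD('n)))"
   have h: "h > 0" "h \<le> h0" "h \<le> r / (2 * CARD('n))" using h0(1) r(1) by (auto simp: h_def)
   define I where "I = inner_grid h \<Omega>1"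
   have "bounded \<Omega>1" using K1(1) \<Omega>1(3) by (meson bounded_subset compact_imp_bounded)
   then have I: "finite I" "I \<subseteq> grid h" "\<And>c. c \<in> I \<Longrightarrow> cube c h \<subseteq> \<Omega>1"
    using finite_inner_grid[OF h(1)] by (auto simp: I_def inner_grid_def)
   define U where "U = (\<Union>c\<in>I. cube c h)"
   have [measurable]: "U \<in> sets borel" unfolding U_def using I(1) by (intro sets.finite_UN) auto
   have UK: "U \<subseteq> K1" "U \<subseteq> \<Omega>" using I(3) \<Omega>1(3) K1(2) by (auto simp: U_def)
   define b where "b c = g (c + (h/2) *\<^sub>R 1)" for c
   have close: "(norm (B x - b c))\<^sup>2 \<le> 2 * (norm (B x - g x))\<^sup>2 + \<sigma>" if c: "c \<in> I" "x \<in> cube c h" for c x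
   proof -
    let ?y = "c + (h/2) *\<^sub>R 1"
    have y: "?y \<in> cube c h" using cube_nonempty[OF h(1)] .
    have cl: "x \<in> K1" "?y \<in> K1" using y c I(3) \<Omega>1(3) by blast+
    have "\<bar>x $ i - ?y $ i\<bar> \<le> h" for i
    proof -
     have "c $ i < x $ i" "x $ i < c $ i + h" using c(2) by (auto simp: mem_cube)
     moreover have "c $ i < ?y $ i" "?y $ i < c $ i + h" using y unfolding mem_cube by blast+
     ultimately show ?thesis by linarith
    qed
    then have "norm (x - ?y) \<le> h * CARD('n)" by (rule norm_cube_diff_le)
    also have "\<dots> \<le> r / 2" using h(3) by (simp add: field_simps)
    also have "\<dots> < r" using r(1) by simp
    finally have "dist (g x) (g ?y) < sqrt (\<sigma> / 2)" using r(2)[OF cl(2,1)] by (simp add: dist_norm)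
    then have "(norm (g x - b c))\<^sup>2 \<le> (sqrt (\<sigma> / 2))\<^sup>2" by (intro power_mono) (auto simp: b_def dist_norm)
    moreover have "(norm ((B x - g x) + (g x - b c)))\<^sup>2 \<le> 2 * (norm (B x - g x))\<^sup>2 + 2 * (norm (g x - b c))\<^sup>2"
     by (rule norm_add_sq_le)
    ultimately show ?thesis using \<sigma> by simp
   qed
   define M3 where "M3 = C' / h\<^sup>2"
   have "M3 > 0" using C'(1) h(1) by (simp add: M3_def)
   define \<tau> where "\<tau> = e / (8 * (M2 + M3))"
   have \<tau>: "\<tau> > 0" using e M \<open>M3 > 0\<close> by (simp add: \<tau>_def)
   obtain N where N: "\<And>n. n \<ge> N \<Longrightarrow> \<exists>u. cont_diff 1 u \<and> sqn K1 u \<le> ennreal \<tau> \<and> sqn K1 (\<lambda>x. (Bn n x - B x) - grad_matrix u x) \<le> ennreal \<tau>"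
    using decomp[OF K1 \<tau>] by blast
   have ev: "(NNINT x:K0. Z (B x)) \<le> (NNINT x:\<Omega>. ennreal (f (Bn n x))) + ennreal e" if n: "n \<ge> N" for n
   proof -

    \<comment> \<open>Pointwise error and the estimate on one cube\<close>
    obtain u where u: "cont_diff 1 u" "sqn K1 u \<le> ennreal \<tau>" "sqn K1 (\<lambda>x. (Bn n x - B x) - grad_matrix u x) \<le> ennreal \<tau>"
     using N[OF n] by blast
    have [measurable]: "grad_matrix u \<in> borel_measurable borel" "u \<in> borel_measurable borel"
     by (rule grad_matrix_measurable[OF u(1)]) (rule cont_diff_measurable[OF u(1)])
    define v where "v x = Bn n x - B x" for x
    have [measurable]: "v \<in> borel_measurable borel" unfolding v_def[abs_def] by measurable
    define b2 where "b2 x = (norm (B x))\<^sup>2" for x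
    define v2 where "v2 x = (norm (v x))\<^sup>2" for x
    define g2 where "g2 x = (norm (B x - g x))\<^sup>2" for x
    define w2 where "w2 x = (norm (v x - grad_matrix u x))\<^sup>2" for x
    define u2 where "u2 x = (norm (u x))\<^sup>2" for x
    have nn: "b2 x \<ge> 0" "v2 x \<ge> 0" "g2 x \<ge> 0" "w2 x \<ge> 0" "u2 x \<ge> 0" for x
     by (auto simp: b2_def v2_def g2_def w2_def u2_def)
    \<comment> \<open>What is left once b c has been traded for B and \<nabla>u for v. Terms with a
      factor \<delta> multiply quantities that are only bounded, by V or A; the others multiply
      quantities that are small.\<close>
    define E where "E x = (2 * \<delta> + M1 * \<sigma>) + 3 * \<delta> * b2 x + 2 * \<delta> * v2 x + 2 * M1 * g2 x + M2 * w2 x + M3 * u2 x" for x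
    have E0: "E x \<ge> 0" for x
     unfolding E_def using nn[of x] \<delta> M \<open>M3 > 0\<close> \<sigma> by (intro add_nonneg_nonneg mult_nonneg_nonneg) auto
    have [measurable]: "b2 \<in> borel_measurable borel" "v2 \<in> borel_measurable borel" "g2 \<in> borel_measurable borel"
     "w2 \<in> borel_measurable borel" "u2 \<in> borel_measurable borel"
     unfolding b2_def[abs_def] v2_def[abs_def] g2_def[abs_def] w2_def[abs_def] u2_def[abs_def] by measurable
    have [measurable]: "E \<in> borel_measurable borel" unfolding E_def[abs_def] by measurable
    have cubeI: "(NNINT x:cube c h. Z (B x)) \<le> (NNINT x:cube c h. ennreal (zr (Bn n x) + E x))" if c: "c \<in> I" for c
    proof -
     let ?P = "\<lambda>x. \<delta> * (1 + b2 x) + Kc * (2 * g2 x + \<sigma>)"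
     let ?R = "\<lambda>x. zr (Bn n x) + \<delta> * (1 + (norm (b c))\<^sup>2 + (norm (grad_matrix u x))\<^sup>2)
      + C' * ((norm (Bn n x - b c - grad_matrix u x))\<^sup>2 + (norm (u x))\<^sup>2 / h\<^sup>2)"
     have P0: "?P x \<ge> 0" for x
      using nn[of x] \<delta> Kc(1) \<sigma> by (intro add_nonneg_nonneg mult_nonneg_nonneg) auto
     have R0: "?R x \<ge> 0" for x using \<delta> C'(1) by (intro add_nonneg_nonneg mult_nonneg_nonneg) auto
     have "(NNINT x:cube c h. Z (B x)) \<le> (NNINT x. Z (b c) * indicator (cube c h) x + ennreal (?P x) * indicator (cube c h) x)"
     proof (rule nn_integral_mono)
      fix x
      show "Z (B x) * indicator (cube c h) x \<le> Z (b c) * indicator (cube c h) x + ennreal (?P x) * indicator (cube c h) x"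
      proof (cases "x \<in> cube c h")
       case True
       have "zr (B x) \<le> zr (b c) + \<delta> * (1 + (norm (B x))\<^sup>2) + Kc * (norm (b c - B x))\<^sup>2" by (rule Kc(2))
       moreover have "Kc * (norm (b c - B x))\<^sup>2 \<le> Kc * (2 * g2 x + \<sigma>)"
        using close[OF c True] Kc(1) by (intro mult_left_mono) (auto simp: g2_def norm_minus_commute)
       ultimately have "zr (B x) \<le> zr (b c) + ?P x" by (simp add: b2_def)
       then have "ennreal (zr (B x)) \<le> ennreal (zr (b c) + ?P x)" by (rule ennreal_leI)
       also have "\<dots> = ennreal (zr (b c)) + ennreal (?P x)" using P0[of x] by (intro ennreal_plus) auto
       finally show ?thesis using True by (simp add: Z_eq_zr)
      qed simp
     qed
     also have "\<dots> = (NNINT x:cube c h. Z (b c)) + (NNINT x:cube c h. ennreal (?P x))"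
      by (rule nn_integral_add) auto
     also have "\<dots> \<le> (NNINT x:cube c h. ennreal (?R x)) + (NNINT x:cube c h. ennreal (?P x))"
      by (intro add_right_mono C'(2)[OF h(1) u(1)]) auto
     also have "\<dots> = (NNINT x. ennreal (?R x) * indicator (cube c h) x + ennreal (?P x) * indicator (cube c h) x)"
      by (rule nn_integral_add[symmetric]) auto
     also have "\<dots> \<le> (NNINT x:cube c h. ennreal (zr (Bn n x) + E x))"
     proof (rule nn_integral_mono)
      fix x
      show "ennreal (?R x) * indicator (cube c h) x + ennreal (?P x) * indicator (cube c h) x \<le>
        ennreal (zr (Bn n x) + E x) * indicator (cube c h) x"
      proof (cases "x \<in> cube c h")
       case True
       let ?q = "2 * g2 x + \<sigma>"
       have q: "(norm (B x - b c))\<^sup>2 \<le> ?q" using close[OF c True] by (simp add: g2_def)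
       have 1: "(norm (b c))\<^sup>2 \<le> 2 * b2 x + 2 * ?q"
        using norm_add_sq_le[of "B x" "- (B x - b c)"] q by (simp add: b2_def norm_minus_commute)
       have 2: "(norm (grad_matrix u x))\<^sup>2 \<le> 2 * v2 x + 2 * w2 x"
        using norm_add_sq_le[of "v x" "- (v x - grad_matrix u x)"] by (simp add: v2_def w2_def norm_minus_commute)
       have eq: "Bn n x - b c - grad_matrix u x = (B x - b c) + (v x - grad_matrix u x)" by (simp add: v_def)
       have 3: "(norm (Bn n x - b c - grad_matrix u x))\<^sup>2 \<le> 2 * ?q + 2 * w2 x"
       proof -
        have "(norm (Bn n x - b c - grad_matrix u x))\<^sup>2 \<le> 2 * (norm (B x - b c))\<^sup>2 + 2 * w2 x"
         unfolding eq w2_def by (rule norm_add_sq_le)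
        also have "\<dots> \<le> 2 * ?q + 2 * w2 x" using q by simp
        finally show ?thesis .
       qed
       have "\<delta> * (1 + (norm (b c))\<^sup>2 + (norm (grad_matrix u x))\<^sup>2) \<le> \<delta> * (1 + (2 * b2 x + 2 * ?q) + (2 * v2 x + 2 * w2 x))"
        using 1 2 \<delta> by (intro mult_left_mono add_mono) auto
       moreover have "C' * ((norm (Bn n x - b c - grad_matrix u x))\<^sup>2 + (norm (u x))\<^sup>2 / h\<^sup>2) \<le> C' * ((2 * ?q + 2 * w2 x) + u2 x / h\<^sup>2)"
        using 3 C'(1) by (intro mult_left_mono add_mono) (auto simp: u2_def)
       ultimately have "?R x + ?P x \<le> zr (Bn n x) + \<delta> * (1 + (2 * b2 x + 2 * ?q) + (2 * v2 x + 2 * w2 x))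
         + C' * ((2 * ?q + 2 * w2 x) + u2 x / h\<^sup>2) + ?P x" by linarith
       also have "\<dots> = zr (Bn n x) + E x"
        by (simp add: E_def M1_def M2_def M3_def algebra_simps)
       finally have "ennreal (?R x + ?P x) \<le> ennreal (zr (Bn n x) + E x)" by (rule ennreal_leI)
       moreover have "ennreal (?R x + ?P x) = ennreal (?R x) + ennreal (?P x)"
        using R0[of x] P0[of x] by (rule ennreal_plus)
       ultimately show ?thesis using True by simp
      qed simp
     qed
     finally show ?thesis .
    qed

    \<comment> \<open>Summation and the total error\<close>
    have sumU: "(\<Sum>c\<in>I. (NNINT x:cube c h. H x)) = (NNINT x:U. H x)"
     if [measurable]: "H \<in> borel_measurable borel" for H :: "real^'n \<Rightarrow> ennreal"
    proof -
     have "(\<Sum>c\<in>I. (NNINT x:cube c h. H x)) = (NNINT x. (\<Sum>c\<in>I. H x * indicator (cube c h) x))"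
      by (rule nn_integral_sum[symmetric]) simp
     also have "\<dots> = (NNINT x:U. H x)"
      using sum_indicator_cubes[OF h(1) I(1,2), of "\<lambda>_. H _"] by (simp add: U_def)
     finally show ?thesis .
    qed
    have "(NNINT x:K0. Z (B x)) \<le> (NNINT x:U. Z (B x))"
    proof (rule nn_integral_mono_AE)
     show "AE x in lborel. Z (B x) * indicator K0 x \<le> Z (B x) * indicator U x"
      using h0(2)[OF h(1,2)] by eventually_elim (auto simp: indicator_def U_def I_def)
    qed
    also have "\<dots> \<le> (NNINT x:U. ennreal (zr (Bn n x) + E x))"
     by (subst (1 2) sumU[symmetric]) (auto intro!: sum_mono cubeI)
    also have "\<dots> \<le> (NNINT x. ennreal (f (Bn n x)) * indicator \<Omega> x + ennreal (E x) * indicator U x)"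
    proof (rule nn_integral_mono)
     fix x
     have "ennreal (zr (Bn n x) + E x) = ennreal (zr (Bn n x)) + ennreal (E x)" using E0[of x] by (intro ennreal_plus) auto
     also have "\<dots> \<le> ennreal (f (Bn n x)) + ennreal (E x)" by (intro add_right_mono ennreal_leI zr_le_f)
     finally show "ennreal (zr (Bn n x) + E x) * indicator U x \<le> ennreal (f (Bn n x)) * indicator \<Omega> x + ennreal (E x) * indicator U x"
      using UK(2) by (auto simp: indicator_def)
    qed
    also have "\<dots> = (NNINT x:\<Omega>. ennreal (f (Bn n x))) + (NNINT x:U. ennreal (E x))"
     by (rule nn_integral_add) auto
    also have "(NNINT x:U. ennreal (E x)) \<le> ennreal e"
    proof -
     have "(NNINT x:U. ennreal (E x)) = (NNINT x. ennreal (2 * \<delta> + M1 * \<sigma>) * indicator U x + (ennreal (3 * \<delta>) * (ennreal (b2 x) * indicator U x)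
       + (ennreal (2 * \<delta>) * (ennreal (v2 x) * indicator U x) + (ennreal (2 * M1) * (ennreal (g2 x) * indicator U x)
       + (ennreal M2 * (ennreal (w2 x) * indicator U x) + ennreal M3 * (ennreal (u2 x) * indicator U x))))))"
     proof (rule nn_integral_cong)
      fix x
      have "ennreal (E x) = ennreal (2 * \<delta> + M1 * \<sigma>) + (ennreal (3 * \<delta>) * ennreal (b2 x)
       + (ennreal (2 * \<delta>) * ennreal (v2 x) + (ennreal (2 * M1) * ennreal (g2 x)
       + (ennreal M2 * ennreal (w2 x) + ennreal M3 * ennreal (u2 x)))))"
       using nn[of x] \<delta> M \<open>M3 > 0\<close> \<sigma>
       by (simp add: E_def ennreal_mult[symmetric] ennreal_plus[symmetric] add.assoc del: ennreal_plus)
      then show "ennreal (E x) * indicator U x = ennreal (2 * \<delta> + M1 * \<sigma>) * indicator U x + (ennreal (3 * \<delta>) * (ennreal (b2 x) * indicator U x)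
       + (ennreal (2 * \<delta>) * (ennreal (v2 x) * indicator U x) + (ennreal (2 * M1) * (ennreal (g2 x) * indicator U x)
       + (ennreal M2 * (ennreal (w2 x) * indicator U x) + ennreal M3 * (ennreal (u2 x) * indicator U x)))))"
       by (cases "x \<in> U") simp_all
     qed
     also have "\<dots> = ennreal (2 * \<delta> + M1 * \<sigma>) * emeasure lborel U + (ennreal (3 * \<delta>) * sqn U B
       + (ennreal (2 * \<delta>) * sqn U v + (ennreal (2 * M1) * sqn U (\<lambda>x. B x - g x)
       + (ennreal M2 * sqn U (\<lambda>x. v x - grad_matrix u x) + ennreal M3 * sqn U u))))"
      by (simp add: nn_integral_add nn_integral_cmult nn_integral_cmult_indicator sqn_def b2_def v2_def g2_def w2_def u2_def)
     also have "\<dots> \<le> ennreal (2 * \<delta> + M1 * \<sigma>) * ennreal V + (ennreal (3 * \<delta>) * ennreal A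
       + (ennreal (2 * \<delta>) * ennreal A + (ennreal (2 * M1) * ennreal \<sigma>2
       + (ennreal M2 * ennreal \<tau> + ennreal M3 * ennreal \<tau>))))"
     proof (intro add_mono mult_left_mono)
      show "emeasure lborel U \<le> ennreal V" unfolding V[symmetric] using UK(2) by (intro emeasure_mono) auto
      show "sqn U B \<le> ennreal A" using sqn_mono[OF UK(2)] A(1) by (rule order_trans)
      show "sqn U v \<le> ennreal A" unfolding v_def[abs_def] using sqn_mono[OF UK(2)] A(2) by (rule order_trans)
      show "sqn U (\<lambda>x. B x - g x) \<le> ennreal \<sigma>2" using sqn_mono[OF UK(2)] g(2) by (rule order_trans)
      show "sqn U (\<lambda>x. v x - grad_matrix u x) \<le> ennreal \<tau>" unfolding v_def using sqn_mono[OF UK(1)] u(3) by (rule order_trans)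
      show "sqn U u \<le> ennreal \<tau>" using sqn_mono[OF UK(1)] u(2) by (rule order_trans)
     qed auto
     also have "\<dots> = ennreal ((2 * \<delta> + M1 * \<sigma>) * V + (3 * \<delta> * A + (2 * \<delta> * A + (2 * M1 * \<sigma>2 + (M2 * \<tau> + M3 * \<tau>)))))"
      using \<delta> M \<open>M3 > 0\<close> \<sigma> \<sigma>2 \<tau> A(3) \<open>V \<ge> 0\<close>
      by (simp add: ennreal_mult[symmetric] ennreal_plus[symmetric] del: ennreal_plus)
     also have "\<dots> \<le> ennreal e"
     proof (rule ennreal_leI)
      have cancel: "e / (4 * a) * a = e / 4" if "a > 0" for a :: real using that by simp
      have "\<delta> * (2 * V + 5 * A) \<le> \<delta> * (2 * V + 5 * A + 1)" using \<delta> by simp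
      also have "\<dots> = e / 4" unfolding \<delta>_def by (rule cancel) (use D0 in simp)
      finally have 1: "\<delta> * (2 * V + 5 * A) \<le> e / 4" .
      have "M1 * \<sigma> * V = e / 8 * (V / (V + 1))" using M by (simp add: \<sigma>_def)
      also have "\<dots> \<le> e / 8 * 1" using e \<open>V \<ge> 0\<close> by (intro mult_left_mono) auto
      finally have 2: "M1 * \<sigma> * V \<le> e / 8" by simp
      have 3: "2 * M1 * \<sigma>2 = e / 8" using M by (simp add: \<sigma>2_def)
      have "a * (e / (8 * a)) = e / 8" if "a > 0" for a :: real using that by simp
      from this[of "M2 + M3"] have 4: "(M2 + M3) * \<tau> = e / 8" using M \<open>M3 > 0\<close> by (simp only: \<tau>_def add_pos_pos)
      show "(2 * \<delta> + M1 * \<sigma>) * V + (3 * \<delta> * A + (2 * \<delta> * A + (2 * M1 * \<sigma>2 + (M2 * \<tau> + M3 * \<tau>)))) \<le> e"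
       using 1 2 3 4 e by (simp add: algebra_simps)
     qed
     finally show ?thesis .
    qed
    finally show ?thesis by (simp add: add_left_mono)
   qed
   have "(NNINT x:K0. Z (B x)) \<le> liminf (\<lambda>n. (NNINT x:\<Omega>. ennreal (f (Bn n x))) + ennreal e)"
    by (rule Liminf_bounded) (use ev in \<open>auto simp: eventually_sequentially\<close>)
   also have "\<dots> = ?L + ennreal e"
    by (rule Liminf_add_const) auto
   finally show "(NNINT x:K0. Z (B x)) \<le> ?L + ennreal e" .
  qed
 qed simp
qed simp

end

section \<open>Weak derivatives\<close>

lemma Cinf_compactD:
 assumes "\<phi> \<in> Cinf_compact \<Omega>"
 shows "cont_diff m \<phi>" and "\<phi> \<in> C1_compact \<Omega>" and "x \<notin> \<Omega> \<Longrightarrow> \<phi> x = 0"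
proof -
 show "cont_diff m \<phi>" using assms by (simp add: Cinf_compact_def)
 show c: "\<phi> \<in> C1_compact \<Omega>" using assms unfolding Cinf_compact_def C1_compact_def by blast
 show "x \<notin> \<Omega> \<Longrightarrow> \<phi> x = 0" using C1_compactD(2)[OF c] .
qed

lemma C1_compact_deriv_bounded:
 fixes \<phi> :: "'a::euclidean_space \<Rightarrow> 'b::euclidean_space"
 assumes "\<phi> \<in> C1_compact \<Omega>"
 obtains M where "M > 0" "\<And>x. norm (\<phi> x) \<le> M" "\<And>x. norm (frechet_derivative \<phi> (at x) v) \<le> M"
proof -
 obtain K where K: "compact K" "\<And>x. x \<notin> K \<Longrightarrow> \<phi> x = 0" using C1_compactE[OF assms] by metis
 note c = C1_compactD(1)[OF assms]
 obtain M1 where M1: "M1 > 0" "\<And>x. norm (\<phi> x) \<le> M1"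
  using compact_support_cont_bounded[OF cont_diff_continuous[OF c] K] by blast
 obtain M2 where M2: "M2 > 0" "\<And>x. norm (frechet_derivative \<phi> (at x) v) \<le> M2"
  using compact_support_cont_bounded[OF C1_deriv_continuous[OF c] K(1) C1_compact_deriv[OF c K]] by blast
 show ?thesis by (rule that[of "max M1 M2"]) (use M1 M2 in \<open>auto simp: le_max_iff_disj\<close>)
qed

lemma L2_measurable: "F \<in> L2 \<Omega> \<Longrightarrow> F \<in> borel_measurable (lebesgue_on \<Omega>)"
 by (simp add: L2_def)

lemma borel_lebesgue_on: "g \<in> borel_measurable borel \<Longrightarrow> g \<in> borel_measurable (lebesgue_on \<Omega>)"
 by (intro measurable_restrict_space1 measurable_completion) simp

lemma L2_rep_D:
 assumes "L2_rep \<Omega> F F'"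
 shows "L2c F'" "F' \<in> borel_measurable borel" "\<And>x. x \<notin> \<Omega> \<Longrightarrow> F' x = 0" "AE x in lebesgue_on \<Omega>. F x = F' x"
 using assms by (auto simp: L2_rep_def L2c_def)

lemma sqn_UNIV_eq: "(\<And>x. x \<notin> \<Omega> \<Longrightarrow> F x = 0) \<Longrightarrow> sqn \<Omega> F = sqn UNIV F"
 unfolding sqn_def by (intro nn_integral_cong) (auto simp: indicator_def)

lemma L2_of_rep:
 fixes F :: "'a::euclidean_space \<Rightarrow> 'b::euclidean_space"
 assumes \<Omega>: "open \<Omega>" and F: "F \<in> borel_measurable (lebesgue_on \<Omega>)" and r: "L2_rep \<Omega> F F'"
 shows "F \<in> L2 \<Omega>"
proof -
 have "(\<integral>\<^sup>+x. ennreal (norm ((norm (F x))\<^sup>2)) \<partial>lebesgue_on \<Omega>) = (NNINT x:\<Omega>. ennreal (norm ((norm (F' x))\<^sup>2)))"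
  by (rule L2_rep_nn_integral[OF _ r]) (use \<Omega> in simp)
 also have "\<dots> = sqn \<Omega> F'" by (simp add: sqn_def)
 also have "\<dots> \<le> sqn UNIV F'" by (rule sqn_mono) simp
 also have "\<dots> < \<infinity>" using L2_rep_D(1)[OF r] by (simp add: L2c_def)
 finally show ?thesis unfolding L2_def using F by (auto simp: integrable_iff_bounded)
qed

lemma L2c_add: "L2c F \<Longrightarrow> L2c G \<Longrightarrow> L2c (\<lambda>x. F x + G x)"
proof -
 assume F: "L2c F" and G: "L2c G"
 have "L2c (\<lambda>x. - G x)" using G by (simp add: L2c_def)
 from L2c_diff[OF F this] show ?thesis by simp
qed

lemma L2c_scaleR: "L2c F \<Longrightarrow> L2c (\<lambda>x. a *\<^sub>R F x)"
proof -
 assume F: "L2c F"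
 then have [measurable]: "F \<in> borel_measurable borel" by (simp add: L2c_def)
 have "sqn UNIV (\<lambda>x. a *\<^sub>R F x) = ennreal (a\<^sup>2) * sqn UNIV F"
  unfolding sqn_def by (subst nn_integral_cmult[symmetric]) (auto simp: power_mult_distrib ennreal_mult intro!: nn_integral_cong)
 also have "\<dots> < \<infinity>" using F by (simp add: L2c_def ennreal_mult_less_top)
 finally show ?thesis using F by (auto simp: L2c_def)
qed

lemma sqn_scaleR:
 assumes [measurable]: "F \<in> borel_measurable borel" "A \<in> sets borel"
 shows "sqn A (\<lambda>x. a *\<^sub>R F x) = ennreal (a\<^sup>2) * sqn A F"
 unfolding sqn_def
 by (subst nn_integral_cmult[symmetric])
  (auto simp: power_mult_distrib ennreal_mult mult.assoc intro!: nn_integral_cong)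

lemma L2c_bounded:
 fixes F :: "'a::euclidean_space \<Rightarrow> 'b::euclidean_space"
 assumes \<Omega>: "\<Omega> \<in> sets borel" "bounded \<Omega>" and [measurable]: "F \<in> borel_measurable borel" and C: "\<And>x. norm (F x) \<le> C"
  and 0: "\<And>x. x \<notin> \<Omega> \<Longrightarrow> F x = 0"
 shows "L2c F"
proof -
 have "sqn UNIV F \<le> (NNINT x. ennreal (C\<^sup>2) * indicator \<Omega> x)"
  unfolding sqn_def
 proof (rule nn_integral_mono)
  fix x show "ennreal ((norm (F x))\<^sup>2) * indicator UNIV x \<le> ennreal (C\<^sup>2) * indicator \<Omega> x"
   using C[of x] 0[of x] by (cases "x \<in> \<Omega>") (auto intro!: ennreal_leI power_mono)
 qed
 also have "\<dots> = ennreal (C\<^sup>2) * emeasure lborel \<Omega>" using \<Omega>(1) by (simp add: nn_integral_cmult_indicator)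
 also have "\<dots> < \<infinity>" using emeasure_bounded_lt_top[OF \<Omega>(2)] by (simp add: ennreal_mult_less_top)
 finally have "sqn UNIV F < \<infinity>" .
 moreover have "\<exists>R. \<forall>x. norm x > R \<longrightarrow> F x = 0" using \<Omega>(2) 0 unfolding bounded_iff by (meson leD)
 ultimately show ?thesis by (simp add: L2c_def)
qed

lemma L2c_C1_compact:
 fixes \<phi> :: "real^'n \<Rightarrow> real^'d"
 assumes "open \<Omega>" "bounded \<Omega>" "\<phi> \<in> C1_compact \<Omega>"
 shows "L2c \<phi>" "L2c (grad_matrix \<phi>)"
proof -
 have \<Omega>: "\<Omega> \<in> sets borel" using assms(1) by simp
 obtain M where M: "\<And>x. norm (\<phi> x) \<le> M" "\<And>x. norm (grad_matrix \<phi> x) \<le> M" using C1_compact_bounded[OF assms(3)] by metis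
 note c = C1_compactD(1)[OF assms(3)]
 show "L2c \<phi>"
  by (rule L2c_bounded[OF \<Omega> assms(2) cont_diff_measurable[OF c] M(1) C1_compactD(2)[OF assms(3)]])
 show "L2c (grad_matrix \<phi>)"
  by (rule L2c_bounded[OF \<Omega> assms(2) grad_matrix_measurable[OF c] M(2) C1_compact_grad_0[OF assms(3)]])
qed

lemma vec_nth_lebesgue_on:
 fixes G :: "'a::euclidean_space \<Rightarrow> 'b::euclidean_space^'n"
 assumes "G \<in> borel_measurable M"
 shows "(\<lambda>x. G x $ i) \<in> borel_measurable M"
proof -
 have "(\<lambda>A::'b^'n. A $ i) \<in> borel_measurable borel"
  by (intro borel_measurable_continuous_onI continuous_intros)
 from measurable_compose[OF assms this] show ?thesis .
qed

lemma bilinear_measurable: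
 fixes prod :: "'a::euclidean_space \<Rightarrow> 'b::euclidean_space \<Rightarrow> 'c::euclidean_space"
 assumes "bounded_bilinear prod" "f \<in> borel_measurable M" "g \<in> borel_measurable M"
 shows "(\<lambda>x. prod (f x) (g x)) \<in> borel_measurable M"
proof (rule borel_measurable_continuous_Pair[OF assms(2,3)])
 show "continuous_on UNIV (\<lambda>x. prod (fst x) (snd x))"
  by (intro bounded_bilinear.continuous_on[OF assms(1)] continuous_intros)
qed

lemma has_weak_gradient_rep:
 fixes k :: "real^'n \<Rightarrow> real^'d"
 assumes \<Omega>: "open \<Omega>" and k: "k \<in> L2 \<Omega>" "L2_rep \<Omega> k k'" and G: "G \<in> L2 \<Omega>" "L2_rep \<Omega> G G'"
 shows "has_weak_gradient \<Omega> k G \<longleftrightarrow>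
  (\<forall>\<phi>\<in>Cinf_compact \<Omega>. \<forall>i j. (LBINT x. G' x $ i $ j * \<phi> x) = - (LBINT x. k' x $ i * partial j \<phi> x))"
proof -
 have \<Omega>b: "\<Omega> \<in> sets borel" using \<Omega> by simp
 have "(\<integral>x. G x $ i $ j * \<phi> x \<partial>lebesgue_on \<Omega>) = (LBINT x. G' x $ i $ j * \<phi> x)"
  and "(\<integral>x. k x $ i * partial j \<phi> x \<partial>lebesgue_on \<Omega>) = (LBINT x. k' x $ i * partial j \<phi> x)"
  if \<phi>: "\<phi> \<in> Cinf_compact \<Omega>" for \<phi> i j
 proof -
  have c: "cont_diff 1 \<phi>" using Cinf_compactD(1)[OF \<phi>] .
  have m1: "\<phi> \<in> borel_measurable borel" by (rule cont_diff_measurable[OF c])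
  have m2: "partial j \<phi> \<in> borel_measurable borel"
   unfolding partial_def by (rule borel_measurable_continuous_onI[OF C1_deriv_continuous[OF c]])
  show "(\<integral>x. G x $ i $ j * \<phi> x \<partial>lebesgue_on \<Omega>) = (LBINT x. G' x $ i $ j * \<phi> x)"
  proof (rule integral_lebesgue_on_rep[OF \<Omega>b])
   show "(\<lambda>x. G x $ i $ j * \<phi> x) \<in> borel_measurable (lebesgue_on \<Omega>)"
    by (intro borel_measurable_times vec_nth_lebesgue_on L2_measurable G(1) borel_lebesgue_on m1)
   show "(\<lambda>x. G' x $ i $ j * \<phi> x) \<in> borel_measurable borel"
    by (intro borel_measurable_times vec_nth_lebesgue_on L2_rep_D(2)[OF G(2)] m1)
   show "AE x in lebesgue_on \<Omega>. G x $ i $ j * \<phi> x = G' x $ i $ j * \<phi> x"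
    using L2_rep_D(4)[OF G(2)] by eventually_elim simp
  qed (simp add: Cinf_compactD(3)[OF \<phi>])
  show "(\<integral>x. k x $ i * partial j \<phi> x \<partial>lebesgue_on \<Omega>) = (LBINT x. k' x $ i * partial j \<phi> x)"
  proof (rule integral_lebesgue_on_rep[OF \<Omega>b])
   show "(\<lambda>x. k x $ i * partial j \<phi> x) \<in> borel_measurable (lebesgue_on \<Omega>)"
    by (intro borel_measurable_times vec_nth_lebesgue_on L2_measurable k(1) borel_lebesgue_on m2)
   show "(\<lambda>x. k' x $ i * partial j \<phi> x) \<in> borel_measurable borel"
    by (intro borel_measurable_times vec_nth_lebesgue_on L2_rep_D(2)[OF k(2)] m2)
   show "AE x in lebesgue_on \<Omega>. k x $ i * partial j \<phi> x = k' x $ i * partial j \<phi> x"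
    using L2_rep_D(4)[OF k(2)] by eventually_elim simp
  qed (simp add: L2_rep_D(3)[OF k(2)])
 qed
 then show ?thesis unfolding has_weak_gradient_def by simp
qed

lemma weak_gradient_works:
 assumes "k \<in> W12 \<Omega>"
 shows "k \<in> L2 \<Omega>" "weak_gradient \<Omega> k \<in> L2 \<Omega>" "has_weak_gradient \<Omega> k (weak_gradient \<Omega> k)"
proof -
 have "\<exists>G. G \<in> L2 \<Omega> \<and> has_weak_gradient \<Omega> k G" using assms by (auto simp: W12_def)
 from someI_ex[OF this] show "weak_gradient \<Omega> k \<in> L2 \<Omega>" "has_weak_gradient \<Omega> k (weak_gradient \<Omega> k)"
  unfolding weak_gradient_def by auto
 show "k \<in> L2 \<Omega>" using assms by (simp add: W12_def)
qed

text \<open>Equal action on test functions forces equality almost everywhere, by the fundamental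
  lemma, so one representative may be exchanged for another.\<close>

lemma L2_rep_unique:
 fixes H' G' :: "'a::euclidean_space \<Rightarrow> 'b::euclidean_space"
 assumes \<Omega>: "open \<Omega>" and H: "L2_rep \<Omega> H H'" and G: "L2c G'" "\<And>x. x \<notin> \<Omega> \<Longrightarrow> G' x = 0"
  and eq: "\<And>\<phi>. \<phi> \<in> Cinf_compact \<Omega> \<Longrightarrow> (LBINT x. \<phi> x *\<^sub>R H' x) = (LBINT x. \<phi> x *\<^sub>R G' x)"
 shows "L2_rep \<Omega> H G'"
proof -
 have "AE x in lborel. x \<in> \<Omega> \<longrightarrow> H' x - G' x = 0"
 proof (rule L2c_eq_0_AE[OF \<Omega> L2c_diff[OF L2_rep_D(1)[OF H] G(1)]])
  fix \<phi> :: "'a \<Rightarrow> real" assume \<phi>: "\<phi> \<in> Cinf_compact \<Omega>"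
  obtain M where M: "\<And>x. norm (\<phi> x) \<le> M" using C1_compact_deriv_bounded[OF Cinf_compactD(2)[OF \<phi>]] by metis
  have m: "\<phi> \<in> borel_measurable borel"
   by (rule cont_diff_measurable[OF Cinf_compactD(1)[OF \<phi>, of 0]])
  have M': "\<bar>\<phi> x\<bar> \<le> M" for x using M[of x] by simp
  show "(LBINT x. \<phi> x *\<^sub>R (H' x - G' x)) = 0"
   unfolding scaleR_diff_right
   using Bochner_Integration.integral_diff[OF L2c_integrable_mult[OF L2_rep_D(1)[OF H] m M'] L2c_integrable_mult[OF G(1) m M']] eq[OF \<phi>]
   by simp
 qed
 then have "AE x in lebesgue. x \<in> \<Omega> \<longrightarrow> H' x - G' x = 0" by (rule AE_completion)
 then have "AE x in lebesgue_on \<Omega>. H' x - G' x = 0" using \<Omega> by (subst AE_restrict_space_iff) auto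
 then have "AE x in lebesgue_on \<Omega>. H x = G' x" using L2_rep_D(4)[OF H] by eventually_elim simp
 then show ?thesis using G by (simp add: L2_rep_def)
qed

lemma integral_test_vec:
 fixes G :: "'a::euclidean_space \<Rightarrow> 'b::euclidean_space^'n"
 assumes "L2c G" "\<phi> \<in> borel_measurable borel" "\<And>x. \<bar>\<phi> x\<bar> \<le> (C::real)"
 shows "(LBINT x. \<phi> x *\<^sub>R G x) $ i = (LBINT x. \<phi> x *\<^sub>R (G x $ i))"
 by (subst integral_vec_nth(1)[OF L2c_integrable_mult[OF assms]]) simp

lemma Cinf_compact_test:
 assumes "\<phi> \<in> Cinf_compact \<Omega>"
 obtains C where "\<phi> \<in> borel_measurable borel" "\<And>x. \<bar>\<phi> x\<bar> \<le> (C::real)"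
proof -
 obtain M where M: "\<And>x. norm (\<phi> x) \<le> M" using C1_compact_deriv_bounded[OF Cinf_compactD(2)[OF assms]] by metis
 have "\<phi> \<in> borel_measurable borel"
  by (rule cont_diff_measurable[OF Cinf_compactD(1)[OF assms, of 0]])
 with M that show ?thesis by auto
qed

lemma integral_test_matrix:
 fixes G :: "'a::euclidean_space \<Rightarrow> real^'n^'d"
 assumes "L2c G" "\<phi> \<in> borel_measurable borel" "\<And>x. \<bar>\<phi> x\<bar> \<le> (C::real)"
 shows "(LBINT x. \<phi> x *\<^sub>R G x) $ i $ j = (LBINT x. G x $ i $ j * \<phi> x)"
proof -
 note i = L2c_integrable_mult[OF assms]
 show ?thesis
  by (subst integral_vec_nth(1)[OF i], subst integral_vec_nth(1)[OF integral_vec_nth(2)[OF i]]) (simp add: mult.commute)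
qed

text \<open>The gradient in the functional is an unspecified choice. Any weak gradient found by hand
  determines that choice up to null sets, which is all an integral can see.\<close>

lemma weak_gradient_rep:
 fixes k :: "real^'n \<Rightarrow> real^'d"
 assumes \<Omega>: "open \<Omega>" "bounded \<Omega>" and k: "k \<in> L2 \<Omega>" and G: "G \<in> L2 \<Omega>" "L2_rep \<Omega> G G'" and wg: "has_weak_gradient \<Omega> k G"
 shows "k \<in> W12 \<Omega>" "L2_rep \<Omega> (weak_gradient \<Omega> k) G'"
proof -
 show W: "k \<in> W12 \<Omega>" using k G wg by (auto simp: W12_def)
 obtain k' where k': "L2_rep \<Omega> k k'" using L2_rep_exists[OF \<Omega> k] by blast
 obtain H' where H': "L2_rep \<Omega> (weak_gradient \<Omega> k) H'" using L2_rep_exists[OF \<Omega> weak_gradient_works(2)[OF W]] by blast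
 show "L2_rep \<Omega> (weak_gradient \<Omega> k) G'"
 proof (rule L2_rep_unique[OF \<Omega>(1) H' L2_rep_D(1)[OF G(2)] L2_rep_D(3)[OF G(2)]])
  fix \<phi> :: "real^'n \<Rightarrow> real" assume \<phi>: "\<phi> \<in> Cinf_compact \<Omega>"
  obtain C where C: "\<phi> \<in> borel_measurable borel" "\<And>x. \<bar>\<phi> x\<bar> \<le> C" using Cinf_compact_test[OF \<phi>] by blast
  have "(LBINT x. H' x $ i $ j * \<phi> x) = (LBINT x. G' x $ i $ j * \<phi> x)" for i j
   using weak_gradient_works(3)[OF W] wg \<phi>
   unfolding has_weak_gradient_rep[OF \<Omega>(1) k k' weak_gradient_works(2)[OF W] H'] has_weak_gradient_rep[OF \<Omega>(1) k k' G]
   by simp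
  then show "(LBINT x. \<phi> x *\<^sub>R H' x) = (LBINT x. \<phi> x *\<^sub>R G' x)"
   by (simp add: vec_eq_iff integral_test_matrix[OF L2_rep_D(1)[OF H'] C] integral_test_matrix[OF L2_rep_D(1)[OF G(2)] C])
 qed
qed

context curl_product
begin

lemma has_weak_curl_rep:
 assumes \<Omega>: "open \<Omega>" and B: "B \<in> L2 \<Omega>" "L2_rep \<Omega> B B'" and c: "c \<in> L2 \<Omega>" "L2_rep \<Omega> c c'"
 shows "has_weak_curl X \<Omega> B c \<longleftrightarrow>
  (\<forall>\<phi>\<in>Cinf_compact \<Omega>. \<forall>i. (LBINT x. \<phi> x *\<^sub>R (c' x $ i)) = - (LBINT x. X (grad \<phi> x) (B' x $ i)))"
proof -
 have \<Omega>b: "\<Omega> \<in> sets borel" using \<Omega> by simp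
 have "(\<integral>x. \<phi> x *\<^sub>R (c x $ i) \<partial>lebesgue_on \<Omega>) = (LBINT x. \<phi> x *\<^sub>R (c' x $ i))"
  and "(\<integral>x. X (grad \<phi> x) (B x $ i) \<partial>lebesgue_on \<Omega>) = (LBINT x. X (grad \<phi> x) (B' x $ i))"
  if \<phi>: "\<phi> \<in> Cinf_compact \<Omega>" for \<phi> i
 proof -
  have cd: "cont_diff 1 \<phi>" using Cinf_compactD(1)[OF \<phi>] .
  have m1: "\<phi> \<in> borel_measurable borel" by (rule cont_diff_measurable[OF cd])
  have m2: "grad \<phi> \<in> borel_measurable borel" by (rule borel_measurable_continuous_onI[OF continuous_grad[OF cd]])
  show "(\<integral>x. \<phi> x *\<^sub>R (c x $ i) \<partial>lebesgue_on \<Omega>) = (LBINT x. \<phi> x *\<^sub>R (c' x $ i))"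
  proof (rule integral_lebesgue_on_rep[OF \<Omega>b])
   show "(\<lambda>x. \<phi> x *\<^sub>R (c x $ i)) \<in> borel_measurable (lebesgue_on \<Omega>)"
    by (intro borel_measurable_scaleR vec_nth_lebesgue_on L2_measurable c(1) borel_lebesgue_on m1)
   show "(\<lambda>x. \<phi> x *\<^sub>R (c' x $ i)) \<in> borel_measurable borel"
    by (intro borel_measurable_scaleR vec_nth_lebesgue_on L2_rep_D(2)[OF c(2)] m1)
   show "AE x in lebesgue_on \<Omega>. \<phi> x *\<^sub>R (c x $ i) = \<phi> x *\<^sub>R (c' x $ i)"
    using L2_rep_D(4)[OF c(2)] by eventually_elim simp
  qed (simp add: Cinf_compactD(3)[OF \<phi>])
  show "(\<integral>x. X (grad \<phi> x) (B x $ i) \<partial>lebesgue_on \<Omega>) = (LBINT x. X (grad \<phi> x) (B' x $ i))"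
  proof (rule integral_lebesgue_on_rep[OF \<Omega>b])
   show "(\<lambda>x. X (grad \<phi> x) (B x $ i)) \<in> borel_measurable (lebesgue_on \<Omega>)"
    by (intro bilinear_measurable[OF X] vec_nth_lebesgue_on L2_measurable B(1) borel_lebesgue_on m2)
   show "(\<lambda>x. X (grad \<phi> x) (B' x $ i)) \<in> borel_measurable borel"
    by (intro bilinear_measurable[OF X] vec_nth_lebesgue_on L2_rep_D(2)[OF B(2)] m2)
   show "AE x in lebesgue_on \<Omega>. X (grad \<phi> x) (B x $ i) = X (grad \<phi> x) (B' x $ i)"
    using L2_rep_D(4)[OF B(2)] by eventually_elim simp
  qed (simp add: L2_rep_D(3)[OF B(2)] bounded_bilinear.zero_right[OF X])
 qed
 then show ?thesis unfolding has_weak_curl_def by simp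
qed

lemma weak_curl_works:
 assumes "B \<in> Hcurl X \<Omega>"
 shows "B \<in> L2 \<Omega>" "weak_curl X \<Omega> B \<in> L2 \<Omega>" "has_weak_curl X \<Omega> B (weak_curl X \<Omega> B)"
proof -
 have "\<exists>c. c \<in> L2 \<Omega> \<and> has_weak_curl X \<Omega> B c" using assms by (auto simp: Hcurl_def)
 from someI_ex[OF this] show "weak_curl X \<Omega> B \<in> L2 \<Omega>" "has_weak_curl X \<Omega> B (weak_curl X \<Omega> B)"
  unfolding weak_curl_def by auto
 show "B \<in> L2 \<Omega>" using assms by (simp add: Hcurl_def)
qed

lemma weak_curl_rep:
 assumes \<Omega>: "open \<Omega>" "bounded \<Omega>" and B: "B \<in> L2 \<Omega>" and c: "c \<in> L2 \<Omega>" "L2_rep \<Omega> c c'" and wc: "has_weak_curl X \<Omega> B c"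
 shows "B \<in> Hcurl X \<Omega>" "L2_rep \<Omega> (weak_curl X \<Omega> B) c'"
proof -
 show W: "B \<in> Hcurl X \<Omega>" using B c wc by (auto simp: Hcurl_def)
 obtain B' where B': "L2_rep \<Omega> B B'" using L2_rep_exists[OF \<Omega> B] by blast
 obtain H' where H': "L2_rep \<Omega> (weak_curl X \<Omega> B) H'" using L2_rep_exists[OF \<Omega> weak_curl_works(2)[OF W]] by blast
 show "L2_rep \<Omega> (weak_curl X \<Omega> B) c'"
 proof (rule L2_rep_unique[OF \<Omega>(1) H' L2_rep_D(1)[OF c(2)] L2_rep_D(3)[OF c(2)]])
  fix \<phi> :: "real^'n \<Rightarrow> real" assume \<phi>: "\<phi> \<in> Cinf_compact \<Omega>"
  obtain C where C: "\<phi> \<in> borel_measurable borel" "\<And>x. \<bar>\<phi> x\<bar> \<le> C" using Cinf_compact_test[OF \<phi>] by blast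
  have "(LBINT x. \<phi> x *\<^sub>R (H' x $ i)) = (LBINT x. \<phi> x *\<^sub>R (c' x $ i))" for i
   using weak_curl_works(3)[OF W] wc \<phi>
   unfolding has_weak_curl_rep[OF \<Omega>(1) B B' weak_curl_works(2)[OF W] H'] has_weak_curl_rep[OF \<Omega>(1) B B' c]
   by simp
  then show "(LBINT x. \<phi> x *\<^sub>R H' x) = (LBINT x. \<phi> x *\<^sub>R c' x)"
   by (simp add: vec_eq_iff integral_test_vec[OF L2_rep_D(1)[OF H'] C] integral_test_vec[OF L2_rep_D(1)[OF c(2)] C])
 qed
qed

lemma X_antisym: "X a b = - X b a"
proof -
 have "X a b + X b a = X (a + b) (a + b)"
  unfolding bounded_bilinear.add_left[OF X] bounded_bilinear.add_right[OF X] by (simp add: X_self)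
 also have "\<dots> = 0" by (rule X_self)
 finally show ?thesis by (simp add: eq_neg_iff_add_eq_0)
qed

text \<open>Gradients are curl-free in the weak sense. Expanded in the basis, the integral is a
  double sum of coefficients I a b against X of two basis vectors. The coefficients are symmetric, X
  is antisymmetric, so the sum equals its own negative. Only one derivative of u is used.\<close>

lemma integral_X_grad:
 assumes \<phi>: "\<phi> \<in> Cinf_compact \<Omega>" and u: "u \<in> C1_compact \<Omega>"
 shows "(LBINT x. X (grad \<phi> x) (grad_matrix u x $ i)) = 0"
proof -
 obtain K where K: "compact K" "\<And>x. x \<notin> K \<Longrightarrow> \<phi> x = 0" using C1_compactE[OF Cinf_compactD(2)[OF \<phi>]] by metis
 obtain L where L: "compact L" "\<And>x. x \<notin> L \<Longrightarrow> u x = 0" using C1_compactE[OF u] by metis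
 have c1: "cont_diff 1 \<phi>" and c2: "cont_diff 2 \<phi>" using Cinf_compactD(1)[OF \<phi>] by auto
 have cu: "cont_diff 1 u" using C1_compactD(1)[OF u] .
 define w where "w x = u x $ i" for x
 have w: "cont_diff 1 w" unfolding w_def[abs_def] by (rule cont_diff_bounded_linear[OF bounded_linear_vec_nth cu])
 have w0: "x \<notin> L \<Longrightarrow> w x = 0" for x by (simp add: w_def L(2))
 have wd: "grad_matrix u x $ i $ b = frechet_derivative w (at x) (axis b 1)" for x b
 proof -
  have "(w has_derivative (\<lambda>h. frechet_derivative u (at x) h $ i)) (at x)"
   unfolding w_def[abs_def] by (rule bounded_linear.has_derivative[OF bounded_linear_vec_nth C1_has_derivative[OF cu]])
  from fun_cong[OF frechet_derivative_at[OF this], of "axis b 1"] show ?thesis by (simp add: grad_matrix_def partial_def)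
 qed
 let ?p = "\<lambda>a x. frechet_derivative \<phi> (at x) (axis a 1)" and ?q = "\<lambda>b x. frechet_derivative w (at x) (axis b 1)"
 have int: "integrable lborel (\<lambda>x. (?p a x * ?q b x) *\<^sub>R X (axis a 1) (axis b 1))" for a b
  by (rule integrable_compact_support[OF _ K(1)])
   (auto intro!: continuous_intros C1_deriv_continuous[OF c1] C1_deriv_continuous[OF w] simp: C1_compact_deriv[OF c1 K])
 have "X (grad \<phi> x) (grad_matrix u x $ i) = (\<Sum>a\<in>UNIV. \<Sum>b\<in>UNIV. (?p a x * ?q b x) *\<^sub>R X (axis a 1) (axis b 1))" for x
 proof -
  have "X g v = (\<Sum>a\<in>UNIV. \<Sum>b\<in>UNIV. (g $ a * v $ b) *\<^sub>R X (axis a 1) (axis b 1))" for g v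
  proof -
   have "X y v = (\<Sum>b\<in>UNIV. v $ b *\<^sub>R X y (axis b 1))" for y
   proof -
    have "X y v = X y (\<Sum>b\<in>UNIV. v $ b *\<^sub>R axis b 1)" by (simp add: basis_expansion scalar_mult_eq_scaleR[symmetric])
    then show ?thesis by (simp add: bounded_bilinear.sum_right[OF X] bounded_bilinear.scaleR_right[OF X])
   qed
   then show ?thesis unfolding X_expand[of g v] by (simp add: scaleR_sum_right)
  qed
  from this[of "grad \<phi> x" "grad_matrix u x $ i"] show ?thesis by (simp add: wd) (simp add: grad_def partial_def)
 qed
 then have "(LBINT x. X (grad \<phi> x) (grad_matrix u x $ i)) =
   (\<Sum>a\<in>UNIV. \<Sum>b\<in>UNIV. LBINT x. (?p a x * ?q b x) *\<^sub>R X (axis a 1) (axis b 1))"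
  using int by (simp add: Bochner_Integration.integral_sum integrable_sum)
 also have "\<dots> = (\<Sum>a\<in>UNIV. \<Sum>b\<in>UNIV. (LBINT x. ?p a x * ?q b x) *\<^sub>R X (axis a 1) (axis b 1))"
 proof -
  have i: "integrable lborel (\<lambda>x. ?p a x * ?q b x)" for a b
   by (rule integrable_compact_support[OF _ K(1)])
    (auto intro!: continuous_intros C1_deriv_continuous[OF c1] C1_deriv_continuous[OF w] simp: C1_compact_deriv[OF c1 K])
  show ?thesis by (intro sum.cong refl integral_scaleR_left i)
 qed
 finally have S: "(LBINT x. X (grad \<phi> x) (grad_matrix u x $ i)) = \<dots>" .
 define I where "I a b = (LBINT x. ?p a x * ?q b x)" for a b
 have sym: "I a b = I b a" for a b unfolding I_def by (rule integral_deriv_deriv_swap[OF c2 K w L(1) w0])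
 let ?S = "\<Sum>a\<in>UNIV. \<Sum>b\<in>UNIV. I a b *\<^sub>R X (axis a 1) (axis b 1)"
 have "?S = (\<Sum>a\<in>UNIV. \<Sum>b\<in>UNIV. I b a *\<^sub>R X (axis b 1) (axis a 1))"
  by (rule sum.swap)
 also have "\<dots> = (\<Sum>a\<in>UNIV. \<Sum>b\<in>UNIV. I a b *\<^sub>R - X (axis a 1) (axis b 1))"
  by (intro sum.cong refl arg_cong2[where f=scaleR] sym X_antisym)
 also have "\<dots> = - ?S" by (simp add: sum_negf)
 finally have "2 *\<^sub>R ?S = 0" unfolding scaleR_2 by (simp only: eq_neg_iff_add_eq_0)
 then have "?S = 0" by simp
 then show ?thesis unfolding S I_def .
qed

end

section \<open>The lower bound\<close>

lemma ennreal_liminf_add_le: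
 fixes f g :: "nat \<Rightarrow> ennreal"
 assumes "a \<le> liminf f" "b \<le> liminf g"
 shows "a + b \<le> liminf (\<lambda>n. f n + g n)"
proof -
 have "a + b \<le> liminf f + liminf g" using assms by (rule add_mono)
 also have "\<dots> = (SUP n. (INF m\<in>{n..}. f m) + (INF m\<in>{n..}. g m))"
  unfolding liminf_SUP_INF by (rule ennreal_SUP_add[symmetric]) (auto intro!: monoI INF_superset_mono)
 also have "\<dots> \<le> liminf (\<lambda>n. f n + g n)"
  unfolding liminf_SUP_INF by (intro SUP_mono' INF_greatest add_mono INF_lower) auto
 finally show ?thesis .
qed

lemma ennreal_liminf_cmult_le:
 fixes f :: "nat \<Rightarrow> ennreal"
 assumes "a \<le> liminf f"
 shows "c * a \<le> liminf (\<lambda>n. c * f n)"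
proof -
 have "c * a \<le> c * liminf f" using assms by (rule mult_left_mono) simp
 also have "\<dots> \<le> liminf (\<lambda>n. c * f n)"
  unfolding liminf_SUP_INF SUP_mult_left_ennreal by (intro SUP_mono' INF_greatest mult_left_mono INF_lower) auto
 finally show ?thesis .
qed

lemma L2_rep_sequence:
 fixes u :: "nat \<Rightarrow> 'a::euclidean_space \<Rightarrow> 'b::euclidean_space"
 assumes "open \<Omega>" "bounded \<Omega>" "\<And>n. u n \<in> L2 \<Omega>"
 obtains u' where "\<And>n. L2_rep \<Omega> (u n) (u' n)"
proof -
 have "\<exists>F. L2_rep \<Omega> (u n) F" for n using L2_rep_exists[OF assms, of n] by blast
 then show ?thesis using that by metis
qed

lemma L2_strong_lim_rep:
 fixes u :: "nat \<Rightarrow> 'a::euclidean_space \<Rightarrow> 'b::euclidean_space"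
 assumes \<Omega>: "open \<Omega>" and u: "\<And>n. u n \<in> L2 \<Omega>" "\<And>n. L2_rep \<Omega> (u n) (u' n)"
  and v: "v \<in> L2 \<Omega>" "L2_rep \<Omega> v v'" and lim: "L2_strong_lim \<Omega> u v"
 shows "(\<lambda>n. sqn \<Omega> (\<lambda>x. u' n x - v' x)) \<longlonglongrightarrow> 0"
proof -
 note [measurable] = L2_rep_D(2)[OF u(2)] L2_rep_D(2)[OF v(2)]
 have \<Omega>b[measurable]: "\<Omega> \<in> sets borel" using \<Omega> by simp
 have "sqn \<Omega> (\<lambda>x. u' n x - v' x) = ennreal (\<integral>x. (norm (u n x - v x))\<^sup>2 \<partial>lebesgue_on \<Omega>)" for n
 proof -
  have d: "L2c (\<lambda>x. u' n x - v' x)" by (intro L2c_diff L2_rep_D(1)[OF u(2)] L2_rep_D(1)[OF v(2)])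
  have 0: "u' n x - v' x = 0" if "x \<notin> \<Omega>" for x using that by (simp add: L2_rep_D(3)[OF u(2)] L2_rep_D(3)[OF v(2)])
  have s: "sqn \<Omega> (\<lambda>x. u' n x - v' x) = (NNINT x. ennreal ((norm (u' n x - v' x))\<^sup>2))"
   using sqn_UNIV_eq[OF 0] by (simp add: sqn_def)
  have i: "integrable lborel (\<lambda>x. (norm (u' n x - v' x))\<^sup>2)"
   using d by (auto simp: L2c_def sqn_def intro!: integrableI_bounded)
  have "(\<integral>x. (norm (u n x - v x))\<^sup>2 \<partial>lebesgue_on \<Omega>) = (LBINT x. (norm (u' n x - v' x))\<^sup>2)"
  proof (rule integral_lebesgue_on_rep[OF \<Omega>b])
   show "(\<lambda>x. (norm (u n x - v x))\<^sup>2) \<in> borel_measurable (lebesgue_on \<Omega>)"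
    using L2_measurable[OF u(1)[of n]] L2_measurable[OF v(1)] by measurable
   show "AE x in lebesgue_on \<Omega>. (norm (u n x - v x))\<^sup>2 = (norm (u' n x - v' x))\<^sup>2"
    using L2_rep_D(4)[OF u(2)[of n]] L2_rep_D(4)[OF v(2)] by eventually_elim simp
  qed (use 0 in auto)
  then show ?thesis unfolding s using nn_integral_eq_integral[OF i] by simp
 qed
 moreover have "(\<lambda>n. ennreal (\<integral>x. (norm (u n x - v x))\<^sup>2 \<partial>lebesgue_on \<Omega>)) \<longlonglongrightarrow> ennreal 0"
  using lim unfolding L2_strong_lim_def by (intro tendsto_ennrealI)
 ultimately show ?thesis by simp
qed

text \<open>On a bounded set the square integral controls the integral: t \<le> \<delta> +
  t^2/\<delta>. The threshold q depends on neither v nor F, so it may be fixed before the functions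
  are chosen.\<close>

lemma integral_small:
 assumes \<Omega>: "open \<Omega>" "bounded \<Omega>" and C0: "C \<ge> 0" and e: "e > 0"
 obtains q where "q > 0" "\<And>(v::'a::euclidean_space \<Rightarrow> 'b::euclidean_space) (F::'a \<Rightarrow> 'c::euclidean_space).
  v \<in> borel_measurable borel \<Longrightarrow> (\<And>x. x \<notin> \<Omega> \<Longrightarrow> v x = 0) \<Longrightarrow> (\<And>x. norm (F x) \<le> C * norm (v x)) \<Longrightarrow>
  sqn \<Omega> v \<le> ennreal q \<Longrightarrow> norm (LBINT x. F x) < e"
proof -
 have [measurable]: "\<Omega> \<in> sets borel" using \<Omega> by simp
 define V where "V = measure lborel \<Omega>"
 have V: "emeasure lborel \<Omega> = ennreal V" "V \<ge> 0"
  using emeasure_bounded_lt_top[OF \<Omega>(2)] by (simp_all add: V_def emeasure_eq_ennreal_measure)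
 define \<delta> where "\<delta> = e / (2 * (C * V + 1))"
 have D0: "C * V + 1 > 0" using C0 V by (simp add: add_nonneg_pos)
 have \<delta>: "\<delta> > 0" using e D0 by (simp add: \<delta>_def)
 have cancel: "e / (2 * a) * a = e / 2" if "a > 0" for a :: real using that by simp
 have CV: "C * \<delta> * V < e / 2"
 proof -
  have "C * \<delta> * V < \<delta> * (C * V + 1)" using \<delta> by (simp add: algebra_simps)
  also have "\<dots> = e / 2" unfolding \<delta>_def by (rule cancel[OF D0])
  finally show ?thesis .
 qed
 define q where "q = e * \<delta> / (2 * (C + 1))"
 have q: "q > 0" using e \<delta> C0 by (simp add: q_def)
 have Cq: "C / \<delta> * q \<le> e / 2"
 proof -
  have "C / \<delta> * q = (e / 2) * (C / (C + 1))" using \<delta> by (simp add: q_def)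
  also have "\<dots> \<le> (e / 2) * 1" using e C0 by (intro mult_left_mono) auto
  finally show ?thesis by simp
 qed
 show ?thesis
 proof (rule that[OF q])
  fix v :: "'a \<Rightarrow> 'b" and F :: "'a \<Rightarrow> 'c"
  assume [measurable]: "v \<in> borel_measurable borel" and 0: "\<And>x. x \<notin> \<Omega> \<Longrightarrow> v x = 0"
   and F: "\<And>x. norm (F x) \<le> C * norm (v x)" and vq: "sqn \<Omega> v \<le> ennreal q"
  have "ennreal (norm (LBINT x. F x)) \<le> (NNINT x. ennreal (norm (F x)))"
   by (rule norm_integral_le_nn)
  also have "\<dots> \<le> (NNINT x. ennreal (C * \<delta>) * indicator \<Omega> x + ennreal (C / \<delta>) * (ennreal ((norm (v x))\<^sup>2) * indicator \<Omega> x))"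
  proof (rule nn_integral_mono)
   fix x
   show "ennreal (norm (F x)) \<le> ennreal (C * \<delta>) * indicator \<Omega> x + ennreal (C / \<delta>) * (ennreal ((norm (v x))\<^sup>2) * indicator \<Omega> x)"
   proof (cases "x \<in> \<Omega>")
    case True
    have "t \<le> \<delta> + t\<^sup>2 / \<delta>" for t :: real
    proof (cases "t \<le> \<delta>")
     case False
     then have "t * \<delta> \<le> t * t" using \<delta> by (intro mult_left_mono) auto
     then have "t \<le> t\<^sup>2 / \<delta>" using \<delta> by (simp add: field_simps power2_eq_square)
     then show ?thesis using \<delta> by linarith
    qed (use \<delta> in \<open>simp add: add_increasing2\<close>)
    from mult_left_mono[OF this C0, of "norm (v x)"] have "norm (F x) \<le> C * (\<delta> + (norm (v x))\<^sup>2 / \<delta>)"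
     using F[of x] by linarith
    then have "ennreal (norm (F x)) \<le> ennreal (C * \<delta> + C / \<delta> * (norm (v x))\<^sup>2)"
     by (intro ennreal_leI) (simp add: distrib_left)
    also have "\<dots> = ennreal (C * \<delta>) + ennreal (C / \<delta>) * ennreal ((norm (v x))\<^sup>2)"
     using C0 \<delta> by (simp add: ennreal_plus[symmetric] ennreal_mult[symmetric] del: ennreal_plus)
    finally show ?thesis using True by simp
   qed (use F[of x] 0[of x] in simp)
  qed
  also have "\<dots> = ennreal (C * \<delta>) * ennreal V + ennreal (C / \<delta>) * sqn \<Omega> v"
   by (simp add: nn_integral_add nn_integral_cmult nn_integral_cmult_indicator sqn_def V(1))
  also have "\<dots> \<le> ennreal (C * \<delta>) * ennreal V + ennreal (C / \<delta>) * ennreal q"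
   using vq by (intro add_left_mono mult_left_mono) auto
  also have "\<dots> = ennreal (C * \<delta> * V + C / \<delta> * q)"
   using C0 \<delta> V q by (simp add: ennreal_plus[symmetric] ennreal_mult[symmetric] del: ennreal_plus)
  finally have "norm (LBINT x. F x) \<le> C * \<delta> * V + C / \<delta> * q"
   using C0 \<delta> V q by (subst (asm) ennreal_le_iff) auto
  then show "norm (LBINT x. F x) < e" using CV Cq by linarith
 qed
qed

lemma integral_tendsto_0:
 fixes v :: "nat \<Rightarrow> 'a::euclidean_space \<Rightarrow> 'b::euclidean_space" and F :: "nat \<Rightarrow> 'a \<Rightarrow> 'c::euclidean_space"
 assumes \<Omega>: "open \<Omega>" "bounded \<Omega>" and v: "\<And>n. v n \<in> borel_measurable borel" and 0: "\<And>n x. x \<notin> \<Omega> \<Longrightarrow> v n x = 0"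
  and lim: "(\<lambda>n. sqn \<Omega> (v n)) \<longlonglongrightarrow> 0" and F: "\<And>n x. norm (F n x) \<le> C * norm (v n x)" and C: "C \<ge> 0"
 shows "(\<lambda>n. LBINT x. F n x) \<longlonglongrightarrow> 0"
proof (rule LIMSEQ_I)
 fix e :: real assume "e > 0"
 from integral_small[where ?'b='b and ?'c='c, OF \<Omega> C this] obtain q where q: "q > 0" "\<And>(v::'a \<Rightarrow> 'b) (F::'a \<Rightarrow> 'c).
  v \<in> borel_measurable borel \<Longrightarrow> (\<And>x. x \<notin> \<Omega> \<Longrightarrow> v x = 0) \<Longrightarrow> (\<And>x. norm (F x) \<le> C * norm (v x)) \<Longrightarrow>
  sqn \<Omega> v \<le> ennreal q \<Longrightarrow> norm (LBINT x. F x) < e" by metis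
 have "eventually (\<lambda>n. sqn \<Omega> (v n) < ennreal q) sequentially"
  using lim q(1) by (intro order_tendstoD(2)) auto
 then obtain N where N: "\<And>n. n \<ge> N \<Longrightarrow> sqn \<Omega> (v n) < ennreal q" by (auto simp: eventually_sequentially)
 have "norm (LBINT x. F n x) < e" if "n \<ge> N" for n
  by (rule q(2)[OF v[of n] 0[of _ n] F[of n]]) (use N[OF that] in auto)
 then show "\<exists>N. \<forall>n\<ge>N. norm ((LBINT x. F n x) - 0) < e" by auto
qed

lemma strong_imp_weak:
 fixes v :: "nat \<Rightarrow> 'a::euclidean_space \<Rightarrow> 'b::euclidean_space"
 assumes \<Omega>: "open \<Omega>" "bounded \<Omega>" and v: "\<And>n. v n \<in> borel_measurable borel" and 0: "\<And>n x. x \<notin> \<Omega> \<Longrightarrow> v n x = 0"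
  and lim: "(\<lambda>n. sqn \<Omega> (v n)) \<longlonglongrightarrow> 0" and C: "\<And>x. \<bar>\<psi> x\<bar> \<le> (C::real)"
 shows "(\<lambda>n. LBINT x. \<psi> x *\<^sub>R v n x) \<longlonglongrightarrow> 0"
proof (rule integral_tendsto_0[OF \<Omega> v 0 lim])
 show "C \<ge> 0" using C[of 0] by linarith
qed (auto intro!: mult_right_mono C)

context curl_product
begin

text \<open>It reduces the distributional curl to finitely many integrals of B against bounded
  scalar weights, to which the weak convergence statement for representatives applies.\<close>

lemma integral_X_grad_expand:
 fixes B :: "real^'n \<Rightarrow> real^'n^'n"
 assumes \<phi>: "\<phi> \<in> Cinf_compact \<Omega>" and B: "L2c B"
 shows "(LBINT x. X (grad \<phi> x) (B x $ i)) = (\<Sum>a\<in>UNIV. X (axis a 1) ((LBINT x. partial a \<phi> x *\<^sub>R B x) $ i))"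
proof -
 have int: "integrable lborel (\<lambda>x. partial a \<phi> x *\<^sub>R B x)" for a
 proof -
  obtain M where M: "\<And>x. norm (frechet_derivative \<phi> (at x) (axis a 1)) \<le> M"
   using C1_compact_deriv_bounded[OF Cinf_compactD(2)[OF \<phi>], of "axis a 1"] by metis
  show ?thesis
   unfolding partial_def
   by (rule L2c_integrable_mult[OF B borel_measurable_continuous_onI[OF C1_deriv_continuous[OF Cinf_compactD(1)[OF \<phi>]]]])
    (use M in simp)
 qed
 have bl: "bounded_linear (\<lambda>A::real^'n^'n. X (axis a 1) (A $ i))" for a
  using bounded_linear_compose[OF bounded_bilinear.bounded_linear_right[OF X] bounded_linear_vec_nth] .
 have "X (grad \<phi> x) (B x $ i) = (\<Sum>a\<in>UNIV. X (axis a 1) ((partial a \<phi> x *\<^sub>R B x) $ i))" for x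
  unfolding X_expand[of "grad \<phi> x"] by (simp add: grad_def bounded_bilinear.scaleR_right[OF X])
 then have "(LBINT x. X (grad \<phi> x) (B x $ i)) = (\<Sum>a\<in>UNIV. LBINT x. X (axis a 1) ((partial a \<phi> x *\<^sub>R B x) $ i))"
  using integrable_bounded_linear[OF bl int] by (simp add: Bochner_Integration.integral_sum)
 also have "\<dots> = (\<Sum>a\<in>UNIV. X (axis a 1) ((LBINT x. partial a \<phi> x *\<^sub>R B x) $ i))"
  by (intro sum.cong refl integral_bounded_linear[OF bl int])
 finally show ?thesis .
qed

end

locale energy_setting = curl_product X Y
 for X :: "real^'n \<Rightarrow> real^'n \<Rightarrow> 'c::euclidean_space" and Y :: "'c \<Rightarrow> real^'n \<Rightarrow> real^'n" +
 fixes \<Omega> :: "(real^'n) set" and \<epsilon> \<xi> C :: real and W :: "real \<Rightarrow> real"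
 assumes open_domain: "open \<Omega>" and bounded_domain: "bounded \<Omega>" and eps: "\<epsilon> > 0" and xi: "\<xi> > 0"
  and W_cont: "continuous_on {0..} W" and W_nonneg: "\<And>x. x \<ge> 0 \<Longrightarrow> W x \<ge> 0" and C: "C > 0"
  and W_lower: "\<And>x. x \<ge> 0 \<Longrightarrow> (1 / C) * x\<^sup>2 - C \<le> W x" and W_upper: "\<And>x. x \<ge> 0 \<Longrightarrow> W x \<le> C * (1 + x\<^sup>2)"
begin

sublocale integrand "\<lambda>\<eta>::real^'n^'n. W (norm \<eta>)" C
proof
 show "continuous_on UNIV (\<lambda>\<eta>::real^'n^'n. W (norm \<eta>))"
  by (rule continuous_on_compose2[OF W_cont]) (auto intro!: continuous_intros)
qed (auto simp: W_nonneg W_upper C)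

definition s where "s = \<epsilon> * \<xi>"

lemma s_pos: "s > 0" using eps xi by (simp add: s_def)

lemma coefficients: "\<epsilon> * \<xi>\<^sup>2 > 0" "1 / (\<epsilon> * \<xi>\<^sup>2) > 0" using eps xi by auto

lemma \<Omega>_borel [measurable]: "\<Omega> \<in> sets borel" using open_domain by simp

lemma \<Omega>_measure: obtains V where "emeasure lborel \<Omega> = ennreal V" "V \<ge> 0"
 using emeasure_bounded_lt_top[OF bounded_domain]
 by (intro that[of "measure lborel \<Omega>"]) (simp_all add: emeasure_eq_ennreal_measure)

definition well :: "(real^'n \<Rightarrow> real^'n) \<Rightarrow> ennreal" where
 "well k = (NNINT x:\<Omega>. ennreal ((norm (k x) - 1)\<^sup>2 / (\<epsilon> * \<xi>\<^sup>2)))"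

text \<open>Once the chosen gradient and curl are replaced by Borel representatives, the integrand
  splits into four measurable nonnegative parts that can be treated one by one.\<close>

lemma energy_functional_rep:
 assumes [measurable]: "\<Phi> \<in> borel_measurable borel"
  and k: "L2_rep \<Omega> k k'" and G: "L2_rep \<Omega> (weak_gradient \<Omega> k) G'"
  and B: "L2_rep \<Omega> B B'" and c: "L2_rep \<Omega> (weak_curl X \<Omega> B) c'"
 shows "energy_functional X \<Omega> \<epsilon> \<xi> \<Phi> k B = well k' + sqn \<Omega> (\<lambda>x. G' x - B' x) + ennreal (\<epsilon> * \<xi>\<^sup>2) * sqn \<Omega> c'
  + ennreal (1 / (\<epsilon> * \<xi>\<^sup>2)) * (NNINT x:\<Omega>. \<Phi> (B' x))"
proof -
 note [measurable] = L2_rep_D(2)[OF k] L2_rep_D(2)[OF G] L2_rep_D(2)[OF B] L2_rep_D(2)[OF c]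
 have "energy_functional X \<Omega> \<epsilon> \<xi> \<Phi> k B = (\<integral>\<^sup>+x. ennreal ((norm (k' x) - 1)\<^sup>2 / (\<epsilon> * \<xi>\<^sup>2) + (norm (G' x - B' x))\<^sup>2
   + \<epsilon> * \<xi>\<^sup>2 * (norm (c' x))\<^sup>2) + ennreal (1 / (\<epsilon> * \<xi>\<^sup>2)) * \<Phi> (B' x) \<partial>lebesgue_on \<Omega>)"
  unfolding energy_functional_def
 proof (rule nn_integral_cong_AE)
  show "AE x in lebesgue_on \<Omega>. ennreal ((norm (k x) - 1)\<^sup>2 / (\<epsilon> * \<xi>\<^sup>2) + (norm (weak_gradient \<Omega> k x - B x))\<^sup>2
    + \<epsilon> * \<xi>\<^sup>2 * (norm (weak_curl X \<Omega> B x))\<^sup>2) + ennreal (1 / (\<epsilon> * \<xi>\<^sup>2)) * \<Phi> (B x) =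
   ennreal ((norm (k' x) - 1)\<^sup>2 / (\<epsilon> * \<xi>\<^sup>2) + (norm (G' x - B' x))\<^sup>2
    + \<epsilon> * \<xi>\<^sup>2 * (norm (c' x))\<^sup>2) + ennreal (1 / (\<epsilon> * \<xi>\<^sup>2)) * \<Phi> (B' x)"
   using L2_rep_D(4)[OF k] L2_rep_D(4)[OF G] L2_rep_D(4)[OF B] L2_rep_D(4)[OF c] by eventually_elim simp
 qed
 also have "\<dots> = (NNINT x. ennreal ((norm (k' x) - 1)\<^sup>2 / (\<epsilon> * \<xi>\<^sup>2)) * indicator \<Omega> x + ennreal ((norm (G' x - B' x))\<^sup>2) * indicator \<Omega> x
   + ennreal (\<epsilon> * \<xi>\<^sup>2) * (ennreal ((norm (c' x))\<^sup>2) * indicator \<Omega> x) + ennreal (1 / (\<epsilon> * \<xi>\<^sup>2)) * (\<Phi> (B' x) * indicator \<Omega> x))"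
  unfolding nn_integral_lebesgue_on[OF \<Omega>_borel]
  using coefficients by (intro nn_integral_cong) (auto simp: indicator_def ennreal_mult)
 also have "\<dots> = well k' + sqn \<Omega> (\<lambda>x. G' x - B' x) + ennreal (\<epsilon> * \<xi>\<^sup>2) * sqn \<Omega> c'
  + ennreal (1 / (\<epsilon> * \<xi>\<^sup>2)) * (NNINT x:\<Omega>. \<Phi> (B' x))"
  by (simp add: nn_integral_add nn_integral_cmult sqn_def well_def)
 finally show ?thesis .
qed

lemma W_norm_measurable: "(\<lambda>\<eta>::real^'n^'n. ennreal (W (norm (s *\<^sub>R \<eta>)))) \<in> borel_measurable borel"
proof -
 have "(\<lambda>\<eta>::real^'n^'n. W (norm (s *\<^sub>R \<eta>))) \<in> borel_measurable borel"
  by (intro borel_measurable_continuous_onI continuous_on_compose2[OF W_cont]) (auto intro!: continuous_intros)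
 then show ?thesis by measurable
qed

lemma energy_eq: "energy X \<Omega> \<epsilon> \<xi> W = energy_functional X \<Omega> \<epsilon> \<xi> (\<lambda>\<eta>. ennreal (W (norm (s *\<^sub>R \<eta>))))"
 using s_pos by (simp add: energy_def[abs_def] s_def)

text \<open>The reverse triangle inequality transfers L^2 closeness of k_n and k to their norms, and
  Young's inequality compares the two integrals up to a factor 1 + \<tau>. This term is not convex
  in k, so strong convergence is essential.\<close>

lemma well_lsc:
 assumes k[measurable]: "k \<in> borel_measurable borel" "\<And>n. kn n \<in> borel_measurable borel"
  and lim: "(\<lambda>n. sqn \<Omega> (\<lambda>x. kn n x - k x)) \<longlonglongrightarrow> 0" and fin: "liminf (\<lambda>n. well (kn n)) < \<infinity>"
 shows "well k \<le> liminf (\<lambda>n. well (kn n))"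
proof (rule ennreal_le_of_approx[OF fin])
 fix \<tau> :: real assume \<tau>: "0 < \<tau>" "\<tau> < 1"
 define D where "D = (1 + 1 / \<tau>) / (\<epsilon> * \<xi>\<^sup>2)"
 have D: "D > 0" using \<tau> coefficients by (simp add: D_def add_pos_pos)
 have le: "well k \<le> ennreal (1 + \<tau>) * well (kn n) + ennreal D * sqn \<Omega> (\<lambda>x. kn n x - k x)" for n
 proof -
  have "well k \<le> (NNINT x. ennreal (1 + \<tau>) * (ennreal ((norm (kn n x) - 1)\<^sup>2 / (\<epsilon> * \<xi>\<^sup>2)) * indicator \<Omega> x)
    + ennreal D * (ennreal ((norm (kn n x - k x))\<^sup>2) * indicator \<Omega> x))"
   unfolding well_def
  proof (rule nn_integral_mono)
   fix x
   have "(norm (k x) - 1)\<^sup>2 \<le> (1 + \<tau>) * (norm (kn n x) - 1)\<^sup>2 + (1 + 1 / \<tau>) * (norm (k x) - norm (kn n x))\<^sup>2"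
    using norm_sq_split[OF \<tau>(1), of "norm (k x) - 1" "norm (kn n x) - 1"] by simp
   also have "\<dots> \<le> (1 + \<tau>) * (norm (kn n x) - 1)\<^sup>2 + (1 + 1 / \<tau>) * (norm (kn n x - k x))\<^sup>2"
   proof (intro add_left_mono mult_left_mono)
    have "\<bar>norm (k x) - norm (kn n x)\<bar> \<le> norm (kn n x - k x)"
     using norm_triangle_ineq3[of "k x" "kn n x"] by (simp add: norm_minus_commute)
    then show "(norm (k x) - norm (kn n x))\<^sup>2 \<le> (norm (kn n x - k x))\<^sup>2" by (simp add: abs_le_square_iff[symmetric])
   qed (use \<tau> in simp)
   finally have "(norm (k x) - 1)\<^sup>2 / (\<epsilon> * \<xi>\<^sup>2) \<le> ((1 + \<tau>) * (norm (kn n x) - 1)\<^sup>2 + (1 + 1 / \<tau>) * (norm (kn n x - k x))\<^sup>2) / (\<epsilon> * \<xi>\<^sup>2)"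
    using coefficients(1) by (intro divide_right_mono) auto
   also have "\<dots> = (1 + \<tau>) * ((norm (kn n x) - 1)\<^sup>2 / (\<epsilon> * \<xi>\<^sup>2)) + D * (norm (kn n x - k x))\<^sup>2"
   proof -
    have "(p * a + q * b) / d = p * (a / d) + q / d * b" for p q a b d :: real by (simp add: add_divide_distrib)
    then show ?thesis unfolding D_def .
   qed
   finally have "ennreal ((norm (k x) - 1)\<^sup>2 / (\<epsilon> * \<xi>\<^sup>2)) \<le> ennreal ((1 + \<tau>) * ((norm (kn n x) - 1)\<^sup>2 / (\<epsilon> * \<xi>\<^sup>2)) + D * (norm (kn n x - k x))\<^sup>2)"
    by (rule ennreal_leI)
   also have "\<dots> = ennreal (1 + \<tau>) * ennreal ((norm (kn n x) - 1)\<^sup>2 / (\<epsilon> * \<xi>\<^sup>2)) + ennreal D * ennreal ((norm (kn n x - k x))\<^sup>2)"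
   proof -
    have "ennreal ((1 + \<tau>) * a + D * b) = ennreal (1 + \<tau>) * ennreal a + ennreal D * ennreal b" if "a \<ge> 0" "b \<ge> 0" for a b
     using \<tau> D that by (simp add: ennreal_mult[symmetric] ennreal_plus[symmetric] del: ennreal_plus)
    from this[OF divide_nonneg_pos[OF _ coefficients(1)]] show ?thesis by simp
   qed
   finally show "ennreal ((norm (k x) - 1)\<^sup>2 / (\<epsilon> * \<xi>\<^sup>2)) * indicator \<Omega> x \<le> ennreal (1 + \<tau>) * (ennreal ((norm (kn n x) - 1)\<^sup>2 / (\<epsilon> * \<xi>\<^sup>2)) * indicator \<Omega> x)
    + ennreal D * (ennreal ((norm (kn n x - k x))\<^sup>2) * indicator \<Omega> x)"
    by (cases "x \<in> \<Omega>") simp_all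
  qed
  also have "\<dots> = ennreal (1 + \<tau>) * well (kn n) + ennreal D * sqn \<Omega> (\<lambda>x. kn n x - k x)"
   by (simp add: nn_integral_add nn_integral_cmult sqn_def well_def)
  finally show ?thesis .
 qed
 have "eventually (\<lambda>n. sqn \<Omega> (\<lambda>x. kn n x - k x) < ennreal (\<tau> / D)) sequentially"
  using lim \<tau> D by (intro order_tendstoD(2)) auto
 then have ev: "eventually (\<lambda>n. well k \<le> ennreal (1 + \<tau>) * well (kn n) + ennreal \<tau>) sequentially"
 proof eventually_elim
  case (elim n)
  have "ennreal D * sqn \<Omega> (\<lambda>x. kn n x - k x) \<le> ennreal D * ennreal (\<tau> / D)" using elim by (intro mult_left_mono) auto
  also have "\<dots> = ennreal \<tau>" using D \<tau> by (simp add: ennreal_mult[symmetric])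
  finally show ?case using le[of n] by (meson add_left_mono order_trans)
 qed
 have "well k \<le> liminf (\<lambda>n. ennreal (1 + \<tau>) * well (kn n) + ennreal \<tau>)" by (rule Liminf_bounded[OF ev])
 also have "\<dots> = liminf (\<lambda>n. ennreal (1 + \<tau>) * well (kn n)) + ennreal \<tau>" by (rule Liminf_add_const) auto
 also have "liminf (\<lambda>n. ennreal (1 + \<tau>) * well (kn n)) = ennreal (1 + \<tau>) * liminf (\<lambda>n. well (kn n))"
 proof -
  have "continuous_on UNIV (\<lambda>x. ennreal (1 + \<tau>) * x)"
   by (auto simp: continuous_on_def intro!: ennreal_tendsto_cmult tendsto_ident_at)
  from Liminf_compose_continuous_mono[OF this _ sequentially_bot] show ?thesis
   by (simp add: monoI mult_left_mono)
 qed
 finally show "well k \<le> ennreal (1 + \<tau>) * liminf (\<lambda>n. well (kn n)) + ennreal \<tau>" .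
qed

text \<open>The lower growth bound solved for the square: |B|^2 \<le> C W(|B|) + C^2.\<close>

lemma sqn_le_coercive:
 assumes [measurable]: "B \<in> borel_measurable borel" and V: "emeasure lborel \<Omega> = ennreal V" "V \<ge> 0"
  and M: "(NNINT x:\<Omega>. ennreal (W (norm (B x :: real^'n^'n)))) \<le> ennreal M" "M \<ge> 0"
 shows "sqn \<Omega> B \<le> ennreal (C * M + C * C * V)"
proof -
 note [measurable] = borel_measurable_continuous_onI[OF cont]
 have "sqn \<Omega> B \<le> (NNINT x. ennreal C * (ennreal (W (norm (B x))) * indicator \<Omega> x) + ennreal (C * C) * indicator \<Omega> x)"
  unfolding sqn_def
 proof (rule nn_integral_mono)
  fix x
  have "(norm (B x))\<^sup>2 \<le> C * W (norm (B x)) + C * C"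
   using W_lower[of "norm (B x)"] C by (simp add: field_simps)
  then have "ennreal ((norm (B x))\<^sup>2) \<le> ennreal (C * W (norm (B x)) + C * C)" by (rule ennreal_leI)
  also have "\<dots> = ennreal C * ennreal (W (norm (B x))) + ennreal (C * C)"
   using C W_nonneg[of "norm (B x)"] by (simp add: ennreal_mult)
  finally show "ennreal ((norm (B x))\<^sup>2) * indicator \<Omega> x \<le> ennreal C * (ennreal (W (norm (B x))) * indicator \<Omega> x) + ennreal (C * C) * indicator \<Omega> x"
   by (cases "x \<in> \<Omega>") simp_all
 qed
 also have "\<dots> = ennreal C * (NNINT x:\<Omega>. ennreal (W (norm (B x)))) + ennreal (C * C) * ennreal V"
  by (simp add: nn_integral_add nn_integral_cmult nn_integral_cmult_indicator V(1))
 also have "\<dots> \<le> ennreal C * ennreal M + ennreal (C * C) * ennreal V"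
  using M by (intro add_right_mono mult_left_mono) auto
 also have "\<dots> = ennreal (C * M + C * C * V)"
  using C M V by (simp add: ennreal_mult[symmetric] ennreal_plus[symmetric] del: ennreal_plus)
 finally show ?thesis .
qed

text \<open>Superadditivity of liminf allows the four terms to be treated separately. The energy
  bound controls the curls and, by coercivity, the fields B_n. Gradients and curls need no
  compactness: their limits are identified against test functions from those of k_n and B_n, and
  that is all that \<open>sqn_lsc\<close> asks for.\<close>

lemma lower_bound_of_bounded:
 assumes k: "k \<in> W12 \<Omega>" and B: "B \<in> Hcurl X \<Omega>" and kn: "\<And>n. kn n \<in> W12 \<Omega>" and Bn: "\<And>n. Bn n \<in> Hcurl X \<Omega>"
  and sl: "L2_strong_lim \<Omega> kn k" and wl: "L2_weak_lim \<Omega> Bn B"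
  and M: "\<And>n. energy X \<Omega> \<epsilon> \<xi> W (kn n) (Bn n) \<le> ennreal M" "M \<ge> 0"
 shows "energy_functional X \<Omega> \<epsilon> \<xi> (\<lambda>\<eta>. Z (s *\<^sub>R \<eta>)) k B \<le> liminf (\<lambda>n. energy X \<Omega> \<epsilon> \<xi> W (kn n) (Bn n))"
proof -
 note od = open_domain bounded_domain

 \<comment> \<open>Representatives and bounds on the single terms\<close>
 obtain k' where k': "L2_rep \<Omega> k k'" using L2_rep_exists[OF od weak_gradient_works(1)[OF k]] by blast
 obtain G' where G': "L2_rep \<Omega> (weak_gradient \<Omega> k) G'" using L2_rep_exists[OF od weak_gradient_works(2)[OF k]] by blast
 obtain B' where B': "L2_rep \<Omega> B B'" using L2_rep_exists[OF od weak_curl_works(1)[OF B]] by blast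
 obtain c' where c': "L2_rep \<Omega> (weak_curl X \<Omega> B) c'" using L2_rep_exists[OF od weak_curl_works(2)[OF B]] by blast
 obtain kj where kj: "\<And>n. L2_rep \<Omega> (kn n) (kj n)" using L2_rep_sequence[where u=kn, OF od weak_gradient_works(1)[OF kn]] by blast
 obtain Gj where Gj: "\<And>n. L2_rep \<Omega> (weak_gradient \<Omega> (kn n)) (Gj n)"
  using L2_rep_sequence[where u="\<lambda>n. weak_gradient \<Omega> (kn n)", OF od weak_gradient_works(2)[OF kn]] by blast
 obtain Bj where Bj: "\<And>n. L2_rep \<Omega> (Bn n) (Bj n)" using L2_rep_sequence[where u=Bn, OF od weak_curl_works(1)[OF Bn]] by blast
 obtain cj where cj: "\<And>n. L2_rep \<Omega> (weak_curl X \<Omega> (Bn n)) (cj n)"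
  using L2_rep_sequence[where u="\<lambda>n. weak_curl X \<Omega> (Bn n)", OF od weak_curl_works(2)[OF Bn]] by blast
 note [measurable] = L2_rep_D(2)[OF k'] L2_rep_D(2)[OF G'] L2_rep_D(2)[OF B'] L2_rep_D(2)[OF c']
  L2_rep_D(2)[OF kj] L2_rep_D(2)[OF Gj] L2_rep_D(2)[OF Bj] L2_rep_D(2)[OF cj]
 define F where "F n = (NNINT x:\<Omega>. ennreal (W (norm (s *\<^sub>R Bj n x))))" for n
 define c0 where "c0 = 1 / (\<epsilon> * \<xi>\<^sup>2)"
 have c0: "c0 > 0" using coefficients by (simp add: c0_def)
 have E: "energy X \<Omega> \<epsilon> \<xi> W (kn n) (Bn n) = well (kj n) + sqn \<Omega> (\<lambda>x. Gj n x - Bj n x) + ennreal (\<epsilon> * \<xi>\<^sup>2) * sqn \<Omega> (cj n) + ennreal c0 * F n" for n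
  unfolding energy_eq energy_functional_rep[OF W_norm_measurable kj Gj Bj cj] F_def c0_def by (rule refl)
 have E_well: "well (kj n) \<le> ennreal M" and E_c: "ennreal (\<epsilon> * \<xi>\<^sup>2) * sqn \<Omega> (cj n) \<le> ennreal M" and E_F: "ennreal c0 * F n \<le> ennreal M" for n
 proof -
  have le: "a + b + c + d \<le> m \<Longrightarrow> a \<le> m \<and> c \<le> m \<and> d \<le> m" for a b c d m :: ennreal
   by (meson add_increasing add_increasing2 order_trans order_refl zero_le)
  from le[OF M(1)[of n, unfolded E]] show "well (kj n) \<le> ennreal M" "ennreal (\<epsilon> * \<xi>\<^sup>2) * sqn \<Omega> (cj n) \<le> ennreal M"
   "ennreal c0 * F n \<le> ennreal M" by auto
 qed
 have divide: "x \<le> ennreal (M / a)" if "ennreal a * x \<le> ennreal M" "a > 0" for x a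
 proof -
  have "x = ennreal (1 / a) * (ennreal a * x)" using that(2) by (simp add: mult.assoc[symmetric] ennreal_mult[symmetric])
  also have "\<dots> \<le> ennreal (1 / a) * ennreal M" using that(1) by (intro mult_left_mono) auto
  also have "\<dots> = ennreal (M / a)" using that(2) M(2) by (simp add: ennreal_mult[symmetric])
  finally show ?thesis .
 qed

 \<comment> \<open>The term in k and the limits of B_n and k_n\<close>
 have well_le: "well k' \<le> liminf (\<lambda>n. well (kj n))"
 proof (rule well_lsc)
  show "(\<lambda>n. sqn \<Omega> (\<lambda>x. kj n x - k' x)) \<longlonglongrightarrow> 0"
   by (rule L2_strong_lim_rep[OF open_domain weak_gradient_works(1)[OF kn] kj weak_gradient_works(1)[OF k] k' sl])
  have "liminf (\<lambda>n. well (kj n)) \<le> ennreal M" by (rule Liminf_le) (auto simp: E_well)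
  then show "liminf (\<lambda>n. well (kj n)) < \<infinity>" using ennreal_less_top[of M] by (simp add: le_less_trans)
 qed auto
 have B_lim: "(\<lambda>n. LBINT x. \<psi> x *\<^sub>R Bj n x) \<longlonglongrightarrow> (LBINT x. \<psi> x *\<^sub>R B' x)"
  if "\<psi> \<in> borel_measurable borel" "\<And>x. \<bar>\<psi> x\<bar> \<le> (D::real)" for \<psi> D
  by (rule L2_weak_lim_rep[OF od weak_curl_works(1)[OF Bn] Bj weak_curl_works(1)[OF B] B' wl that])
 have k_lim: "(\<lambda>n. LBINT x. \<psi> x *\<^sub>R kj n x) \<longlonglongrightarrow> (LBINT x. \<psi> x *\<^sub>R k' x)"
  if \<psi>: "\<psi> \<in> borel_measurable borel" "\<And>x. \<bar>\<psi> x\<bar> \<le> (D::real)" for \<psi> D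
 proof -
  have "(\<lambda>n. LBINT x. \<psi> x *\<^sub>R (kj n x - k' x)) \<longlonglongrightarrow> 0"
   by (rule strong_imp_weak[OF od _ _ _ \<psi>(2)])
    (auto simp: L2_rep_D(3)[OF kj] L2_rep_D(3)[OF k'] L2_strong_lim_rep[OF open_domain weak_gradient_works(1)[OF kn] kj weak_gradient_works(1)[OF k] k' sl])
  then have "(\<lambda>n. (LBINT x. \<psi> x *\<^sub>R kj n x) - (LBINT x. \<psi> x *\<^sub>R k' x)) \<longlonglongrightarrow> 0"
   unfolding scaleR_diff_right
   using Bochner_Integration.integral_diff[OF L2c_integrable_mult[OF L2_rep_D(1)[OF kj] \<psi>] L2c_integrable_mult[OF L2_rep_D(1)[OF k'] \<psi>]]
   by simp
  then show ?thesis by (simp add: LIM_zero_iff)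
 qed
 have partial: "partial a \<phi> \<in> borel_measurable borel" "\<exists>D. \<forall>x. \<bar>partial a \<phi> x\<bar> \<le> D" if \<phi>: "\<phi> \<in> Cinf_compact \<Omega>" for a and \<phi> :: "real^'n \<Rightarrow> real"
 proof -
  show "partial a \<phi> \<in> borel_measurable borel"
   unfolding partial_def by (rule borel_measurable_continuous_onI[OF C1_deriv_continuous[OF Cinf_compactD(1)[OF \<phi>]]])
  obtain D where "\<And>x. norm (frechet_derivative \<phi> (at x) (axis a 1)) \<le> D"
   using C1_compact_deriv_bounded[OF Cinf_compactD(2)[OF \<phi>], of "axis a 1"] by metis
  then show "\<exists>D. \<forall>x. \<bar>partial a \<phi> x\<bar> \<le> D" unfolding partial_def real_norm_def by blast
 qed

 \<comment> \<open>The gradient term\<close>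
 have G_lim: "(\<lambda>n. LBINT x. \<phi> x *\<^sub>R Gj n x) \<longlonglongrightarrow> (LBINT x. \<phi> x *\<^sub>R G' x)" if \<phi>: "\<phi> \<in> Cinf_compact \<Omega>" for \<phi>
 proof (intro vec_tendstoI)
  fix i j :: 'n
  obtain D where D: "\<phi> \<in> borel_measurable borel" "\<And>x. \<bar>\<phi> x\<bar> \<le> D" using Cinf_compact_test[OF \<phi>] by blast
  obtain D' where D': "\<And>x. \<bar>partial j \<phi> x\<bar> \<le> D'" using partial(2)[OF \<phi>] by blast
  have eq: "(LBINT x. \<phi> x *\<^sub>R H x) $ i $ j = - ((LBINT x. partial j \<phi> x *\<^sub>R h x) $ i)"
   if h: "g \<in> W12 \<Omega>" "L2_rep \<Omega> g h" "L2_rep \<Omega> (weak_gradient \<Omega> g) H" for g h H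
  proof -
   have "(LBINT x. H x $ i $ j * \<phi> x) = - (LBINT x. h x $ i * partial j \<phi> x)"
    using weak_gradient_works(3)[OF h(1)] \<phi>
    unfolding has_weak_gradient_rep[OF open_domain weak_gradient_works(1)[OF h(1)] h(2) weak_gradient_works(2)[OF h(1)] h(3)] by blast
   then show ?thesis
    unfolding integral_test_matrix[OF L2_rep_D(1)[OF h(3)] D] integral_test_vec[OF L2_rep_D(1)[OF h(2)] partial(1)[OF \<phi>] D']
    by (simp add: mult.commute)
  qed
  show "(\<lambda>n. (LBINT x. \<phi> x *\<^sub>R Gj n x) $ i $ j) \<longlonglongrightarrow> (LBINT x. \<phi> x *\<^sub>R G' x) $ i $ j"
   unfolding eq[OF kn kj Gj] eq[OF k k' G']
   by (intro tendsto_intros k_lim[OF partial(1)[OF \<phi>] D'])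
 qed
 have "sqn \<Omega> (\<lambda>x. G' x - B' x) \<le> liminf (\<lambda>n. sqn \<Omega> (\<lambda>x. Gj n x - Bj n x))"
 proof (rule sqn_lsc[OF open_domain])
  fix \<phi> :: "real^'n \<Rightarrow> real" assume \<phi>: "\<phi> \<in> Cinf_compact \<Omega>"
  obtain D where D: "\<phi> \<in> borel_measurable borel" "\<And>x. \<bar>\<phi> x\<bar> \<le> D" using Cinf_compact_test[OF \<phi>] by blast
  have d: "(LBINT x. \<phi> x *\<^sub>R (H x - H' x)) = (LBINT x. \<phi> x *\<^sub>R H x) - (LBINT x. \<phi> x *\<^sub>R H' x)"
   if "L2c H" "L2c H'" for H H' :: "real^'n \<Rightarrow> real^'n^'n"
   unfolding scaleR_diff_right by (intro Bochner_Integration.integral_diff L2c_integrable_mult[OF _ D] that)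
  show "(\<lambda>n. LBINT x. \<phi> x *\<^sub>R (Gj n x - Bj n x)) \<longlonglongrightarrow> (LBINT x. \<phi> x *\<^sub>R (G' x - B' x))"
   unfolding d[OF L2_rep_D(1)[OF Gj] L2_rep_D(1)[OF Bj]] d[OF L2_rep_D(1)[OF G'] L2_rep_D(1)[OF B']]
   by (intro tendsto_diff G_lim[OF \<phi>] B_lim[OF D])
 qed (intro L2c_diff L2_rep_D(1)[OF G'] L2_rep_D(1)[OF B'] L2_rep_D(1)[OF Gj] L2_rep_D(1)[OF Bj])+
 note gradient_le = this

 \<comment> \<open>The curl term\<close>
 have curl_eq: "(LBINT x. \<phi> x *\<^sub>R (h x $ i)) = - (LBINT x. X (grad \<phi> x) (H x $ i))"
  if "\<phi> \<in> Cinf_compact \<Omega>" "g \<in> Hcurl X \<Omega>" "L2_rep \<Omega> g H" "L2_rep \<Omega> (weak_curl X \<Omega> g) h" for \<phi> g H h i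
  using weak_curl_works(3)[OF that(2)] that(1)
  unfolding has_weak_curl_rep[OF open_domain weak_curl_works(1)[OF that(2)] that(3) weak_curl_works(2)[OF that(2)] that(4)] by blast
 have curl_le: "sqn \<Omega> c' \<le> liminf (\<lambda>n. sqn \<Omega> (cj n))"
 proof (rule sqn_lsc[OF open_domain L2_rep_D(1)[OF c'] L2_rep_D(1)[OF cj]])
  fix \<phi> :: "real^'n \<Rightarrow> real" assume \<phi>: "\<phi> \<in> Cinf_compact \<Omega>"
  obtain D where D: "\<phi> \<in> borel_measurable borel" "\<And>x. \<bar>\<phi> x\<bar> \<le> D" using Cinf_compact_test[OF \<phi>] by blast
  show "(\<lambda>n. LBINT x. \<phi> x *\<^sub>R cj n x) \<longlonglongrightarrow> (LBINT x. \<phi> x *\<^sub>R c' x)"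
  proof (rule vec_tendstoI)
   fix i :: 'n
   have lim: "(\<lambda>n. LBINT x. partial a \<phi> x *\<^sub>R Bj n x) \<longlonglongrightarrow> (LBINT x. partial a \<phi> x *\<^sub>R B' x)" for a
    using partial[OF \<phi>, of a] B_lim by blast
   show "(\<lambda>n. (LBINT x. \<phi> x *\<^sub>R cj n x) $ i) \<longlonglongrightarrow> (LBINT x. \<phi> x *\<^sub>R c' x) $ i"
    unfolding integral_test_vec[OF L2_rep_D(1)[OF cj] D] integral_test_vec[OF L2_rep_D(1)[OF c'] D]
     curl_eq[OF \<phi> Bn Bj cj] curl_eq[OF \<phi> B B' c']
     integral_X_grad_expand[OF \<phi> L2_rep_D(1)[OF Bj]] integral_X_grad_expand[OF \<phi> L2_rep_D(1)[OF B']]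
    by (intro tendsto_minus tendsto_sum bounded_bilinear.tendsto[OF X] tendsto_const tendsto_vec_nth lim)
  qed
 qed

 \<comment> \<open>The term with the envelope\<close>
 obtain V where V: "emeasure lborel \<Omega> = ennreal V" "V \<ge> 0" by (rule \<Omega>_measure)
 define A1 where "A1 = C * (M / c0) + C * C * V"
 have A1: "A1 \<ge> 0" using C M(2) c0 V by (simp add: A1_def)
 have sBj: "sqn \<Omega> (\<lambda>x. s *\<^sub>R Bj n x) \<le> ennreal A1" for n
  unfolding A1_def
 proof (rule sqn_le_coercive[OF _ V])
  show "(NNINT x:\<Omega>. ennreal (W (norm (s *\<^sub>R Bj n x)))) \<le> ennreal (M / c0)"
   using divide[OF E_F c0] unfolding F_def .
 qed (use M(2) c0 in auto)
 have fin: "\<exists>a\<ge>0. sqn \<Omega> H \<le> ennreal a" if "L2c H" for H :: "real^'n \<Rightarrow> 'e::euclidean_space"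
 proof -
  have "sqn \<Omega> H \<le> sqn UNIV H" by (rule sqn_mono) simp
  also have "\<dots> < \<infinity>" using that by (simp add: L2c_def)
  finally show ?thesis by (intro exI[of _ "enn2real (sqn \<Omega> H)"]) (simp add: less_top)
 qed
 obtain A2 where A2: "A2 \<ge> 0" "sqn \<Omega> (\<lambda>x. s *\<^sub>R B' x) \<le> ennreal A2" using fin[OF L2c_scaleR[OF L2_rep_D(1)[OF B']]] by blast
 obtain A3 where A3: "A3 \<ge> 0" "sqn \<Omega> c' \<le> ennreal A3" using fin[OF L2_rep_D(1)[OF c']] by blast
 define A4 where "A4 = M / (\<epsilon> * \<xi>\<^sup>2)"
 have A4: "A4 \<ge> 0" "\<And>n. sqn \<Omega> (cj n) \<le> ennreal A4"
  using M(2) coefficients divide[OF E_c coefficients(1)] by (auto simp: A4_def)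
 define A where "A = 2 * A1 + 2 * A2 + s\<^sup>2 * (2 * A4 + 2 * A3)"
 have A: "A \<ge> 0" "A2 \<le> A" "2 * A1 + 2 * A2 \<le> A" "s\<^sup>2 * (2 * A4 + 2 * A3) \<le> A"
  using A1 A2(1) A3(1) A4(1) by (auto simp: A_def add_increasing add_increasing2)
 \<comment> \<open>The fields are multiplied by s = \<epsilon> \<xi> because the integrand is
   evaluated there; \<open>w n\<close> is the weak curl of \<open>v n\<close>, so the pair fits the
   gradient decomposition.\<close>
 define v where "v n x = s *\<^sub>R Bj n x - s *\<^sub>R B' x" for n x
 define w where "w n x = s *\<^sub>R (cj n x - c' x)" for n x
 have v: "L2c (v n)" for n
  unfolding v_def[abs_def] by (intro L2c_diff L2c_scaleR L2_rep_D(1)[OF Bj] L2_rep_D(1)[OF B'])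
 have w: "L2c (w n)" for n
  unfolding w_def[abs_def] by (intro L2c_diff L2c_scaleR L2_rep_D(1)[OF cj] L2_rep_D(1)[OF c'])
 have sq2: "2 * ennreal a + 2 * ennreal b = ennreal (2 * a + 2 * b)" if "a \<ge> 0" "b \<ge> 0" for a b
  using that ennreal_mult[of 2 a] ennreal_mult[of 2 b] by (simp add: ennreal_plus)
 have vA: "sqn \<Omega> (v n) \<le> ennreal A" for n
 proof -
  have "sqn \<Omega> (v n) \<le> 2 * sqn \<Omega> (\<lambda>x. s *\<^sub>R Bj n x) + 2 * sqn \<Omega> (\<lambda>x. s *\<^sub>R B' x)"
   unfolding v_def[abs_def] by (rule sqn_diff_le) auto
  also have "\<dots> \<le> 2 * ennreal A1 + 2 * ennreal A2" by (intro add_mono mult_left_mono sBj A2(2)) auto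
  also have "\<dots> = ennreal (2 * A1 + 2 * A2)" by (rule sq2[OF A1 A2(1)])
  also have "\<dots> \<le> ennreal A" using A by (intro ennreal_leI)
  finally show ?thesis .
 qed
 have wA: "sqn \<Omega> (w n) \<le> ennreal A" for n
 proof -
  have "sqn \<Omega> (w n) = ennreal (s\<^sup>2) * sqn \<Omega> (\<lambda>x. cj n x - c' x)"
   unfolding w_def[abs_def] by (rule sqn_scaleR) auto
  also have "\<dots> \<le> ennreal (s\<^sup>2) * (2 * sqn \<Omega> (cj n) + 2 * sqn \<Omega> c')"
   by (intro mult_left_mono sqn_diff_le) auto
  also have "\<dots> \<le> ennreal (s\<^sup>2) * (2 * ennreal A4 + 2 * ennreal A3)"
   by (intro add_mono mult_left_mono A4(2) A3(2)) auto
  also have "\<dots> = ennreal (s\<^sup>2 * (2 * A4 + 2 * A3))"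
   unfolding sq2[OF A4(1) A3(1)] using A3(1) A4(1) by (intro ennreal_mult[symmetric]) auto
  also have "\<dots> \<le> ennreal A" using A by (intro ennreal_leI)
  finally show ?thesis .
 qed
 have v0: "v n x = 0" and w0: "w n x = 0" if "x \<notin> \<Omega>" for n x
  using that by (simp_all add: v_def w_def L2_rep_D(3)[OF Bj] L2_rep_D(3)[OF B'] L2_rep_D(3)[OF cj] L2_rep_D(3)[OF c'])
 have "(NNINT x:\<Omega>. Z (s *\<^sub>R B' x)) \<le> liminf (\<lambda>n. NNINT x:\<Omega>. ennreal (W (norm (s *\<^sub>R Bj n x))))"
 proof (rule lower_semicontinuity[OF od, of _ _ A])
  show "sqn \<Omega> (\<lambda>x. s *\<^sub>R B' x) \<le> ennreal A" using A2(2) A(2) by (meson ennreal_leI order_trans)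
  show "sqn \<Omega> (\<lambda>x. s *\<^sub>R Bj n x - s *\<^sub>R B' x) \<le> ennreal A" for n using vA[of n] by (simp add: v_def[abs_def])
  fix K :: "(real^'n) set" and \<tau> :: real assume K: "compact K" "K \<subseteq> \<Omega>" and \<tau>: "\<tau> > 0"
  have "\<exists>N. \<forall>n\<ge>N. \<exists>u. cont_diff 1 u \<and> sqn K u \<le> ennreal \<tau> \<and> sqn K (\<lambda>x. v n x - grad_matrix u x) \<le> ennreal \<tau>"
  proof (rule gradient_decomposition[OF od v w _ _ A(1) _ _ K \<tau>])
   show "sqn UNIV (v n) \<le> ennreal A" for n using vA[of n] sqn_UNIV_eq[of \<Omega> "v n", OF v0] by simp
   show "sqn UNIV (w n) \<le> ennreal A" for n using wA[of n] sqn_UNIV_eq[of \<Omega> "w n", OF w0] by simp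
   show "(LBINT z. \<phi> z *\<^sub>R (w n z $ i)) = - (LBINT z. X (grad \<phi> z) (v n z $ i))" if \<phi>: "\<phi> \<in> Cinf_compact \<Omega>" for n \<phi> i
   proof -
    obtain D where D: "\<phi> \<in> borel_measurable borel" "\<And>x. \<bar>\<phi> x\<bar> \<le> D" using Cinf_compact_test[OF \<phi>] by blast
    have i1: "integrable lborel (\<lambda>z. \<phi> z *\<^sub>R (h z $ i))" if "L2c h" for h :: "real^'n \<Rightarrow> 'c^'n"
     using integral_vec_nth(2)[OF L2c_integrable_mult[OF that D], of i] by simp
    have 1: "(LBINT z. \<phi> z *\<^sub>R (w n z $ i)) = s *\<^sub>R ((LBINT z. \<phi> z *\<^sub>R (cj n z $ i)) - (LBINT z. \<phi> z *\<^sub>R (c' z $ i)))"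
    proof -
     have "(LBINT z. \<phi> z *\<^sub>R (w n z $ i)) = (LBINT z. s *\<^sub>R (\<phi> z *\<^sub>R (cj n z $ i) - \<phi> z *\<^sub>R (c' z $ i)))"
      by (intro Bochner_Integration.integral_cong refl) (simp add: w_def algebra_simps)
     then show ?thesis
      using Bochner_Integration.integral_diff[OF i1[OF L2_rep_D(1)[OF cj]] i1[OF L2_rep_D(1)[OF c']]] by simp
    qed
    have 2: "(LBINT z. X (grad \<phi> z) (v n z $ i)) = s *\<^sub>R ((LBINT z. X (grad \<phi> z) (Bj n z $ i)) - (LBINT z. X (grad \<phi> z) (B' z $ i)))"
    proof -
     have "(LBINT x. partial a \<phi> x *\<^sub>R v n x) = s *\<^sub>R ((LBINT x. partial a \<phi> x *\<^sub>R Bj n x) - (LBINT x. partial a \<phi> x *\<^sub>R B' x))" for a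
     proof -
      obtain D' where D': "\<And>x. \<bar>partial a \<phi> x\<bar> \<le> D'" using partial(2)[OF \<phi>] by blast
      have "(LBINT x. partial a \<phi> x *\<^sub>R v n x) = (LBINT x. s *\<^sub>R (partial a \<phi> x *\<^sub>R Bj n x - partial a \<phi> x *\<^sub>R B' x))"
       by (intro Bochner_Integration.integral_cong refl) (simp add: v_def algebra_simps)
      then show ?thesis
       using Bochner_Integration.integral_diff[OF L2c_integrable_mult[OF L2_rep_D(1)[OF Bj] partial(1)[OF \<phi>] D']
         L2c_integrable_mult[OF L2_rep_D(1)[OF B'] partial(1)[OF \<phi>] D']] by simp
     qed
     then show ?thesis
      unfolding integral_X_grad_expand[OF \<phi> v] integral_X_grad_expand[OF \<phi> L2_rep_D(1)[OF Bj]] integral_X_grad_expand[OF \<phi> L2_rep_D(1)[OF B']]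
      by (simp add: bounded_bilinear.diff_right[OF X] bounded_bilinear.scaleR_right[OF X] sum_subtractf scaleR_sum_right scaleR_diff_right)
    qed
    show ?thesis unfolding 1 2 curl_eq[OF \<phi> Bn Bj cj] curl_eq[OF \<phi> B B' c'] by (simp add: scaleR_diff_right)
   qed
   show "(\<lambda>n. LBINT x. \<psi> x *\<^sub>R v n x) \<longlonglongrightarrow> 0" if \<psi>: "\<psi> \<in> borel_measurable borel" "\<And>x. \<bar>\<psi> x\<bar> \<le> (D::real)" for \<psi> D
   proof -
    have "(LBINT x. \<psi> x *\<^sub>R v n x) = s *\<^sub>R ((LBINT x. \<psi> x *\<^sub>R Bj n x) - (LBINT x. \<psi> x *\<^sub>R B' x))" for n
    proof -
     have "(LBINT x. \<psi> x *\<^sub>R v n x) = (LBINT x. s *\<^sub>R (\<psi> x *\<^sub>R Bj n x - \<psi> x *\<^sub>R B' x))"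
      by (intro Bochner_Integration.integral_cong refl) (simp add: v_def algebra_simps)
     then show ?thesis
      using Bochner_Integration.integral_diff[OF L2c_integrable_mult[OF L2_rep_D(1)[OF Bj] \<psi>] L2c_integrable_mult[OF L2_rep_D(1)[OF B'] \<psi>]] by simp
    qed
    moreover have "(\<lambda>n. s *\<^sub>R ((LBINT x. \<psi> x *\<^sub>R Bj n x) - (LBINT x. \<psi> x *\<^sub>R B' x))) \<longlonglongrightarrow> s *\<^sub>R 0"
     using LIM_zero[OF B_lim[OF \<psi>]] by (intro tendsto_scaleR tendsto_const)
    ultimately show ?thesis by simp
   qed
  qed
  then show "\<exists>N. \<forall>n\<ge>N. \<exists>u. cont_diff 1 u \<and> sqn K u \<le> ennreal \<tau> \<and> sqn K (\<lambda>x. (s *\<^sub>R Bj n x - s *\<^sub>R B' x) - grad_matrix u x) \<le> ennreal \<tau>"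
   unfolding v_def .
 qed (use A in auto)
 then have Z_le: "(NNINT x:\<Omega>. Z (s *\<^sub>R B' x)) \<le> liminf F" by (simp add: F_def[abs_def])
 have [measurable]: "(\<lambda>\<eta>. Z (s *\<^sub>R \<eta>)) \<in> borel_measurable borel" by measurable
 show ?thesis
  unfolding E energy_functional_rep[OF \<open>(\<lambda>\<eta>. Z (s *\<^sub>R \<eta>)) \<in> borel_measurable borel\<close> k' G' B' c'] c0_def[symmetric]
  by (intro ennreal_liminf_add_le ennreal_liminf_cmult_le well_le gradient_le curl_le Z_le)
qed

end

section \<open>The upper bound\<close>

lemma C1_compact_scaleR:
 assumes "\<phi> \<in> C1_compact S"
 shows "(\<lambda>x. a *\<^sub>R \<phi> x) \<in> C1_compact S"
proof -
 obtain K where K: "compact K" "K \<subseteq> S" "\<And>x. x \<notin> K \<Longrightarrow> \<phi> x = 0" using C1_compactE[OF assms] by blast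
 have "compact_support_in S (\<lambda>x. a *\<^sub>R \<phi> x)" by (rule compact_support_inI[OF K(1,2)]) (simp add: K(3))
 then show ?thesis
  unfolding C1_compact_iff using cont_diff_bounded_linear[OF bounded_linear_scaleR_right C1_compactD(1)[OF assms]] by blast
qed

lemma integral_grad_matrix_by_parts:
 fixes u :: "real^'n \<Rightarrow> real^'d"
 assumes u: "u \<in> C1_compact \<Omega>" and g: "cont_diff 1 g"
 shows "(LBINT x. grad_matrix u x $ i $ j * g x) = - (LBINT x. u x $ i * partial j g x)"
proof -
 note cu = C1_compactD(1)[OF u]
 obtain K where K: "compact K" "\<And>x. x \<notin> K \<Longrightarrow> u x = 0" using C1_compactE[OF u] by metis
 have c: "cont_diff 1 (\<lambda>x. u x $ i)" by (rule cont_diff_bounded_linear[OF bounded_linear_vec_nth cu])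
 have "grad_matrix u x $ i $ j = frechet_derivative (\<lambda>x. u x $ i) (at x) (axis j 1)" for x
 proof -
  have "((\<lambda>x. u x $ i) has_derivative (\<lambda>h. frechet_derivative u (at x) h $ i)) (at x)"
   by (rule bounded_linear.has_derivative[OF bounded_linear_vec_nth C1_has_derivative[OF cu]])
  from fun_cong[OF frechet_derivative_at[OF this], of "axis j 1"] show ?thesis by (simp add: grad_matrix_def partial_def)
 qed
 then show ?thesis using integral_by_parts[OF c K(1) _ g, of "axis j 1"] K(2) by (simp add: partial_def)
qed

lemma sqn_tendsto_0:
 fixes u :: "nat \<Rightarrow> 'a::euclidean_space \<Rightarrow> 'b::euclidean_space"
 assumes \<Omega>: "open \<Omega>" "bounded \<Omega>" and u: "\<And>n x. norm (u n x) \<le> t n" and t: "t \<longlonglongrightarrow> 0"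
 shows "(\<lambda>n. sqn \<Omega> (u n)) \<longlonglongrightarrow> 0"
proof -
 have [measurable]: "\<Omega> \<in> sets borel" using \<Omega> by simp
 have fin: "emeasure lborel \<Omega> < \<infinity>" by (rule emeasure_bounded_lt_top[OF \<Omega>(2)])
 have le: "sqn \<Omega> (u n) \<le> ennreal ((t n)\<^sup>2) * emeasure lborel \<Omega>" for n
 proof -
  have "sqn \<Omega> (u n) \<le> (NNINT x:\<Omega>. ennreal ((t n)\<^sup>2))"
   unfolding sqn_def using u by (intro nn_integral_mono mult_right_mono ennreal_leI power_mono) auto
  then show ?thesis by (simp add: nn_integral_cmult_indicator)
 qed
 have "(\<lambda>n. (t n)\<^sup>2) \<longlonglongrightarrow> 0" using tendsto_power[OF t, of 2] by simp
 then have "(\<lambda>n. ennreal ((t n)\<^sup>2)) \<longlonglongrightarrow> 0" using tendsto_ennrealI by fastforce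
 then have "(\<lambda>n. emeasure lborel \<Omega> * ennreal ((t n)\<^sup>2)) \<longlonglongrightarrow> emeasure lborel \<Omega> * 0"
  using fin by (intro ennreal_tendsto_cmult) auto
 then have "(\<lambda>n. ennreal ((t n)\<^sup>2) * emeasure lborel \<Omega>) \<longlonglongrightarrow> 0" by (simp add: mult.commute)
 from tendsto_sandwich[OF _ _ tendsto_const this, of "\<lambda>n. sqn \<Omega> (u n)"] le show ?thesis by simp
qed

text \<open>For smooth weights the derivative moves to the weight, and uniform smallness of u_n
  suffices. A general weight is mollified first; the bound M on the gradients makes the replacement
  error small uniformly in n.\<close>

lemma grad_weakly_null:
 fixes u :: "nat \<Rightarrow> real^'n \<Rightarrow> real^'d"
 assumes \<Omega>: "open \<Omega>" "bounded \<Omega>" and u: "\<And>n. u n \<in> C1_compact \<Omega>" "\<And>n x. norm (u n x) \<le> t n"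
  "\<And>n x. norm (grad_matrix (u n) x) \<le> M" and t: "t \<longlonglongrightarrow> 0" and \<psi>: "L2c \<psi>"
 shows "(\<lambda>n. LBINT x. grad_matrix (u n) x \<bullet> \<psi> x) \<longlonglongrightarrow> 0"
proof (rule LIMSEQ_I)
 note [measurable] = L2c_measurable[OF \<psi>]
 have \<Omega>b[measurable]: "\<Omega> \<in> sets borel" using \<Omega> by simp
 fix e :: real assume e: "e > 0"
 then have e2: "e / 2 > 0" by simp
 have "0 \<le> norm (grad_matrix (u 0) 0)" by simp
 also have "\<dots> \<le> M" by (rule u(3))
 finally have M: "M \<ge> 0" .
 obtain q where q: "q > 0" "\<And>(v::real^'n \<Rightarrow> real^'n^'d) (F::real^'n \<Rightarrow> real).
  v \<in> borel_measurable borel \<Longrightarrow> (\<And>x. x \<notin> \<Omega> \<Longrightarrow> v x = 0) \<Longrightarrow> (\<And>x. norm (F x) \<le> M * norm (v x)) \<Longrightarrow>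
  sqn \<Omega> v \<le> ennreal q \<Longrightarrow> norm (LBINT x. F x) < e / 2"
  using integral_small[where ?'b="real^'n^'d" and ?'c=real, OF \<Omega> M e2] by metis
 obtain s0 where s0: "s0 > 0" "\<And>s. 0 < s \<Longrightarrow> s \<le> s0 \<Longrightarrow> sqn \<Omega> (\<lambda>x. mollify s \<psi> x - \<psi> x) \<le> ennreal q"
  using mollify_tendsto[OF \<psi> \<Omega>b \<Omega>(2) q(1)] by metis
 define g where "g = mollify s0 \<psi>"
 have cg: "cont_diff 1 g" unfolding g_def by (rule cont_diff_mollify[OF s0(1) L2c_integrable[OF \<psi>]])
 have [measurable]: "g \<in> borel_measurable borel" by (rule cont_diff_measurable[OF cg])
 have gq: "sqn \<Omega> (\<lambda>x. g x - \<psi> x) \<le> ennreal q" unfolding g_def using s0 by simp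
 have grad_int: "integrable lborel (\<lambda>x. grad_matrix (u n) x \<bullet> g x)"
  and "integrable lborel (\<lambda>x. grad_matrix (u n) x $ i $ j * g x $ i $ j)" for n i j
 proof -
  obtain K where K: "compact K" "\<And>x. x \<notin> K \<Longrightarrow> u n x = 0" using C1_compactE[OF u(1)] by metis
  note c = C1_compactD(1)[OF u(1)[of n]]
  show "integrable lborel (\<lambda>x. grad_matrix (u n) x \<bullet> g x)"
   "integrable lborel (\<lambda>x. grad_matrix (u n) x $ i $ j * g x $ i $ j)"
   by (rule integrable_compact_support[OF _ K(1)],
    auto intro!: continuous_intros continuous_grad_matrix[OF c] cont_diff_continuous[OF cg] simp: grad_matrix_eq_0[OF c K])+
 qed
 note grad_int_nth = this(2)
 have sq: "(\<lambda>n. sqn \<Omega> (u n)) \<longlonglongrightarrow> 0" by (rule sqn_tendsto_0[OF \<Omega> u(2) t])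
 have um: "u n \<in> borel_measurable borel" for n
  by (rule cont_diff_measurable[OF C1_compactD(1)[OF u(1)]])
 have "(\<lambda>n. LBINT x. grad_matrix (u n) x $ i $ j * g x $ i $ j) \<longlonglongrightarrow> 0" for i j
 proof -
  have c: "cont_diff 1 (\<lambda>x. g x $ i $ j)"
   by (rule cont_diff_bounded_linear[OF bounded_linear_vec_nth cont_diff_bounded_linear[OF bounded_linear_vec_nth cg]])
  have "compact (closure \<Omega>)" using \<Omega>(2) by simp
  from compact_imp_bounded[OF compact_continuous_image[OF continuous_on_subset[OF C1_deriv_continuous[OF c, of "axis j 1"] subset_UNIV] this]]
  obtain D where D: "D > 0" "\<And>x. x \<in> closure \<Omega> \<Longrightarrow> \<bar>partial j (\<lambda>x. g x $ i $ j) x\<bar> \<le> D"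
   unfolding bounded_pos partial_def by auto
  have "(\<lambda>n. LBINT x. u n x $ i * partial j (\<lambda>x. g x $ i $ j) x) \<longlonglongrightarrow> 0"
  proof (rule integral_tendsto_0[OF \<Omega> um C1_compactD(2)[OF u(1)] sq])
   show "norm (u n x $ i * partial j (\<lambda>x. g x $ i $ j) x) \<le> D * norm (u n x)" for n x
   proof (cases "x \<in> \<Omega>")
    case True
    have "\<bar>u n x $ i\<bar> * \<bar>partial j (\<lambda>x. g x $ i $ j) x\<bar> \<le> norm (u n x) * D"
     using D(2)[of x] closure_subset[of \<Omega>] True by (intro mult_mono component_le_norm_cart) auto
    then show ?thesis by (simp add: abs_mult mult.commute)
   qed (simp add: C1_compactD(2)[OF u(1)])
  qed (use D in auto)
  from tendsto_minus[OF this] show ?thesis unfolding integral_grad_matrix_by_parts[OF u(1) c] by simp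
 qed
 then have "(\<lambda>n. \<Sum>i\<in>UNIV. \<Sum>j\<in>UNIV. LBINT x. grad_matrix (u n) x $ i $ j * g x $ i $ j) \<longlonglongrightarrow> (\<Sum>i\<in>(UNIV::'d set). \<Sum>j\<in>(UNIV::'n set). 0)"
  by (intro tendsto_sum)
 moreover have "(LBINT x. grad_matrix (u n) x \<bullet> g x) = (\<Sum>i\<in>UNIV. \<Sum>j\<in>UNIV. LBINT x. grad_matrix (u n) x $ i $ j * g x $ i $ j)" for n
  using grad_int_nth by (simp add: inner_vec_def Bochner_Integration.integral_sum integrable_sum)
 ultimately have "(\<lambda>n. LBINT x. grad_matrix (u n) x \<bullet> g x) \<longlonglongrightarrow> 0" by simp
 from LIMSEQ_D[OF this e2] obtain N where N: "\<And>n. n \<ge> N \<Longrightarrow> norm (LBINT x. grad_matrix (u n) x \<bullet> g x) < e / 2" by auto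
 show "\<exists>N. \<forall>n\<ge>N. norm ((LBINT x. grad_matrix (u n) x \<bullet> \<psi> x) - 0) < e"
 proof (intro exI allI impI)
  fix n assume n: "n \<ge> N"
  have gm: "grad_matrix (u n) \<in> borel_measurable borel" by (rule grad_matrix_measurable[OF C1_compactD(1)[OF u(1)]])
  note [measurable] = gm
  have CS: "norm (grad_matrix (u n) x \<bullet> y) \<le> M * norm y" for x y
   using Cauchy_Schwarz_ineq2[of "grad_matrix (u n) x" y] u(3)[of n x] mult_right_mono[OF u(3)[of n x], of "norm y"] by simp
  have int: "integrable lborel (\<lambda>x. grad_matrix (u n) x \<bullet> \<psi> x)"
  proof (rule Bochner_Integration.integrable_bound[of _ "\<lambda>x. M *\<^sub>R \<psi> x"])
   show "integrable lborel (\<lambda>x. M *\<^sub>R \<psi> x)" using L2c_integrable[OF \<psi>] by simp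
  qed (use CS M in auto)
  have 1: "norm (LBINT x. grad_matrix (u n) x \<bullet> (\<psi> x - g x)) < e / 2"
  proof (rule q(2)[of "\<lambda>x. indicator \<Omega> x *\<^sub>R (g x - \<psi> x)"])
   show "norm (grad_matrix (u n) x \<bullet> (\<psi> x - g x)) \<le> M * norm (indicator \<Omega> x *\<^sub>R (g x - \<psi> x))" for x
    using CS[of x "\<psi> x - g x"] by (cases "x \<in> \<Omega>") (auto simp: norm_minus_commute C1_compact_grad_0[OF u(1)])
   have "sqn \<Omega> (\<lambda>x. indicator \<Omega> x *\<^sub>R (g x - \<psi> x)) = sqn \<Omega> (\<lambda>x. g x - \<psi> x)"
    unfolding sqn_def by (intro nn_integral_cong) (simp add: indicator_def)
   then show "sqn \<Omega> (\<lambda>x. indicator \<Omega> x *\<^sub>R (g x - \<psi> x)) \<le> ennreal q" using gq by simp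
  qed auto
  have 2: "(LBINT x. grad_matrix (u n) x \<bullet> (\<psi> x - g x)) = (LBINT x. grad_matrix (u n) x \<bullet> \<psi> x) - (LBINT x. grad_matrix (u n) x \<bullet> g x)"
   unfolding inner_diff_right by (rule Bochner_Integration.integral_diff[OF int grad_int])
  have 3: "\<bar>a\<bar> < e" if "\<bar>a - b\<bar> < e / 2" "\<bar>b\<bar> < e / 2" for a b :: real using that by linarith
  show "norm ((LBINT x. grad_matrix (u n) x \<bullet> \<psi> x) - 0) < e"
   unfolding real_norm_def diff_zero by (rule 3[OF 1[unfolded 2 real_norm_def] N[OF n, unfolded real_norm_def]])
 qed
qed

lemma L2_rep_add:
 fixes F u :: "'a::euclidean_space \<Rightarrow> 'b::euclidean_space"
 assumes \<Omega>: "open \<Omega>" and F: "F \<in> L2 \<Omega>" "L2_rep \<Omega> F F'" and u: "L2c u" "\<forall>x. x \<notin> \<Omega> \<longrightarrow> u x = 0"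
 shows "L2_rep \<Omega> (\<lambda>x. F x + u x) (\<lambda>x. F' x + u x)" "(\<lambda>x. F x + u x) \<in> L2 \<Omega>"
proof -
 have "AE x in lebesgue_on \<Omega>. F x + u x = F' x + u x" using L2_rep_D(4)[OF F(2)] by eventually_elim simp
 then show r: "L2_rep \<Omega> (\<lambda>x. F x + u x) (\<lambda>x. F' x + u x)"
  using L2c_add[OF L2_rep_D(1)[OF F(2)] u(1)] u(2) L2_rep_D(3)[OF F(2)] by (simp add: L2_rep_def)
 show "(\<lambda>x. F x + u x) \<in> L2 \<Omega>"
  by (rule L2_of_rep[OF \<Omega> _ r]) (intro borel_measurable_add L2_measurable[OF F(1)] borel_lebesgue_on[OF L2c_measurable[OF u(1)]])
qed

lemma W12_add:
 fixes k u :: "real^'n \<Rightarrow> real^'d"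
 assumes \<Omega>: "open \<Omega>" "bounded \<Omega>" and k: "k \<in> W12 \<Omega>" "L2_rep \<Omega> (weak_gradient \<Omega> k) G'" and u: "u \<in> C1_compact \<Omega>"
 shows "(\<lambda>x. k x + u x) \<in> W12 \<Omega>" "L2_rep \<Omega> (weak_gradient \<Omega> (\<lambda>x. k x + u x)) (\<lambda>x. G' x + grad_matrix u x)"
proof -
 note w = weak_gradient_works[OF k(1)] and uL = L2c_C1_compact[OF \<Omega> u]
 obtain k' where k': "L2_rep \<Omega> k k'" using L2_rep_exists[OF \<Omega> w(1)] by blast
 have u0: "\<forall>x. x \<notin> \<Omega> \<longrightarrow> u x = 0" and g0: "\<forall>x. x \<notin> \<Omega> \<longrightarrow> grad_matrix u x = 0"
  using C1_compactD(2)[OF u] C1_compact_grad_0[OF u] by auto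
 note ku = L2_rep_add[OF \<Omega>(1) w(1) k' uL(1) u0]
 note Gu = L2_rep_add[OF \<Omega>(1) w(2) k(2) uL(2) g0]
 have "has_weak_gradient \<Omega> (\<lambda>x. k x + u x) (\<lambda>x. weak_gradient \<Omega> k x + grad_matrix u x)"
 proof (rule iffD2[OF has_weak_gradient_rep[OF \<Omega>(1) ku(2,1) Gu(2,1)]], intro ballI allI)
  fix \<phi> :: "real^'n \<Rightarrow> real" and i :: 'd and j :: 'n assume \<phi>: "\<phi> \<in> Cinf_compact \<Omega>"
  note c = Cinf_compactD(1)[OF \<phi>, of 1]
  obtain D where D: "\<phi> \<in> borel_measurable borel" "\<And>x. \<bar>\<phi> x\<bar> \<le> D" using Cinf_compact_test[OF \<phi>] by blast
  have pm: "partial j \<phi> \<in> borel_measurable borel"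
   unfolding partial_def by (rule borel_measurable_continuous_onI[OF C1_deriv_continuous[OF c]])
  obtain D' where D': "\<And>x. norm (frechet_derivative \<phi> (at x) (axis j 1)) \<le> D'"
   using C1_compact_deriv_bounded[OF Cinf_compactD(2)[OF \<phi>], of "axis j 1"] by metis
  then have pD: "\<bar>partial j \<phi> x\<bar> \<le> D'" for x unfolding partial_def by simp
  have i1: "integrable lborel (\<lambda>x. H x $ i $ j * \<phi> x)" if "L2c H" for H :: "real^'n \<Rightarrow> real^'n^'d"
   using integral_vec_nth(2)[OF integral_vec_nth(2)[OF L2c_integrable_mult[OF that D], of i], of j] by (simp add: mult.commute)
  have i2: "integrable lborel (\<lambda>x. h x $ i * partial j \<phi> x)" if "L2c h" for h :: "real^'n \<Rightarrow> real^'d"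
   using integral_vec_nth(2)[OF L2c_integrable_mult[OF that pm pD], of i] by (simp add: mult.commute)
  have "(LBINT x. G' x $ i $ j * \<phi> x) = - (LBINT x. k' x $ i * partial j \<phi> x)"
   using w(3) \<phi> unfolding has_weak_gradient_rep[OF \<Omega>(1) w(1) k' w(2) k(2)] by blast
  then show "(LBINT x. (G' x + grad_matrix u x) $ i $ j * \<phi> x) = - (LBINT x. (k' x + u x) $ i * partial j \<phi> x)"
   using integral_grad_matrix_by_parts[OF u c, of i j]
    Bochner_Integration.integral_add[OF i1[OF L2_rep_D(1)[OF k(2)]] i1[OF uL(2)]]
    Bochner_Integration.integral_add[OF i2[OF L2_rep_D(1)[OF k']] i2[OF uL(1)]]
   by (simp add: distrib_right)
 qed
 from weak_gradient_rep[OF \<Omega> ku(2) Gu(2,1) this]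
 show "(\<lambda>x. k x + u x) \<in> W12 \<Omega>" "L2_rep \<Omega> (weak_gradient \<Omega> (\<lambda>x. k x + u x)) (\<lambda>x. G' x + grad_matrix u x)" .
qed

context curl_product
begin

text \<open>The representative c' of the curl is literally unchanged, so the curl term of the energy
  is the same for B and for its perturbations.\<close>

lemma Hcurl_add_gradient:
 assumes \<Omega>: "open \<Omega>" "bounded \<Omega>" and B: "B \<in> Hcurl X \<Omega>" "L2_rep \<Omega> (weak_curl X \<Omega> B) c'" and u: "u \<in> C1_compact \<Omega>"
 shows "(\<lambda>x. B x + grad_matrix u x) \<in> Hcurl X \<Omega>" "L2_rep \<Omega> (weak_curl X \<Omega> (\<lambda>x. B x + grad_matrix u x)) c'"
proof -
 note w = weak_curl_works[OF B(1)] and uL = L2c_C1_compact[OF \<Omega> u]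
 obtain B' where B': "L2_rep \<Omega> B B'" using L2_rep_exists[OF \<Omega> w(1)] by blast
 have g0: "\<forall>x. x \<notin> \<Omega> \<longrightarrow> grad_matrix u x = 0" using C1_compact_grad_0[OF u] by blast
 note Bu = L2_rep_add[OF \<Omega>(1) w(1) B' uL(2) g0]
 have "has_weak_curl X \<Omega> (\<lambda>x. B x + grad_matrix u x) (weak_curl X \<Omega> B)"
 proof (rule iffD2[OF has_weak_curl_rep[OF \<Omega>(1) Bu(2,1) w(2) B(2)]], intro ballI allI)
  fix \<phi> :: "real^'n \<Rightarrow> real" and i :: 'n assume \<phi>: "\<phi> \<in> Cinf_compact \<Omega>"
  have int: "integrable lborel (\<lambda>x. X (grad \<phi> x) (H x $ i))" if H: "L2c H" for H :: "real^'n \<Rightarrow> real^'n^'n"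
  proof -
   have "integrable lborel (\<lambda>x. \<Sum>a\<in>UNIV. X (axis a 1) (partial a \<phi> x *\<^sub>R (H x $ i)))"
   proof (rule Bochner_Integration.integrable_sum)
    fix a :: 'n
    obtain D' where D': "\<And>x. norm (frechet_derivative \<phi> (at x) (axis a 1)) \<le> D'"
     using C1_compact_deriv_bounded[OF Cinf_compactD(2)[OF \<phi>], of "axis a 1"] by metis
    have "integrable lborel (\<lambda>x. partial a \<phi> x *\<^sub>R H x)"
     unfolding partial_def
     by (rule L2c_integrable_mult[OF H borel_measurable_continuous_onI[OF C1_deriv_continuous[OF Cinf_compactD(1)[OF \<phi>]]]])
      (use D' in simp)
    from integrable_bounded_linear[OF bounded_bilinear.bounded_linear_right[OF X] integral_vec_nth(2)[OF this, of i]]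
    show "integrable lborel (\<lambda>x. X (axis a 1) (partial a \<phi> x *\<^sub>R (H x $ i)))" by simp
   qed
   moreover have "X (grad \<phi> x) (H x $ i) = (\<Sum>a\<in>UNIV. X (axis a 1) (partial a \<phi> x *\<^sub>R (H x $ i)))" for x
    unfolding X_expand[of "grad \<phi> x"] by (simp add: grad_def bounded_bilinear.scaleR_right[OF X])
   ultimately show ?thesis by simp
  qed
  have "(LBINT x. \<phi> x *\<^sub>R (c' x $ i)) = - (LBINT x. X (grad \<phi> x) (B' x $ i))"
   using w(3) \<phi> unfolding has_weak_curl_rep[OF \<Omega>(1) w(1) B' w(2) B(2)] by blast
  then show "(LBINT x. \<phi> x *\<^sub>R (c' x $ i)) = - (LBINT x. X (grad \<phi> x) ((B' x + grad_matrix u x) $ i))"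
   using Bochner_Integration.integral_add[OF int[OF L2_rep_D(1)[OF B']] int[OF uL(2)]] integral_X_grad[OF \<phi> u, of i]
   by (simp add: bounded_bilinear.add_right[OF X])
 qed
 from weak_curl_rep[OF \<Omega> Bu(2) w(2) B(2) this]
 show "(\<lambda>x. B x + grad_matrix u x) \<in> Hcurl X \<Omega>" "L2_rep \<Omega> (weak_curl X \<Omega> (\<lambda>x. B x + grad_matrix u x)) c'" .
qed

end

lemma ennreal_INF_cmult:
 fixes F :: "nat \<Rightarrow> ennreal"
 assumes "c > 0"
 shows "(INF m. ennreal c * F m) = ennreal c * (INF m. F m)"
proof (rule antisym)
 have cancel: "ennreal (1 / c) * (ennreal c * x) = x" "ennreal c * (ennreal (1 / c) * x) = x" for x
  using assms by (simp_all add: mult.assoc[symmetric] ennreal_mult[symmetric])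
 have "ennreal (1 / c) * (INF m. ennreal c * F m) \<le> F m" for m
  using mult_left_mono[OF INF_lower[of m UNIV "\<lambda>m. ennreal c * F m"], of "ennreal (1 / c)"] by (simp add: cancel)
 then have "ennreal (1 / c) * (INF m. ennreal c * F m) \<le> (INF m. F m)" by (rule INF_greatest)
 from mult_left_mono[OF this, of "ennreal c"] show "(INF m. ennreal c * F m) \<le> ennreal c * (INF m. F m)" by (simp add: cancel)
qed (auto intro!: INF_greatest mult_left_mono INF_lower)

context energy_setting
begin

text \<open>The bounded case applies along a subsequence whose energies converge to the liminf; past
  some index they stay below the liminf plus 1. Both notions of convergence pass to
  subsequences.\<close>

lemma lower_bound:
 assumes k: "k \<in> W12 \<Omega>" and B: "B \<in> Hcurl X \<Omega>" and seq: "\<And>n. kn n \<in> W12 \<Omega>" "\<And>n. Bn n \<in> Hcurl X \<Omega>"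
  and sl: "L2_strong_lim \<Omega> kn k" and wl: "L2_weak_lim \<Omega> Bn B"
 shows "energy_functional X \<Omega> \<epsilon> \<xi> (\<lambda>\<eta>. Z (s *\<^sub>R \<eta>)) k B \<le> liminf (\<lambda>n. energy X \<Omega> \<epsilon> \<xi> W (kn n) (Bn n))"
proof (cases "liminf (\<lambda>n. energy X \<Omega> \<epsilon> \<xi> W (kn n) (Bn n)) = \<infinity>")
 case False
 define e where "e n = energy X \<Omega> \<epsilon> \<xi> W (kn n) (Bn n)" for n
 have fin: "liminf e < \<infinity>" using False by (simp add: e_def[abs_def] less_top)
 obtain r where r: "strict_mono r" "(e \<circ> r) \<longlonglongrightarrow> liminf e" using liminf_subseq_lim[of e] by blast
 have "liminf e < liminf e + 1" using fin by (cases "liminf e" rule: ennreal_cases) (auto simp: ennreal_less_iff ennreal_plus[symmetric] ennreal_1[symmetric] simp del: ennreal_plus ennreal_1)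
 from order_tendstoD(2)[OF r(2) this] obtain N where N: "\<And>n. n \<ge> N \<Longrightarrow> e (r n) < liminf e + 1"
  by (auto simp: eventually_sequentially)
 define q where "q n = r (n + N)" for n
 have q: "strict_mono q" using r(1) by (simp add: q_def strict_mono_def)
 have lim: "(\<lambda>n. e (q n)) \<longlonglongrightarrow> liminf e" using LIMSEQ_ignore_initial_segment[OF r(2), of N] by (simp add: q_def comp_def)
 define M where "M = enn2real (liminf e + 1)"
 have M: "ennreal M = liminf e + 1" using fin by (simp add: M_def less_top)
 have "energy_functional X \<Omega> \<epsilon> \<xi> (\<lambda>\<eta>. Z (s *\<^sub>R \<eta>)) k B \<le> liminf (\<lambda>n. energy X \<Omega> \<epsilon> \<xi> W (kn (q n)) (Bn (q n)))"
 proof (rule lower_bound_of_bounded[OF k B seq])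
  show "L2_strong_lim \<Omega> (\<lambda>n. kn (q n)) k"
   using LIMSEQ_subseq_LIMSEQ[OF sl[unfolded L2_strong_lim_def] q] by (simp add: L2_strong_lim_def comp_def)
  show "L2_weak_lim \<Omega> (\<lambda>n. Bn (q n)) B"
   unfolding L2_weak_lim_def
  proof
   fix \<psi> :: "real^'n \<Rightarrow> real^'n^'n" assume "\<psi> \<in> L2 \<Omega>"
   from LIMSEQ_subseq_LIMSEQ[OF bspec[OF wl[unfolded L2_weak_lim_def] this] q]
   show "(\<lambda>n. \<integral>x. Bn (q n) x \<bullet> \<psi> x \<partial>lebesgue_on \<Omega>) \<longlonglongrightarrow> (\<integral>x. B x \<bullet> \<psi> x \<partial>lebesgue_on \<Omega>)" by (simp add: comp_def)
  qed
  show "energy X \<Omega> \<epsilon> \<xi> W (kn (q n)) (Bn (q n)) \<le> ennreal M" for n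
   using N[of "n + N"] unfolding M by (simp add: e_def q_def less_imp_le)
  show "M \<ge> 0" by (simp add: M_def)
 qed
 also have "\<dots> = liminf e" using lim_imp_Liminf[OF _ lim] by (simp add: e_def)
 finally show ?thesis by (simp add: e_def[abs_def])
qed simp

text \<open>The recovery sequence adds u to k and its gradient to B, with amplitude t l and
  gradients bounded by M/s independently of l. Only the terms in k and in W change; the others are
  equal for all members.\<close>

lemma upper_bound_finite:
 assumes k: "k \<in> W12 \<Omega>" "L2_rep \<Omega> k k'" "L2_rep \<Omega> (weak_gradient \<Omega> k) G'"
  and B: "B \<in> Hcurl X \<Omega>" "L2_rep \<Omega> B B'" "L2_rep \<Omega> (weak_curl X \<Omega> B) c'"
  and \<Phi>0: "\<Phi> 0 = (\<lambda>x. 0)" and \<Phi>: "\<And>j. \<Phi> j \<in> C1_compact (box 0 1)"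
 shows "relaxed_energy X \<Omega> \<epsilon> \<xi> W k B \<le> well k' + sqn \<Omega> (\<lambda>x. G' x - B' x) + ennreal (\<epsilon> * \<xi>\<^sup>2) * sqn \<Omega> c'
  + ennreal (1 / (\<epsilon> * \<xi>\<^sup>2)) * (NNINT x:\<Omega>. Fm \<Phi> m (s *\<^sub>R B' x))" (is "_ \<le> ?R")
proof (cases "?R < \<infinity>")
 case True
 note od = open_domain bounded_domain
 note [measurable] = L2_rep_D(2)[OF k(2)] L2_rep_D(2)[OF k(3)] L2_rep_D(2)[OF B(2)] L2_rep_D(2)[OF B(3)]
 define c0 where "c0 = 1 / (\<epsilon> * \<xi>\<^sup>2)"
 have c0: "c0 > 0" using coefficients by (simp add: c0_def)
 obtain V where V: "emeasure lborel \<Omega> = ennreal V" "V \<ge> 0" by (rule \<Omega>_measure)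
 have "\<exists>M>0. \<forall>x. norm (grad_matrix (\<Phi> j) x) \<le> M" for j using C1_compact_bounded[OF \<Phi>] by metis
 then obtain Mj where Mj: "\<And>j. Mj j > 0" "\<And>j x. norm (grad_matrix (\<Phi> j) x) \<le> Mj j" by metis
 define M where "M = (\<Sum>j\<le>m. Mj j)"
 have M: "norm (grad_matrix (\<Phi> j) x) \<le> M" if "j \<le> m" for j x
 proof -
  have "Mj j \<le> M" unfolding M_def using that Mj(1) by (intro member_le_sum) (auto simp: less_imp_le)
  then show ?thesis using Mj(2)[of j x] by simp
 qed
 have M0: "M > 0" using Mj(1) by (auto simp: M_def intro!: sum_pos)
 define t where "t l = inverse (real (Suc l))" for l
 have t: "t l > 0" "t l \<le> 1" for l by (auto simp: t_def field_simps)
 have t_lim: "t \<longlonglongrightarrow> 0" unfolding t_def[abs_def] by (rule LIMSEQ_inverse_real_of_nat)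
 have "sqn \<Omega> (\<lambda>x. s *\<^sub>R B' x) \<le> sqn UNIV (\<lambda>x. s *\<^sub>R B' x)" by (rule sqn_mono) simp
 also have "\<dots> < \<infinity>" using L2c_scaleR[OF L2_rep_D(1)[OF B(2)], of s] by (simp add: L2c_def)
 finally have sB: "sqn \<Omega> (\<lambda>x. s *\<^sub>R B' x) < \<infinity>" .
 define P where "P l u \<longleftrightarrow> u \<in> C1_compact \<Omega> \<and> (\<forall>x. norm (u x) \<le> t l) \<and> (\<forall>x. norm (grad_matrix u x) \<le> M / s) \<and>
   (NNINT x:\<Omega>. ennreal (W (norm (s *\<^sub>R (B' x + grad_matrix u x))))) \<le> (NNINT x:\<Omega>. Fm \<Phi> m (s *\<^sub>R B' x)) + ennreal (t l)" for l u
 have "\<exists>u. P l u" for l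
 proof -
  \<comment> \<open>The perturbation is built for s B and then divided by s, so its amplitude bound
    must stay below t l before and after the division.\<close>
  define \<tau> where "\<tau> = min 1 s * t l"
  have \<tau>: "\<tau> > 0" "\<tau> \<le> t l" "\<tau> \<le> s * t l" using t[of l] s_pos by (auto simp: \<tau>_def min_def)
  obtain \<phi> where \<phi>: "\<phi> \<in> C1_compact \<Omega>" "\<And>x. norm (\<phi> x) \<le> \<tau>" "\<And>x. norm (grad_matrix \<phi> x) \<le> M"
   "(NNINT x:\<Omega>. ennreal (W (norm (s *\<^sub>R B' x + grad_matrix \<phi> x)))) \<le> (NNINT x:\<Omega>. Fm \<Phi> m (s *\<^sub>R B' x)) + ennreal \<tau>"
   using oscillating_upper[where \<Phi>=\<Phi> and m=m and B="\<lambda>x. s *\<^sub>R B' x", OF \<Phi>0 \<Phi> M M0 od _ sB \<tau>(1)] by auto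
  have g: "grad_matrix (\<lambda>x. (1 / s) *\<^sub>R \<phi> x) x = (1 / s) *\<^sub>R grad_matrix \<phi> x" for x
   by (rule grad_matrix_scaleR_const[OF C1_compactD(1)[OF \<phi>(1)]])
  show ?thesis
   unfolding P_def
  proof (intro exI conjI allI)
   show "(\<lambda>x. (1 / s) *\<^sub>R \<phi> x) \<in> C1_compact \<Omega>" by (rule C1_compact_scaleR[OF \<phi>(1)])
   show "norm ((1 / s) *\<^sub>R \<phi> x) \<le> t l" for x
    using order_trans[OF \<phi>(2)[of x] \<tau>(3)] s_pos by (simp add: field_simps)
   show "norm (grad_matrix (\<lambda>x. (1 / s) *\<^sub>R \<phi> x) x) \<le> M / s" for x
    unfolding g using \<phi>(3)[of x] s_pos by (simp add: divide_right_mono)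
   have "s *\<^sub>R (B' x + grad_matrix (\<lambda>x. (1 / s) *\<^sub>R \<phi> x) x) = s *\<^sub>R B' x + grad_matrix \<phi> x" for x
    unfolding g using s_pos by (simp add: scaleR_add_right)
   then show "(NNINT x:\<Omega>. ennreal (W (norm (s *\<^sub>R (B' x + grad_matrix (\<lambda>x. (1 / s) *\<^sub>R \<phi> x) x))))) \<le>
     (NNINT x:\<Omega>. Fm \<Phi> m (s *\<^sub>R B' x)) + ennreal (t l)"
    using order_trans[OF \<phi>(4) add_left_mono[OF ennreal_leI[OF \<tau>(2)]]] by simp
  qed
 qed
 then obtain u where "\<And>l. P l (u l)" by metis
 then have u: "\<And>l. u l \<in> C1_compact \<Omega>" "\<And>l x. norm (u l x) \<le> t l" "\<And>l x. norm (grad_matrix (u l) x) \<le> M / s"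
  and u4: "\<And>l. (NNINT x:\<Omega>. ennreal (W (norm (s *\<^sub>R (B' x + grad_matrix (u l) x))))) \<le> (NNINT x:\<Omega>. Fm \<Phi> m (s *\<^sub>R B' x)) + ennreal (t l)"
  unfolding P_def by blast+
 have [measurable]: "u l \<in> borel_measurable borel" for l
  by (rule cont_diff_measurable[OF C1_compactD(1)[OF u(1)]])
 have [measurable]: "grad_matrix (u l) \<in> borel_measurable borel" for l by (rule grad_matrix_measurable[OF C1_compactD(1)[OF u(1)]])
 define kn where "kn l x = k x + u l x" for l x
 define Bn where "Bn l x = B x + grad_matrix (u l) x" for l x
 note uL = L2c_C1_compact[OF od u(1)]
 have kr: "L2_rep \<Omega> (kn l) (\<lambda>x. k' x + u l x)" for l
  unfolding kn_def[abs_def]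
  using C1_compactD(2)[OF u(1)] by (intro L2_rep_add(1)[OF open_domain weak_gradient_works(1)[OF k(1)] k(2) uL(1)]) blast
 have Gr: "kn l \<in> W12 \<Omega>" "L2_rep \<Omega> (weak_gradient \<Omega> (kn l)) (\<lambda>x. G' x + grad_matrix (u l) x)" for l
  unfolding kn_def[abs_def] by (rule W12_add[OF od k(1,3) u(1)])+
 have Br: "L2_rep \<Omega> (Bn l) (\<lambda>x. B' x + grad_matrix (u l) x)" for l
  unfolding Bn_def[abs_def]
  using C1_compact_grad_0[OF u(1)] by (intro L2_rep_add(1)[OF open_domain weak_curl_works(1)[OF B(1)] B(2) uL(2)]) blast
 have cr: "Bn l \<in> Hcurl X \<Omega>" "L2_rep \<Omega> (weak_curl X \<Omega> (Bn l)) c'" for l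
  unfolding Bn_def[abs_def] by (rule Hcurl_add_gradient[OF od B(1,3) u(1)])+

 \<comment> \<open>Convergence of the recovery sequence\<close>
 have sl: "L2_strong_lim \<Omega> kn k"
  unfolding L2_strong_lim_def
 proof (rule tendsto_sandwich[OF _ _ tendsto_const])
  show "eventually (\<lambda>l. (\<integral>x. (norm (kn l x - k x))\<^sup>2 \<partial>lebesgue_on \<Omega>) \<le> (t l)\<^sup>2 * measure (lebesgue_on \<Omega>) \<Omega>) sequentially"
  proof (intro always_eventually allI)
   fix l
   have "finite_measure (lebesgue_on \<Omega>)"
    by (rule finite_measureI) (simp add: emeasure_restrict_space V(1))
   then have "integrable (lebesgue_on \<Omega>) (\<lambda>x. (t l)\<^sup>2)" by (rule finite_measure.integrable_const)
   then have "(\<integral>x. (norm (kn l x - k x))\<^sup>2 \<partial>lebesgue_on \<Omega>) \<le> (\<integral>x. (t l)\<^sup>2 \<partial>lebesgue_on \<Omega>)"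
    by (rule integral_mono') (auto simp: kn_def intro!: power_mono u(2))
   then show "(\<integral>x. (norm (kn l x - k x))\<^sup>2 \<partial>lebesgue_on \<Omega>) \<le> (t l)\<^sup>2 * measure (lebesgue_on \<Omega>) \<Omega>" by (simp add: mult.commute)
  qed
  show "(\<lambda>l. (t l)\<^sup>2 * measure (lebesgue_on \<Omega>) \<Omega>) \<longlonglongrightarrow> 0"
   using tendsto_mult_right[OF tendsto_power[OF t_lim, of 2], of "measure (lebesgue_on \<Omega>) \<Omega>"] by simp
 qed simp
 have wl: "L2_weak_lim \<Omega> Bn B"
  unfolding L2_weak_lim_def
 proof
  fix \<psi> :: "real^'n \<Rightarrow> real^'n^'n" assume \<psi>: "\<psi> \<in> L2 \<Omega>"
  obtain \<psi>' where \<psi>': "L2_rep \<Omega> \<psi> \<psi>'" using L2_rep_exists[OF od \<psi>] by blast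
  note [measurable] = L2_rep_D(2)[OF \<psi>']
  have inner_eq: "(\<integral>x. F x \<bullet> \<psi> x \<partial>lebesgue_on \<Omega>) = (LBINT x. F' x \<bullet> \<psi>' x)" if F: "F \<in> L2 \<Omega>" "L2_rep \<Omega> F F'" for F F'
  proof (rule integral_lebesgue_on_rep[OF \<Omega>_borel])
   show "(\<lambda>x. F x \<bullet> \<psi> x) \<in> borel_measurable (lebesgue_on \<Omega>)" by (intro borel_measurable_inner L2_measurable F(1) \<psi>)
   show "(\<lambda>x. F' x \<bullet> \<psi>' x) \<in> borel_measurable borel" using L2_rep_D(2)[OF F(2)] by measurable
   show "AE x in lebesgue_on \<Omega>. F x \<bullet> \<psi> x = F' x \<bullet> \<psi>' x"
    using L2_rep_D(4)[OF F(2)] L2_rep_D(4)[OF \<psi>'] by eventually_elim simp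
  qed (simp add: L2_rep_D(3)[OF F(2)])
  have int: "integrable lborel (\<lambda>x. F x \<bullet> \<psi>' x)" if F: "L2c F" for F
  proof (rule Bochner_Integration.integrable_bound[of _ "\<lambda>x. (norm (F x))\<^sup>2 + (norm (\<psi>' x))\<^sup>2"])
   have "integrable lborel (\<lambda>x. (norm (H x))\<^sup>2)" if "L2c H" for H :: "real^'n \<Rightarrow> real^'n^'n"
    using that by (auto simp: L2c_def sqn_def intro!: integrableI_bounded)
   then show "integrable lborel (\<lambda>x. (norm (F x))\<^sup>2 + (norm (\<psi>' x))\<^sup>2)" using F L2_rep_D(1)[OF \<psi>'] by simp
   show "(\<lambda>x. F x \<bullet> \<psi>' x) \<in> borel_measurable lborel" using L2c_measurable[OF F] by simp
   have "norm (a \<bullet> b) \<le> (norm a)\<^sup>2 + (norm b)\<^sup>2" for a b :: "real^'n^'n"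
   proof -
    have "norm (a \<bullet> b) \<le> norm a * norm b" using Cauchy_Schwarz_ineq2[of a b] by simp
    also have "\<dots> \<le> (norm a)\<^sup>2 + (norm b)\<^sup>2"
     using sum_squares_bound[of "norm a" "norm b"] mult_nonneg_nonneg[OF norm_ge_zero[of a] norm_ge_zero[of b]] by linarith
    finally show ?thesis .
   qed
   then show "AE x in lborel. norm (F x \<bullet> \<psi>' x) \<le> norm ((norm (F x))\<^sup>2 + (norm (\<psi>' x))\<^sup>2)" by simp
  qed
  have BL: "B \<in> L2 \<Omega>" "Bn l \<in> L2 \<Omega>" for l using weak_curl_works(1)[OF B(1)] weak_curl_works(1)[OF cr(1)] by auto
  have "(\<integral>x. Bn l x \<bullet> \<psi> x \<partial>lebesgue_on \<Omega>) = (\<integral>x. B x \<bullet> \<psi> x \<partial>lebesgue_on \<Omega>) + (LBINT x. grad_matrix (u l) x \<bullet> \<psi>' x)" for l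
   unfolding inner_eq[OF BL(2) Br] inner_eq[OF BL(1) B(2)] inner_add_left
   by (rule Bochner_Integration.integral_add[OF int[OF L2_rep_D(1)[OF B(2)]] int[OF uL(2)]])
  then show "(\<lambda>l. \<integral>x. Bn l x \<bullet> \<psi> x \<partial>lebesgue_on \<Omega>) \<longlonglongrightarrow> (\<integral>x. B x \<bullet> \<psi> x \<partial>lebesgue_on \<Omega>)"
   using tendsto_add[OF tendsto_const grad_weakly_null[OF od u(1,2,3) t_lim L2_rep_D(1)[OF \<psi>']], of "\<integral>x. B x \<bullet> \<psi> x \<partial>lebesgue_on \<Omega>"]
   by simp
 qed

 \<comment> \<open>Energies of the recovery sequence\<close>
 have well_le: "well (\<lambda>x. k' x + u l x) \<le> ennreal (1 + t l) * well k' + ennreal (2 * c0 * V * t l)" for l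
 proof -
  have "well (\<lambda>x. k' x + u l x) \<le> (NNINT x. ennreal (1 + t l) * (ennreal ((norm (k' x) - 1)\<^sup>2 / (\<epsilon> * \<xi>\<^sup>2)) * indicator \<Omega> x)
    + ennreal (2 * c0 * t l) * indicator \<Omega> x)"
   unfolding well_def
  proof (rule nn_integral_mono)
   fix x
   define a where "a = norm (k' x) - 1"
   define d where "d = norm (k' x + u l x) - norm (k' x)"
   have d: "\<bar>d\<bar> \<le> t l"
    using norm_triangle_ineq3[of "k' x + u l x" "k' x"] u(2)[of l x] by (simp add: d_def)
   \<comment> \<open>From |d| \<le> t l \<le> 1 and 2 |a| \<le> a^2 + 1: the cross term costs t l
     (a^2 + 1), and d^2 is at most t l.\<close>
   have "(a + d)\<^sup>2 \<le> (1 + t l) * a\<^sup>2 + 2 * t l"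
   proof -
    have "2 * a * d \<le> 2 * (\<bar>a\<bar> * \<bar>d\<bar>)" using abs_ge_self[of "a * d"] by (simp add: abs_mult)
    also have "\<dots> \<le> 2 * (\<bar>a\<bar> * t l)" using d by (intro mult_left_mono) auto
    also have "\<dots> = t l * (2 * \<bar>a\<bar> * 1)" by simp
    also have "\<dots> \<le> t l * (\<bar>a\<bar>\<^sup>2 + 1\<^sup>2)" using t(1)[of l] sum_squares_bound[of "\<bar>a\<bar>" 1] by (intro mult_left_mono) auto
    finally have 1: "2 * a * d \<le> t l * a\<^sup>2 + t l" by (simp add: distrib_left)
    have "d\<^sup>2 = \<bar>d\<bar> * \<bar>d\<bar>" by (simp add: power2_eq_square)
    also have "\<dots> \<le> t l * 1" using d t(2)[of l] by (intro mult_mono) auto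
    finally show ?thesis using 1 by (simp add: power2_sum algebra_simps)
   qed
   then have "(norm (k' x + u l x) - 1)\<^sup>2 / (\<epsilon> * \<xi>\<^sup>2) \<le> ((1 + t l) * (norm (k' x) - 1)\<^sup>2 + 2 * t l) / (\<epsilon> * \<xi>\<^sup>2)"
    using coefficients(1) by (intro divide_right_mono) (auto simp: a_def d_def)
   also have "\<dots> = (1 + t l) * ((norm (k' x) - 1)\<^sup>2 / (\<epsilon> * \<xi>\<^sup>2)) + 2 * c0 * t l" by (simp add: c0_def add_divide_distrib)
   finally have "ennreal ((norm (k' x + u l x) - 1)\<^sup>2 / (\<epsilon> * \<xi>\<^sup>2)) \<le> ennreal \<dots>" by (rule ennreal_leI)
   also have "\<dots> = ennreal (1 + t l) * ennreal ((norm (k' x) - 1)\<^sup>2 / (\<epsilon> * \<xi>\<^sup>2)) + ennreal (2 * c0 * t l)"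
   proof -
    have "ennreal ((1 + t l) * p + q) = ennreal (1 + t l) * ennreal p + ennreal q" if "p \<ge> 0" "q \<ge> 0" for p q
     using t(1)[of l] that by (simp add: ennreal_mult[symmetric] ennreal_plus[symmetric] del: ennreal_plus)
    from this[OF divide_nonneg_pos[OF _ coefficients(1)]] show ?thesis using c0 t(1)[of l] by simp
   qed
   finally show "ennreal ((norm (k' x + u l x) - 1)\<^sup>2 / (\<epsilon> * \<xi>\<^sup>2)) * indicator \<Omega> x \<le>
     ennreal (1 + t l) * (ennreal ((norm (k' x) - 1)\<^sup>2 / (\<epsilon> * \<xi>\<^sup>2)) * indicator \<Omega> x) + ennreal (2 * c0 * t l) * indicator \<Omega> x"
    by (cases "x \<in> \<Omega>") simp_all
  qed
  also have "\<dots> = ennreal (1 + t l) * well k' + ennreal (2 * c0 * t l) * ennreal V"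
   by (simp add: nn_integral_add nn_integral_cmult nn_integral_cmult_indicator well_def V(1))
  also have "ennreal (2 * c0 * t l) * ennreal V = ennreal (2 * c0 * V * t l)"
   using c0 V(2) t(1)[of l] by (simp add: ennreal_mult[symmetric] mult_ac)
  finally show ?thesis .
 qed
 have E_le: "energy X \<Omega> \<epsilon> \<xi> W (kn l) (Bn l) \<le> ennreal (1 + t l) * ?R + ennreal (c0 * (2 * V + 1) * t l)" for l
 proof -
  let ?F = "NNINT x:\<Omega>. Fm \<Phi> m (s *\<^sub>R B' x)"
  have "energy X \<Omega> \<epsilon> \<xi> W (kn l) (Bn l) = well (\<lambda>x. k' x + u l x) + sqn \<Omega> (\<lambda>x. G' x - B' x) + ennreal (\<epsilon> * \<xi>\<^sup>2) * sqn \<Omega> c'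
    + ennreal c0 * (NNINT x:\<Omega>. ennreal (W (norm (s *\<^sub>R (B' x + grad_matrix (u l) x)))))"
   unfolding energy_eq energy_functional_rep[OF W_norm_measurable kr Gr(2) Br cr(2)] c0_def by simp
  also have "\<dots> \<le> (ennreal (1 + t l) * well k' + ennreal (2 * c0 * V * t l)) + sqn \<Omega> (\<lambda>x. G' x - B' x) + ennreal (\<epsilon> * \<xi>\<^sup>2) * sqn \<Omega> c'
    + ennreal c0 * (?F + ennreal (t l))"
   by (intro add_mono mult_left_mono well_le u4) auto
  also have "\<dots> \<le> (ennreal (1 + t l) * well k' + ennreal (2 * c0 * V * t l)) + ennreal (1 + t l) * sqn \<Omega> (\<lambda>x. G' x - B' x)
    + ennreal (1 + t l) * (ennreal (\<epsilon> * \<xi>\<^sup>2) * sqn \<Omega> c') + (ennreal (1 + t l) * (ennreal c0 * ?F) + ennreal c0 * ennreal (t l))"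
  proof -
   have "1 * y \<le> ennreal (1 + t l) * y" for y
    using ennreal_leI[of 1 "1 + t l"] t(1)[of l] by (intro mult_right_mono) auto
   then have "y \<le> ennreal (1 + t l) * y" for y by simp
   then show ?thesis unfolding distrib_left by (intro add_mono order_refl)
  qed
  also have "\<dots> = ennreal (1 + t l) * ?R + (ennreal (2 * c0 * V * t l) + ennreal c0 * ennreal (t l))"
   by (simp add: c0_def[symmetric] distrib_left ac_simps)
  also have "ennreal (2 * c0 * V * t l) + ennreal c0 * ennreal (t l) = ennreal (c0 * (2 * V + 1) * t l)"
   using c0 V(2) t(1)[of l] by (simp add: ennreal_mult[symmetric] ennreal_plus[symmetric] algebra_simps del: ennreal_plus)
  finally show ?thesis .
 qed
 have "liminf (\<lambda>l. energy X \<Omega> \<epsilon> \<xi> W (kn l) (Bn l)) \<le> ?R"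
 proof (rule ennreal_le_of_approx[OF True])
  fix \<tau> :: real assume \<tau>: "0 < \<tau>" "\<tau> < 1"
  \<comment> \<open>Below p both the factor 1 + t l and the additive error c0 (2 V + 1) t l meet
    their bounds 1 + \<tau> and \<tau>.\<close>
  define p where "p = min \<tau> (\<tau> / (c0 * (2 * V + 1)))"
  have cV: "c0 * (2 * V + 1) > 0" using c0 V(2) by (simp add: add_nonneg_pos)
  have p: "p > 0" using \<tau> cV by (simp add: p_def)
  have "eventually (\<lambda>l. t l < p) sequentially" by (rule order_tendstoD(2)[OF t_lim p])
  then have "eventually (\<lambda>l. energy X \<Omega> \<epsilon> \<xi> W (kn l) (Bn l) \<le> ennreal (1 + \<tau>) * ?R + ennreal \<tau>) sequentially"
  proof eventually_elim
   case (elim l)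
   have "t l \<le> \<tau>" using elim by (simp add: p_def)
   moreover have "c0 * (2 * V + 1) * t l \<le> \<tau>"
    using elim cV by (simp add: p_def less_divide_eq mult.commute less_imp_le)
   ultimately show ?case by (intro order_trans[OF E_le[of l]] add_mono mult_right_mono ennreal_leI) auto
  qed
  then show "liminf (\<lambda>l. energy X \<Omega> \<epsilon> \<xi> W (kn l) (Bn l)) \<le> ennreal (1 + \<tau>) * ?R + ennreal \<tau>"
   by (rule Liminf_le[OF sequentially_bot])
 qed
 moreover have "relaxed_energy X \<Omega> \<epsilon> \<xi> W k B \<le> liminf (\<lambda>l. energy X \<Omega> \<epsilon> \<xi> W (kn l) (Bn l))"
  unfolding relaxed_energy_def using Gr(1) cr(1) sl wl by (intro Inf_lower) blast
 ultimately show ?thesis by (rule order_trans[rotated])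
next
 case False
 then have "?R = top" unfolding infinity_ennreal_def using less_top by blast
 then show ?thesis by (metis top_greatest)
qed

text \<open>The upper bound holds for every finite infimum \<open>Fm\<close>. The infimum over m
  passes through the constants, and then under the integral, where it becomes \<open>Z\<close>,
  which is the envelope.\<close>

theorem relaxation:
 assumes k: "k \<in> W12 \<Omega>" and B: "B \<in> Hcurl X \<Omega>"
 shows "relaxed_energy X \<Omega> \<epsilon> \<xi> W k B =
  energy_functional X \<Omega> \<epsilon> \<xi> (\<lambda>\<eta>. quasiconvex_envelope (\<lambda>\<zeta>. ennreal (W (norm \<zeta>))) ((\<epsilon> * \<xi>) *\<^sub>R \<eta>)) k B"
 unfolding quasiconvex_envelope_eq s_def[symmetric]
proof (rule antisym)
 note od = open_domain bounded_domain
 show "energy_functional X \<Omega> \<epsilon> \<xi> (\<lambda>\<eta>. Z (s *\<^sub>R \<eta>)) k B \<le> relaxed_energy X \<Omega> \<epsilon> \<xi> W k B"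
  unfolding relaxed_energy_def by (rule Inf_greatest) (auto intro!: lower_bound[OF k B])
 obtain k' where k': "L2_rep \<Omega> k k'" using L2_rep_exists[OF od weak_gradient_works(1)[OF k]] by blast
 obtain G' where G': "L2_rep \<Omega> (weak_gradient \<Omega> k) G'" using L2_rep_exists[OF od weak_gradient_works(2)[OF k]] by blast
 obtain B' where B': "L2_rep \<Omega> B B'" using L2_rep_exists[OF od weak_curl_works(1)[OF B]] by blast
 obtain c' where c': "L2_rep \<Omega> (weak_curl X \<Omega> B) c'" using L2_rep_exists[OF od weak_curl_works(2)[OF B]] by blast
 note [measurable] = L2_rep_D(2)[OF B']
 obtain \<Phi> :: "nat \<Rightarrow> real^'n \<Rightarrow> real^'n" where \<Phi>: "\<Phi> 0 = (\<lambda>x. 0)" "\<And>j. \<Phi> j \<in> C1_compact (box 0 1)"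
  "\<And>\<eta>. Z \<eta> = (INF j. qint (\<Phi> j) \<eta>)" using Z_countable by metis
 have "sqn \<Omega> (\<lambda>x. s *\<^sub>R B' x) \<le> sqn UNIV (\<lambda>x. s *\<^sub>R B' x)" by (rule sqn_mono) simp
 also have "\<dots> < \<infinity>" using L2c_scaleR[OF L2_rep_D(1)[OF B'], of s] by (simp add: L2c_def)
 finally have sB: "sqn \<Omega> (\<lambda>x. s *\<^sub>R B' x) < \<infinity>" .
 let ?a = "well k' + sqn \<Omega> (\<lambda>x. G' x - B' x) + ennreal (\<epsilon> * \<xi>\<^sup>2) * sqn \<Omega> c'" and ?c = "ennreal (1 / (\<epsilon> * \<xi>\<^sup>2))"
 let ?F = "\<lambda>m. NNINT x:\<Omega>. Fm \<Phi> m (s *\<^sub>R B' x)"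
 have c: "1 / (\<epsilon> * \<xi>\<^sup>2) > 0" using coefficients(2) .
 have "relaxed_energy X \<Omega> \<epsilon> \<xi> W k B \<le> (INF m. ?a + ?c * ?F m)"
  by (intro INF_greatest upper_bound_finite[where \<Phi>=\<Phi>, OF k k' G' B B' c' \<Phi>(1,2)])
 also have "\<dots> = ?a + ?c * (INF m. ?F m)"
 proof -
  have "(INF m. ?c * ?F m) = ?c * (INF m. ?F m)" using ennreal_INF_cmult[OF c, of ?F] .
  then show ?thesis by (simp add: INF_ennreal_const_add)
 qed
 also have "(INF m. ?F m) = (NNINT x:\<Omega>. Z (s *\<^sub>R B' x))"
  by (rule nn_integral_Fm_INF[where \<Phi>=\<Phi>, OF \<Phi> \<Omega>_borel bounded_domain _ sB]) simp
 also have "?a + ?c * \<dots> = energy_functional X \<Omega> \<epsilon> \<xi> (\<lambda>\<eta>. Z (s *\<^sub>R \<eta>)) k B"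
  by (rule energy_functional_rep[symmetric, OF _ k' G' B' c']) measurable
 finally show "relaxed_energy X \<Omega> \<epsilon> \<xi> W k B \<le> energy_functional X \<Omega> \<epsilon> \<xi> (\<lambda>\<eta>. Z (s *\<^sub>R \<eta>)) k B" .
qed

end

section \<open>Dimensions two and three\<close>

lemma bounded_bilinear_cross2: "bounded_bilinear cross2"
 unfolding bilinear_conv_bounded_bilinear[symmetric]
 by (auto simp: bilinear_def linear_iff cross2_def algebra_simps)

text \<open>In the plane (b y) a - (a y) b is orthogonal to y, hence a multiple of y rotated by a
  right angle; the factor is the determinant of a and b.\<close>

lemma curl_product_cross2: "curl_product cross2 (\<lambda>c y. vector [c * y $ 2, - (c * y $ 1)])"
 unfolding curl_product_def
proof (intro conjI allI)
 show "bounded_bilinear (\<lambda>c y. vector [c * y $ 2, - (c * y $ 1)] :: real^2)"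
  unfolding bilinear_conv_bounded_bilinear[symmetric]
  by (auto simp: bilinear_def linear_iff vec_eq_iff forall_2 algebra_simps)
 show "(b \<bullet> y) *\<^sub>R a - (a \<bullet> y) *\<^sub>R b = vector [cross2 a b * y $ 2, - (cross2 a b * y $ 1)]" for a b y :: "real^2"
  by (simp add: vec_eq_iff forall_2 inner_vec_def sum_2 cross2_def algebra_simps)
qed (simp_all add: bounded_bilinear_cross2, simp add: cross2_def mult.commute)

text \<open>The required identity is the classical expansion of the triple product of y with the
  cross product of a and b.\<close>

lemma curl_product_cross3: "curl_product cross3 (\<lambda>c y. cross3 y c)"
 unfolding curl_product_def
proof (intro conjI allI)
 show X: "bounded_bilinear cross3"
  using bilinear_cross by (simp add: bilinear_conv_bounded_bilinear)
 show "bounded_bilinear (\<lambda>c y. cross3 y c)" by (rule bounded_bilinear.flip[OF X])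
 show "(b \<bullet> y) *\<^sub>R a - (a \<bullet> y) *\<^sub>R b = cross3 y (cross3 a b)" for a b y :: "real^3"
  by (simp add: vec_eq_iff forall_3 inner_vec_def sum_3 cross3_def algebra_simps)
qed (simp add: cross_refl)

theorem theorem3p1:
 fixes \<epsilon> \<xi> :: real and W :: "real \<Rightarrow> real"
 assumes "\<epsilon> > 0" and "\<xi> > 0"
  and "continuous_on {0..} W" and "\<forall>x\<ge>0. W x \<ge> 0"
  and "\<exists>C>0. \<forall>x\<ge>0. (1 / C) * x\<^sup>2 - C \<le> W x \<and> W x \<le> C * (1 + x\<^sup>2)"
  and "{x \<in> {0..}. W x = 0} = {0, 2}"
 shows
  "(\<forall>\<Omega> :: (real^2) set. open \<Omega> \<and> bounded \<Omega> \<and> lipschitz_boundary \<Omega> \<longrightarrow>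
    (\<forall>k\<in>W12 \<Omega>. \<forall>B\<in>Hcurl cross2 \<Omega>.
      relaxed_energy cross2 \<Omega> \<epsilon> \<xi> W k B =
      energy_functional cross2 \<Omega> \<epsilon> \<xi>
       (\<lambda>\<eta>. quasiconvex_envelope (\<lambda>\<zeta>. ennreal (W (norm \<zeta>))) ((\<epsilon> * \<xi>) *\<^sub>R \<eta>)) k B)) \<and>
   (\<forall>\<Omega> :: (real^3) set. open \<Omega> \<and> bounded \<Omega> \<and> lipschitz_boundary \<Omega> \<longrightarrow>
    (\<forall>k\<in>W12 \<Omega>. \<forall>B\<in>Hcurl cross3 \<Omega>.
      relaxed_energy cross3 \<Omega> \<epsilon> \<xi> W k B =
      energy_functional cross3 \<Omega> \<epsilon> \<xi>
       (\<lambda>\<eta>. quasiconvex_envelope (\<lambda>\<zeta>. ennreal (W (norm \<zeta>))) ((\<epsilon> * \<xi>) *\<^sub>R \<eta>)) k B))"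
proof -
 obtain C where C: "C > 0" "\<And>x. x \<ge> 0 \<Longrightarrow> (1 / C) * x\<^sup>2 - C \<le> W x" "\<And>x. x \<ge> 0 \<Longrightarrow> W x \<le> C * (1 + x\<^sup>2)"
  using assms(5) by blast
 have energy_setting: "energy_setting X Y \<Omega> \<epsilon> \<xi> C W" if "curl_product X Y" "open \<Omega>" "bounded \<Omega>"
  for X :: "real^'n \<Rightarrow> real^'n \<Rightarrow> 'c::euclidean_space" and Y \<Omega>
  using that assms(1-4) C unfolding energy_setting_def energy_setting_axioms_def by blast
 show ?thesis
  using energy_setting.relaxation[OF energy_setting[OF curl_product_cross2]]
   energy_setting.relaxation[OF energy_setting[OF curl_product_cross3]] by blast
qed

end
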